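(* Let $G$ be a group that acts cellularly and cocompactly without inversion on a tree $T$ with vertex set $V(T)$ and edge set $E(T)$. Assume that all vertex stabilizers $G_v$ are finitely presented and that all edge stabilizers $G_e$ are finitely generated. Then $$\delta_G(n)\preccurlyeq n\cdot \max_{v\in V(T)} \delta_{G_v}\left(\overline{\mathrm{edist}_T}(n)\right),$$ where $\mathrm{edist}_T(n)=\max_{e\in E(T)} \mathrm{dist}_{G_e}^G(n)$.
   Context: **Actions.** A group acts without inversion if every element mapping a cell to itself fixes that cell pointwise; cocompact means finitely many orbits of cells. Maxima over $v\in V(T)$ and $e\in E(T)$ are taken over a fixed finite set of representatives of the $G$-orbits of vertices and edges (the stabilizers of cells in one orbit are conjugate). Equivalently to the assumptions, $G$ is the fundamental group of a finite graph of groups whose vertex and edge groups are, up to conjugation, the $G_v$ (finitely presented) and the $G_e$ (finitely generated). **Comparison of functions.** For $f,g\colon\mathbb N_0\to\mathbb R_{\ge0}$, $f\preccurlyeq g$ means that there is $C>0$ with $f(n)\le C g(Cn+C)+Cn+C$ for all $n$; $f\lesssim g$ means that there is $C>0$ with $f(n)\le Cg(Cn+C)+C$ for all $n$. The equivalence relations induced by $\preccurlyeq$ and $\lesssim$ are denoted $\approx$ and $\simeq$, respectively. The superadditive closure of $f$ is $\overline f(n)=\max \sum_{i=1}^k f(n_i)$, the maximum over all partitions $n=n_1+\dots+n_k$ with $n,n_i\ge 1$; it is the smallest superadditive function $\ge f$. **Distortion.** For finitely generated groups $H\le G$ with fixed finite generating sets and word lengths $\ell_H,\ell_G$, $\mathrm{dist}_H^G(n)=\max\{\ell_H(h)\mid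 h\in H,\ \ell_G(h)\le n\}$; it is independent of the finite generating sets up to $\simeq$. **Dehn function.** $\delta_H$ denotes the (one-dimensional) Dehn function of a finitely presented group $H$: for a simply connected combinatorial $2$-complex $Y$ with a free cellular cocompact $H$-action (e.g. the universal cover of a finite presentation complex), $\delta_H(n)$ is the maximum, over combinatorial loops of length $\le n$ in $Y^{(1)}$, of the minimal number of $2$-cells of a van Kampen diagram filling the loop. It is well defined up to $\approx$.
   Formalization: On the right side each Dehn function of G_v is represented by a monotone function that is at least n, and edist by an equivalent function not identically zero on n ≥ 1; with arbitrary representatives the bound fails, e.g. for BS(1,2) or Z^2 * Z^2. *)

theory Defs
  imports Complex_Main "HOL-Algebra.Group_Action" "HOL-Algebra.Generated_Groups"
begin

section \<open>Comparison of functions\<close>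

text \<open>The constant is a natural number, so that \<open>C * n + C\<close> is an argument of \<open>g\<close>.\<close>

definition dominated :: "(nat \<Rightarrow> real) \<Rightarrow> (nat \<Rightarrow> real) \<Rightarrow> bool" (infix "\<preceq>" 50) where
  "f \<preceq> g \<longleftrightarrow> (\<exists>C::nat. C > 0 \<and>
     (\<forall>n. f n \<le> real C * g (C * n + C) + real C * real n + real C))"

definition dominated_strict :: "(nat \<Rightarrow> real) \<Rightarrow> (nat \<Rightarrow> real) \<Rightarrow> bool" (infix "\<lesssim>" 50) where
  "f \<lesssim> g \<longleftrightarrow> (\<exists>C::nat. C > 0 \<and> (\<forall>n. f n \<le> real C * g (C * n + C) + real C))"

definition fun_approx :: "(nat \<Rightarrow> real) \<Rightarrow> (nat \<Rightarrow> real) \<Rightarrow> bool" (infix "\<approx>" 50) where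
  "f \<approx> g \<longleftrightarrow> f \<preceq> g \<and> g \<preceq> f"

definition fun_simeq :: "(nat \<Rightarrow> real) \<Rightarrow> (nat \<Rightarrow> real) \<Rightarrow> bool" (infix "\<simeq>" 50) where
  "f \<simeq> g \<longleftrightarrow> f \<lesssim> g \<and> g \<lesssim> f"

definition superadd_closure :: "(nat \<Rightarrow> nat) \<Rightarrow> nat \<Rightarrow> nat" where
  "superadd_closure f n =
     Max {sum_list (map f ns) | ns. (\<forall>m\<in>set ns. 1 \<le> m) \<and> sum_list ns = n}"


section \<open>Word length, distortion, finiteness properties of groups\<close>

definition finite_generating_set :: "('a, 'm) monoid_scheme \<Rightarrow> 'a set \<Rightarrow> bool" where
  "finite_generating_set G S \<longleftrightarrow> finite S \<and> S \<subseteq> carrier G \<and> generate G S = carrier G"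

definition finitely_generated :: "('a, 'm) monoid_scheme \<Rightarrow> bool" where
  "finitely_generated G \<longleftrightarrow> (\<exists>S. finite_generating_set G S)"

text \<open>Words over \<open>S\<close> are lists of pairs; \<open>(s, True)\<close> stands for \<open>s\<close> and \<open>(s, False)\<close>
  for its formal inverse.\<close>

fun word_eval :: "('a, 'm) monoid_scheme \<Rightarrow> ('a \<times> bool) list \<Rightarrow> 'a" where
  "word_eval G [] = \<one>\<^bsub>G\<^esub>"
| "word_eval G ((s, b) # w) = (if b then s else inv\<^bsub>G\<^esub> s) \<otimes>\<^bsub>G\<^esub> word_eval G w"

definition word_length :: "('a, 'm) monoid_scheme \<Rightarrow> 'a set \<Rightarrow> 'a \<Rightarrow> nat" where
  "word_length G S g =
     (LEAST n. \<exists>w. w \<in> lists (S \<times> UNIV) \<and> length w = n \<and> word_eval G w = g)"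

definition distortion ::
  "('a, 'm) monoid_scheme \<Rightarrow> 'a set \<Rightarrow> 'a set \<Rightarrow> 'a set \<Rightarrow> nat \<Rightarrow> nat" where
  "distortion G S H S' n =
     Sup {word_length (G\<lparr>carrier := H\<rparr>) S' h | h. h \<in> H \<and> word_length G S h \<le> n}"

text \<open>One step deletes a cancelling pair or a relator; two words over \<open>S\<close> represent the same element
  of the group presented by \<open>S\<close> and \<open>R\<close> iff they are related by the generated equivalence relation.\<close>

inductive word_step :: "'a set \<Rightarrow> ('a \<times> bool) list set \<Rightarrow>
    ('a \<times> bool) list \<Rightarrow> ('a \<times> bool) list \<Rightarrow> bool"
  for S R where
  cancel: "s \<in> S \<Longrightarrow> word_step S R (u @ [(s, b), (s, \<not> b)] @ w) (u @ w)"
| relator: "r \<in> R \<Longrightarrow> word_step S R (u @ r @ w) (u @ w)"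

definition finitely_presented :: "('a, 'm) monoid_scheme \<Rightarrow> bool" where
  "finitely_presented G \<longleftrightarrow> (\<exists>S R. finite_generating_set G S \<and>
     finite R \<and> R \<subseteq> lists (S \<times> UNIV) \<and>
     (\<forall>w \<in> lists (S \<times> UNIV). word_eval G w = \<one>\<^bsub>G\<^esub> \<longleftrightarrow> equivclp (word_step S R) w []))"


section \<open>Combinatorial 2-complexes\<close>

text \<open>The 1-skeleton is a graph in the sense of Serre: \<open>edges\<close> contains both orientations of every
  geometric edge, and \<open>rv\<close> exchanges them. A 2-cell is attached along the closed edge
  path \<open>bdry\<close>, which matters only up to rotation and inversion.\<close>

record ('v, 'e, 'f) complex2 =
  verts :: "'v set"
  edges :: "'e set"
  faces :: "'f set"
  src :: "'e \<Rightarrow> 'v"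
  rv :: "'e \<Rightarrow> 'e"
  bdry :: "'f \<Rightarrow> 'e list"

definition tgt :: "('v, 'e, 'f) complex2 \<Rightarrow> 'e \<Rightarrow> 'v" where
  "tgt Y e = src Y (rv Y e)"

fun edge_path :: "('v, 'e, 'f) complex2 \<Rightarrow> 'v \<Rightarrow> 'e list \<Rightarrow> 'v \<Rightarrow> bool" where
  "edge_path Y u [] v \<longleftrightarrow> u \<in> verts Y \<and> u = v"
| "edge_path Y u (e # p) v \<longleftrightarrow> e \<in> edges Y \<and> src Y e = u \<and> edge_path Y (tgt Y e) p v"

definition path_inverse :: "('v, 'e, 'f) complex2 \<Rightarrow> 'e list \<Rightarrow> 'e list" where
  "path_inverse Y p = rev (map (rv Y) p)"

definition same_cycle :: "('v, 'e, 'f) complex2 \<Rightarrow> 'e list \<Rightarrow> 'e list \<Rightarrow> bool" where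
  "same_cycle Y p q \<longleftrightarrow> (\<exists>k. p = rotate k q \<or> p = rotate k (path_inverse Y q))"

definition is_complex2 :: "('v, 'e, 'f) complex2 \<Rightarrow> bool" where
  "is_complex2 Y \<longleftrightarrow>
     (\<forall>e\<in>edges Y. src Y e \<in> verts Y \<and> rv Y e \<in> edges Y \<and> rv Y e \<noteq> e \<and> rv Y (rv Y e) = e) \<and>
     (\<forall>f\<in>faces Y. bdry Y f \<noteq> [] \<and> (\<exists>v. edge_path Y v (bdry Y f) v))"

text \<open>Elementary homotopies of edge loops based at \<open>v\<close>. As \<open>cancel\<close> may also be used backwards,
  \<open>face\<close> accounts for all rotations and inverses of boundary paths.\<close>

inductive loop_step :: "('v, 'e, 'f) complex2 \<Rightarrow> 'v \<Rightarrow> 'e list \<Rightarrow> 'e list \<Rightarrow> bool"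
  for Y v where
  cancel: "edge_path Y v (p @ [e, rv Y e] @ q) v \<Longrightarrow>
           loop_step Y v (p @ [e, rv Y e] @ q) (p @ q)"
| face: "f \<in> faces Y \<Longrightarrow> edge_path Y v (p @ bdry Y f @ q) v \<Longrightarrow>
           loop_step Y v (p @ bdry Y f @ q) (p @ q)"

definition simply_connected2 :: "('v, 'e, 'f) complex2 \<Rightarrow> bool" where
  "simply_connected2 Y \<longleftrightarrow> verts Y \<noteq> {} \<and>
     (\<forall>u\<in>verts Y. \<forall>v\<in>verts Y. \<exists>p. edge_path Y u p v) \<and>
     (\<forall>v\<in>verts Y. \<forall>p. edge_path Y v p v \<longrightarrow> equivclp (loop_step Y v) p [])"

text \<open>For a cellular action, freeness on the underlying space means that no nontrivial element maps
  a cell to itself: an inverted edge has a fixed midpoint, and a 2-cell mapped to itself contains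
  a fixed point.\<close>

definition free_cocompact_action where
  "free_cocompact_action H Y \<alpha> \<beta> \<gamma> \<longleftrightarrow>
     group_action H (verts Y) \<alpha> \<and> group_action H (edges Y) \<beta> \<and> group_action H (faces Y) \<gamma> \<and>
     (\<forall>h\<in>carrier H. \<forall>e\<in>edges Y.
        src Y (\<beta> h e) = \<alpha> h (src Y e) \<and> rv Y (\<beta> h e) = \<beta> h (rv Y e)) \<and>
     (\<forall>h\<in>carrier H. \<forall>f\<in>faces Y. same_cycle Y (bdry Y (\<gamma> h f)) (map (\<beta> h) (bdry Y f))) \<and>
     (\<forall>h\<in>carrier H. h \<noteq> \<one>\<^bsub>H\<^esub> \<longrightarrow>
        (\<forall>v\<in>verts Y. \<alpha> h v \<noteq> v) \<and>
        (\<forall>e\<in>edges Y. \<beta> h e \<noteq> e \<and> \<beta> h e \<noteq> rv Y e) \<and>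
        (\<forall>f\<in>faces Y. \<gamma> h f \<noteq> f)) \<and>
     finite (orbits H (verts Y) \<alpha>) \<and> finite (orbits H (edges Y) \<beta>) \<and>
     finite (orbits H (faces Y) \<gamma>)"

definition dehn_complex :: "('a, 'm) monoid_scheme \<Rightarrow> ('v, 'e, 'f) complex2 \<Rightarrow> bool" where
  "dehn_complex H Y \<longleftrightarrow> is_complex2 Y \<and> simply_connected2 Y \<and>
     (\<exists>\<alpha> \<beta> \<gamma>. free_cocompact_action H Y \<alpha> \<beta> \<gamma>)"


section \<open>Van Kampen diagrams and Dehn functions\<close>

text \<open>A van Kampen diagram is a finite connected planar graph together with all its bounded
  complementary regions. A connected planar graph with at least one edge is encoded as a combinatorial map of
  genus 0: \<open>D\<close> is the set of darts (oriented edges), \<open>\<epsilon>\<close> reverses a dart, and \<open>\<phi>\<close> sends a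
  dart to the next one along the face on its left. The cycles of \<open>\<phi>\<close> are the faces, those
  of \<open>\<epsilon>\<close> the edges, and those of \<open>\<phi> \<circ> \<epsilon>\<close>, which rotates the darts issuing from a vertex,
  the vertices.\<close>

definition cycle_of :: "('d \<Rightarrow> 'd) \<Rightarrow> 'd \<Rightarrow> 'd set" where
  "cycle_of f d = range (\<lambda>k. (f ^^ k) d)"

definition cycle_list :: "('d \<Rightarrow> 'd) \<Rightarrow> 'd \<Rightarrow> 'd list" where
  "cycle_list f d = map (\<lambda>k. (f ^^ k) d) [0..<card (cycle_of f d)]"

definition planar_map :: "'d set \<Rightarrow> ('d \<Rightarrow> 'd) \<Rightarrow> ('d \<Rightarrow> 'd) \<Rightarrow> bool" where
  "planar_map D \<epsilon> \<phi> \<longleftrightarrow> finite D \<and> D \<noteq> {} \<and>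
     (\<forall>d\<in>D. \<epsilon> d \<in> D \<and> \<epsilon> d \<noteq> d \<and> \<epsilon> (\<epsilon> d) = d) \<and> bij_betw \<phi> D D \<and>
     (\<forall>d\<in>D. \<forall>d'\<in>D. (d, d') \<in> ({(x, \<epsilon> x) | x. x \<in> D} \<union> {(x, \<phi> x) | x. x \<in> D})\<^sup>*) \<and>
     int (card (cycle_of (\<phi> \<circ> \<epsilon>) ` D)) - int (card (cycle_of \<epsilon> ` D))
       + int (card (cycle_of \<phi> ` D)) = 2"

text \<open>\<open>l\<close> is the combinatorial map to \<open>Y\<close>, given on darts; the condition on \<open>src\<close> makes it well defined
  on vertices. The face of \<open>d\<^sub>0\<close> is the unbounded region, all other faces are 2-cells
  of the diagram. The boundary loop may be read with the unbounded region on the left, because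
  2-cells may be mapped with either orientation.\<close>

definition vk_diagram :: "('v, 'e, 'f) complex2 \<Rightarrow> 'd set \<Rightarrow> ('d \<Rightarrow> 'd) \<Rightarrow> ('d \<Rightarrow> 'd) \<Rightarrow>
    ('d \<Rightarrow> 'e) \<Rightarrow> 'd \<Rightarrow> bool" where
  "vk_diagram Y D \<epsilon> \<phi> l d\<^sub>0 \<longleftrightarrow> planar_map D \<epsilon> \<phi> \<and> d\<^sub>0 \<in> D \<and>
     (\<forall>d\<in>D. l d \<in> edges Y \<and> l (\<epsilon> d) = rv Y (l d) \<and> src Y (l (\<phi> d)) = tgt Y (l d)) \<and>
     (\<forall>d\<in>D. d \<notin> cycle_of \<phi> d\<^sub>0 \<longrightarrow>
        (\<exists>f\<in>faces Y. same_cycle Y (map l (cycle_list \<phi> d)) (bdry Y f)))"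

text \<open>The first disjunct is the diagram consisting of a single vertex. Diagrams being finite, their darts
  may be taken to be natural numbers.\<close>

definition filled_by :: "('v, 'e, 'f) complex2 \<Rightarrow> 'e list \<Rightarrow> nat \<Rightarrow> bool" where
  "filled_by Y p N \<longleftrightarrow> p = [] \<and> N = 0 \<or>
     (\<exists>(D::nat set) \<epsilon> \<phi> l d\<^sub>0. vk_diagram Y D \<epsilon> \<phi> l d\<^sub>0 \<and> map l (cycle_list \<phi> d\<^sub>0) = p \<and>
        card (cycle_of \<phi> ` D - {cycle_of \<phi> d\<^sub>0}) = N)"

definition filling_area :: "('v, 'e, 'f) complex2 \<Rightarrow> 'e list \<Rightarrow> nat" where
  "filling_area Y p = (LEAST N. filled_by Y p N)"

definition dehn_function :: "('v, 'e, 'f) complex2 \<Rightarrow> nat \<Rightarrow> nat" where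
  "dehn_function Y n =
     Sup {filling_area Y p | p. (\<exists>v. edge_path Y v p v) \<and> length p \<le> n}"


section \<open>Representatives\<close>

text \<open>Dehn functions are defined up to \<open>\<approx>\<close> and distortion functions up to \<open>\<simeq>\<close>, but products,
  composition and superadditive closure do not respect these relations, so a bound that combines them
  requires suitable representatives. A Dehn function has to be represented by an at least linear
  function: for \<open>BS(1,2)\<close> acting on its Bass-Serre tree, the vertex group \<open>\<int>\<close> acts on a line, which
  gives the Dehn function 0, although the Dehn function of \<open>BS(1,2)\<close> is exponential. A distortion
  function must not be represented by 0: for \<open>\<int>\<^sup>2 * \<int>\<^sup>2\<close> the edge groups are trivial and
  \<open>edist\<close> below is 0, but the Dehn function is quadratic.
  Each equivalence class has admissible representatives, such as \<open>\<lambda>n. max n (dehn_function Y n)\<close>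
  and \<open>\<lambda>n. max 1 (f n)\<close>. The function \<open>dehn_function Y\<close>, which is monotone for
  \<open>dehn_complex H Y\<close>, is itself admissible if it is bounded below by the identity,
  and \<open>edist\<close> is admissible if some edge stabilizer is nontrivial.\<close>

definition represents_dehn :: "('v, 'e, 'f) complex2 \<Rightarrow> (nat \<Rightarrow> real) \<Rightarrow> bool" where
  "represents_dehn Y \<delta> \<longleftrightarrow> \<delta> \<approx> (\<lambda>n. real (dehn_function Y n)) \<and> mono \<delta> \<and> (\<forall>n. real n \<le> \<delta> n)"

definition represents_dist :: "(nat \<Rightarrow> nat) \<Rightarrow> (nat \<Rightarrow> nat) \<Rightarrow> bool" where
  "represents_dist f D \<longleftrightarrow> (\<lambda>n. real (D n)) \<simeq> (\<lambda>n. real (f n)) \<and> (\<exists>n\<ge>1. D n \<noteq> 0)"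


section \<open>Actions on trees\<close>

text \<open>A tree is a simple graph, so its edges are 2-element sets of vertices and a cellular action
  is determined by the action on the vertices.\<close>

definition is_tree :: "'v set \<Rightarrow> 'v set set \<Rightarrow> bool" where
  "is_tree V E \<longleftrightarrow> V \<noteq> {} \<and>
     (\<forall>e\<in>E. \<exists>x\<in>V. \<exists>y\<in>V. x \<noteq> y \<and> e = {x, y}) \<and>
     (\<forall>x\<in>V. \<forall>y\<in>V. \<exists>xs. xs \<noteq> [] \<and> hd xs = x \<and> last xs = y \<and>
        successively (\<lambda>u v. {u, v} \<in> E) xs) \<and>
     \<not> (\<exists>xs. length xs \<ge> 3 \<and> distinct xs \<and> successively (\<lambda>u v. {u, v} \<in> E) xs \<and>
        {last xs, hd xs} \<in> E)"

definition edge_act :: "('a \<Rightarrow> 'v \<Rightarrow> 'v) \<Rightarrow> 'a \<Rightarrow> 'v set \<Rightarrow> 'v set" where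
  "edge_act \<psi> g e = \<psi> g ` e"

definition tree_action ::
  "('a, 'm) monoid_scheme \<Rightarrow> 'v set \<Rightarrow> 'v set set \<Rightarrow> ('a \<Rightarrow> 'v \<Rightarrow> 'v) \<Rightarrow> bool" where
  "tree_action G V E \<psi> \<longleftrightarrow> is_tree V E \<and> group_action G V \<psi> \<and>
     (\<forall>g\<in>carrier G. \<forall>e\<in>E. edge_act \<psi> g e \<in> E)"

definition without_inversion ::
  "('a, 'm) monoid_scheme \<Rightarrow> 'v set set \<Rightarrow> ('a \<Rightarrow> 'v \<Rightarrow> 'v) \<Rightarrow> bool" where
  "without_inversion G E \<psi> \<longleftrightarrow>
     (\<forall>g\<in>carrier G. \<forall>e\<in>E. edge_act \<psi> g e = e \<longrightarrow> (\<forall>x\<in>e. \<psi> g x = x))"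

definition cocompact ::
  "('a, 'm) monoid_scheme \<Rightarrow> 'v set \<Rightarrow> 'v set set \<Rightarrow> ('a \<Rightarrow> 'v \<Rightarrow> 'v) \<Rightarrow> bool" where
  "cocompact G V E \<psi> \<longleftrightarrow> finite (orbits G V \<psi>) \<and> finite (orbits G E (edge_act \<psi>))"

definition orbit_representatives ::
  "('a, 'm) monoid_scheme \<Rightarrow> 'x set \<Rightarrow> ('a \<Rightarrow> 'x \<Rightarrow> 'x) \<Rightarrow> 'x set \<Rightarrow> bool" where
  "orbit_representatives G X \<psi> R \<longleftrightarrow> finite R \<and> R \<subseteq> X \<and> (\<forall>x\<in>X. \<exists>!r. r \<in> R \<and> r \<in> orbit G \<psi> x)"

definition vertex_group ::
  "('a, 'm) monoid_scheme \<Rightarrow> ('a \<Rightarrow> 'v \<Rightarrow> 'v) \<Rightarrow> 'v \<Rightarrow> ('a, 'm) monoid_scheme" where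
  "vertex_group G \<psi> v = G\<lparr>carrier := stabilizer G \<psi> v\<rparr>"

definition edge_group ::
  "('a, 'm) monoid_scheme \<Rightarrow> ('a \<Rightarrow> 'v \<Rightarrow> 'v) \<Rightarrow> 'v set \<Rightarrow> ('a, 'm) monoid_scheme" where
  "edge_group G \<psi> e = G\<lparr>carrier := stabilizer G (edge_act \<psi>) e\<rparr>"

text \<open>\<open>R\<close> is a set of representatives of the edge orbits. The supremum is 0 if the tree has no edges.\<close>

definition edist :: "('a, 'm) monoid_scheme \<Rightarrow> 'a set \<Rightarrow> ('a \<Rightarrow> 'v \<Rightarrow> 'v) \<Rightarrow> 'v set set \<Rightarrow>
    ('v set \<Rightarrow> 'a set) \<Rightarrow> nat \<Rightarrow> nat" where
  "edist G S \<psi> R S' n = (SUP e\<in>R. distortion G S (stabilizer G (edge_act \<psi>) e) (S' e) n)"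

end

theory Submission
  imports Defs
begin

text \<open>
  Let \<open>Z\<close> be the 2-complex on the vertex orbits whose edges are the generators of the vertex groups together with
  one stable letter for each edge orbit, and whose faces are all closed paths of bounded length representing 1.
  A loop representing 1 in \<open>G\<close> traces a closed walk in \<open>T\<close>. An excursion across
  an edge \<open>e\<close> that returns through \<open>e\<close> represents an element of \<open>G\<^sub>e\<close>, so it can be replaced
  by a word in the generators of \<open>G\<^sub>e\<close> whose length is at most the distortion of the length of the excursion.
  Since the superadditive closure bounds sums of such lengths, all words met on the way have length at most
  the closure, up to constants, and each of the at most \<open>n\<close> replacements is paid for by one filling in a vertex group.

  Dehn functions are compared through a counting version of homotopy, in which every use of a face costs 1. A homotopy of
  cost \<open>N\<close> yields a diagram with at most \<open>N\<close> faces by gluing boundary edges of the diagram; if a gluing separates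
  the combinatorial map, both pieces are planar, because the Euler characteristic of a connected map is at most 2.
  Conversely, the edges between the unbounded region and a 2-cell are removed one by one until the diagram is a tree.
\<close>

section \<open>Homotopies of edge paths with area\<close>

text \<open>Removing excursions one inside another threatens to iterate the distortion. It does not,
  because the replacement word is chosen from the element of the edge group and never from the word
  already reduced: an excursion around \<open>p1\<close> is measured by
  \<open>B (length p1 + 2)\<close>, whatever has become of \<open>p1\<close> meanwhile. The reduced
  \<open>p1\<close> enters only as one side of a filling in a vertex group, with boundary length at
  most \<open>2 * B n\<close>. The complex \<open>Y\<close> of the statement is arbitrary and not
  related to \<open>Z\<close>. The two are compared by translating loops back and forth. This is why
  all short closed paths representing 1 are faces of \<open>Z\<close>: the image of a face of
  \<open>Y\<close>, or the round trip of a letter, then costs a single face. The bound on their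
  length is a parameter \<open>K\<close>, fixed only after the constants of all vertex groups are
  known. The area estimate is stated for an abstract filling function \<open>A\<close> and a
  superadditive \<open>B\<close>. With Dehn and distortion functions it gives the inequality; with
  functions obtained from mere finiteness it gives finite presentability.\<close>

text \<open>\<open>homotopic Y u v N p q\<close>: the edge path \<open>p\<close> can be turned into \<open>q\<close> by at most \<open>N\<close> insertions or
  deletions of face boundaries; insertions and deletions of \<open>[e, rv Y e]\<close> are not counted.\<close>

inductive homotopy_step :: "('v, 'e, 'f) complex2 \<Rightarrow> 'v \<Rightarrow> 'v \<Rightarrow> nat \<Rightarrow> 'e list \<Rightarrow> 'e list \<Rightarrow> bool"
  for Y u v where
  cancel: "edge_path Y u (p @ [e, rv Y e] @ q) v \<Longrightarrow>
    homotopy_step Y u v 0 (p @ [e, rv Y e] @ q) (p @ q)"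
| face: "f \<in> faces Y \<Longrightarrow> edge_path Y u (p @ bdry Y f @ q) v \<Longrightarrow>
    homotopy_step Y u v 1 (p @ bdry Y f @ q) (p @ q)"

inductive homotopic :: "('v, 'e, 'f) complex2 \<Rightarrow> 'v \<Rightarrow> 'v \<Rightarrow> nat \<Rightarrow> 'e list \<Rightarrow> 'e list \<Rightarrow> bool"
  for Y u v where
  refl: "edge_path Y u p v \<Longrightarrow> homotopic Y u v N p p"
| forward: "homotopic Y u v N p q \<Longrightarrow> homotopy_step Y u v k q r \<Longrightarrow> homotopic Y u v (N + k) p r"
| backward: "homotopic Y u v N p q \<Longrightarrow> homotopy_step Y u v k r q \<Longrightarrow> homotopic Y u v (N + k) p r"

lemma rotate_invertible: "\<exists>j. xs = rotate j (rotate k xs)"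
proof (cases "xs = []")
  case False
  then have "k mod length xs < length xs" by simp
  then have "rotate (length xs - k mod length xs) (rotate (k mod length xs) xs) = rotate (length xs) xs"
    by (simp add: rotate_rotate)
  then show ?thesis by (metis rotate_conv_mod rotate_length01 rotate_id mod_self rotate0 id_apply)
qed simp

lemma rev_rotate: "\<exists>j. rev (rotate k xs) = rotate j (rev xs)"
proof (induction k)
  case 0
  have "rev (rotate 0 xs) = rotate 0 (rev xs)" by simp
  then show ?case by blast
next
  case (Suc k)
  then obtain j where j: "rev (rotate k xs) = rotate j (rev xs)" by blast
  show ?case
  proof (cases "rotate k xs")
    case Nil
    then have "rev (rotate (Suc k) xs) = rotate 0 (rev xs)" by simp
    then show ?thesis by blast
  next
    case (Cons a ys)
    then have "rev (rotate (Suc k) xs) = rotate (length ys) (rev (rotate k xs))"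
      using rotate_append[of "rev ys" "[a]"] by simp
    then show ?thesis unfolding j rotate_rotate by blast
  qed
qed

locale two_complex =
  fixes Y :: "('v, 'e, 'f) complex2"
  assumes complex: "is_complex2 Y"
begin

abbreviation path_inv where "path_inv \<equiv> path_inverse Y"

lemma rv_in [simp]: "e \<in> edges Y \<Longrightarrow> rv Y e \<in> edges Y"
  and rv_neq: "e \<in> edges Y \<Longrightarrow> rv Y e \<noteq> e"
  and rv_rv [simp]: "e \<in> edges Y \<Longrightarrow> rv Y (rv Y e) = e"
  and src_in [simp]: "e \<in> edges Y \<Longrightarrow> src Y e \<in> verts Y"
  using complex unfolding is_complex2_def by auto

lemma tgt_in [simp]: "e \<in> edges Y \<Longrightarrow> tgt Y e \<in> verts Y"
  by (simp add: tgt_def)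

lemma tgt_rv [simp]: "e \<in> edges Y \<Longrightarrow> tgt Y (rv Y e) = src Y e"
  by (simp add: tgt_def)

lemma src_rv [simp]: "src Y (rv Y e) = tgt Y e"
  by (simp add: tgt_def)

lemma edge_path_verts: "edge_path Y u p v \<Longrightarrow> u \<in> verts Y \<and> v \<in> verts Y"
  by (induction p arbitrary: u) auto

lemma edge_path_edges: "edge_path Y u p v \<Longrightarrow> set p \<subseteq> edges Y"
  by (induction p arbitrary: u) auto

lemma edge_path_append_iff:
  "edge_path Y u (p @ q) v \<longleftrightarrow> (\<exists>w. edge_path Y u p w \<and> edge_path Y w q v)"
  by (induction p arbitrary: u) (auto dest: edge_path_verts)

lemma edge_path_append: "edge_path Y u p w \<Longrightarrow> edge_path Y w q v \<Longrightarrow> edge_path Y u (p @ q) v"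
  using edge_path_append_iff by blast

lemma edge_path_target_unique: "edge_path Y u p v \<Longrightarrow> edge_path Y u p w \<Longrightarrow> v = w"
  by (induction p arbitrary: u) auto

lemma edge_path_source_unique: "edge_path Y u p v \<Longrightarrow> edge_path Y w p v' \<Longrightarrow> p \<noteq> [] \<Longrightarrow> u = w"
  by (cases p) auto

lemma path_inverse_Nil [simp]: "path_inv [] = []"
  and path_inverse_append [simp]: "path_inv (p @ q) = path_inv q @ path_inv p"
  and path_inverse_Cons: "path_inv (e # p) = path_inv p @ [rv Y e]"
  and length_path_inverse [simp]: "length (path_inv p) = length p"
  by (simp_all add: path_inverse_def)

lemma path_inverse_inverse [simp]: "set p \<subseteq> edges Y \<Longrightarrow> path_inv (path_inv p) = p"
  by (induction p) (auto simp: path_inverse_def)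

lemma path_inverse_edges [simp]: "set p \<subseteq> edges Y \<Longrightarrow> set (path_inv p) \<subseteq> edges Y"
  by (auto simp: path_inverse_def)

lemma edge_path_inverse: "edge_path Y u p v \<Longrightarrow> edge_path Y v (path_inv p) u"
proof (induction p arbitrary: u)
  case (Cons e p)
  then have e: "e \<in> edges Y" "src Y e = u" and p: "edge_path Y (tgt Y e) p v" by auto
  have "edge_path Y (tgt Y e) [rv Y e] u" using e src_in[of e] by auto
  with Cons.IH[OF p] show ?case unfolding path_inverse_Cons by (rule edge_path_append)
qed simp

lemma face_nonempty: "f \<in> faces Y \<Longrightarrow> bdry Y f \<noteq> []"
  and face_loop: "f \<in> faces Y \<Longrightarrow> \<exists>v. edge_path Y v (bdry Y f) v"
  using complex unfolding is_complex2_def by auto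

lemma homotopy_step_path: "homotopy_step Y u v k p q \<Longrightarrow> edge_path Y u p v \<and> edge_path Y u q v"
proof (induction rule: homotopy_step.induct)
  case (cancel p e q)
  then show ?case by (fastforce simp: edge_path_append_iff)
next
  case (face f p q)
  then obtain w w' where w: "edge_path Y u p w" "edge_path Y w (bdry Y f) w'" "edge_path Y w' q v"
    by (auto simp: edge_path_append_iff)
  \<comment> \<open>The boundary is closed at some \<open>x\<close>. A nonempty path determines its
    source and its target, so \<open>w = w'\<close>.\<close>
  obtain x where "edge_path Y x (bdry Y f) x" using face_loop face by blast
  then have "w = w'" using w face_nonempty[OF face(1)] edge_path_source_unique edge_path_target_unique
    by metis
  then show ?case using w face by (auto simp: edge_path_append_iff)
qed

lemma homotopic_path: "homotopic Y u v N p q \<Longrightarrow> edge_path Y u p v \<and> edge_path Y u q v"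
  by (induction rule: homotopic.induct) (auto dest: homotopy_step_path)

lemma homotopic_mono: "homotopic Y u v N p q \<Longrightarrow> N \<le> M \<Longrightarrow> homotopic Y u v M p q"
proof (induction arbitrary: M rule: homotopic.induct)
  case (refl p N)
  then show ?case by (simp add: homotopic.refl)
next
  case (forward N p q k r)
  then have "homotopic Y u v ((M - k) + k) p r"
    by (intro homotopic.forward[OF forward.IH]) auto
  then show ?case using forward.prems by simp
next
  case (backward N p q k r)
  then have "homotopic Y u v ((M - k) + k) p r"
    by (intro homotopic.backward[OF backward.IH]) auto
  then show ?case using backward.prems by simp
qed

lemma homotopic_trans:
  assumes "homotopic Y u v N p q" and "homotopic Y u v M q r"
  shows "homotopic Y u v (N + M) p r"
  using assms(2,1)
proof (induction rule: homotopic.induct)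
  case (refl p N)
  then show ?case by (metis homotopic_mono le_add1)
next
  case (forward M q r k s)
  then show ?case using homotopic.forward by (metis add.assoc)
next
  case (backward M q r k s)
  then show ?case using homotopic.backward by (metis add.assoc)
qed

lemma homotopy_step_homotopic:
  assumes "homotopy_step Y u v k p q"
  shows "homotopic Y u v k p q" and "homotopic Y u v k q p"
  using homotopic.forward[OF homotopic.refl[of Y u p v 0]] homotopic.backward[OF homotopic.refl[of Y u q v 0]]
    homotopy_step_path[OF assms] assms by fastforce+

lemma homotopic_sym: "homotopic Y u v N p q \<Longrightarrow> homotopic Y u v N q p"
proof (induction rule: homotopic.induct)
  case (refl p N)
  then show ?case by (rule homotopic.refl)
next
  case (forward N p q k r)
  then show ?case using homotopic_trans homotopy_step_homotopic(2) by (metis add.commute)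
next
  case (backward N p q k r)
  then show ?case using homotopic_trans homotopy_step_homotopic(1) by (metis add.commute)
qed

lemma homotopy_step_context:
  assumes "homotopy_step Y u v k p q" "edge_path Y u' a u" "edge_path Y v b v'"
  shows "homotopy_step Y u' v' k (a @ p @ b) (a @ q @ b)"
  using assms
proof (induction rule: homotopy_step.induct)
  case (cancel p e q)
  then have "edge_path Y u' (a @ (p @ [e, rv Y e] @ q) @ b) v'"
    by (blast intro: edge_path_append)
  then show ?case using homotopy_step.cancel[of Y u' "a @ p" e "q @ b" v'] by simp
next
  case (face f p q)
  then have "edge_path Y u' (a @ (p @ bdry Y f @ q) @ b) v'"
    by (blast intro: edge_path_append)
  then show ?case using homotopy_step.face[of f Y u' "a @ p" "q @ b" v'] face by simp
qed

lemma homotopic_context: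
  assumes "homotopic Y u v N p q" "edge_path Y u' a u" "edge_path Y v b v'"
  shows "homotopic Y u' v' N (a @ p @ b) (a @ q @ b)"
  using assms
proof (induction rule: homotopic.induct)
  case (refl p N)
  then show ?case by (blast intro: homotopic.refl edge_path_append)
next
  case (forward N p q k r)
  then show ?case using homotopic.forward homotopy_step_context by metis
next
  case (backward N p q k r)
  then show ?case using homotopic.backward homotopy_step_context by metis
qed

lemma homotopic_append:
  assumes "homotopic Y u v N p p'" "homotopic Y v w M q q'"
  shows "homotopic Y u w (N + M) (p @ q) (p' @ q')"
proof -
  have "homotopic Y u w N (p @ q) (p' @ q)"
    using homotopic_context[OF assms(1), of u "[]" q w] homotopic_path[OF assms(1)]
      homotopic_path[OF assms(2)] by (auto dest: edge_path_verts)
  moreover have "homotopic Y u w M (p' @ q) (p' @ q')"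
    using homotopic_context[OF assms(2), of u p' "[]" w] homotopic_path[OF assms(1)]
      homotopic_path[OF assms(2)] by (auto dest: edge_path_verts)
  ultimately show ?thesis by (rule homotopic_trans)
qed

lemma homotopic_cancel:
  "edge_path Y u p v \<Longrightarrow> homotopic Y u u N (p @ path_inv p) []"
proof (induction p arbitrary: u N)
  case Nil
  then show ?case by (auto intro: homotopic.refl)
next
  case (Cons e p)
  then have e: "e \<in> edges Y" "src Y e = u" and p: "edge_path Y (tgt Y e) p v" by auto
  have "homotopic Y u u N ([e] @ (p @ path_inv p) @ [rv Y e]) ([e] @ [] @ [rv Y e])"
    by (rule homotopic_context[OF Cons.IH[OF p]]) (use e in auto)
  moreover have "homotopy_step Y u u 0 ([] @ [e, rv Y e] @ []) ([] @ [])"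
    by (rule homotopy_step.cancel) (use e in auto)
  ultimately have "homotopic Y u u (N + 0) ((e # p) @ path_inv (e # p)) []"
    by (intro homotopic.forward[where q = "[e, rv Y e]"]) (simp_all add: path_inverse_Cons)
  then show ?case by simp
qed

lemma homotopic_cancel':
  assumes "edge_path Y u p v"
  shows "homotopic Y v v N (path_inv p @ p) []"
  using homotopic_cancel[OF edge_path_inverse[OF assms]] edge_path_edges[OF assms] by simp

text \<open>Both sides are moved by \<open>b\<close> and back, so a relation holds as soon as the loop formed by its
  two sides is null-homotopic.\<close>

lemma homotopic_of_loop:
  assumes "edge_path Y u p v" "edge_path Y u q v" "homotopic Y u u N (p @ path_inv q) []"
  shows "homotopic Y u v N p q"
proof -
  have "homotopic Y u v 0 (p @ (path_inv q @ q)) (p @ [])"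
    using homotopic_append[OF homotopic.refl[OF assms(1), of 0] homotopic_cancel'[OF assms(2), of 0]]
    by simp
  then have "homotopic Y u v 0 p (p @ path_inv q @ q)" using homotopic_sym by simp
  moreover have "homotopic Y u v N ((p @ path_inv q) @ q) ([] @ q)"
    using homotopic_append[OF assms(3) homotopic.refl[OF assms(2), of 0]] by simp
  ultimately show ?thesis using homotopic_trans by fastforce
qed

text \<open>An induction over the steps would meet inverted boundary words, which need not be
  boundaries. Instead \<open>path_inv p\<close> is extended by \<open>q @ path_inv q\<close>, the
  middle \<open>q\<close> is exchanged for \<open>p\<close>, and \<open>path_inv p @ p\<close>
  cancels; only the exchange costs area.\<close>

lemma homotopic_inverse:
  assumes "homotopic Y u v N p q"
  shows "homotopic Y v u N (path_inv p) (path_inv q)"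
proof -
  have p: "edge_path Y u p v" and q: "edge_path Y u q v" using homotopic_path[OF assms] by auto
  note p' = edge_path_inverse[OF p] and q' = edge_path_inverse[OF q]
  have "homotopic Y v u 0 (path_inv p @ q @ path_inv q) (path_inv p @ [])"
    using homotopic_append[OF homotopic.refl[OF p', of 0] homotopic_cancel[OF q, of 0]] by simp
  moreover have "homotopic Y v u N (path_inv p @ p @ path_inv q) (path_inv p @ q @ path_inv q)"
    by (rule homotopic_context[OF assms p' q'])
  moreover have "homotopic Y v u 0 ((path_inv p @ p) @ path_inv q) ([] @ path_inv q)"
    using homotopic_append[OF homotopic_cancel'[OF p, of 0] homotopic.refl[OF q', of 0]] by simp
  ultimately show ?thesis
    using homotopic_sym homotopic_trans by (metis add.right_neutral append.assoc append_Nil append_Nil2)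
qed

text \<open>Moving \<open>q\<close> to the other side makes \<open>p\<close> homotopic to
  \<open>path_inv q\<close>, and prefixing \<open>q\<close> turns this into a null-homotopy of
  \<open>q @ p\<close> with the same count.\<close>

lemma homotopic_rotate:
  assumes "edge_path Y u p v" "edge_path Y v q u" "homotopic Y u u N (p @ q) []"
  shows "homotopic Y v v N (q @ p) []"
proof -
  have "homotopic Y u v N p (path_inv q)"
    by (rule homotopic_of_loop) (use assms edge_path_inverse edge_path_edges in auto)
  then have "homotopic Y v v (0 + N) (q @ p) (q @ path_inv q)"
    using homotopic_append[OF homotopic.refl[OF assms(2), of 0]] by simp
  then show ?thesis using homotopic_trans[OF _ homotopic_cancel[OF assms(2), of 0]] by simp
qed

lemma homotopic_face: "f \<in> faces Y \<Longrightarrow> edge_path Y u (bdry Y f) u \<Longrightarrow> homotopic Y u u 1 (bdry Y f) []"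
  using homotopy_step_homotopic(1)[OF homotopy_step.face[of f Y u "[]" "[]" u]] by simp

lemma homotopic_rotate_iff:
  assumes "edge_path Y u p u" "edge_path Y v (rotate k p) v" "homotopic Y u u N p []"
  shows "homotopic Y v v N (rotate k p) []"
proof (cases "p = []")
  case True
  then show ?thesis using assms by (auto intro: homotopic.refl)
next
  case False
  let ?a = "take (k mod length p) p" and ?b = "drop (k mod length p) p"
  obtain w where w: "edge_path Y u ?a w" "edge_path Y w ?b u"
    using assms(1) edge_path_append_iff append_take_drop_id by metis
  have "homotopic Y w w N (?b @ ?a) []" by (rule homotopic_rotate[OF w]) (simp add: assms(3))
  moreover have "w = v"
  proof (rule edge_path_source_unique)
    show "edge_path Y w (rotate k p) w" unfolding rotate_drop_take using w edge_path_append by blast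
  qed (use assms(2) False in auto)
  ultimately show ?thesis by (simp add: rotate_drop_take)
qed

lemma homotopic_same_cycle:
  assumes "same_cycle Y p q" "edge_path Y u p u" "edge_path Y v q v" "homotopic Y v v N q []"
  shows "homotopic Y u u N p []"
proof -
  from assms(1) consider k where "p = rotate k q" | k where "p = rotate k (path_inv q)"
    unfolding same_cycle_def by blast
  then show ?thesis
  proof cases
    case 1
    then show ?thesis using homotopic_rotate_iff[OF assms(3) _ assms(4)] assms(2) by simp
  next
    case 2
    have "homotopic Y v v N (path_inv q) []" using homotopic_inverse[OF assms(4)] by simp
    then show ?thesis
      using homotopic_rotate_iff[OF edge_path_inverse[OF assms(3)]] assms(2) 2 by simp
  qed
qed

lemma homotopic_face_cycle:
  "f \<in> faces Y \<Longrightarrow> same_cycle Y p (bdry Y f) \<Longrightarrow> edge_path Y u p u \<Longrightarrow> homotopic Y u u 1 p []"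
  using homotopic_same_cycle[of p "bdry Y f" u] face_loop[of f] homotopic_face[of f] by blast

lemma path_inverse_rotate: "\<exists>j. path_inv (rotate k p) = rotate j (path_inv p)"
  using rev_rotate[of k "map (rv Y) p"] unfolding path_inverse_def by (simp add: rotate_map)

lemma same_cycle_sym:
  assumes "same_cycle Y p q" "set q \<subseteq> edges Y"
  shows "same_cycle Y q p"
proof -
  from assms(1) consider k where "p = rotate k q" | k where "p = rotate k (path_inv q)"
    unfolding same_cycle_def by blast
  then show ?thesis
  proof cases
    case 1
    then show ?thesis using rotate_invertible[of q k] unfolding same_cycle_def by metis
  next
    case 2
    then obtain j where "path_inv q = rotate j p" using rotate_invertible[of "path_inv q" k] by metis
    then have "q = path_inv (rotate j p)" using assms(2) path_inverse_inverse by metis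
    then show ?thesis using path_inverse_rotate[of j p] unfolding same_cycle_def by metis
  qed
qed

lemma same_cycle_inverse:
  assumes "same_cycle Y p q" "set q \<subseteq> edges Y"
  shows "same_cycle Y (path_inv p) q"
proof -
  from assms(1) consider k where "p = rotate k q" | k where "p = rotate k (path_inv q)"
    unfolding same_cycle_def by blast
  then show ?thesis
  proof cases
    case 1
    then show ?thesis using path_inverse_rotate[of k q] unfolding same_cycle_def by auto
  next
    case 2
    then show ?thesis using path_inverse_rotate[of k "path_inv q"] assms(2) unfolding same_cycle_def by auto
  qed
qed

text \<open>Passes between simple connectivity, which is formulated with uncounted steps, and
  homotopies of some finite area.\<close>

lemma equivclp_loop_step_iff:
  assumes "edge_path Y v p v"
  shows "equivclp (loop_step Y v) p q \<longleftrightarrow> (\<exists>N. homotopic Y v v N p q)"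
proof
  have s: "\<exists>k. homotopy_step Y v v k p q" if "loop_step Y v p q" for p q
    using that by (induction rule: loop_step.induct) (blast intro: homotopy_step.intros)+
  show "\<exists>N. homotopic Y v v N p q" if "equivclp (loop_step Y v) p q"
    using that
  proof (induction rule: equivclp_induct)
    case base
    show ?case using homotopic.refl[OF assms, of 0] by blast
  next
    case (step y z)
    then obtain N where N: "homotopic Y v v N p y" by blast
    from step(2) show ?case
    proof
      assume "loop_step Y v y z"
      then obtain k where "homotopy_step Y v v k y z" using s by blast
      then show ?case using homotopic.forward[OF N] by blast
    next
      assume "loop_step Y v z y"
      then obtain k where "homotopy_step Y v v k z y" using s by blast
      then show ?case using homotopic.backward[OF N] by blast
    qed
  qed
next
  have s: "loop_step Y v p q" if "homotopy_step Y v v k p q" for p q k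
    using that by (induction rule: homotopy_step.induct) (blast intro: loop_step.intros)+
  assume "\<exists>N. homotopic Y v v N p q"
  then obtain N where "homotopic Y v v N p q" by blast
  then show "equivclp (loop_step Y v) p q"
  proof (induction rule: homotopic.induct)
    case (forward N p q k r)
    then show ?case using s equivclp_into_equivclp by metis
  next
    case (backward N p q k r)
    then show ?case using s equivclp_into_equivclp by metis
  qed simp
qed

end

section \<open>Cycles of permutations\<close>

text \<open>A cycle is kept as a list with a chosen start, so that mapping labels over it yields a
  boundary word. It coincides with \<open>cycle_list f\<close> at its head.\<close>

definition is_cycle :: "('d \<Rightarrow> 'd) \<Rightarrow> 'd list \<Rightarrow> bool" where
  "is_cycle f xs \<longleftrightarrow> xs \<noteq> [] \<and> distinct xs \<and> successively (\<lambda>x y. f x = y) xs \<and> f (last xs) = hd xs"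

definition perm_on :: "'d set \<Rightarrow> ('d \<Rightarrow> 'd) \<Rightarrow> bool" where
  "perm_on D f \<longleftrightarrow> finite D \<and> bij_betw f D D"

definition cycle_count :: "('d \<Rightarrow> 'd) \<Rightarrow> 'd set \<Rightarrow> nat" where
  "cycle_count f A = card (cycle_of f ` A)"

text \<open>\<open>skip a f\<close> removes \<open>a\<close> from its cycle.\<close>

definition skip :: "'d \<Rightarrow> ('d \<Rightarrow> 'd) \<Rightarrow> 'd \<Rightarrow> 'd" where
  "skip a f = (\<lambda>z. if f z = a then f a else f z)"

lemma perm_onI: "finite D \<Longrightarrow> inj_on f D \<Longrightarrow> f ` D \<subseteq> D \<Longrightarrow> perm_on D f"
  unfolding perm_on_def bij_betw_def by (simp add: endo_inj_surj)

lemma perm_onD: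
  assumes "perm_on D f"
  shows "finite D" "inj_on f D" "f ` D = D" "\<And>x. x \<in> D \<Longrightarrow> f x \<in> D"
  using assms unfolding perm_on_def bij_betw_def by auto

lemma perm_on_subset: "perm_on D f \<Longrightarrow> A \<subseteq> D \<Longrightarrow> f ` A \<subseteq> A \<Longrightarrow> perm_on A f"
  by (rule perm_onI) (auto simp: perm_on_def bij_betw_def intro: finite_subset inj_on_subset)

text \<open>On a finite invariant set an injective map is onto, so nothing from outside can be
  mapped into it.\<close>

lemma perm_on_Diff:
  assumes "perm_on D f" "A \<subseteq> D" "f ` A \<subseteq> A"
  shows "f ` (D - A) \<subseteq> D - A"
proof -
  have "f ` A = A" using perm_onD(3)[OF perm_on_subset[OF assms]] .
  then show ?thesis using perm_onD[OF assms(1)] assms(2)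
    by (auto simp: inj_on_def) (metis imageE in_mono)
qed

lemma perm_on_cong: "(\<And>x. x \<in> D \<Longrightarrow> f x = g x) \<Longrightarrow> perm_on D f \<longleftrightarrow> perm_on D g"
  unfolding perm_on_def using bij_betw_cong by blast

lemma is_cycle_nth:
  assumes "is_cycle f xs" "i < length xs"
  shows "f (xs ! i) = xs ! (Suc i mod length xs)"
proof (cases "Suc i < length xs")
  case True
  then show ?thesis using assms unfolding is_cycle_def by (simp add: successively_conv_nth)
next
  case False
  then have "i = length xs - 1" "Suc i = length xs" using assms(2) by auto
  then show ?thesis using assms unfolding is_cycle_def by (auto simp: last_conv_nth hd_conv_nth)
qed

lemma is_cycle_funpow:
  assumes "is_cycle f xs" "i < length xs"
  shows "(f ^^ k) (xs ! i) = xs ! ((i + k) mod length xs)"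
proof (induction k)
  case (Suc k)
  have "length xs > 0" using assms by auto
  then show ?case using Suc is_cycle_nth[OF assms(1), of "(i + k) mod length xs"]
    by (simp add: mod_Suc_eq)
qed (use assms in simp)

lemma cycle_of_is_cycle:
  assumes "is_cycle f xs" "z \<in> set xs"
  shows "cycle_of f z = set xs"
proof -
  let ?n = "length xs"
  obtain i where i: "i < ?n" "z = xs ! i" using assms(2) by (metis in_set_conv_nth)
  have "cycle_of f z = range (\<lambda>k. xs ! ((i + k) mod ?n))"
    unfolding cycle_of_def i(2) using is_cycle_funpow[OF assms(1) i(1)] by simp
  also have "\<dots> = set xs"
  proof
    show "range (\<lambda>k. xs ! ((i + k) mod ?n)) \<subseteq> set xs"
      using i(1) by (auto intro!: nth_mem mod_less_divisor)
    show "set xs \<subseteq> range (\<lambda>k. xs ! ((i + k) mod ?n))"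
    proof
      fix y assume "y \<in> set xs"
      then obtain j where j: "j < ?n" "y = xs ! j" by (metis in_set_conv_nth)
      have "(i + (j + ?n - i)) mod ?n = j" using i(1) j(1) by simp
      then show "y \<in> range (\<lambda>k. xs ! ((i + k) mod ?n))" using j(2) by (metis rangeI)
    qed
  qed
  finally show ?thesis .
qed

lemma cycle_list_is_cycle:
  assumes "is_cycle f xs"
  shows "cycle_list f (hd xs) = xs"
proof -
  have ne: "xs \<noteq> []" and d: "distinct xs" using assms unfolding is_cycle_def by auto
  have "card (cycle_of f (hd xs)) = length xs"
    using cycle_of_is_cycle[OF assms, of "hd xs"] ne d by (simp add: distinct_card)
  then show ?thesis unfolding cycle_list_def
    by (intro nth_equalityI) (use ne is_cycle_funpow[OF assms, of 0] in \<open>auto simp: hd_conv_nth\<close>)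
qed

lemma is_cycle_append_commute:
  assumes "is_cycle f (xs @ ys)"
  shows "is_cycle f (ys @ xs)"
proof (cases "xs = [] \<or> ys = []")
  case False
  then show ?thesis using assms unfolding is_cycle_def by (auto simp: successively_append_iff)
qed (use assms in auto)

lemma is_cycle_at:
  assumes "is_cycle f xs" "z \<in> set xs"
  obtains ys where "is_cycle f (z # ys)" "set (z # ys) = set xs" "\<exists>k. z # ys = rotate k xs"
proof -
  obtain as bs where xs: "xs = as @ z # bs" using assms(2) by (meson split_list)
  then have "is_cycle f (z # bs @ as)" using is_cycle_append_commute[of f as "z # bs"] assms(1) by simp
  moreover have "z # bs @ as = rotate (length as) xs" unfolding xs by (simp add: rotate_append)
  ultimately show ?thesis using that[of "bs @ as"] xs by auto
qed

lemma is_cycle_closed: "is_cycle f xs \<Longrightarrow> f ` set xs \<subseteq> set xs"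
  by (auto simp: in_set_conv_nth is_cycle_nth) (metis is_cycle_nth length_pos_if_in_set mod_less_divisor nth_mem)

lemma is_cycle_cong: "(\<And>x. x \<in> set xs \<Longrightarrow> f x = g x) \<Longrightarrow> is_cycle f xs \<Longrightarrow> is_cycle g xs"
  unfolding is_cycle_def by (auto simp: successively_conv_nth)

text \<open>By finiteness two iterates of \<open>d\<close> agree, and injectivity of the powers
  pulls the coincidence back to \<open>d\<close> itself. The orbit up to the least return time
  \<open>n\<close> is then free of repetitions.\<close>

lemma is_cycle_cycle_list:
  assumes f: "perm_on D f" and d: "d \<in> D"
  shows "is_cycle f (cycle_list f d)" "hd (cycle_list f d) = d" "set (cycle_list f d) = cycle_of f d"
    "cycle_of f d \<subseteq> D"
proof -
  have D: "(f ^^ k) x \<in> D" if "x \<in> D" for k x using that perm_onD(4)[OF f] by (induction k) auto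
  then show "cycle_of f d \<subseteq> D" using d unfolding cycle_of_def by auto
  have inj: "inj_on (f ^^ k) D" for k
  proof (induction k)
    case (Suc k)
    then show ?case using perm_onD(2)[OF f] D by (auto simp: inj_on_def)
  qed simp
  have pow: "(f ^^ i) ((f ^^ (j - i)) d) = (f ^^ j) d" if "i \<le> j" for i j
    using that funpow_add[of i "j - i" f] by simp
  have fin: "finite (range (\<lambda>k. (f ^^ k) d))"
    by (rule finite_subset[OF _ perm_onD(1)[OF f]]) (use D[OF d] in auto)
  obtain i j where ij: "i < j" "(f ^^ i) d = (f ^^ j) d"
  proof (rule ccontr)
    assume "\<not> thesis"
    then have "inj (\<lambda>k. (f ^^ k) d)" using that by (intro linorder_inj_onI) auto
    then show False using finite_imageD[OF fin] infinite_UNIV_nat by blast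
  qed
  have "(f ^^ (j - i)) d = d"
    using inj_onD[OF inj[of i], of "(f ^^ (j - i)) d" d] pow[of i j] ij D[OF d] d by simp
  then have ex: "\<exists>n>0. (f ^^ n) d = d" using ij(1) by (intro exI[of _ "j - i"]) simp
  define n where "n = (LEAST n. n > 0 \<and> (f ^^ n) d = d)"
  have n: "n > 0" "(f ^^ n) d = d"
    using LeastI_ex[OF ex] unfolding n_def by auto
  have least: "m = 0" if "m < n" "(f ^^ m) d = d" for m
    using not_less_Least[of m "\<lambda>n. n > 0 \<and> (f ^^ n) d = d"] that unfolding n_def by auto
  define xs where "xs = map (\<lambda>k. (f ^^ k) d) [0..<n]"
  have dist: "i = j" if "i \<le> j" "j < n" "(f ^^ i) d = (f ^^ j) d" for i j
  proof -
    have "(f ^^ (j - i)) d = d"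
      using inj_onD[OF inj[of i], of "(f ^^ (j - i)) d" d] pow[of i j] that D[OF d] d by simp
    then show ?thesis using least[of "j - i"] that less_imp_diff_less[of j n i] by simp
  qed
  have cyc: "is_cycle f xs"
    unfolding is_cycle_def
  proof (intro conjI)
    show "xs \<noteq> []" using n unfolding xs_def by simp
    have "inj_on (\<lambda>k. (f ^^ k) d) {0..<n}"
    proof (rule linorder_inj_onI)
      fix x y assume "x < y" "y \<in> {0..<n}"
      then show "(f ^^ x) d \<noteq> (f ^^ y) d" using dist[of x y] by auto
    qed auto
    then show "distinct xs" unfolding xs_def by (simp add: distinct_map)
    show "successively (\<lambda>x y. f x = y) xs" unfolding xs_def by (simp add: successively_conv_nth)
    have "f ((f ^^ (n - 1)) d) = (f ^^ n) d" using n(1) by (cases n) auto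
    then show "f (last xs) = hd xs" using n unfolding xs_def by (simp add: last_map hd_map)
  qed
  have hd: "hd xs = d" using n unfolding xs_def by (simp add: hd_map)
  have l: "cycle_list f d = xs" using cycle_list_is_cycle[OF cyc] hd by simp
  show "is_cycle f (cycle_list f d)" "hd (cycle_list f d) = d" using l cyc hd by auto
  have "d \<in> set xs" using hd cyc unfolding is_cycle_def by (cases xs) auto
  then show "set (cycle_list f d) = cycle_of f d" using l cycle_of_is_cycle[OF cyc] by simp
qed

lemma obtain_cycle:
  assumes "perm_on D f" "d \<in> D"
  obtains xs where "is_cycle f (d # xs)" "cycle_list f d = d # xs" "set (d # xs) = cycle_of f d" "set (d # xs) \<subseteq> D"
  using is_cycle_cycle_list[OF assms] that unfolding is_cycle_def
  by (metis list.exhaust_sel)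

lemma self_in_cycle_of [simp]: "d \<in> cycle_of f d"
  unfolding cycle_of_def by (rule range_eqI[of _ _ 0]) simp

lemma cycle_of_subset: "f ` A \<subseteq> A \<Longrightarrow> d \<in> A \<Longrightarrow> cycle_of f d \<subseteq> A"
proof -
  assume "f ` A \<subseteq> A" "d \<in> A"
  then have "(f ^^ k) d \<in> A" for k by (induction k) auto
  then show ?thesis unfolding cycle_of_def by auto
qed

lemma cycle_of_closed: "f ` cycle_of f d \<subseteq> cycle_of f d"
proof
  fix z assume "z \<in> f ` cycle_of f d"
  then obtain k where "z = (f ^^ Suc k) d" unfolding cycle_of_def by auto
  then show "z \<in> cycle_of f d" unfolding cycle_of_def by (rule range_eqI)
qed

lemma cycle_of_eq: "perm_on D f \<Longrightarrow> d \<in> D \<Longrightarrow> z \<in> cycle_of f d \<Longrightarrow> cycle_of f z = cycle_of f d"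
  using cycle_of_is_cycle[OF is_cycle_cycle_list(1)] is_cycle_cycle_list(3) by metis

lemma cycle_of_cong:
  assumes "\<And>x. x \<in> A \<Longrightarrow> f x = g x" "f ` A \<subseteq> A" "d \<in> A"
  shows "cycle_of f d = cycle_of g d"
proof -
  have "(f ^^ k) d = (g ^^ k) d \<and> (f ^^ k) d \<in> A" for k
    by (induction k) (use assms in auto)
  then show ?thesis unfolding cycle_of_def by auto
qed

lemma cycle_count_cong:
  assumes "\<And>x. x \<in> A \<Longrightarrow> f x = g x" "f ` A \<subseteq> A"
  shows "cycle_count f A = cycle_count g A"
  unfolding cycle_count_def using cycle_of_cong[OF assms] by (metis (no_types, lifting) image_cong)

lemma cycle_count_Un:
  assumes "finite A" "finite B" "A \<inter> B = {}" "f ` A \<subseteq> A" "f ` B \<subseteq> B"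
  shows "cycle_count f (A \<union> B) = cycle_count f A + cycle_count f B"
proof -
  have "cycle_of f ` A \<inter> cycle_of f ` B = {}"
  proof (rule ccontr)
    assume "cycle_of f ` A \<inter> cycle_of f ` B \<noteq> {}"
    then obtain a b where "a \<in> A" "b \<in> B" "cycle_of f a = cycle_of f b" by auto
    then show False using cycle_of_subset[OF assms(4)] cycle_of_subset[OF assms(5)] assms(3)
      by (metis disjoint_iff self_in_cycle_of subsetD)
  qed
  then show ?thesis unfolding cycle_count_def image_Un using assms by (simp add: card_Un_disjoint)
qed

lemma cycle_count_is_cycle: "is_cycle f xs \<Longrightarrow> cycle_count f (set xs) = 1"
proof -
  assume c: "is_cycle f xs"
  then have "cycle_of f ` set xs = {set xs}"
    using cycle_of_is_cycle[OF c] unfolding is_cycle_def by (cases xs) auto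
  then show ?thesis unfolding cycle_count_def by simp
qed

lemma cycle_count_Diff:
  assumes "perm_on D f" "A \<subseteq> D" "f ` A \<subseteq> A"
  shows "cycle_count f D = cycle_count f A + cycle_count f (D - A)"
proof -
  have "finite A" "finite (D - A)" using perm_onD(1)[OF assms(1)] assms(2) finite_subset by auto
  then show ?thesis using cycle_count_Un[of A "D - A" f] perm_on_Diff[OF assms] assms
    by (simp add: Un_absorb1)
qed

lemma is_cycle_skip:
  assumes "is_cycle f (a # xs)" "xs \<noteq> []"
  shows "is_cycle (skip a f) xs"
proof -
  have xs: "distinct xs" "a \<notin> set xs" "f a = hd xs" "successively (\<lambda>x y. f x = y) xs" "f (last xs) = a"
    using assms unfolding is_cycle_def by (auto simp: successively_Cons)
  have "successively (\<lambda>x y. skip a f x = y) xs"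
    by (rule successively_mono[OF xs(4)]) (use xs(2) in \<open>auto simp: skip_def\<close>)
  with xs assms(2) show ?thesis unfolding is_cycle_def by (simp add: skip_def)
qed

lemma is_cycle_skip_other: "is_cycle f xs \<Longrightarrow> a \<notin> set xs \<Longrightarrow> is_cycle (skip a f) xs"
proof (rule is_cycle_cong)
  fix x assume "is_cycle f xs" "a \<notin> set xs" "x \<in> set xs"
  then have "f x \<noteq> a" using is_cycle_closed[of f xs] by blast
  then show "f x = skip a f x" by (simp add: skip_def)
qed

lemma perm_on_skip:
  assumes "perm_on D f" "a \<in> D"
  shows "perm_on (D - {a}) (skip a f)"
proof (rule perm_onI)
  show "inj_on (skip a f) (D - {a})"
  proof (rule inj_onI)
    fix x y assume xy: "x \<in> D - {a}" "y \<in> D - {a}" "skip a f x = skip a f y"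
    note inj = inj_onD[OF perm_onD(2)[OF assms(1)]]
    show "x = y"
      by (cases "f x = a"; cases "f y = a")
        (use xy assms(2) inj[of x y] inj[of a y] inj[of x a] in \<open>auto simp: skip_def\<close>)
  qed
  have "f a \<noteq> a" if "f z = a" "z \<noteq> a" "z \<in> D" for z
    using perm_onD(2)[OF assms(1)] assms(2) that by (metis inj_onD)
  then show "skip a f ` (D - {a}) \<subseteq> D - {a}"
    using perm_onD(4)[OF assms(1)] assms(2) by (auto simp: skip_def)
qed (use perm_onD(1)[OF assms(1)] in simp)

lemma cycle_of_skip:
  assumes "perm_on D f" "a \<in> D" "z \<in> D" "z \<noteq> a"
  shows "cycle_of (skip a f) z = cycle_of f z - {a}"
proof -
  obtain xs where c: "is_cycle f (z # xs)" "set (z # xs) = cycle_of f z"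
    using obtain_cycle[OF assms(1,3)] by metis
  show ?thesis
  proof (cases "a \<in> set (z # xs)")
    case True
    then obtain ys where ys: "is_cycle f (a # ys)" "set (a # ys) = set (z # xs)"
      using is_cycle_at[OF c(1)] by metis
    have "z \<in> set ys" using ys(2) assms(4) by auto
    then have "is_cycle (skip a f) ys" using is_cycle_skip[OF ys(1)] by (cases ys) auto
    then have "cycle_of (skip a f) z = set ys" using cycle_of_is_cycle \<open>z \<in> set ys\<close> by metis
    also have "\<dots> = cycle_of f z - {a}" using ys c(2) unfolding is_cycle_def by auto
    finally show ?thesis .
  next
    case False
    then show ?thesis using cycle_of_is_cycle[OF is_cycle_skip_other[OF c(1) False], of z] c(2) by auto
  qed
qed

text \<open>Removing \<open>a\<close> from all cycles identifies no two of them: each cycle keeps a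
  point, because the cycle of \<open>a\<close> also contains \<open>f a \<noteq> a\<close>.\<close>

lemma cycle_count_skip:
  assumes "perm_on D f" "a \<in> D" "f a \<noteq> a"
  shows "cycle_count (skip a f) (D - {a}) = cycle_count f D"
proof -
  let ?h = "\<lambda>c. c - {a}"
  have fa: "f a \<in> D - {a}" using assms perm_onD(4) by fastforce
  have "cycle_of f (f a) = cycle_of f a"
    by (rule cycle_of_eq[OF assms(1,2)]) (use cycle_of_closed[of f a] self_in_cycle_of[of a f] in blast)
  then have "cycle_of f a \<in> cycle_of f ` (D - {a})" using fa by (metis imageI)
  then have "cycle_of f ` D = cycle_of f ` (D - {a})" using assms(2) by auto
  moreover have "cycle_of (skip a f) ` (D - {a}) = ?h ` cycle_of f ` (D - {a})"
    unfolding image_image by (rule image_cong) (use cycle_of_skip[OF assms(1,2)] in auto)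
  ultimately have img: "cycle_of (skip a f) ` (D - {a}) = ?h ` cycle_of f ` D" by simp
  have "inj_on ?h (cycle_of f ` D)"
  proof (rule inj_onI)
    fix c c' assume "c \<in> cycle_of f ` D" "c' \<in> cycle_of f ` D" and eq: "c - {a} = c' - {a}"
    then obtain x y where x: "x \<in> D" "c = cycle_of f x" and y: "y \<in> D" "c' = cycle_of f y" by auto
    have "\<exists>z \<in> c. z \<noteq> a"
    proof (cases "x = a")
      case True
      then have "f a \<in> c" using x cycle_of_closed[of f a] self_in_cycle_of[of a f] by blast
      then show ?thesis using assms(3) by blast
    next
      case False
      then show ?thesis using x self_in_cycle_of[of x f] by blast
    qed
    then obtain z where "z \<in> c" "z \<in> c'" using eq by blast
    then show "c = c'" using cycle_of_eq[OF assms(1) x(1), of z] cycle_of_eq[OF assms(1) y(1), of z] x y by simp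
  qed
  then show ?thesis unfolding cycle_count_def img by (rule card_image)
qed

lemma cycle_count_fixpoint:
  assumes "perm_on D f" "a \<in> D" "f a = a"
  shows "cycle_count f D = Suc (cycle_count (skip a f) (D - {a}))"
proof -
  have "is_cycle f [a]" using assms(3) unfolding is_cycle_def by simp
  then have "cycle_count f D = 1 + cycle_count f (D - {a})"
    using cycle_count_Diff[OF assms(1), of "{a}"] cycle_count_is_cycle[of f "[a]"] assms by simp
  moreover have "cycle_count f (D - {a}) = cycle_count (skip a f) (D - {a})"
    by (rule cycle_count_cong) (use perm_on_Diff[OF assms(1), of "{a}"] assms(2,3) in \<open>auto simp: skip_def\<close>)
  ultimately show ?thesis by simp
qed

text \<open>Exchanging two values composes \<open>f\<close> with a transposition. From
  \<open>a\<close> the new map continues behind \<open>b\<close> through \<open>ys\<close> and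
  arrives at \<open>b\<close>, from where it continues behind \<open>a\<close> through
  \<open>xs\<close>.\<close>

lemma is_cycle_merge:
  assumes "is_cycle f (a # xs)" "is_cycle f (b # ys)" "set (a # xs) \<inter> set (b # ys) = {}"
  shows "is_cycle (f(a := f b, b := f a)) (a # ys @ b # xs)"
proof -
  let ?g = "f(a := f b, b := f a)"
  have d: "distinct (a # ys @ b # xs)" using assms unfolding is_cycle_def by auto
  then have ne: "a \<noteq> b" "a \<notin> set xs" "a \<notin> set ys" "b \<notin> set xs" "b \<notin> set ys" by auto
  have f: "successively (\<lambda>x y. f x = y) xs" "successively (\<lambda>x y. f x = y) ys"
    using assms(1,2) unfolding is_cycle_def by (cases "xs = []"; cases "ys = []"; simp add: successively_Cons)+
  have fa: "f a = (if xs = [] then a else hd xs)" "xs \<noteq> [] \<Longrightarrow> f (last xs) = a"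
    "f b = (if ys = [] then b else hd ys)" "ys \<noteq> [] \<Longrightarrow> f (last ys) = b"
    using assms(1,2) unfolding is_cycle_def by (auto simp: successively_Cons)
  have s: "successively (\<lambda>x y. ?g x = y) xs" "successively (\<lambda>x y. ?g x = y) ys"
    by (rule successively_mono[OF f(1)] successively_mono[OF f(2)], use ne in auto)+
  have l: "xs \<noteq> [] \<Longrightarrow> last xs \<noteq> a \<and> last xs \<noteq> b" "ys \<noteq> [] \<Longrightarrow> last ys \<noteq> a \<and> last ys \<noteq> b"
    using ne last_in_set by metis+
  show ?thesis using d fa s l unfolding is_cycle_def
    by (cases "xs = []"; cases "ys = []") (simp_all add: successively_Cons successively_append_iff)
qed

text \<open>The same exchange inside one cycle: \<open>a\<close> jumps to the point behind
  \<open>b\<close>, and the stretch \<open>xs\<close> that is passed over closes up with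
  \<open>b\<close>.\<close>

lemma is_cycle_split:
  assumes "is_cycle f (a # xs @ b # ys)"
  shows "is_cycle (f(a := f b, b := f a)) (a # ys)" "is_cycle (f(a := f b, b := f a)) (b # xs)"
proof -
  let ?g = "f(a := f b, b := f a)"
  have d: "distinct (a # xs @ b # ys)" using assms unfolding is_cycle_def by auto
  then have ne: "a \<noteq> b" "a \<notin> set xs" "a \<notin> set ys" "b \<notin> set xs" "b \<notin> set ys" by auto
  have f: "successively (\<lambda>x y. f x = y) xs" "successively (\<lambda>x y. f x = y) ys"
    using assms unfolding is_cycle_def
    by (cases "xs = []"; cases "ys = []"; simp add: successively_Cons successively_append_iff)+
  have fa: "f a = (if xs = [] then b else hd xs)" "xs \<noteq> [] \<Longrightarrow> f (last xs) = b"
    "f b = (if ys = [] then a else hd ys)" "ys \<noteq> [] \<Longrightarrow> f (last ys) = a"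
    using assms unfolding is_cycle_def
    by (cases "xs = []"; cases "ys = []"; simp add: successively_Cons successively_append_iff)+
  have s: "successively (\<lambda>x y. ?g x = y) xs" "successively (\<lambda>x y. ?g x = y) ys"
    by (rule successively_mono[OF f(1)] successively_mono[OF f(2)], use ne in auto)+
  have l: "xs \<noteq> [] \<Longrightarrow> last xs \<noteq> a \<and> last xs \<noteq> b" "ys \<noteq> [] \<Longrightarrow> last ys \<noteq> a \<and> last ys \<noteq> b"
    using ne last_in_set by metis+
  show "is_cycle ?g (a # ys)" "is_cycle ?g (b # xs)" using d fa s l unfolding is_cycle_def
    by (cases "xs = []"; cases "ys = []"; simp add: successively_Cons)+
qed

lemma perm_on_swap:
  assumes "perm_on D f" "a \<in> D" "b \<in> D"
  shows "perm_on D (f(a := f b, b := f a))"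
proof (rule perm_onI)
  show "inj_on (f(a := f b, b := f a)) D"
    using perm_onD(2)[OF assms(1)] assms by (auto simp: inj_on_def)
qed (use perm_onD[OF assms(1)] assms in auto)

text \<open>Only the cycles through \<open>a\<close> and \<open>b\<close> change. They are merged or
  split according to \<open>is_cycle_merge\<close> and \<open>is_cycle_split\<close>, and on the
  rest of \<open>D\<close> the two maps agree.\<close>

lemma cycle_count_swap:
  assumes "perm_on D f" "a \<in> D" "b \<in> D" "a \<noteq> b"
  defines "g \<equiv> f(a := f b, b := f a)"
  shows "b \<notin> cycle_of f a \<Longrightarrow> Suc (cycle_count g D) = cycle_count f D"
    and "b \<in> cycle_of f a \<Longrightarrow> cycle_count g D = Suc (cycle_count f D)"
proof -
  have g: "perm_on D g" unfolding g_def using perm_on_swap assms by metis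
  obtain xs where xs: "is_cycle f (a # xs)" "set (a # xs) = cycle_of f a" "set (a # xs) \<subseteq> D"
    using obtain_cycle[OF assms(1,2)] by metis
  have same: "cycle_count g (D - U) = cycle_count f (D - U)"
    if "a \<in> U" "b \<in> U" "U \<subseteq> D" "f ` U \<subseteq> U" for U
    by (rule cycle_count_cong[symmetric]) (use that perm_on_Diff[OF assms(1) that(3,4)] in \<open>auto simp: g_def\<close>)
  show "Suc (cycle_count g D) = cycle_count f D" if b: "b \<notin> cycle_of f a"
  proof -
    obtain ys where ys: "is_cycle f (b # ys)" "set (b # ys) = cycle_of f b" "set (b # ys) \<subseteq> D"
      using obtain_cycle[OF assms(1,3)] by metis
    have dis: "set (a # xs) \<inter> set (b # ys) = {}"
      using cycle_of_is_cycle[OF xs(1)] cycle_of_is_cycle[OF ys(1)] b xs(2) ys(2)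
      by (metis disjoint_iff self_in_cycle_of)
    have m: "is_cycle g (a # ys @ b # xs)" unfolding g_def by (rule is_cycle_merge[OF xs(1) ys(1) dis])
    let ?U = "set (a # xs) \<union> set (b # ys)"
    have U: "set (a # ys @ b # xs) = ?U" by auto
    have cl: "f ` ?U \<subseteq> ?U" using is_cycle_closed[OF xs(1)] is_cycle_closed[OF ys(1)] by blast
    have "cycle_count f D = cycle_count f ?U + cycle_count f (D - ?U)"
      by (rule cycle_count_Diff[OF assms(1) _ cl]) (use xs ys in auto)
    also have "cycle_count f ?U = 2"
      using cycle_count_Un[OF _ _ dis is_cycle_closed[OF xs(1)] is_cycle_closed[OF ys(1)]]
        cycle_count_is_cycle[OF xs(1)] cycle_count_is_cycle[OF ys(1)] by simp
    also have "cycle_count f (D - ?U) = cycle_count g (D - ?U)"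
      by (rule same[symmetric]) (use xs ys cl in auto)
    finally have "cycle_count f D = 2 + cycle_count g (D - ?U)" .
    moreover have "cycle_count g D = 1 + cycle_count g (D - ?U)"
    proof -
      have "set (a # ys @ b # xs) \<subseteq> D" using xs ys by auto
      from cycle_count_Diff[OF g this is_cycle_closed[OF m]] show ?thesis
        using cycle_count_is_cycle[OF m] U by metis
    qed
    ultimately show ?thesis by simp
  qed
  show "cycle_count g D = Suc (cycle_count f D)" if b: "b \<in> cycle_of f a"
  proof -
    have "b \<in> set xs" using b xs(2) assms(4) by auto
    then obtain us vs where uv: "xs = us @ b # vs" by (meson split_list)
    have sp: "is_cycle g (a # vs)" "is_cycle g (b # us)"
      using is_cycle_split[of f a us b vs] xs(1) uv unfolding g_def by auto
    have dis: "set (a # vs) \<inter> set (b # us) = {}" using xs(1) unfolding is_cycle_def uv by auto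
    let ?U = "set (a # xs)"
    have U: "?U = set (a # vs) \<union> set (b # us)" unfolding uv by auto
    have clg: "g ` ?U \<subseteq> ?U" using is_cycle_closed[OF sp(1)] is_cycle_closed[OF sp(2)] unfolding U by blast
    have "cycle_count g D = cycle_count g ?U + cycle_count g (D - ?U)"
      by (rule cycle_count_Diff[OF g xs(3) clg])
    also have "cycle_count g ?U = 2"
      using cycle_count_Un[OF _ _ dis is_cycle_closed[OF sp(1)] is_cycle_closed[OF sp(2)]]
        cycle_count_is_cycle[OF sp(1)] cycle_count_is_cycle[OF sp(2)] unfolding U by simp
    also have "cycle_count g (D - ?U) = cycle_count f (D - ?U)"
      by (rule same) (use xs uv is_cycle_closed[OF xs(1)] in auto)
    also have "cycle_count f D = 1 + cycle_count f (D - ?U)"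
      using cycle_count_Diff[OF assms(1) xs(3) is_cycle_closed[OF xs(1)]] cycle_count_is_cycle[OF xs(1)] by simp
    ultimately show ?thesis by simp
  qed
qed

section \<open>The Euler inequality for combinatorial maps\<close>

text \<open>Connectedness is phrased with invariant subsets instead of chains of darts, since the
  removal arguments enlarge or restrict such subsets. The two versions are matched in
  \<open>planar_map_iff\<close>.\<close>

definition transitive_pair :: "'d set \<Rightarrow> ('d \<Rightarrow> 'd) \<Rightarrow> ('d \<Rightarrow> 'd) \<Rightarrow> bool" where
  "transitive_pair D \<epsilon> \<phi> \<longleftrightarrow> (\<forall>A\<subseteq>D. A \<noteq> {} \<longrightarrow> \<epsilon> ` A \<subseteq> A \<longrightarrow> \<phi> ` A \<subseteq> A \<longrightarrow> A = D)"

lemma transitive_pairD: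
  "transitive_pair D \<epsilon> \<phi> \<Longrightarrow> A \<subseteq> D \<Longrightarrow> A \<noteq> {} \<Longrightarrow> \<epsilon> ` A \<subseteq> A \<Longrightarrow> \<phi> ` A \<subseteq> A \<Longrightarrow> A = D"
  unfolding transitive_pair_def by blast

lemma perm_on_involution:
  assumes "finite D" "\<And>z. z \<in> D \<Longrightarrow> \<epsilon> z \<in> D \<and> \<epsilon> (\<epsilon> z) = z"
  shows "perm_on D \<epsilon>"
proof (rule perm_onI)
  show "inj_on \<epsilon> D" by (rule inj_onI) (use assms(2) in metis)
qed (use assms in auto)

text \<open>The 2-cycles of \<open>\<epsilon>\<close> are added one at a time; fixed points of \<open>\<epsilon>\<close> are therefore allowed. A new
  2-cycle changes the number of cycles of \<open>\<phi> \<circ> \<epsilon>\<close> by one, and decreases it if it joins two components.\<close>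

lemma euler_inequality:
  assumes "perm_on D \<phi>" "\<And>z. z \<in> D \<Longrightarrow> \<epsilon> z \<in> D \<and> \<epsilon> (\<epsilon> z) = z" "D \<noteq> {}" "transitive_pair D \<epsilon> \<phi>"
  shows "2 * cycle_count (\<phi> \<circ> \<epsilon>) D + 2 * cycle_count \<phi> D \<le> 4 + card {z \<in> D. \<epsilon> z \<noteq> z}"
  using assms
proof (induction "card {z \<in> D. \<epsilon> z \<noteq> z}" arbitrary: D \<epsilon> rule: less_induct)
  case less
  note fin = perm_onD(1)[OF less.prems(1)]
  show ?case
  proof (cases "{z \<in> D. \<epsilon> z \<noteq> z} = {}")
    case True
    then have id: "\<epsilon> z = z" if "z \<in> D" for z using that by auto
    obtain d where d: "d \<in> D" using less.prems(3) by auto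
    have sub: "cycle_of \<phi> d \<subseteq> D" using is_cycle_cycle_list(4)[OF less.prems(1) d] .
    then have "\<epsilon> ` cycle_of \<phi> d \<subseteq> cycle_of \<phi> d" using id by auto
    then have cD: "cycle_of \<phi> d = D"
      using transitive_pairD[OF less.prems(4) sub] cycle_of_closed[of \<phi> d] self_in_cycle_of[of d \<phi>] by blast
    have "cycle_of \<phi> z = D" if "z \<in> D" for z
      using cycle_of_eq[OF less.prems(1) d, of z] that cD by simp
    then have "cycle_of \<phi> ` D = {D}" using d by auto
    then have "cycle_count \<phi> D = 1" unfolding cycle_count_def by simp
    moreover have "cycle_count \<phi> D = cycle_count (\<phi> \<circ> \<epsilon>) D"
      by (rule cycle_count_cong) (use id perm_onD(3)[OF less.prems(1)] in auto)
    ultimately show ?thesis by simp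
  next
    case False
    then obtain d where d: "d \<in> D" "\<epsilon> d \<noteq> d" by auto
    define x where "x = \<epsilon> d"
    have x: "x \<in> D" "x \<noteq> d" "\<epsilon> x = d" using less.prems(2)[OF d(1)] d unfolding x_def by auto
    \<comment> \<open>The edge \<open>{d, x}\<close> is dissolved into two fixed points. In terms of
      vertices, putting it back is an exchange of two values of
      \<open>\<phi> \<circ> \<epsilon>'\<close>.\<close>
    define \<epsilon>' where "\<epsilon>' = \<epsilon>(d := d, x := x)"
    have inv': "\<epsilon>' z \<in> D \<and> \<epsilon>' (\<epsilon>' z) = z" if "z \<in> D" for z
      using less.prems(2)[OF that] less.prems(2)[OF d(1)] x that unfolding \<epsilon>'_def x_def by auto
    have comp: "\<phi> \<circ> \<epsilon> = (\<phi> \<circ> \<epsilon>')(d := (\<phi> \<circ> \<epsilon>') x, x := (\<phi> \<circ> \<epsilon>') d)"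
      using x unfolding \<epsilon>'_def x_def by auto
    have inv_perm: "perm_on D \<epsilon>'" by (rule perm_on_involution[OF fin inv'])
    have perm: "perm_on D (\<phi> \<circ> \<epsilon>')"
      using inv_perm less.prems(1) unfolding perm_on_def by (auto intro: bij_betw_trans)
    have moved: "{z \<in> D. \<epsilon> z \<noteq> z} = {z \<in> D. \<epsilon>' z \<noteq> z} \<union> {d, x}" "{z \<in> D. \<epsilon>' z \<noteq> z} \<inter> {d, x} = {}"
      using d x unfolding \<epsilon>'_def by auto
    then have cd: "card {z \<in> D. \<epsilon> z \<noteq> z} = card {z \<in> D. \<epsilon>' z \<noteq> z} + 2"
      using fin x(2) by (simp add: card_Un_disjoint)
    note swap = cycle_count_swap[OF perm d(1) x(1) x(2)[symmetric], folded comp]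
    show ?thesis
    proof (cases "transitive_pair D \<epsilon>' \<phi>")
      case True
      then have "2 * cycle_count (\<phi> \<circ> \<epsilon>') D + 2 * cycle_count \<phi> D \<le> 4 + card {z \<in> D. \<epsilon>' z \<noteq> z}"
        using less.hyps[of D \<epsilon>'] cd less.prems inv' by simp
      moreover have "cycle_count (\<phi> \<circ> \<epsilon>) D \<le> Suc (cycle_count (\<phi> \<circ> \<epsilon>') D)"
        using swap by (cases "x \<in> cycle_of (\<phi> \<circ> \<epsilon>') d") auto
      ultimately show ?thesis using cd by linarith
    next
      case False
      have ext: "\<epsilon> ` C \<subseteq> C" if "\<epsilon>' ` C \<subseteq> C" "d \<in> C \<longleftrightarrow> x \<in> C" "C \<subseteq> D" for C
      proof
        fix z assume "z \<in> \<epsilon> ` C"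
        then obtain y where y: "y \<in> C" "z = \<epsilon> y" by auto
        show "z \<in> C"
        proof (cases "y = d \<or> y = x")
          case True
          then show ?thesis using y that(2) x unfolding x_def by auto
        next
          case False
          then have "\<epsilon>' y = z" using y unfolding \<epsilon>'_def by simp
          then show ?thesis using that(1) y by blast
        qed
      qed
      \<comment> \<open>The dissolved map is disconnected. A proper nonempty invariant set must
        separate the two ends of the edge, for otherwise it would be invariant under
        \<open>\<epsilon>\<close> as well.\<close>
      have two: "\<exists>A. A \<subseteq> D \<and> d \<in> A \<and> x \<notin> A \<and> \<epsilon>' ` A \<subseteq> A \<and> \<phi> ` A \<subseteq> A"
      proof -
        obtain A where A: "A \<subseteq> D" "A \<noteq> {}" "\<epsilon>' ` A \<subseteq> A" "\<phi> ` A \<subseteq> A" "A \<noteq> D"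
          using False unfolding transitive_pair_def by blast
        have "\<not> (d \<in> A \<longleftrightarrow> x \<in> A)"
        proof
          assume "d \<in> A \<longleftrightarrow> x \<in> A"
          then have "\<epsilon> ` A \<subseteq> A" using ext[OF A(3) _ A(1)] by blast
          then show False using A transitive_pairD[OF less.prems(4) A(1,2)] by blast
        qed
        moreover have "D - A \<subseteq> D" "\<epsilon>' ` (D - A) \<subseteq> D - A" "\<phi> ` (D - A) \<subseteq> D - A"
          using perm_on_Diff[OF inv_perm A(1,3)] perm_on_Diff[OF less.prems(1) A(1,4)] by auto
        ultimately show ?thesis using A d(1) x(1) by (cases "d \<in> A") blast+
      qed
      then obtain A where A: "A \<subseteq> D" "d \<in> A" "x \<notin> A" "\<epsilon>' ` A \<subseteq> A" "\<phi> ` A \<subseteq> A" by blast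
      let ?B = "D - A"
      have B: "\<epsilon>' ` ?B \<subseteq> ?B" "\<phi> ` ?B \<subseteq> ?B" "x \<in> ?B" "d \<notin> ?B"
        using perm_on_Diff[OF inv_perm A(1,4)] perm_on_Diff[OF less.prems(1) A(1,5)] A x by auto
      \<comment> \<open>Both halves are connected: a smaller invariant \<open>C\<close> that
        contains the end of the edge lying in \<open>P\<close>, together with the opposite half
        \<open>D - P\<close>, is invariant under \<open>\<epsilon>\<close> and hence
        everything.\<close>
      have trans: "transitive_pair P \<epsilon>' \<phi>"
        if P: "P \<subseteq> D" "\<epsilon>' ` P \<subseteq> P" "\<phi> ` P \<subseteq> P" "(d \<in> P \<and> x \<notin> P) \<or> (d \<notin> P \<and> x \<in> P)" for P
        unfolding transitive_pair_def
      proof (intro allI impI)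
        fix C assume C: "C \<subseteq> P" "C \<noteq> {}" "\<epsilon>' ` C \<subseteq> C" "\<phi> ` C \<subseteq> C"
        have Q: "\<epsilon>' ` (D - P) \<subseteq> D - P" "\<phi> ` (D - P) \<subseteq> D - P"
          using perm_on_Diff[OF inv_perm P(1,2)] perm_on_Diff[OF less.prems(1) P(1,3)] by auto
        show "C = P"
        proof (cases "d \<in> C \<or> x \<in> C")
          case True
          have "\<epsilon> ` (C \<union> (D - P)) \<subseteq> C \<union> (D - P)"
            by (rule ext) (use C Q P True d x in blast)+
          moreover have "\<phi> ` (C \<union> (D - P)) \<subseteq> C \<union> (D - P)" using C Q by blast
          ultimately have "C \<union> (D - P) = D"
            using transitive_pairD[OF less.prems(4), of "C \<union> (D - P)"] C(1,2) P(1) by blast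
          then show ?thesis using C P by blast
        next
          case False
          then have "\<epsilon> ` C \<subseteq> C" using ext[of C] C P by blast
          then have "C = D" using transitive_pairD[OF less.prems(4), of C] C P(1) by blast
          then show ?thesis using False d by auto
        qed
      qed
      have cAB: "card {z \<in> D. \<epsilon>' z \<noteq> z} = card {z \<in> A. \<epsilon>' z \<noteq> z} + card {z \<in> ?B. \<epsilon>' z \<noteq> z}"
      proof -
        have "{z \<in> D. \<epsilon>' z \<noteq> z} = {z \<in> A. \<epsilon>' z \<noteq> z} \<union> {z \<in> ?B. \<epsilon>' z \<noteq> z}" using A(1) by auto
        then show ?thesis using fin finite_subset[OF A(1) fin] by (simp add: card_Un_disjoint disjoint_iff)
      qed
      have IH: "2 * cycle_count (\<phi> \<circ> \<epsilon>') P + 2 * cycle_count \<phi> P \<le> 4 + card {z \<in> P. \<epsilon>' z \<noteq> z}"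
        if "P = A \<or> P = ?B" for P
      proof (rule less.hyps)
        show "card {z \<in> P. \<epsilon>' z \<noteq> z} < card {z \<in> D. \<epsilon> z \<noteq> z}" using cd cAB that by auto
        show "perm_on P \<phi>" using that perm_on_subset[OF less.prems(1)] A B by blast
        show "\<epsilon>' z \<in> P \<and> \<epsilon>' (\<epsilon>' z) = z" if "z \<in> P" for z
        proof -
          have "P \<subseteq> D" "\<epsilon>' ` P \<subseteq> P" using \<open>P = A \<or> P = ?B\<close> A B by auto
          then show ?thesis using inv' that by blast
        qed
        show "P \<noteq> {}" using that A B by auto
        show "transitive_pair P \<epsilon>' \<phi>" by (rule trans) (use that A B in auto)
      qed
      have cyc: "cycle_count f D = cycle_count f A + cycle_count f ?B" if "perm_on D f" "f ` A \<subseteq> A" for f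
        by (rule cycle_count_Diff[OF that(1) A(1) that(2)])
      have clA: "(\<phi> \<circ> \<epsilon>') ` A \<subseteq> A" using A by auto
      have "x \<notin> cycle_of (\<phi> \<circ> \<epsilon>') d" using cycle_of_subset[OF clA A(2)] A(3) by auto
      \<comment> \<open>The exchange merges the vertices at the two ends, so one vertex is lost.
        This compensates for the constant 4, which the two inductive bounds contribute twice while
        only two moved darts are gained.\<close>
      then have "Suc (cycle_count (\<phi> \<circ> \<epsilon>) D) = cycle_count (\<phi> \<circ> \<epsilon>') D" using swap by simp
      then show ?thesis
        using IH[of A] IH[of ?B] cyc[OF perm clA] cyc[OF less.prems(1) A(5)] cAB cd by simp
    qed
  qed
qed

section \<open>Removing an edge from a planar map\<close>

text \<open>The part of \<open>planar_map\<close> that survives cutting and gluing; connectedness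
  and the Euler characteristic are tracked separately.\<close>

definition dart_map :: "'d set \<Rightarrow> ('d \<Rightarrow> 'd) \<Rightarrow> ('d \<Rightarrow> 'd) \<Rightarrow> bool" where
  "dart_map D \<epsilon> \<phi> \<longleftrightarrow> (\<forall>d\<in>D. \<epsilon> d \<in> D \<and> \<epsilon> d \<noteq> d \<and> \<epsilon> (\<epsilon> d) = d) \<and> perm_on D \<phi>"

lemma dart_mapD:
  assumes "dart_map D \<epsilon> \<phi>"
  shows "\<And>d. d \<in> D \<Longrightarrow> \<epsilon> d \<in> D" "\<And>d. d \<in> D \<Longrightarrow> \<epsilon> d \<noteq> d" "\<And>d. d \<in> D \<Longrightarrow> \<epsilon> (\<epsilon> d) = d"
    "perm_on D \<phi>" "finite D" "\<And>d. d \<in> D \<Longrightarrow> \<phi> d \<in> D" "perm_on D \<epsilon>" "perm_on D (\<phi> \<circ> \<epsilon>)"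
proof -
  show *: "\<And>d. d \<in> D \<Longrightarrow> \<epsilon> d \<in> D" "\<And>d. d \<in> D \<Longrightarrow> \<epsilon> d \<noteq> d" "\<And>d. d \<in> D \<Longrightarrow> \<epsilon> (\<epsilon> d) = d"
    "perm_on D \<phi>"
    using assms unfolding dart_map_def by auto
  show "finite D" "\<And>d. d \<in> D \<Longrightarrow> \<phi> d \<in> D" using perm_onD[OF *(4)] by auto
  then show "perm_on D \<epsilon>" by (intro perm_on_involution) (use * in auto)
  then show "perm_on D (\<phi> \<circ> \<epsilon>)" using *(4) unfolding perm_on_def by (auto intro: bij_betw_trans)
qed

lemma double_cycle_count_involution:
  assumes "dart_map D \<epsilon> \<phi>"
  shows "2 * cycle_count \<epsilon> D = card D"
proof -
  have c: "cycle_of \<epsilon> d = {d, \<epsilon> d}" "card {d, \<epsilon> d} = 2" if "d \<in> D" for d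
  proof -
    have ne: "d \<noteq> \<epsilon> d" using dart_mapD(2)[OF assms that] by metis
    then have "is_cycle \<epsilon> [d, \<epsilon> d]" using dart_mapD(3)[OF assms that] unfolding is_cycle_def by simp
    from cycle_of_is_cycle[OF this, of d] show "cycle_of \<epsilon> d = {d, \<epsilon> d}" by simp
    show "card {d, \<epsilon> d} = 2" using ne by simp
  qed
  note p = dart_mapD(7)[OF assms]
  have U: "\<Union> (cycle_of \<epsilon> ` D) = D"
    using is_cycle_cycle_list(4)[OF p] self_in_cycle_of by fastforce
  have "2 * card (cycle_of \<epsilon> ` D) = card (\<Union> (cycle_of \<epsilon> ` D))"
  proof (rule card_partition)
    show "finite (cycle_of \<epsilon> ` D)" "finite (\<Union> (cycle_of \<epsilon> ` D))" using dart_mapD(5)[OF assms] U by auto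
    show "card b = 2" if "b \<in> cycle_of \<epsilon> ` D" for b using that c by auto
    show "b \<inter> b' = {}" if b: "b \<in> cycle_of \<epsilon> ` D" "b' \<in> cycle_of \<epsilon> ` D" "b \<noteq> b'" for b b'
    proof (rule ccontr)
      assume "b \<inter> b' \<noteq> {}"
      then obtain z where "z \<in> b" "z \<in> b'" by auto
      then show False using b cycle_of_eq[OF p] by (metis imageE)
    qed
  qed
  then show ?thesis unfolding cycle_count_def U .
qed

text \<open>Serves to find leaves: a fixed point of \<open>\<phi> \<circ> \<epsilon>\<close> is a
  vertex of degree one, and without one every vertex would use up two darts.\<close>

lemma double_cycle_count_le:
  assumes p: "perm_on D f" and "\<And>d. d \<in> D \<Longrightarrow> f d \<noteq> d"
  shows "2 * cycle_count f D \<le> card D"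
proof -
  have fin: "finite (cycle_of f ` D)" using perm_onD(1)[OF p] by simp
  have U: "\<Union> (cycle_of f ` D) = D"
    using is_cycle_cycle_list(4)[OF p] self_in_cycle_of by fastforce
  have ge: "2 \<le> card c" if c: "c \<in> cycle_of f ` D" for c
  proof -
    obtain d where d: "d \<in> D" "c = cycle_of f d" using c by auto
    have "{d, f d} \<subseteq> c" using d cycle_of_closed[of f d] self_in_cycle_of[of d f] by blast
    moreover have "finite c" using d is_cycle_cycle_list(4)[OF p d(1)] perm_onD(1)[OF p] finite_subset by metis
    ultimately have "card {d, f d} \<le> card c" by (rule card_mono[rotated])
    moreover have "card {d, f d} = 2" using assms(2)[OF d(1)] by simp
    ultimately show ?thesis by simp
  qed
  have "card D = (\<Sum>c\<in>cycle_of f ` D. card c)"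
  proof (subst U[symmetric], rule card_Union_disjoint)
    show "pairwise disjnt (cycle_of f ` D)"
      unfolding pairwise_def disjnt_def
    proof (intro ballI impI)
      fix b b' assume b: "b \<in> cycle_of f ` D" "b' \<in> cycle_of f ` D" "b \<noteq> b'"
      show "b \<inter> b' = {}"
      proof (rule ccontr)
        assume "b \<inter> b' \<noteq> {}"
        then obtain z where "z \<in> b" "z \<in> b'" by auto
        then show False using b cycle_of_eq[OF p] by (metis imageE)
      qed
    qed
    show "finite c" if "c \<in> cycle_of f ` D" for c
      using that U perm_onD(1)[OF p] by (metis Union_upper finite_subset)
  qed
  also have "\<dots> \<ge> (\<Sum>c\<in>cycle_of f ` D. 2)" by (rule sum_mono) (rule ge)
  finally show ?thesis unfolding cycle_count_def by simp
qed

text \<open>Euler's formula is doubled, with \<open>card D\<close> in place of twice the number of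
  edges, to avoid halves. The condition on chains of darts becomes
  \<open>transitive_pair\<close>.\<close>

lemma planar_map_iff:
  "planar_map D \<epsilon> \<phi> \<longleftrightarrow> D \<noteq> {} \<and> dart_map D \<epsilon> \<phi> \<and> transitive_pair D \<epsilon> \<phi> \<and>
     2 * cycle_count (\<phi> \<circ> \<epsilon>) D + 2 * cycle_count \<phi> D = card D + 4"
proof -
  let ?R = "{(x, \<epsilon> x) | x. x \<in> D} \<union> {(x, \<phi> x) | x. x \<in> D}"
  have base: "(finite D \<and> D \<noteq> {} \<and> (\<forall>d\<in>D. \<epsilon> d \<in> D \<and> \<epsilon> d \<noteq> d \<and> \<epsilon> (\<epsilon> d) = d) \<and> bij_betw \<phi> D D)
      \<longleftrightarrow> D \<noteq> {} \<and> dart_map D \<epsilon> \<phi>"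
    unfolding dart_map_def perm_on_def by auto
  have conn: "(\<forall>d\<in>D. \<forall>d'\<in>D. (d, d') \<in> ?R\<^sup>*) \<longleftrightarrow> transitive_pair D \<epsilon> \<phi>" if m: "dart_map D \<epsilon> \<phi>"
  proof
    assume c: "\<forall>d\<in>D. \<forall>d'\<in>D. (d, d') \<in> ?R\<^sup>*"
    show "transitive_pair D \<epsilon> \<phi>"
      unfolding transitive_pair_def
    proof (intro allI impI)
      fix A assume A: "A \<subseteq> D" "A \<noteq> {}" "\<epsilon> ` A \<subseteq> A" "\<phi> ` A \<subseteq> A"
      then obtain a where a: "a \<in> A" by auto
      have "z \<in> A" if "(a, z) \<in> ?R\<^sup>*" for z
        using that by (induction rule: rtrancl_induct) (use a A in auto)
      then show "A = D" using c a A(1) by blast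
    qed
  next
    assume t: "transitive_pair D \<epsilon> \<phi>"
    show "\<forall>d\<in>D. \<forall>d'\<in>D. (d, d') \<in> ?R\<^sup>*"
    proof
      fix d assume d: "d \<in> D"
      let ?A = "{z \<in> D. (d, z) \<in> ?R\<^sup>*}"
      have "?A = D"
      proof (rule transitive_pairD[OF t])
        have "(z, \<epsilon> z) \<in> ?R" "(z, \<phi> z) \<in> ?R" if "z \<in> D" for z using that by auto
        then show "\<epsilon> ` ?A \<subseteq> ?A" "\<phi> ` ?A \<subseteq> ?A"
          using dart_mapD(1,6)[OF m] by (auto intro: rtrancl_into_rtrancl)
        show "?A \<noteq> {}" using d by auto
      qed auto
      then show "\<forall>d'\<in>D. (d, d') \<in> ?R\<^sup>*" by blast
    qed
  qed
  have euler: "int (card (cycle_of (\<phi> \<circ> \<epsilon>) ` D)) - int (card (cycle_of \<epsilon> ` D)) + int (card (cycle_of \<phi> ` D)) = 2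
      \<longleftrightarrow> 2 * cycle_count (\<phi> \<circ> \<epsilon>) D + 2 * cycle_count \<phi> D = card D + 4" if m: "dart_map D \<epsilon> \<phi>"
    using double_cycle_count_involution[OF m] unfolding cycle_count_def by linarith
  show ?thesis unfolding planar_map_def using base conn euler by blast
qed

lemma dart_map_euler_le:
  assumes "dart_map D \<epsilon> \<phi>" "D \<noteq> {}" "transitive_pair D \<epsilon> \<phi>"
  shows "2 * cycle_count (\<phi> \<circ> \<epsilon>) D + 2 * cycle_count \<phi> D \<le> 4 + card D"
proof -
  have "{z \<in> D. \<epsilon> z \<noteq> z} = D" using dart_mapD(2)[OF assms(1)] by auto
  then show ?thesis
    using euler_inequality[OF dart_mapD(4)[OF assms(1)] _ assms(2,3)] dart_mapD(1,3)[OF assms(1)] by simp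
qed

lemma transitive_pair_cong:
  assumes "\<And>z. z \<in> D \<Longrightarrow> \<epsilon> z = \<epsilon>' z" "\<And>z. z \<in> D \<Longrightarrow> \<phi> z = \<phi>' z"
  shows "transitive_pair D \<epsilon> \<phi> \<longleftrightarrow> transitive_pair D \<epsilon>' \<phi>'"
proof -
  have "\<epsilon> ` A = \<epsilon>' ` A" "\<phi> ` A = \<phi>' ` A" if "A \<subseteq> D" for A
    using assms that by (auto intro!: image_cong)
  then show ?thesis unfolding transitive_pair_def by metis
qed

lemma planar_map_cong:
  assumes "\<And>z. z \<in> D \<Longrightarrow> \<epsilon> z = \<epsilon>' z" "\<And>z. z \<in> D \<Longrightarrow> \<phi> z = \<phi>' z" "planar_map D \<epsilon> \<phi>"
  shows "planar_map D \<epsilon>' \<phi>'"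
proof -
  have m: "dart_map D \<epsilon> \<phi>" using assms(3) planar_map_iff by blast
  have "dart_map D \<epsilon>' \<phi>'"
    unfolding dart_map_def
  proof (intro conjI ballI)
    show "perm_on D \<phi>'" using perm_on_cong[of D \<phi> \<phi>'] assms(2) dart_mapD(4)[OF m] by simp
    fix d assume "d \<in> D"
    then show "\<epsilon>' d \<in> D" "\<epsilon>' d \<noteq> d" "\<epsilon>' (\<epsilon>' d) = d"
      using dart_mapD(1-3)[OF m, of d] assms(1)[of d] assms(1)[of "\<epsilon> d"] by auto
  qed
  moreover have "cycle_count (\<phi> \<circ> \<epsilon>) D = cycle_count (\<phi>' \<circ> \<epsilon>') D" "cycle_count \<phi> D = cycle_count \<phi>' D"
    by (rule cycle_count_cong; use assms(1,2) dart_mapD[OF m] in auto)+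
  moreover have "transitive_pair D \<epsilon> \<phi> \<longleftrightarrow> transitive_pair D \<epsilon>' \<phi>'"
    by (rule transitive_pair_cong[OF assms(1,2)])
  ultimately show ?thesis using assms(3) unfolding planar_map_iff by simp
qed

text \<open>The conditions on \<open>d\<close> say that its end is a vertex of degree one, since
  \<open>\<phi> \<circ> \<epsilon>\<close> fixes \<open>x\<close>. Removal costs one vertex and one
  edge and no face. Planarity is stated as an equivalence because it is also read backwards, to
  attach a spike. The condition \<open>\<phi> x \<noteq> d\<close> excludes the connected map with a
  single edge.\<close>

lemma remove_spike:
  assumes m: "dart_map D \<epsilon> \<phi>" and d: "d \<in> D" "\<epsilon> d = x" "\<phi> d = x" "\<phi> x \<noteq> d"
  defines "D' \<equiv> D - {d, x}" and "\<phi>' \<equiv> skip x (skip d \<phi>)"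
  shows "dart_map D' \<epsilon> \<phi>'" "D' \<noteq> {}" "cycle_count \<phi>' D' = cycle_count \<phi> D"
    "planar_map D \<epsilon> \<phi> \<longleftrightarrow> planar_map D' \<epsilon> \<phi>'"
proof -
  note M = dart_mapD[OF m]
  note inj = inj_onD[OF perm_onD(2)[OF M(4)]]
  have x: "x \<in> D" "x \<noteq> d" "\<epsilon> x = d" using M d by auto
  have D'': "D' = D - {d} - {x}" unfolding D'_def by auto
  have xx: "\<phi> x \<noteq> x" using inj[of x d] d x by auto
  have f1: "skip d \<phi> x = \<phi> x" "skip d \<phi> d = x" using d x unfolding skip_def by auto
  have phi': "\<phi>' w = (if \<phi> w = d then \<phi> x else \<phi> w)" if "w \<in> D'" for w
    using that inj[of w d] d x xx unfolding \<phi>'_def skip_def D'_def by auto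
  have p1: "perm_on (D - {d}) (skip d \<phi>)" by (rule perm_on_skip[OF M(4) d(1)])
  have p': "perm_on D' \<phi>'" unfolding D'' \<phi>'_def by (rule perm_on_skip[OF p1]) (use x in auto)
  have eD': "\<epsilon> z \<in> D'" if z: "z \<in> D'" for z
  proof -
    have "z \<in> D" "z \<noteq> d" "z \<noteq> x" using z unfolding D'_def by auto
    then have "\<epsilon> z \<in> D" "\<epsilon> z \<noteq> d" "\<epsilon> z \<noteq> x" using M(1)[of z] M(3)[of z] x d by auto
    then show ?thesis unfolding D'_def by simp
  qed
  show m': "dart_map D' \<epsilon> \<phi>'"
    unfolding dart_map_def using p' eD' M(2,3) unfolding D'_def by auto
  show ne: "D' \<noteq> {}" using M(6)[OF x(1)] d xx unfolding D'_def by auto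
  show cphi: "cycle_count \<phi>' D' = cycle_count \<phi> D"
    unfolding D'' \<phi>'_def
    using cycle_count_skip[OF p1, of x] cycle_count_skip[OF M(4) d(1)] x d f1 xx by auto
  let ?\<rho> = "\<phi> \<circ> \<epsilon>"
  have r1: "perm_on (D - {x}) (skip x ?\<rho>)" by (rule perm_on_skip[OF M(8) x(1)])
  \<comment> \<open>Here the vertex \<open>{x}\<close> disappears. Afterwards \<open>d\<close> is
    dropped from a vertex that has further darts.\<close>
  have c1: "cycle_count ?\<rho> D = Suc (cycle_count (skip x ?\<rho>) (D - {x}))"
    by (rule cycle_count_fixpoint[OF M(8) x(1)]) (use d x in simp)
  have "skip x ?\<rho> d \<noteq> d" using d x xx unfolding skip_def by auto
  then have c2: "cycle_count (skip d (skip x ?\<rho>)) (D - {x} - {d}) = cycle_count (skip x ?\<rho>) (D - {x})"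
    by (intro cycle_count_skip[OF r1]) (use d x in auto)
  have D''': "D - {x} - {d} = D'" unfolding D'_def by auto
  have "cycle_count (\<phi>' \<circ> \<epsilon>) D' = cycle_count (skip d (skip x ?\<rho>)) D'"
  proof (rule cycle_count_cong)
    show "(\<phi>' \<circ> \<epsilon>) ` D' \<subseteq> D'" using perm_onD(4)[OF dart_mapD(8)[OF m']] by auto
    fix z assume z: "z \<in> D'"
    then have "\<phi> (\<epsilon> z) \<noteq> x" using eD'[OF z] inj[of "\<epsilon> z" d] d M(1) unfolding D'_def by auto
    then show "(\<phi>' \<circ> \<epsilon>) z = skip d (skip x ?\<rho>) z"
      using phi'[OF eD'[OF z]] d x xx unfolding skip_def by auto
  qed
  then have crho: "cycle_count ?\<rho> D = Suc (cycle_count (\<phi>' \<circ> \<epsilon>) D')" using c1 c2 D''' by simp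
  have cD: "card D = card D' + 2"
    using M(5) d(1) x card_Diff_subset[of "{d,x}" D] card_mono[of D "{d,x}"] unfolding D'_def by auto
  obtain p where p: "p \<in> D" "\<phi> p = d" using perm_onD(3)[OF M(4)] d(1) by (metis imageE)
  have pD': "p \<in> D'" using p d x unfolding D'_def by auto
  have trans: "transitive_pair D \<epsilon> \<phi> \<longleftrightarrow> transitive_pair D' \<epsilon> \<phi>'"
  proof
    assume t: "transitive_pair D \<epsilon> \<phi>"
    show "transitive_pair D' \<epsilon> \<phi>'"
      unfolding transitive_pair_def
    proof (intro allI impI)
      fix A' assume A': "A' \<subseteq> D'" "A' \<noteq> {}" "\<epsilon> ` A' \<subseteq> A'" "\<phi>' ` A' \<subseteq> A'"
      \<comment> \<open>\<open>p\<close> precedes \<open>d\<close> on its face, so an invariant set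
        of the smaller map has to be enlarged by \<open>d\<close> and \<open>x\<close> exactly if it
        contains \<open>p\<close>.\<close>
      define A where "A = (if p \<in> A' then A' \<union> {d, x} else A')"
      have cl: "\<phi> w \<in> A" if "w \<in> A'" for w
      proof (cases "\<phi> w = d")
        case True
        then have "w = p" using inj[of w p] p that A'(1) unfolding D'_def by auto
        then show ?thesis using True that unfolding A_def by auto
      next
        case False
        then have "\<phi>' w = \<phi> w" using phi'[of w] that A'(1) by auto
        then have "\<phi> w \<in> A'" using A'(4) that by (metis image_subset_iff)
        then show ?thesis unfolding A_def by auto
      qed
      have "\<phi> x \<in> A" if "p \<in> A'"
      proof -
        have "\<phi>' p = \<phi> x" using phi'[OF pD'] p by simp
        then have "\<phi> x \<in> A'" using A'(4) that by (metis image_subset_iff)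
        then show ?thesis unfolding A_def by auto
      qed
      then have ext: "p \<in> A' \<Longrightarrow> \<phi> x \<in> A \<and> \<phi> d \<in> A" using d unfolding A_def by auto
      have "\<phi> ` A \<subseteq> A"
      proof
        fix y assume "y \<in> \<phi> ` A"
        then obtain w where w: "w \<in> A" "y = \<phi> w" by auto
        show "y \<in> A"
        proof (cases "w \<in> A'")
          case False
          then have "p \<in> A'" "w = d \<or> w = x" using w(1) unfolding A_def by (auto split: if_splits)
          then show ?thesis using ext w(2) by auto
        qed (use cl w in auto)
      qed
      moreover have "\<epsilon> ` A \<subseteq> A" using A'(3) d x unfolding A_def by auto
      moreover have "A \<subseteq> D" "A \<noteq> {}" using A'(1,2) d x unfolding A_def D'_def by auto
      ultimately have "A = D" using transitive_pairD[OF t] by blast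
      then show "A' = D'" using A'(1) d x unfolding A_def D'_def by (auto split: if_splits)
    qed
  next
    assume t: "transitive_pair D' \<epsilon> \<phi>'"
    show "transitive_pair D \<epsilon> \<phi>"
      unfolding transitive_pair_def
    proof (intro allI impI)
      fix A assume A: "A \<subseteq> D" "A \<noteq> {}" "\<epsilon> ` A \<subseteq> A" "\<phi> ` A \<subseteq> A"
      have dx: "d \<in> A \<longleftrightarrow> x \<in> A" using A(3) d x by (metis image_subset_iff)
      have cl: "\<phi> w \<in> A" "\<epsilon> w \<in> A" if "w \<in> A" for w using A(3,4) that by auto
      have "A - {d, x} = D'"
      proof (rule transitive_pairD[OF t])
        show "A - {d, x} \<subseteq> D'" using A(1) unfolding D'_def by auto
        show "A - {d, x} \<noteq> {}"
        proof (cases "x \<in> A")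
          case True
          then show ?thesis using cl(1)[of x] d xx by auto
        next
          case False
          then show ?thesis using dx A(2) by auto
        qed
        show "\<epsilon> ` (A - {d, x}) \<subseteq> A - {d, x}"
          using cl(2) eD' A(1) unfolding D'_def by auto
        show "\<phi>' ` (A - {d, x}) \<subseteq> A - {d, x}"
        proof
          fix y assume "y \<in> \<phi>' ` (A - {d, x})"
          then obtain w where w: "w \<in> A - {d, x}" "y = \<phi>' w" by auto
          then have wD: "w \<in> D'" using A(1) unfolding D'_def by auto
          then have "y \<in> D'" using w dart_mapD(6)[OF m'] by simp
          moreover have "y \<in> A" using phi'[OF wD] w cl dx by (auto split: if_splits)
          ultimately show "y \<in> A - {d, x}" unfolding D'_def by auto
        qed
      qed
      then have "d \<in> A" using pD' cl(1)[of p] p by auto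
      then show "A = D" using \<open>A - {d, x} = D'\<close> dx A(1) unfolding D'_def by auto
    qed
  qed
  show "planar_map D \<epsilon> \<phi> \<longleftrightarrow> planar_map D' \<epsilon> \<phi>'"
    unfolding planar_map_iff using m m' ne d trans cphi crho cD by auto
qed

text \<open>The edge separates two faces. Exchanging the values at \<open>d\<close> and
  \<open>x\<close> joins these two cycles, and skipping both darts leaves their rest: one face and
  one edge fewer, with the number of vertices unchanged. The excluded case is a loop with a face of
  length one on either side, where nothing would remain of its component.\<close>

lemma remove_chord:
  assumes m: "dart_map D \<epsilon> \<phi>" and d: "d \<in> D" "\<epsilon> d = x" "x \<notin> cycle_of \<phi> d" "\<not> (\<phi> d = d \<and> \<phi> x = x)"
  defines "D' \<equiv> D - {d, x}" and "\<phi>' \<equiv> skip x (skip d (\<phi>(d := \<phi> x, x := \<phi> d)))"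
  shows "dart_map D' \<epsilon> \<phi>'" "D' \<noteq> {}" "cycle_count \<phi> D = Suc (cycle_count \<phi>' D')"
    "planar_map D \<epsilon> \<phi> \<longleftrightarrow> planar_map D' \<epsilon> \<phi>'"
proof -
  note M = dart_mapD[OF m]
  note inj = inj_onD[OF perm_onD(2)[OF M(4)]]
  have x: "x \<in> D" "x \<noteq> d" "\<epsilon> x = d" using M d by auto
  define \<sigma> where "\<sigma> = \<phi>(d := \<phi> x, x := \<phi> d)"
  have D'': "D' = D - {d} - {x}" unfolding D'_def by auto
  have dx: "\<phi> d \<noteq> x" using d(3) cycle_of_closed[of \<phi> d] self_in_cycle_of[of d \<phi>] by blast
  have xd: "\<phi> x \<noteq> d"
  proof
    assume "\<phi> x = d"
    then have "d \<in> cycle_of \<phi> x" using cycle_of_closed[of \<phi> x] self_in_cycle_of[of x \<phi>] by blast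
    then have "cycle_of \<phi> d = cycle_of \<phi> x" by (rule cycle_of_eq[OF M(4) x(1)])
    then show False using d(3) by simp
  qed
  have s: "\<sigma> d = \<phi> x" "\<sigma> x = \<phi> d" "\<And>w. w \<in> D' \<Longrightarrow> \<sigma> w = \<phi> w" using x unfolding \<sigma>_def D'_def by auto
  have ps: "perm_on D \<sigma>" unfolding \<sigma>_def by (rule perm_on_swap[OF M(4) d(1) x(1)])
  have p1: "perm_on (D - {d}) (skip d \<sigma>)" by (rule perm_on_skip[OF ps d(1)])
  have p': "perm_on D' \<phi>'" unfolding D'' \<phi>'_def \<sigma>_def[symmetric] by (rule perm_on_skip[OF p1]) (use x in auto)
  have eD': "\<epsilon> z \<in> D'" if z: "z \<in> D'" for z
  proof -
    have "z \<in> D" "z \<noteq> d" "z \<noteq> x" using z unfolding D'_def by auto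
    then have "\<epsilon> z \<in> D" "\<epsilon> z \<noteq> d" "\<epsilon> z \<noteq> x" using M(1)[of z] M(3)[of z] x d by auto
    then show ?thesis unfolding D'_def by simp
  qed
  show m': "dart_map D' \<epsilon> \<phi>'"
    unfolding dart_map_def using p' eD' M(2,3) unfolding D'_def by auto
  show ne: "D' \<noteq> {}" using M(6)[OF x(1)] M(6)[OF d(1)] d dx xd unfolding D'_def by auto
  have sx: "skip d \<sigma> x = (if \<phi> d = d then \<phi> x else \<phi> d)" using s unfolding skip_def by simp
  then have sxx: "skip d \<sigma> x \<noteq> x" using d(4) dx by auto
  have "cycle_count \<phi>' D' = cycle_count (skip d \<sigma>) (D - {d})"
    unfolding D'' \<phi>'_def \<sigma>_def[symmetric] by (rule cycle_count_skip[OF p1 _ sxx]) (use x in auto)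
  also have "\<dots> = cycle_count \<sigma> D" by (rule cycle_count_skip[OF ps d(1)]) (use s xd in simp)
  finally show cphi: "cycle_count \<phi> D = Suc (cycle_count \<phi>' D')"
    using cycle_count_swap(1)[OF M(4) d(1) x(1) x(2)[symmetric] d(3)] unfolding \<sigma>_def by simp
  let ?\<rho> = "\<phi> \<circ> \<epsilon>"
  have r1: "perm_on (D - {d}) (skip d ?\<rho>)" by (rule perm_on_skip[OF M(8) d(1)])
  have rx: "skip d ?\<rho> x = skip d \<sigma> x" using d x s unfolding skip_def by simp
  have "cycle_count (skip x (skip d ?\<rho>)) D' = cycle_count (skip d ?\<rho>) (D - {d})"
    unfolding D'' by (rule cycle_count_skip[OF r1]) (use rx sxx x in auto)
  also have "\<dots> = cycle_count ?\<rho> D" by (rule cycle_count_skip[OF M(8) d(1)]) (use d xd in simp)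
  also have "cycle_count (skip x (skip d ?\<rho>)) D' = cycle_count (\<phi>' \<circ> \<epsilon>) D'"
  proof (rule cycle_count_cong[symmetric])
    show "(\<phi>' \<circ> \<epsilon>) ` D' \<subseteq> D'" using perm_onD(4)[OF dart_mapD(8)[OF m']] by auto
    fix z assume z: "z \<in> D'"
    have "skip d \<sigma> (\<epsilon> z) = skip d ?\<rho> z" using s(3)[OF eD'[OF z]] s(1) d x unfolding skip_def by simp
    then show "(\<phi>' \<circ> \<epsilon>) z = skip x (skip d ?\<rho>) z"
      unfolding \<phi>'_def \<sigma>_def[symmetric] using rx by (simp add: skip_def[of x])
  qed
  finally have crho: "cycle_count ?\<rho> D = cycle_count (\<phi>' \<circ> \<epsilon>) D'" by (rule sym)
  have cD: "card D = card D' + 2"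
    using M(5) d(1) x card_Diff_subset[of "{d,x}" D] card_mono[of D "{d,x}"] unfolding D'_def by auto
  have phi'1: "\<phi>' w = \<phi> w" if "w \<in> D'" "\<phi> w \<noteq> d" "\<phi> w \<noteq> x" for w
    using that s unfolding \<phi>'_def \<sigma>_def[symmetric] by (simp add: skip_def)
  have phi'2: "\<phi>' w \<in> {\<phi> w, \<phi> d, \<phi> x}" if "w \<in> D'" for w
    using that s unfolding \<phi>'_def \<sigma>_def[symmetric] by (auto simp: skip_def)
  obtain P where P: "is_cycle \<phi> (d # P)" "set (d # P) = cycle_of \<phi> d" "set (d # P) \<subseteq> D"
    using obtain_cycle[OF M(4) d(1)] by metis
  obtain Q where Q: "is_cycle \<phi> (x # Q)" "set (x # Q) = cycle_of \<phi> x" "set (x # Q) \<subseteq> D"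
    using obtain_cycle[OF M(4) x(1)] by metis
  have dis: "set (d # P) \<inter> set (x # Q) = {}"
    using cycle_of_is_cycle[OF P(1)] cycle_of_is_cycle[OF Q(1)] d(3) P(2) Q(2)
    by (metis disjoint_iff self_in_cycle_of)
  have cs: "is_cycle \<sigma> (d # Q @ x # P)" unfolding \<sigma>_def by (rule is_cycle_merge[OF P(1) Q(1) dis])
  \<comment> \<open>Every remaining dart of the two old faces lies on the one new face, so an
    invariant set that meets this face contains all of it.\<close>
  have merged: "cycle_of \<phi>' w = set P \<union> set Q" if "w \<in> set P \<union> set Q" for w
  proof -
    have wn: "w \<in> D" "w \<noteq> d" "w \<noteq> x" using that P Q dis unfolding is_cycle_def by auto
    have "cycle_of \<phi>' w = cycle_of (skip d \<sigma>) w - {x}"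
      unfolding \<phi>'_def \<sigma>_def[symmetric] by (rule cycle_of_skip[OF p1]) (use wn x in auto)
    also have "cycle_of (skip d \<sigma>) w = cycle_of \<sigma> w - {d}" by (rule cycle_of_skip[OF ps d(1)]) (use wn in auto)
    also have "cycle_of \<sigma> w = set (d # Q @ x # P)" by (rule cycle_of_is_cycle[OF cs]) (use that in auto)
    finally show ?thesis using cs unfolding is_cycle_def by auto
  qed
  have trans: "transitive_pair D \<epsilon> \<phi> \<longleftrightarrow> transitive_pair D' \<epsilon> \<phi>'"
  proof
    assume t: "transitive_pair D \<epsilon> \<phi>"
    show "transitive_pair D' \<epsilon> \<phi>'"
      unfolding transitive_pair_def
    proof (intro allI impI)
      fix A' assume A': "A' \<subseteq> D'" "A' \<noteq> {}" "\<epsilon> ` A' \<subseteq> A'" "\<phi>' ` A' \<subseteq> A'"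
      let ?M = "set P \<union> set Q"
      define A where "A = (if A' \<inter> ?M = {} then A' else A' \<union> {d, x})"
      have sub: "?M \<subseteq> A'" if "A' \<inter> ?M \<noteq> {}"
      proof -
        obtain w where w: "w \<in> A'" "w \<in> ?M" using \<open>A' \<inter> ?M \<noteq> {}\<close> by blast
        show ?thesis using cycle_of_subset[OF A'(4) w(1)] merged[OF w(2)] by simp
      qed
      have cl: "\<phi> w \<in> A" if "w \<in> A'" for w
      proof (cases "\<phi> w = d \<or> \<phi> w = x")
        case True
        have wD: "w \<in> D" "w \<noteq> d" "w \<noteq> x" using A'(1) that unfolding D'_def by auto
        have "\<phi> w \<in> cycle_of \<phi> w" using cycle_of_closed[of \<phi> w] self_in_cycle_of[of w \<phi>] by blast
        then have "cycle_of \<phi> (\<phi> w) = cycle_of \<phi> w" by (rule cycle_of_eq[OF M(4) wD(1)])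
        then have "w \<in> cycle_of \<phi> d \<or> w \<in> cycle_of \<phi> x" using True self_in_cycle_of[of w \<phi>] by metis
        then have "w \<in> set (d # P) \<or> w \<in> set (x # Q)" unfolding P(2) Q(2) .
        then have "w \<in> ?M" using wD(2,3) by auto
        then show ?thesis using True that unfolding A_def by auto
      next
        case False
        then have "\<phi>' w = \<phi> w" using phi'1[of w] that A'(1) by auto
        then have "\<phi> w \<in> A'" using A'(4) that by (metis image_subset_iff)
        then show ?thesis unfolding A_def by auto
      qed
      have "\<phi> d \<in> set (d # P)" "\<phi> x \<in> set (x # Q)" using is_cycle_closed[OF P(1)] is_cycle_closed[OF Q(1)] by auto
      then have ext: "\<phi> d \<in> A \<and> \<phi> x \<in> A" if "A' \<inter> ?M \<noteq> {}" using sub[OF that] that unfolding A_def by auto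
      have "\<phi> ` A \<subseteq> A"
      proof
        fix y assume "y \<in> \<phi> ` A"
        then obtain w where w: "w \<in> A" "y = \<phi> w" by auto
        show "y \<in> A"
        proof (cases "w \<in> A'")
          case False
          then have "A' \<inter> ?M \<noteq> {}" "w = d \<or> w = x" using w(1) unfolding A_def by (auto split: if_splits)
          then show ?thesis using ext w(2) by auto
        qed (use cl w in auto)
      qed
      moreover have "\<epsilon> ` A \<subseteq> A" using A'(3) d x unfolding A_def by auto
      moreover have "A \<subseteq> D" "A \<noteq> {}" using A'(1,2) d x unfolding A_def D'_def by auto
      ultimately have "A = D" using transitive_pairD[OF t] by blast
      then show "A' = D'" using A'(1) d x unfolding A_def D'_def by (auto split: if_splits)
    qed
  next
    assume t: "transitive_pair D' \<epsilon> \<phi>'"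
    show "transitive_pair D \<epsilon> \<phi>"
      unfolding transitive_pair_def
    proof (intro allI impI)
      fix A assume A: "A \<subseteq> D" "A \<noteq> {}" "\<epsilon> ` A \<subseteq> A" "\<phi> ` A \<subseteq> A"
      have dxA: "d \<in> A \<longleftrightarrow> x \<in> A" using A(3) d x by (metis image_subset_iff)
      have cl: "\<phi> w \<in> A" "\<epsilon> w \<in> A" if "w \<in> A" for w using A(3,4) that by auto
      have "A - {d, x} = D'"
      proof (rule transitive_pairD[OF t])
        show "A - {d, x} \<subseteq> D'" using A(1) unfolding D'_def by auto
        show "A - {d, x} \<noteq> {}"
        proof (cases "x \<in> A")
          case True
          then have "\<phi> x \<in> A" "\<phi> d \<in> A" using cl dxA by auto
          then show ?thesis using d(4) dx xd by auto
        next
          case False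
          then show ?thesis using dxA A(2) by auto
        qed
        show "\<epsilon> ` (A - {d, x}) \<subseteq> A - {d, x}"
          using cl(2) eD' A(1) unfolding D'_def by auto
        show "\<phi>' ` (A - {d, x}) \<subseteq> A - {d, x}"
        proof
          fix y assume "y \<in> \<phi>' ` (A - {d, x})"
          then obtain w where w: "w \<in> A - {d, x}" "y = \<phi>' w" by auto
          then have wD: "w \<in> D'" using A(1) unfolding D'_def by auto
          then have "y \<in> D'" using w dart_mapD(6)[OF m'] by simp
          moreover have "y \<in> A"
          proof (cases "\<phi> w = d \<or> \<phi> w = x")
            case True
            then have "d \<in> A" "x \<in> A" using cl(1)[of w] w dxA by auto
            moreover have "w \<in> A" using w(1) by simp
            ultimately have "\<phi> w \<in> A" "\<phi> d \<in> A" "\<phi> x \<in> A" using cl(1) by blast+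
            with phi'2[OF wD] show ?thesis unfolding w(2) by (elim insertE emptyE) simp_all
          next
            case False
            then have "y = \<phi> w" using phi'1[OF wD] w(2) by simp
            then show ?thesis using w(1) cl(1)[of w] by simp
          qed
          ultimately show "y \<in> A - {d, x}" unfolding D'_def by auto
        qed
      qed
      then have D'A: "w \<in> A" if "w \<in> D" "w \<noteq> d" "w \<noteq> x" for w
        using that unfolding D'_def by blast
      \<comment> \<open>A predecessor of \<open>d\<close> outside the edge exists unless
        \<open>d\<close> is a face of its own. In that case \<open>x\<close> is not, and its
        predecessor serves instead.\<close>
      have "d \<in> A"
      proof (cases "\<phi> d = d")
        case False
        obtain p where p: "p \<in> D" "\<phi> p = d" using perm_onD(3)[OF M(4)] d(1) by (metis imageE)
        then have "p \<noteq> d" "p \<noteq> x" using False xd by metis+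
        then show ?thesis using D'A[OF p(1)] cl(1)[of p] p(2) by simp
      next
        case True
        obtain p where p: "p \<in> D" "\<phi> p = x" using perm_onD(3)[OF M(4)] x(1) by (metis imageE)
        then have "p \<noteq> d" "p \<noteq> x" using True d(4) dx by metis+
        then have "x \<in> A" using D'A[OF p(1)] cl(1)[of p] p(2) by simp
        then show ?thesis using dxA by simp
      qed
      then show "A = D" using D'A dxA A(1) by blast
    qed
  qed
  show "planar_map D \<epsilon> \<phi> \<longleftrightarrow> planar_map D' \<epsilon> \<phi>'"
    unfolding planar_map_iff using m m' ne d trans cphi crho cD by auto
qed

section \<open>Diagrams\<close>

lemma is_cycle_unique: "is_cycle f xs \<Longrightarrow> is_cycle g xs \<Longrightarrow> z \<in> set xs \<Longrightarrow> f z = g z"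
  by (metis in_set_conv_nth is_cycle_nth)

lemma is_cycle_meet:
  assumes "is_cycle f xs" "is_cycle f ys" "set xs \<inter> set ys \<noteq> {}"
  shows "\<exists>k. ys = rotate k xs"
proof -
  obtain z where z: "z \<in> set xs" "z \<in> set ys" using assms(3) by auto
  obtain xs' where x: "is_cycle f (z # xs')" "\<exists>k. z # xs' = rotate k xs" using is_cycle_at[OF assms(1) z(1)] by metis
  obtain ys' i where y: "is_cycle f (z # ys')" "z # ys' = rotate i ys" using is_cycle_at[OF assms(2) z(2)] by metis
  have "z # xs' = z # ys'" using cycle_list_is_cycle[OF x(1)] cycle_list_is_cycle[OF y(1)] by simp
  then have "rotate i ys = z # xs'" using y(2) by simp
  then obtain k where k: "rotate i ys = rotate k xs" using x(2) by auto
  then show ?thesis using rotate_invertible[of ys i] by (metis rotate_rotate)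
qed

text \<open>The inverse of \<open>skip\<close>: the new point starts as a fixed point, and an
  exchange with the last element of \<open>us\<close> merges it into the cycle at its end.\<close>

lemma insert_into_cycle:
  assumes "perm_on D f" "is_cycle f us" "set us \<subseteq> D" "b \<notin> D"
  obtains g where "perm_on (insert b D) g" "is_cycle g (us @ [b])" "\<And>z. z \<in> D - set us \<Longrightarrow> g z = f z"
proof -
  define f0 where "f0 = f(b := b)"
  have f0: "f0 z = f z" if "z \<in> D" for z using that assms(4) unfolding f0_def by auto
  have p0: "perm_on (insert b D) f0"
  proof (rule perm_onI)
    show "inj_on f0 (insert b D)"
      using perm_onD[OF assms(1)] assms(4) unfolding f0_def inj_on_def by auto
  qed (use perm_onD[OF assms(1)] f0 in \<open>auto simp: f0_def\<close>)
  have ne: "us \<noteq> []" using assms(2) unfolding is_cycle_def by auto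
  define a where "a = last us"
  have us: "us = butlast us @ [a]" using ne unfolding a_def by simp
  have a: "a \<in> D" using ne assms(3) unfolding a_def by auto
  have c: "is_cycle f0 us" by (rule is_cycle_cong[OF _ assms(2)]) (use f0 assms(3) in auto)
  then have ca: "is_cycle f0 (a # butlast us)" using is_cycle_append_commute[of f0 "butlast us" "[a]"] us by simp
  have cb: "is_cycle f0 [b]" unfolding is_cycle_def f0_def by simp
  define g where "g = f0(a := f0 b, b := f0 a)"
  have "set (butlast us) \<subseteq> D" using us assms(3) by (metis Un_subset_iff set_append)
  then have "is_cycle g (a # [] @ b # butlast us)"
    unfolding g_def by (intro is_cycle_merge[OF ca cb]) (use a assms(4) in auto)
  then have "is_cycle g (butlast us @ [a, b])"
    using is_cycle_append_commute[of g "[a, b]" "butlast us"] by simp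
  then have "is_cycle g ((butlast us @ [a]) @ [b])" by simp
  then have "is_cycle g (us @ [b])" using us by metis
  moreover have "perm_on (insert b D) g" unfolding g_def by (rule perm_on_swap[OF p0]) (use a in auto)
  moreover have "g z = f z" if "z \<in> D - set us" for z
    using that f0[of z] us assms(4) ne unfolding g_def a_def by (auto simp: last_in_set)
  ultimately show ?thesis using that by blast
qed

lemma skip_pair:
  assumes "inj_on f D" "d \<in> D" "x \<in> D" "f d = x" "d \<noteq> x" "f x \<noteq> d" "f x \<noteq> x" "w \<in> D - {d, x}"
  shows "skip x (skip d f) w = (if f w = d then f x else f w)"
  using assms inj_onD[OF assms(1), of w d] by (auto simp: skip_def)

text \<open>Applied with \<open>s\<close> the source of the label of a dart. Skipping a dart whose
  successor starts at the same vertex of \<open>Y\<close> keeps consecutive labels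
  composable.\<close>

lemma skip_invariant: "s (f a) = s a \<Longrightarrow> s (skip a f z) = s (f z)"
  by (simp add: skip_def)

definition face_label :: "('v, 'e, 'f) complex2 \<Rightarrow> 'e list \<Rightarrow> bool" where
  "face_label Y p \<longleftrightarrow> (\<exists>f\<in>faces Y. same_cycle Y p (bdry Y f))"

text \<open>\<open>vk_diagram\<close> with the outer face listed as a cycle \<open>xs\<close>, so
  that its label can be split and rotated like a list. The darts are of any type, and
  \<open>N\<close> is the number of inner faces.\<close>

definition diagram :: "('v, 'e, 'f) complex2 \<Rightarrow> 'd set \<Rightarrow> ('d \<Rightarrow> 'd) \<Rightarrow> ('d \<Rightarrow> 'd) \<Rightarrow>
    ('d \<Rightarrow> 'e) \<Rightarrow> 'd list \<Rightarrow> nat \<Rightarrow> bool" where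
  "diagram Y D \<epsilon> \<phi> l xs N \<longleftrightarrow> planar_map D \<epsilon> \<phi> \<and>
     (\<forall>d\<in>D. l d \<in> edges Y \<and> l (\<epsilon> d) = rv Y (l d) \<and> src Y (l (\<phi> d)) = tgt Y (l d)) \<and>
     is_cycle \<phi> xs \<and> set xs \<subseteq> D \<and>
     (\<forall>ys. is_cycle \<phi> ys \<longrightarrow> set ys \<subseteq> D \<longrightarrow> set ys \<inter> set xs = {} \<longrightarrow> face_label Y (map l ys)) \<and>
     cycle_count \<phi> D = Suc N"

lemma diagramD:
  assumes "diagram Y D \<epsilon> \<phi> l xs N"
  shows "planar_map D \<epsilon> \<phi>" "dart_map D \<epsilon> \<phi>" "transitive_pair D \<epsilon> \<phi>"
    "\<And>d. d \<in> D \<Longrightarrow> l d \<in> edges Y" "\<And>d. d \<in> D \<Longrightarrow> l (\<epsilon> d) = rv Y (l d)"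
    "\<And>d. d \<in> D \<Longrightarrow> src Y (l (\<phi> d)) = tgt Y (l d)"
    "is_cycle \<phi> xs" "set xs \<subseteq> D"
    "\<And>ys. is_cycle \<phi> ys \<Longrightarrow> set ys \<subseteq> D \<Longrightarrow> set ys \<inter> set xs = {} \<Longrightarrow> face_label Y (map l ys)"
    "cycle_count \<phi> D = Suc N" "xs \<noteq> []" "distinct xs"
  using assms unfolding diagram_def planar_map_iff is_cycle_def by auto

lemma filled_by_iff:
  "filled_by Y p N \<longleftrightarrow> p = [] \<and> N = 0 \<or>
     (\<exists>(D::nat set) \<epsilon> \<phi> l xs. diagram Y D \<epsilon> \<phi> l xs N \<and> map l xs = p)"
proof -
  have "vk_diagram Y D \<epsilon> \<phi> l d \<and> card (cycle_of \<phi> ` D - {cycle_of \<phi> d}) = N \<longleftrightarrow>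
      d \<in> D \<and> diagram Y D \<epsilon> \<phi> l (cycle_list \<phi> d) N"
    for D :: "nat set" and \<epsilon> \<phi> l d
  proof (cases "planar_map D \<epsilon> \<phi> \<and> d \<in> D")
    case True
    then have p: "perm_on D \<phi>" and dD: "d \<in> D" unfolding planar_map_iff dart_map_def by auto
    note c = is_cycle_cycle_list[OF p dD]
    have "cycle_count \<phi> D = Suc (card (cycle_of \<phi> ` D - {cycle_of \<phi> d}))"
      unfolding cycle_count_def using perm_onD(1)[OF p] dD by (intro card_Suc_Diff1[symmetric]) auto
    moreover have "(\<forall>z\<in>D. z \<notin> cycle_of \<phi> d \<longrightarrow> face_label Y (map l (cycle_list \<phi> z))) \<longleftrightarrow>
      (\<forall>ys. is_cycle \<phi> ys \<longrightarrow> set ys \<subseteq> D \<longrightarrow> set ys \<inter> set (cycle_list \<phi> d) = {} \<longrightarrow> face_label Y (map l ys))"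
      (is "?L \<longleftrightarrow> ?R")
    proof
      assume L: ?L
      show ?R
      proof (intro allI impI)
        fix ys assume ys: "is_cycle \<phi> ys" "set ys \<subseteq> D" "set ys \<inter> set (cycle_list \<phi> d) = {}"
        have "hd ys \<in> set ys" using ys(1) unfolding is_cycle_def by auto
        then have "hd ys \<in> D" "hd ys \<notin> cycle_of \<phi> d" using ys(2,3) c(3) by auto
        then show "face_label Y (map l ys)" using L cycle_list_is_cycle[OF ys(1)] by metis
      qed
    next
      assume R: ?R
      show ?L
      proof (intro ballI impI)
        fix z assume z: "z \<in> D" "z \<notin> cycle_of \<phi> d"
        note cz = is_cycle_cycle_list[OF p z(1)]
        have "cycle_of \<phi> z \<inter> cycle_of \<phi> d = {}"
        proof (rule ccontr)
          assume "cycle_of \<phi> z \<inter> cycle_of \<phi> d \<noteq> {}"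
          then obtain y where "y \<in> cycle_of \<phi> z" "y \<in> cycle_of \<phi> d" by auto
          then have "cycle_of \<phi> z = cycle_of \<phi> d" using cycle_of_eq[OF p] z(1) dD by metis
          then show False using z(2) self_in_cycle_of by metis
        qed
        then show "face_label Y (map l (cycle_list \<phi> z))" using R cz c(3) by simp
      qed
    qed
    ultimately show ?thesis
      using True c unfolding vk_diagram_def diagram_def face_label_def by auto
  next
    case False
    then show ?thesis unfolding vk_diagram_def diagram_def by auto
  qed
  moreover have "\<exists>d\<in>D. cycle_list \<phi> d = xs" if "diagram Y D \<epsilon> \<phi> l xs N" for D :: "nat set" and \<epsilon> \<phi> l xs
    using diagramD(7,8,11)[OF that] cycle_list_is_cycle[of \<phi> xs] by (meson hd_in_set subsetD)
  ultimately show ?thesis unfolding filled_by_def by metis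
qed

lemma diagram_rotate: "diagram Y D \<epsilon> \<phi> l (xs @ ys) N \<Longrightarrow> diagram Y D \<epsilon> \<phi> l (ys @ xs) N"
  unfolding diagram_def using is_cycle_append_commute by (auto simp: Un_commute)

context two_complex
begin

lemma face_label_rotate: "face_label Y p \<Longrightarrow> face_label Y (rotate k p)"
  unfolding face_label_def same_cycle_def by (metis rotate_rotate)

lemma face_label_inverse: "face_label Y p \<Longrightarrow> face_label Y (path_inv p)"
  unfolding face_label_def using same_cycle_inverse face_loop edge_path_edges by metis

lemma edge_path_successively:
  assumes "xs \<noteq> []" "set xs \<subseteq> D" "\<And>d. d \<in> D \<Longrightarrow> l d \<in> edges Y"
    "successively (\<lambda>x y. src Y (l y) = tgt Y (l x)) xs"
  shows "edge_path Y (src Y (l (hd xs))) (map l xs) (tgt Y (l (last xs)))"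
  using assms(1,2,4)
proof (induction xs)
  case (Cons x xs)
  show ?case
  proof (cases "xs = []")
    case True
    then show ?thesis using Cons assms(3) by auto
  next
    case False
    then show ?thesis using Cons assms(3)[of x] by (auto simp: successively_Cons)
  qed
qed simp

lemma cycle_edge_path:
  assumes "diagram Y D \<epsilon> \<phi> l xs N" "is_cycle \<phi> ys" "set ys \<subseteq> D"
  shows "edge_path Y (src Y (l (hd ys))) (map l ys) (src Y (l (hd ys)))"
proof -
  note d = diagramD[OF assms(1)]
  have ne: "ys \<noteq> []" using assms(2) unfolding is_cycle_def by auto
  have "successively (\<lambda>x y. \<phi> x = y) ys" using assms(2) unfolding is_cycle_def by auto
  then have s: "successively (\<lambda>x y. src Y (l y) = tgt Y (l x)) ys"
    by (rule successively_mono) (use d(6) assms(3) in auto)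
  have "last ys \<in> D" using assms(3) ne last_in_set by blast
  then have "tgt Y (l (last ys)) = src Y (l (\<phi> (last ys)))" using d(6)[of "last ys"] by simp
  also have "\<phi> (last ys) = hd ys" using assms(2) unfolding is_cycle_def by auto
  finally show ?thesis using edge_path_successively[OF ne assms(3) d(4) s] by simp
qed

text \<open>The predecessor of \<open>d\<close> is led on to \<open>\<phi> x\<close>, which starts
  at the same vertex of \<open>Y\<close> as \<open>d\<close>, so labels still compose. The inner
  faces are untouched, and \<open>P \<noteq> []\<close> guarantees that darts remain.\<close>

lemma diagram_remove_spike:
  assumes "diagram Y D \<epsilon> \<phi> l (d # x # P) N" "\<epsilon> d = x" "P \<noteq> []"
  shows "diagram Y (D - {d, x}) \<epsilon> (skip x (skip d \<phi>)) l P N"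
proof -
  note dg = diagramD[OF assms(1)]
  note inj = perm_onD(2)[OF dart_mapD(4)[OF dg(2)]]
  let ?\<phi>' = "skip x (skip d \<phi>)"
  have c: "\<phi> d = x" "\<phi> x = hd P" "d \<noteq> x" "d \<notin> set P" "x \<notin> set P" "d \<in> D" "x \<in> D"
    using dg(7,8) assms(3) unfolding is_cycle_def by (auto simp: successively_Cons)
  have xx: "\<phi> x \<noteq> d" "\<phi> x \<noteq> x" using c assms(3) hd_in_set by metis+
  note r = remove_spike[OF dg(2) c(6) assms(2) c(1) xx(1)]
  have P: "is_cycle ?\<phi>' P"
    using is_cycle_skip[OF is_cycle_skip[OF dg(7)]] assms(3) by simp
  have phi': "?\<phi>' w = (if \<phi> w = d then \<phi> x else \<phi> w)" if "w \<in> D - {d, x}" for w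
    by (rule skip_pair[OF inj]) (use c xx that in auto)
  show ?thesis
    unfolding diagram_def
  proof (intro conjI ballI allI impI)
    show "planar_map (D - {d, x}) \<epsilon> ?\<phi>'" using r(4) dg(1) by simp
    show "cycle_count ?\<phi>' (D - {d, x}) = Suc N" using r(3) dg(10) by simp
    fix w assume w: "w \<in> D - {d, x}"
    then show "l w \<in> edges Y" "l (\<epsilon> w) = rv Y (l w)" using dg(4,5) by auto
    have "src Y (l (\<phi> x)) = src Y (l d)" using dg(6)[OF c(7)] dg(5)[OF c(6)] dg(4)[OF c(6)] assms(2) by simp
    then show "src Y (l (?\<phi>' w)) = tgt Y (l w)" using phi'[OF w] dg(6)[of w] w by auto
  next
    show "set P \<subseteq> D - {d, x}" using dg(8) c by auto
    fix ys assume ys: "is_cycle ?\<phi>' ys" "set ys \<subseteq> D - {d, x}" "set ys \<inter> set P = {}"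
    have "?\<phi>' w = \<phi> w" if "w \<in> set ys" for w
    proof -
      have "\<phi> w \<noteq> d"
      proof
        assume "\<phi> w = d"
        then have "?\<phi>' w = hd P" using phi'[of w] that ys(2) c by auto
        then have "hd P \<in> set ys" using is_cycle_closed[OF ys(1)] that by auto
        then show False using ys(3) hd_in_set[OF assms(3)] by auto
      qed
      then show ?thesis using phi'[of w] that ys(2) by auto
    qed
    then have "is_cycle \<phi> ys" using is_cycle_cong[OF _ ys(1)] by blast
    then show "face_label Y (map l ys)" by (rule dg(9)) (use ys in auto)
  qed (rule P)
qed

text \<open>The inner face behind \<open>d\<close> is opened up and disappears from the count, its
  rest \<open>Q\<close> taking the place of \<open>d\<close> on the boundary. That labels still
  compose is an instance of \<open>skip_invariant\<close>.\<close>

lemma diagram_remove_chord: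
  assumes "diagram Y D \<epsilon> \<phi> l (d # P) N" "\<epsilon> d = x" "x \<notin> set (d # P)" "is_cycle \<phi> (x # Q)" "set Q \<subseteq> D" "P @ Q \<noteq> []"
  shows "\<exists>\<phi>' N'. N = Suc N' \<and> diagram Y (D - {d, x}) \<epsilon> \<phi>' l (Q @ P) N'"
proof -
  note dg = diagramD[OF assms(1)]
  have dx: "d \<in> D" "x \<in> D" "d \<noteq> x" "\<epsilon> x = d" using dg(8) dart_mapD[OF dg(2)] assms(2,3) by auto
  have cd: "cycle_of \<phi> d = set (d # P)" by (rule cycle_of_is_cycle[OF dg(7)]) simp
  have dis: "set (d # P) \<inter> set (x # Q) = {}"
    using cycle_of_is_cycle[OF assms(4)] cycle_of_is_cycle[OF dg(7)] assms(3)
    by (metis disjoint_iff list.set_intros(1))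
  let ?\<sigma> = "\<phi>(d := \<phi> x, x := \<phi> d)"
  let ?\<phi>' = "skip x (skip d ?\<sigma>)"
  have nf: "\<not> (\<phi> d = d \<and> \<phi> x = x)"
  proof
    assume a: "\<phi> d = d \<and> \<phi> x = x"
    have "P = []" using dg(7) a unfolding is_cycle_def by (cases P) auto
    moreover have "Q = []" using assms(4) a unfolding is_cycle_def by (cases Q) auto
    ultimately show False using assms(6) by simp
  qed
  note r = remove_chord[OF dg(2) dx(1) assms(2) _ nf]
  have xc: "x \<notin> cycle_of \<phi> d" using cd assms(3) by simp
  have merged: "is_cycle ?\<sigma> (d # Q @ x # P)" by (rule is_cycle_merge[OF dg(7) assms(4) dis])
  then have "is_cycle (skip d ?\<sigma>) (Q @ x # P)" by (rule is_cycle_skip) simp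
  then have "is_cycle (skip d ?\<sigma>) (x # P @ Q)" using is_cycle_append_commute[of _ Q "x # P"] by simp
  then have "is_cycle ?\<phi>' (P @ Q)" by (rule is_cycle_skip) (rule assms(6))
  then have QP: "is_cycle ?\<phi>' (Q @ P)" by (rule is_cycle_append_commute)
  have s: "src Y (l (\<phi> d)) = src Y (l x)" "src Y (l (\<phi> x)) = src Y (l d)"
    by (simp_all only: dg(6)[OF dx(1)] dg(6)[OF dx(2)] dg(5)[OF dx(1), unfolded assms(2)] tgt_def
      rv_rv[OF dg(4)[OF dx(1)]])
  define N' where "N' = cycle_count ?\<phi>' (D - {d, x}) - 1"
  have pm: "planar_map (D - {d, x}) \<epsilon> ?\<phi>'" using r(4)[OF xc] dg(1) by simp
  have "cycle_count ?\<phi>' (D - {d, x}) > 0"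
    using r(2)[OF xc] dart_mapD(5)[OF r(1)[OF xc]] unfolding cycle_count_def by (simp add: card_gt_0_iff)
  then have N: "cycle_count ?\<phi>' (D - {d, x}) = Suc N'" "N = Suc N'"
    using r(3)[OF xc] dg(10) unfolding N'_def by auto
  have "diagram Y (D - {d, x}) \<epsilon> ?\<phi>' l (Q @ P) N'"
    unfolding diagram_def
  proof (intro conjI ballI allI impI)
    fix w assume w: "w \<in> D - {d, x}"
    then show "l w \<in> edges Y" "l (\<epsilon> w) = rv Y (l w)" using dg(4,5) by auto
    have 1: "src Y (l (skip d ?\<sigma> z)) = src Y (l (?\<sigma> z))" for z
      by (rule skip_invariant[of "\<lambda>z. src Y (l z)"]) (use s dx in simp)
    have "src Y (l (?\<phi>' w)) = src Y (l (skip d ?\<sigma> w))"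
      by (rule skip_invariant[of "\<lambda>z. src Y (l z)"]) (use s dx 1[of x] in simp)
    then show "src Y (l (?\<phi>' w)) = tgt Y (l w)" using 1[of w] dg(6)[of w] w by auto
  next
    show "set (Q @ P) \<subseteq> D - {d, x}"
      using dg(7,8) assms(3,4,5) dis unfolding is_cycle_def by auto
    fix ys assume ys: "is_cycle ?\<phi>' ys" "set ys \<subseteq> D - {d, x}" "set ys \<inter> set (Q @ P) = {}"
    have "?\<phi>' w = \<phi> w" if w: "w \<in> set ys" for w
    proof -
      have wD: "w \<in> D" "w \<noteq> d" "w \<noteq> x" using ys(2) w by auto
      have "\<phi> w \<notin> {d, x}"
      proof
        assume a: "\<phi> w \<in> {d, x}"
        have "\<phi> w \<in> cycle_of \<phi> w" using cycle_of_closed[of \<phi> w] self_in_cycle_of[of w \<phi>] by blast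
        then have "cycle_of \<phi> (\<phi> w) = cycle_of \<phi> w" by (rule cycle_of_eq[OF dart_mapD(4)[OF dg(2)] wD(1)])
        then have "w \<in> cycle_of \<phi> (\<phi> w)" using self_in_cycle_of[of w \<phi>] by simp
        moreover have "cycle_of \<phi> x = set (x # Q)" by (rule cycle_of_is_cycle[OF assms(4)]) simp
        ultimately have "w \<in> set (d # P) \<or> w \<in> set (x # Q)" using a cd by (metis insertE singletonD)
        then show False using wD ys(3) w by auto
      qed
      then show ?thesis using wD by (simp add: skip_def)
    qed
    then have "is_cycle \<phi> ys" using is_cycle_cong[OF _ ys(1)] by blast
    then show "face_label Y (map l ys)" by (rule dg(9)) (use ys assms(3) in auto)
  qed (use pm QP N in auto)
  then show ?thesis using N(2) by blast
qed

text \<open>Removing an edge between the outer face and an inner face replaces it by the rest of that face.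
  If no such edge exists, the diagram is a tree and has a leaf.\<close>

lemma diagram_homotopic:
  assumes "diagram Y D \<epsilon> \<phi> l xs N"
  shows "homotopic Y (src Y (l (hd xs))) (src Y (l (hd xs))) N (map l xs) []"
  using assms
proof (induction "card D" arbitrary: D \<phi> xs N rule: less_induct)
  case less
  note dg = diagramD[OF less.prems]
  note M = dart_mapD[OF dg(2)]
  \<comment> \<open>Both cases below single out a dart \<open>d\<close> somewhere on the outer face;
    this allows the boundary to be read from \<open>d\<close> onwards.\<close>
  have rotate: "homotopic Y (src Y (l (hd xs))) (src Y (l (hd xs))) N (map l xs) []"
    if xs: "xs = as @ bs" and h: "homotopic Y (src Y (l (hd (bs @ as)))) (src Y (l (hd (bs @ as)))) N (map l (bs @ as)) []"
    for as bs
  proof -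
    have "edge_path Y (src Y (l (hd xs))) (map l xs) (src Y (l (hd xs)))"
      by (rule cycle_edge_path[OF less.prems dg(7,8)])
    then obtain w where w: "edge_path Y (src Y (l (hd xs))) (map l as) w" "edge_path Y w (map l bs) (src Y (l (hd xs)))"
      using xs by (auto simp: edge_path_append_iff)
    have "edge_path Y w (map l (bs @ as)) w" using w edge_path_append by auto
    moreover have "bs @ as \<noteq> []" using xs dg(11) by auto
    ultimately have "src Y (l (hd (bs @ as))) = w"
      using edge_path_source_unique homotopic_path[OF h] by (metis map_is_Nil_conv)
    then show ?thesis using homotopic_rotate[OF w(2,1)] xs h by simp
  qed
  have small: "card (D - {d, \<epsilon> d}) < card D" if "d \<in> D" for d
    using that M(5) by (intro psubset_card_mono) auto
  show ?case
  proof (cases "\<exists>d\<in>set xs. \<epsilon> d \<notin> set xs")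
    case True
    then obtain d where d: "d \<in> set xs" "\<epsilon> d \<notin> set xs" by auto
    obtain as bs where xs: "xs = as @ d # bs" using d(1) by (meson split_list)
    define P where "P = bs @ as"
    have dgP: "diagram Y D \<epsilon> \<phi> l (d # P) N"
      using diagram_rotate[of Y D \<epsilon> \<phi> l as "d # bs" N] less.prems xs unfolding P_def by simp
    define x where "x = \<epsilon> d"
    have dD: "d \<in> D" using d(1) dg(8) by auto
    have x: "x \<in> D" "\<epsilon> x = d" "x \<noteq> d" "x \<notin> set (d # P)"
      using M(1-3)[OF dD] d(2) unfolding x_def P_def xs by auto
    obtain Q where Q: "is_cycle \<phi> (x # Q)" "set (x # Q) = cycle_of \<phi> x" "set (x # Q) \<subseteq> D"
      using obtain_cycle[OF M(4) x(1)] by metis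
    have cP: "is_cycle \<phi> (d # P)" "set (d # P) \<subseteq> D" using diagramD(7,8)[OF dgP] by auto
    have dis: "set (x # Q) \<inter> set (d # P) = {}"
      using cycle_of_is_cycle[OF Q(1)] cycle_of_is_cycle[OF cP(1)] x(4)
      by (metis disjoint_iff list.set_intros(1))
    have e: "l d \<in> edges Y" "l x = rv Y (l d)" using dg(4,5)[OF dD] unfolding x_def by auto
    have fl: "face_label Y (rv Y (l d) # map l Q)"
      using diagramD(9)[OF dgP Q(1,3) dis] e by simp
    have pP: "edge_path Y (src Y (l d)) (l d # map l P) (src Y (l d))"
      using cycle_edge_path[OF dgP cP] by simp
    have pQ: "edge_path Y (tgt Y (l d)) (rv Y (l d) # map l Q) (tgt Y (l d))"
      using cycle_edge_path[OF dgP Q(1,3)] e by simp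
    have pd: "edge_path Y (src Y (l d)) [l d] (tgt Y (l d))" using e by simp
    have "face_label Y (path_inv (rv Y (l d) # map l Q))" by (rule face_label_inverse[OF fl])
    moreover have "path_inv (rv Y (l d) # map l Q) = path_inv (map l Q) @ [l d]"
      using e by (simp add: path_inverse_Cons)
    ultimately have "face_label Y (rotate (length Q) (path_inv (map l Q) @ [l d]))"
      using face_label_rotate by metis
    then have "face_label Y (l d # path_inv (map l Q))"
      using rotate_append[of "path_inv (map l Q)" "[l d]"] by simp
    then obtain f where f: "f \<in> faces Y" "same_cycle Y ([l d] @ path_inv (map l Q)) (bdry Y f)"
      unfolding face_label_def by auto
    have pQ': "edge_path Y (src Y (l d)) (map l Q) (tgt Y (l d))" using pQ e by simp
    have "homotopic Y (src Y (l d)) (src Y (l d)) 1 ([l d] @ path_inv (map l Q)) []"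
      by (rule homotopic_face_cycle[OF f edge_path_append[OF pd edge_path_inverse[OF pQ']]])
    \<comment> \<open>The only face paid for in this round: the edge \<open>l d\<close> is pushed
      across it onto \<open>map l Q\<close>.\<close>
    then have dQ: "homotopic Y (src Y (l d)) (tgt Y (l d)) 1 [l d] (map l Q)"
      by (rule homotopic_of_loop[OF pd pQ'])
    have "homotopic Y (src Y (l d)) (src Y (l d)) N (l d # map l P) []"
    proof (cases "P @ Q = []")
      \<comment> \<open>Both faces have length one, so by connectedness the single loop is the
        entire map.\<close>
      case True
      then have "\<phi> d = d" "\<phi> x = x" using cP(1) Q(1) unfolding is_cycle_def by auto
      then have "{d, x} = D" using transitive_pairD[OF dg(3), of "{d, x}"] dD x x_def by auto
      moreover have "cycle_of \<phi> d = {d}" "cycle_of \<phi> x = {x}"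
        using cycle_of_is_cycle[OF cP(1), of d] cycle_of_is_cycle[OF Q(1), of x] True by auto
      ultimately have "cycle_of \<phi> ` D = {{d}, {x}}" by auto
      then have "cycle_count \<phi> D = 2" using x(3) unfolding cycle_count_def by simp
      then have "N = 1" using dg(10) by simp
      then show ?thesis using dQ True pQ' by auto
    next
      case False
      then obtain \<phi>' N' where N': "N = Suc N'" "diagram Y (D - {d, x}) \<epsilon> \<phi>' l (Q @ P) N'"
        using diagram_remove_chord[OF dgP x_def[symmetric] x(4) Q(1)] Q(3) by auto
      have IH: "homotopic Y (src Y (l (hd (Q @ P)))) (src Y (l (hd (Q @ P)))) N' (map l (Q @ P)) []"
        by (rule less.hyps[OF _ N'(2)]) (use small[OF dD] x_def in auto)
      have pP': "edge_path Y (tgt Y (l d)) (map l P) (src Y (l d))" using pP by simp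
      have pQP: "edge_path Y (src Y (l d)) (map l (Q @ P)) (src Y (l d))"
        using edge_path_append[OF _ pP', of "src Y (l d)" "map l Q"] pQ e by auto
      have "src Y (l (hd (Q @ P))) = src Y (l d)"
        using edge_path_source_unique[OF _ pQP] homotopic_path[OF IH] False by auto
      then have IH': "homotopic Y (src Y (l d)) (src Y (l d)) N' (map l Q @ map l P) []" using IH by simp
      have "homotopic Y (src Y (l d)) (src Y (l d)) (1 + 0) ([l d] @ map l P) (map l Q @ map l P)"
        by (rule homotopic_append[OF dQ homotopic.refl[OF pP']])
      from homotopic_trans[OF this IH'] show ?thesis using N'(1) by simp
    qed
    then show ?thesis using rotate[OF xs] unfolding P_def by simp
  next
    case False
    then have "\<epsilon> ` set xs \<subseteq> set xs" by auto
    then have D: "set xs = D" using transitive_pairD[OF dg(3) dg(8)] dg(11) is_cycle_closed[OF dg(7)] by auto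
    then have c1: "cycle_count \<phi> D = 1" using cycle_count_is_cycle[OF dg(7)] by simp
    then have N: "N = 0" using dg(10) by simp
    \<comment> \<open>Only the outer face is left, so Euler's formula yields more vertices than
      \<open>double_cycle_count_le\<close> permits for a map without fixed points. A fixed point of
      \<open>\<phi> \<circ> \<epsilon>\<close> is the desired leaf.\<close>
    have "2 * cycle_count (\<phi> \<circ> \<epsilon>) D = card D + 2" using dg(1) c1 unfolding planar_map_iff by simp
    then have "\<exists>x\<in>D. (\<phi> \<circ> \<epsilon>) x = x" using double_cycle_count_le[OF M(8)] by fastforce
    then obtain x where x: "x \<in> D" "\<phi> (\<epsilon> x) = x" by auto
    define d where "d = \<epsilon> x"
    have d: "d \<in> D" "\<epsilon> d = x" "\<phi> d = x" "d \<noteq> x" using M(1-3)[OF x(1)] x unfolding d_def by auto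
    obtain as bs where xs: "xs = as @ d # bs" using d(1) D by (metis split_list)
    have rot: "diagram Y D \<epsilon> \<phi> l (d # bs @ as) N"
      using diagram_rotate[of Y D \<epsilon> \<phi> l as "d # bs" N] less.prems xs by simp
    have "bs @ as \<noteq> []"
    proof
      assume "bs @ as = []"
      then show False using diagramD(7)[OF rot] d(3,4) unfolding is_cycle_def by auto
    qed
    then obtain P where P: "bs @ as = x # P"
      using diagramD(7)[OF rot] d(3) unfolding is_cycle_def by (cases "bs @ as") auto
    have dgP: "diagram Y D \<epsilon> \<phi> l (d # x # P) N" using rot P by simp
    have e: "l d \<in> edges Y" "l x = rv Y (l d)" using dg(4,5)[OF d(1)] d(2) by auto
    have pP: "edge_path Y (src Y (l d)) (map l (d # x # P)) (src Y (l d))"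
      using cycle_edge_path[OF dgP diagramD(7,8)[OF dgP]] by simp
    have can: "homotopic Y (src Y (l d)) (src Y (l d)) 0 [l d, rv Y (l d)] []"
      using homotopic_cancel[of "src Y (l d)" "[l d]" "tgt Y (l d)" 0] e by (simp add: path_inverse_def)
    have "homotopic Y (src Y (l d)) (src Y (l d)) N (map l (d # x # P)) []"
    proof (cases "P = []")
      case True
      then show ?thesis using can e N by simp
    next
      case False
      have IH: "homotopic Y (src Y (l (hd P))) (src Y (l (hd P))) N (map l P) []"
        by (rule less.hyps[OF _ diagram_remove_spike[OF dgP d(2) False]]) (use small[OF d(1)] d(2) in auto)
      have pP': "edge_path Y (src Y (l d)) (map l P) (src Y (l d))" using pP e by simp
      have "src Y (l (hd P)) = src Y (l d)"
        using edge_path_source_unique[OF _ pP'] homotopic_path[OF IH] False by auto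
      then have IH': "homotopic Y (src Y (l d)) (src Y (l d)) N (map l P) []" using IH by simp
      show ?thesis using homotopic_append[OF can IH'] e by simp
    qed
    then have "homotopic Y (src Y (l d)) (src Y (l d)) N (map l ((d # bs) @ as)) []" using P by simp
    then show ?thesis by (intro rotate[OF xs]) simp
  qed
qed

lemma filled_by_homotopic:
  assumes "filled_by Y p N" "edge_path Y v p v"
  shows "homotopic Y v v N p []"
proof -
  consider "p = []" | D \<epsilon> \<phi> l xs where "diagram Y (D :: nat set) \<epsilon> \<phi> l xs N" "map l xs = p" "p \<noteq> []"
    using assms(1) unfolding filled_by_iff by blast
  then show ?thesis
  proof cases
    case 1
    then show ?thesis using assms(2) by (auto intro: homotopic.refl)
  next
    case 2
    have h: "homotopic Y (src Y (l (hd xs))) (src Y (l (hd xs))) N p []"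
      using diagram_homotopic[OF 2(1)] 2(2) by simp
    then have "src Y (l (hd xs)) = v"
      using edge_path_source_unique[OF _ assms(2) 2(3)] homotopic_path by blast
    then show ?thesis using h by simp
  qed
qed

end

section \<open>Building diagrams by attaching spikes and faces\<close>

lemma filled_byI:
  assumes "diagram Y (D :: nat set) \<epsilon> \<phi> l xs N" "map l xs = p"
  shows "filled_by Y p N"
  unfolding filled_by_iff by (intro disjI2 exI conjI) (rule assms)+

lemma filled_byE:
  assumes "filled_by Y p N" "p \<noteq> []"
  obtains D :: "nat set" and \<epsilon> \<phi> l xs where "diagram Y D \<epsilon> \<phi> l xs N" "map l xs = p"
proof -
  have "\<exists>(D::nat set) \<epsilon> \<phi> l xs. diagram Y D \<epsilon> \<phi> l xs N \<and> map l xs = p"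
    using assms unfolding filled_by_iff by simp
  then show ?thesis by (elim exE conjE) (rule that)
qed

lemma filled_by_Nil [simp]: "filled_by Y [] N \<longleftrightarrow> N = 0"
  unfolding filled_by_iff by (auto dest: diagramD(11))

lemma transitive_pair_two: "transitive_pair {0, 1} (\<lambda>z::nat. 1 - z) \<phi>"
  unfolding transitive_pair_def
proof (intro allI impI)
  fix A :: "nat set" assume A: "A \<subseteq> {0, 1}" "A \<noteq> {}" "(\<lambda>z. 1 - z) ` A \<subseteq> A"
  then obtain a where a: "a \<in> A" by auto
  then have "1 - a \<in> A" "a = 0 \<or> a = 1" using A by auto
  then have "0 \<in> A" "1 \<in> A" using a by auto
  then show "A = {0, 1}" using A(1) by auto
qed

lemma dart_map_insert_edge:
  assumes "dart_map D \<epsilon> \<phi>" "d \<notin> D" "x \<notin> D" "d \<noteq> x" "perm_on (insert x (insert d D)) \<phi>1"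
  shows "dart_map (insert x (insert d D)) (\<epsilon>(d := x, x := d)) \<phi>1"
proof -
  have "\<epsilon> z \<noteq> d" "\<epsilon> z \<noteq> x" if "z \<in> D" for z using dart_mapD(1)[OF assms(1) that] assms(2,3) by auto
  then show ?thesis
    unfolding dart_map_def using assms dart_mapD(1-3)[OF assms(1)] by auto
qed

context two_complex
begin

text \<open>A separate base case: the diagram with a single vertex has no darts, so a spike attached
  to it is out of reach of \<open>remove_spike\<close>.\<close>

lemma diagram_single_edge:
  assumes "e \<in> edges Y"
  shows "filled_by Y [e, rv Y e] 0"
proof -
  let ?f = "\<lambda>z::nat. 1 - z"
  let ?l = "\<lambda>z::nat. if z = 0 then e else rv Y e"
  have c: "is_cycle ?f [0, 1]" unfolding is_cycle_def by simp
  have p: "perm_on {0, 1} ?f" by (rule perm_onI) (auto simp: inj_on_def)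
  have c2: "cycle_of (?f \<circ> ?f) z = {z}" if "z \<in> {0, 1}" for z
  proof -
    have "is_cycle (?f \<circ> ?f) [z]" using that unfolding is_cycle_def by auto
    from cycle_of_is_cycle[OF this, of z] show ?thesis by simp
  qed
  have "cycle_of (?f \<circ> ?f) ` {0, 1} = {{0}, {1}}" using c2 by auto
  then have n2: "cycle_count (?f \<circ> ?f) {0, 1} = 2" unfolding cycle_count_def by simp
  have n1: "cycle_count ?f {0, 1} = 1" using cycle_count_is_cycle[OF c] by simp
  have t: "transitive_pair {0, 1} ?f ?f"
    by (rule transitive_pair_two)
  have "diagram Y {0, 1} ?f ?f ?l [0, 1] 0"
    unfolding diagram_def planar_map_iff
  proof (intro conjI ballI allI impI)
    show "dart_map {0, 1} ?f ?f" using p unfolding dart_map_def by auto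
    fix ys :: "nat list" assume "is_cycle ?f ys" "set ys \<subseteq> {0, 1}" "set ys \<inter> set [0, 1] = {}"
    then show "face_label Y (map ?l ys)" unfolding is_cycle_def by (cases ys) auto
  next
    fix z :: nat assume "z \<in> {0, 1}"
    then consider "z = 0" | "z = 1" by auto
    then show "?l z \<in> edges Y" "?l (?f z) = rv Y (?l z)" "src Y (?l (?f z)) = tgt Y (?l z)"
      by (cases; use assms in simp)+
  next
    show "2 * cycle_count (?f \<circ> ?f) {0, 1} + 2 * cycle_count ?f {0, 1} = card {0, 1::nat} + 4"
      unfolding n1 n2 by simp
    show "cycle_count ?f {0, 1} = Suc 0" unfolding n1 by simp
  qed (use c t in simp_all)
  moreover have "map ?l [0, 1] = [e, rv Y e]" by simp
  ultimately show ?thesis by (rule filled_byI)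
qed

text \<open>The base case for chords: one vertex and one loop on the sphere, with
  \<open>[rv Y e]\<close> as the label of its inner face.\<close>

lemma diagram_single_loop:
  assumes "e \<in> edges Y" "src Y e = tgt Y e" "face_label Y [rv Y e]"
  shows "filled_by Y [e] 1"
proof -
  let ?f = "\<lambda>z::nat. 1 - z"
  let ?l = "\<lambda>z::nat. if z = 0 then e else rv Y e"
  have c: "is_cycle ?f [0, 1]" unfolding is_cycle_def by simp
  have p: "perm_on {0, 1} (\<lambda>z::nat. z)" by (rule perm_onI) auto
  have c2: "cycle_of (\<lambda>z::nat. z) z = {z}" for z
  proof -
    have "is_cycle (\<lambda>z::nat. z) [z]" unfolding is_cycle_def by auto
    from cycle_of_is_cycle[OF this, of z] show ?thesis by simp
  qed
  have "cycle_of (\<lambda>z::nat. z) ` {0, 1} = {{0}, {1}}" using c2 by auto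
  then have n2: "cycle_count (\<lambda>z::nat. z) {0, 1} = 2" unfolding cycle_count_def by simp
  have n1: "cycle_count ((\<lambda>z::nat. z) \<circ> ?f) {0, 1} = 1" using cycle_count_is_cycle[OF c] by (simp add: comp_def)
  have t: "transitive_pair {0, 1} ?f (\<lambda>z. z)"
    by (rule transitive_pair_two)
  have dm: "dart_map {0, 1} ?f (\<lambda>z. z)" using p unfolding dart_map_def by auto
  have "diagram Y {0, 1} ?f (\<lambda>z. z) ?l [0] 1"
    unfolding diagram_def planar_map_iff
  proof (intro conjI ballI allI impI)
    show "is_cycle (\<lambda>z. z) [0::nat]" unfolding is_cycle_def by simp
    fix ys :: "nat list" assume ys: "is_cycle (\<lambda>z. z) ys" "set ys \<subseteq> {0, 1}" "set ys \<inter> set [0] = {}"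
    then have "ys \<noteq> []" "distinct ys" "set ys \<subseteq> {1}" unfolding is_cycle_def by auto
    then have "ys = [1]" by (cases ys; cases "tl ys") auto
    then show "face_label Y (map ?l ys)" using assms(3) by simp
  next
    fix z :: nat assume "z \<in> {0, 1}"
    then consider "z = 0" | "z = 1" by auto
    then show "?l z \<in> edges Y" "?l (?f z) = rv Y (?l z)" "src Y (?l z) = tgt Y (?l z)"
      by (cases; use assms in simp)+
  next
    show "2 * cycle_count ((\<lambda>z. z) \<circ> ?f) {0, 1} + 2 * cycle_count (\<lambda>z::nat. z) {0, 1} = card {0, 1::nat} + 4"
      unfolding n1 n2 by simp
    show "cycle_count (\<lambda>z::nat. z) {0, 1} = Suc 1" unfolding n2 by simp
  qed (use t dm in simp_all)
  moreover have "map ?l [0] = [e]" by simp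
  ultimately show ?thesis by (rule filled_byI)
qed

lemma fresh_darts:
  assumes "finite (D :: nat set)"
  obtains d x where "d \<notin> D" "x \<notin> D" "d \<noteq> x"
  using assms ex_new_if_finite[OF infinite_UNIV_nat] by (metis finite_insert insertCI)

text \<open>Planarity of the enlarged map is not computed. The new darts are put on the outer cycle,
  and \<open>remove_spike\<close>, read backwards, reduces the claim to the given diagram.\<close>

lemma filled_by_add_spike:
  assumes "filled_by Y p N" "edge_path Y v p v" "e \<in> edges Y" "src Y e = v"
  shows "filled_by Y (e # rv Y e # p) N"
proof (cases "p = []")
  case True
  then show ?thesis using assms(1) diagram_single_edge[OF assms(3)] by simp
next
  case False
  then obtain D :: "nat set" and \<epsilon> \<phi> l P where dgP: "diagram Y D \<epsilon> \<phi> l P N" and p: "map l P = p"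
    using filled_byE[OF assms(1)] by metis
  note dg = diagramD[OF dgP]
  note M = dart_mapD[OF dg(2)]
  obtain d x where f: "d \<notin> D" "x \<notin> D" "d \<noteq> x" using fresh_darts[OF M(5)] .
  obtain g1 where g1: "perm_on (insert d D) g1" "is_cycle g1 (P @ [d])" "\<And>z. z \<in> D - set P \<Longrightarrow> g1 z = \<phi> z"
    using insert_into_cycle[OF M(4) dg(7,8) f(1)] by metis
  have sub: "set (P @ [d]) \<subseteq> insert d D" "x \<notin> insert d D" using dg(8) f by auto
  obtain \<phi>1 where g2: "perm_on (insert x (insert d D)) \<phi>1" "is_cycle \<phi>1 ((P @ [d]) @ [x])"
    "\<And>z. z \<in> insert d D - set (P @ [d]) \<Longrightarrow> \<phi>1 z = g1 z"
    using insert_into_cycle[OF g1(1,2) sub] by metis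
  have out: "\<phi>1 z = \<phi> z" if "z \<in> D - set P" for z using g2(3)[of z] g1(3)[of z] that f by auto
  let ?D1 = "insert x (insert d D)" and ?e1 = "\<epsilon>(d := x, x := d)" and ?l1 = "l(d := e, x := rv Y e)"
  have cyc: "is_cycle \<phi>1 (d # x # P)" using is_cycle_append_commute[of \<phi>1 P "[d, x]"] g2(2) by simp
  have m1: "dart_map ?D1 ?e1 \<phi>1" by (rule dart_map_insert_edge[OF dg(2) f g2(1)])
  have D: "?D1 - {d, x} = D" using f by auto
  have c: "\<phi>1 d = x" "\<phi>1 x = hd P" using cyc dg(11) unfolding is_cycle_def by (auto simp: successively_Cons)
  have hP: "hd P \<in> D" using dg(8,11) hd_in_set by blast
  then have xx: "\<phi>1 x \<noteq> d" "\<phi>1 x \<noteq> x" using c f by auto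
  let ?\<phi>' = "skip x (skip d \<phi>1)"
  note r = remove_spike[OF m1, of d x, unfolded D]
  have P': "is_cycle ?\<phi>' P" using is_cycle_skip[OF is_cycle_skip[OF cyc]] dg(11) by simp
  have sp: "?\<phi>' w = (if \<phi>1 w = d then \<phi>1 x else \<phi>1 w)" if "w \<in> D" for w
    by (rule skip_pair[OF perm_onD(2)[OF g2(1)]]) (use c xx f that in auto)
  \<comment> \<open>On \<open>set P\<close> both maps follow the cycle \<open>P\<close>, and
    elsewhere nothing was changed, so removing the spike gives back the old map.\<close>
  have eq: "?\<phi>' w = \<phi> w" if w: "w \<in> D" for w
  proof (cases "w \<in> set P")
    case True
    then show ?thesis using is_cycle_unique[OF P' dg(7)] by simp
  next
    case False
    then have "\<phi>1 w = \<phi> w" using out w by simp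
    then show ?thesis using sp[OF w] M(6)[OF w] f by auto
  qed
  have "planar_map D ?e1 ?\<phi>'"
    by (rule planar_map_cong[OF _ _ dg(1)]) (use eq f in auto)
  then have pm: "planar_map ?D1 ?e1 \<phi>1" using r(4) c xx f by simp
  have "cycle_count ?\<phi>' D = cycle_count \<phi> D"
    by (rule cycle_count_cong) (use eq M(6) in auto)
  then have cc: "cycle_count \<phi>1 ?D1 = Suc N" using r(3) c xx f dg(10) by simp
  have sP: "src Y (l (hd P)) = v"
    using edge_path_source_unique[OF cycle_edge_path[OF dgP dg(7,8)], of v v] assms(2) p False by simp
  have "diagram Y ?D1 ?e1 \<phi>1 ?l1 (d # x # P) N"
    unfolding diagram_def
  proof (intro conjI ballI allI impI)
    fix z assume z: "z \<in> ?D1"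
    have eD: "\<epsilon> z \<in> D" if "z \<in> D" using M(1) that .
    show "?l1 z \<in> edges Y" using z dg(4) assms(3) by auto
    show "?l1 (?e1 z) = rv Y (?l1 z)" using z dg(5)[of z] eD assms(3) f by auto
    show "src Y (?l1 (\<phi>1 z)) = tgt Y (?l1 z)"
    proof (cases "z \<in> D")
      case True
      then have t: "src Y (l (\<phi> z)) = tgt Y (l z)" using dg(6) by simp
      have lz: "?l1 z = l z" using True f by auto
      show ?thesis
      proof (cases "\<phi>1 z = d")
        case True
        then have "\<phi> z = hd P" using sp[OF \<open>z \<in> D\<close>] eq[OF \<open>z \<in> D\<close>] c by simp
        then show ?thesis using True t sP assms(4) lz f by simp
      next
        case False
        then have "\<phi>1 z = \<phi> z" using sp[OF \<open>z \<in> D\<close>] eq[OF \<open>z \<in> D\<close>] by simp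
        moreover have "?l1 (\<phi> z) = l (\<phi> z)" using M(6)[OF \<open>z \<in> D\<close>] f by auto
        ultimately show ?thesis using t lz by simp
      qed
    next
      case False
      then consider "z = d" | "z = x" using z by auto
      then show ?thesis
      proof cases
        case 1
        then show ?thesis using c(1) f(3) by simp
      next
        case 2
        have "?l1 (hd P) = l (hd P)" using hP f by auto
        then have "src Y (?l1 (\<phi>1 z)) = src Y e" using sP assms(4) c(2) 2 by metis
        then show ?thesis using 2 assms(3) f(3) by simp
      qed
    qed
  next
    fix ys assume ys: "is_cycle \<phi>1 ys" "set ys \<subseteq> ?D1" "set ys \<inter> set (d # x # P) = {}"
    have "is_cycle \<phi> ys" by (rule is_cycle_cong[OF _ ys(1)]) (use out ys in auto)
    then have "face_label Y (map l ys)" by (rule dg(9)) (use ys in auto)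
    moreover have "map ?l1 ys = map l ys" using ys by (intro map_cong) auto
    ultimately show "face_label Y (map ?l1 ys)" by (simp only:)
  qed (use pm cyc dg(8) cc in auto)
  moreover have "map ?l1 (d # x # P) = e # rv Y e # p" using p f dg(8) by (auto intro!: map_cong)
  ultimately show ?thesis by (rule filled_byI)
qed

text \<open>The reverse of \<open>diagram_remove_chord\<close>: \<open>e\<close> is drawn outside
  the diagram between the ends of the boundary piece \<open>q\<close>, and the region enclosed by
  the two becomes a new face.\<close>

lemma filled_by_add_chord:
  assumes "filled_by Y (q @ p) N" "e \<in> edges Y" "edge_path Y (src Y e) q (tgt Y e)"
    "edge_path Y (tgt Y e) p (src Y e)" "face_label Y (rv Y e # q)"
  shows "filled_by Y (e # p) (Suc N)"
proof (cases "q @ p = []")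
  case True
  then have "N = 0" using assms(1) by simp
  then show ?thesis using True diagram_single_loop[OF assms(2)] assms(3,5) by simp
next
  case False
  then obtain D :: "nat set" and \<epsilon> \<phi> l R where dgR: "diagram Y D \<epsilon> \<phi> l R N" and R: "map l R = q @ p"
    using filled_byE[OF assms(1)] by metis
  then obtain Q P where QP: "R = Q @ P" "map l Q = q" "map l P = p" by (metis map_eq_append_conv)
  note dg = diagramD[OF dgR[unfolded QP(1)]]
  note M = dart_mapD[OF dg(2)]
  obtain d x where f: "d \<notin> D" "x \<notin> D" "d \<noteq> x" using fresh_darts[OF M(5)] .
  obtain g1 where g1: "perm_on (insert d D) g1" "is_cycle g1 ((Q @ P) @ [d])"
    "\<And>z. z \<in> D - set (Q @ P) \<Longrightarrow> g1 z = \<phi> z"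
    using insert_into_cycle[OF M(4) dg(7,8) f(1)] by metis
  have g1': "is_cycle g1 (P @ [d] @ Q)" using is_cycle_append_commute[of g1 Q "P @ [d]"] g1(2) by simp
  have sub: "set (P @ [d] @ Q) \<subseteq> insert d D" "x \<notin> insert d D" using dg(8) f by auto
  obtain \<tau> where g2: "perm_on (insert x (insert d D)) \<tau>" "is_cycle \<tau> ((P @ [d] @ Q) @ [x])"
    "\<And>z. z \<in> insert d D - set (P @ [d] @ Q) \<Longrightarrow> \<tau> z = g1 z"
    using insert_into_cycle[OF g1(1) g1' sub] by metis
  have tcyc: "is_cycle \<tau> (d # Q @ x # P)"
    using is_cycle_append_commute[of \<tau> P "d # Q @ [x]"] g2(2) by simp
  \<comment> \<open>\<open>\<tau>\<close> has both new darts on the cycle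
    \<open>d # Q @ x # P\<close>. Exchanging their values splits it into the outer face
    \<open>d # P\<close> and the new inner face \<open>x # Q\<close>; exchanging once more gives
    back \<open>\<tau>\<close>, the merged map that appears in \<open>remove_chord\<close>.\<close>
  define \<phi>1 where "\<phi>1 = \<tau>(d := \<tau> x, x := \<tau> d)"
  let ?D1 = "insert x (insert d D)" and ?e1 = "\<epsilon>(d := x, x := d)" and ?l1 = "l(d := e, x := rv Y e)"
  have cyc: "is_cycle \<phi>1 (d # P)" "is_cycle \<phi>1 (x # Q)"
    using is_cycle_split[OF tcyc] unfolding \<phi>1_def by auto
  have p1: "perm_on ?D1 \<phi>1" unfolding \<phi>1_def by (rule perm_on_swap[OF g2(1)]) auto
  have out: "\<phi>1 z = \<phi> z" if "z \<in> D - set (Q @ P)" for z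
    using g2(3)[of z] g1(3)[of z] that f unfolding \<phi>1_def by auto
  have tz: "\<phi>1 z = \<tau> z" if "z \<in> D" for z using that f unfolding \<phi>1_def by auto
  have m1: "dart_map ?D1 ?e1 \<phi>1" by (rule dart_map_insert_edge[OF dg(2) f p1])
  have D: "?D1 - {d, x} = D" using f by auto
  have tau: "\<phi>1(d := \<phi>1 x, x := \<phi>1 d) = \<tau>" using f unfolding \<phi>1_def by auto
  let ?\<phi>' = "skip x (skip d \<tau>)"
  have xn: "x \<notin> cycle_of \<phi>1 d" using cycle_of_is_cycle[OF cyc(1), of d] f dg(8) by auto
  have h1: "\<phi>1 d = hd (P @ [d])" "\<phi>1 x = hd (Q @ [x])"
    using cyc unfolding is_cycle_def by (cases P; cases Q; simp add: successively_Cons)+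
  have nf: "\<not> (\<phi>1 d = d \<and> \<phi>1 x = x)"
    using h1 dg(8) f dg(11) by (cases P; cases Q) auto
  have e1: "?e1 d = x" using f by simp
  have dD1: "d \<in> ?D1" by simp
  note r = remove_chord[OF m1 dD1 e1 xn nf, unfolded D tau]
  have "is_cycle (skip d \<tau>) (Q @ x # P)" using tcyc by (rule is_cycle_skip) simp
  then have "is_cycle (skip d \<tau>) (x # P @ Q)" using is_cycle_append_commute[of _ Q "x # P"] by simp
  then have "is_cycle ?\<phi>' (P @ Q)" by (rule is_cycle_skip) (use dg(11) in auto)
  then have QP': "is_cycle ?\<phi>' (Q @ P)" by (rule is_cycle_append_commute)
  have eq: "?\<phi>' w = \<phi> w" if w: "w \<in> D" for w
  proof (cases "w \<in> set (Q @ P)")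
    case True
    then show ?thesis using is_cycle_unique[OF QP' dg(7)] by simp
  next
    case False
    then have "\<tau> w = \<phi> w" using out[of w] tz[OF w] w by simp
    then show ?thesis using M(6)[OF w] f by (auto simp: skip_def)
  qed
  have "planar_map D ?e1 ?\<phi>'"
    by (rule planar_map_cong[OF _ _ dg(1)]) (use eq f in auto)
  then have pm: "planar_map ?D1 ?e1 \<phi>1" using r(4) by (rule iffD2[rotated])
  have "cycle_count ?\<phi>' D = cycle_count \<phi> D"
    by (rule cycle_count_cong) (use eq M(6) in auto)
  then have cc: "cycle_count \<phi>1 ?D1 = Suc (Suc N)" using r(3) dg(10) by simp
  have l1: "?l1 z = l z" if "z \<in> D" for z using that f by auto
  have sQ: "src Y (?l1 (hd (Q @ [x]))) = src Y e"
  proof (cases Q)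
    case Nil
    then show ?thesis using assms(3) QP(2) by auto
  next
    case (Cons a Q')
    then show ?thesis using assms(3) QP(2) l1[of a] dg(8) by auto
  qed
  have sP: "src Y (?l1 (hd (P @ [d]))) = tgt Y e"
  proof (cases P)
    case Nil
    then show ?thesis using assms(4) QP(3) f by auto
  next
    case (Cons a P')
    then show ?thesis using assms(4) QP(3) l1[of a] dg(8) by auto
  qed
  have s1: "src Y (?l1 (\<tau> d)) = src Y (?l1 d)" using sQ h1(2) f tau unfolding \<phi>1_def by auto
  have s2: "src Y (?l1 (\<tau> x)) = src Y (?l1 x)" using sP h1(1) f tau unfolding \<phi>1_def by auto
  have sk: "src Y (?l1 (skip d \<tau> z)) = src Y (?l1 (\<tau> z))" for z
    by (rule skip_invariant[of "\<lambda>z. src Y (?l1 z)"]) (rule s1)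
  have sk': "src Y (?l1 (?\<phi>' z)) = src Y (?l1 (\<tau> z))" for z
  proof -
    have "src Y (?l1 (?\<phi>' z)) = src Y (?l1 (skip d \<tau> z))"
      by (rule skip_invariant[of "\<lambda>z. src Y (?l1 z)"]) (use sk s2 in metis)
    then show ?thesis using sk by metis
  qed
  have "diagram Y ?D1 ?e1 \<phi>1 ?l1 (d # P) (Suc N)"
    unfolding diagram_def
  proof (intro conjI ballI allI impI)
    fix z assume z: "z \<in> ?D1"
    have eD: "\<epsilon> z \<in> D" if "z \<in> D" using M(1) that .
    show "?l1 z \<in> edges Y" using z dg(4) assms(2) by auto
    show "?l1 (?e1 z) = rv Y (?l1 z)" using z dg(5)[of z] eD assms(2) f by auto
    show "src Y (?l1 (\<phi>1 z)) = tgt Y (?l1 z)"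
    proof (cases "z \<in> D")
      case True
      have "src Y (?l1 (\<phi>1 z)) = src Y (?l1 (?\<phi>' z))" using sk' tz[OF True] by metis
      also have "?\<phi>' z = \<phi> z" by (rule eq[OF True])
      also have "?l1 (\<phi> z) = l (\<phi> z)" by (rule l1[OF M(6)[OF True]])
      finally have "src Y (?l1 (\<phi>1 z)) = src Y (l (\<phi> z))" .
      then show ?thesis using dg(6)[OF True] l1[OF True] by metis
    next
      case False
      then consider "z = d" | "z = x" using z by auto
      then show ?thesis
      proof cases
        case 1
        then show ?thesis using sP h1(1) f(3) by simp
      next
        case 2
        have "src Y (?l1 (\<phi>1 z)) = src Y e" using sQ h1(2) 2 by metis
        then show ?thesis using 2 assms(2) f(3) by simp
      qed
    qed
  next
    fix ys assume ys: "is_cycle \<phi>1 ys" "set ys \<subseteq> ?D1" "set ys \<inter> set (d # P) = {}"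
    show "face_label Y (map ?l1 ys)"
    proof (cases "set ys \<inter> set (x # Q) = {}")
      case True
      have "is_cycle \<phi> ys" by (rule is_cycle_cong[OF _ ys(1)]) (use out ys True in auto)
      then have "face_label Y (map l ys)" by (rule dg(9)) (use ys True in auto)
      moreover have "map ?l1 ys = map l ys" using ys True by (intro map_cong) auto
      ultimately show ?thesis by (simp only:)
    next
      case False
      then obtain k where "ys = rotate k (x # Q)" using is_cycle_meet[OF cyc(2) ys(1)] by blast
      moreover have "map ?l1 (x # Q) = rv Y e # q" using QP(2) f dg(8) by (auto intro!: map_cong)
      ultimately have "map ?l1 ys = rotate k (rv Y e # q)" by (metis rotate_map)
      then show ?thesis using face_label_rotate[OF assms(5)] by simp
    qed
  qed (use pm cyc dg(8) cc in auto)
  moreover have "map ?l1 (d # P) = e # p" using QP(3) f dg(8) by (auto intro!: map_cong)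
  ultimately show ?thesis by (rule filled_byI)
qed

end

section \<open>Folding the boundary, and diagrams from homotopies\<close>

context two_complex
begin

text \<open>Gluing the darts \<open>a\<close> and \<open>b\<close>, which are adjacent on the outer face. If \<open>a\<close> and \<open>b\<close> form a closed
  curve, the map falls apart into two planar maps by the Euler inequality, and the one that
  contains the rest of the outer face is kept.\<close>

lemma diagram_fold:
  assumes "diagram Y D \<epsilon> \<phi> l (a # b # P) N" "l b = rv Y (l a)" "P \<noteq> []"
  shows "\<exists>D' \<epsilon>' \<phi>' M. M \<le> N \<and> diagram Y D' \<epsilon>' \<phi>' l P M"
proof (cases "\<epsilon> a = b")
  case True
  then show ?thesis using diagram_remove_spike[OF assms(1) True assms(3)] by blast
next
  case False
  note dg = diagramD[OF assms(1)]
  note M = dart_mapD[OF dg(2)]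
  note inj = inj_onD[OF perm_onD(2)[OF M(4)]]
  define x y h where "x = \<epsilon> a" and "y = \<epsilon> b" and "h = hd P"
  have ab: "a \<in> D" "b \<in> D" "a \<noteq> b" "a \<notin> set P" "b \<notin> set P" "h \<in> set P"
    using dg(8,12) assms(3) unfolding h_def by auto
  have c: "\<phi> a = b" "\<phi> b = h" "\<phi> (last P) = a"
    using dg(7) assms(3) unfolding is_cycle_def h_def by (auto simp: successively_Cons)
  have hne: "h \<noteq> a" "h \<noteq> b" using ab by auto
  have xy: "x \<in> D" "y \<in> D" "\<epsilon> x = a" "\<epsilon> y = b" using M(1,3) ab unfolding x_def y_def by auto
  have ne: "x \<noteq> a" "x \<noteq> b" "y \<noteq> a" "y \<noteq> b" "x \<noteq> y"
    using False M(2,3) ab xy unfolding x_def y_def by metis+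
  define D' where "D' = D - {a, b}"
  define \<epsilon>' where "\<epsilon>' = \<epsilon>(x := y, y := x)"
  define \<phi>' where "\<phi>' = skip b (skip a \<phi>)"
  have phi': "\<phi>' w = (if \<phi> w = a then h else \<phi> w)" if "w \<in> D'" for w
    unfolding \<phi>'_def c(2)[symmetric]
    by (rule skip_pair[OF perm_onD(2)[OF M(4)] ab(1,2)]) (use c ab hne that in \<open>auto simp: D'_def\<close>)
  have eps: "\<epsilon>' x = y" "\<epsilon>' y = x" "\<And>z. z \<noteq> x \<Longrightarrow> z \<noteq> y \<Longrightarrow> \<epsilon>' z = \<epsilon> z"
    using ne unfolding \<epsilon>'_def by auto
  have eD: "\<epsilon> z \<in> D' \<and> \<epsilon> z \<noteq> x \<and> \<epsilon> z \<noteq> y" if "z \<in> D'" "z \<noteq> x" "z \<noteq> y" for z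
  proof -
    have z: "z \<in> D" "z \<noteq> a" "z \<noteq> b" using that unfolding D'_def by auto
    then have "\<epsilon> z \<noteq> a" "\<epsilon> z \<noteq> b" "\<epsilon> z \<noteq> x" "\<epsilon> z \<noteq> y"
      using M(3)[OF z(1)] xy that unfolding x_def y_def by metis+
    then show ?thesis using M(1)[OF z(1)] unfolding D'_def by auto
  qed
  have xyD: "x \<in> D'" "y \<in> D'" using xy ne unfolding D'_def by auto
  have D'': "D' = D - {a} - {b}" "D' = D - {b} - {a}" unfolding D'_def by auto
  have pa: "perm_on (D - {a}) (skip a \<phi>)" by (rule perm_on_skip[OF M(4) ab(1)])
  have p': "perm_on D' \<phi>'" unfolding D''(1) \<phi>'_def by (rule perm_on_skip[OF pa]) (use ab in auto)
  have m': "dart_map D' \<epsilon>' \<phi>'"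
    unfolding dart_map_def
  proof (intro conjI ballI p')
    fix z assume z: "z \<in> D'"
    then have zD: "z \<in> D" unfolding D'_def by auto
    consider "z = x" | "z = y" | "z \<noteq> x" "z \<noteq> y" by auto
    then show "\<epsilon>' z \<in> D'" "\<epsilon>' z \<noteq> z" "\<epsilon>' (\<epsilon>' z) = z"
      by (cases; use eps xyD ne eD[OF z] M(2,3)[OF zD] in simp)+
  qed
  note M' = dart_mapD[OF m']
  have P': "is_cycle \<phi>' P" unfolding \<phi>'_def using is_cycle_skip[OF is_cycle_skip[OF dg(7)]] assms(3) by simp
  have PD': "set P \<subseteq> D'" using dg(8) ab unfolding D'_def by auto
  have sb: "skip a \<phi> b = h" using c hne unfolding skip_def by auto
  have F: "cycle_count \<phi>' D' = cycle_count \<phi> D"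
  proof -
    have "cycle_count \<phi>' D' = cycle_count (skip a \<phi>) (D - {a})"
      unfolding D''(1) \<phi>'_def by (rule cycle_count_skip[OF pa]) (use ab sb hne in auto)
    also have "\<dots> = cycle_count \<phi> D" by (rule cycle_count_skip[OF M(4) ab(1)]) (use c ab in simp)
    finally show ?thesis .
  qed
  have cD: "card D = card D' + 2"
    using M(5) ab card_Diff_subset[of "{a,b}" D] card_mono[of D "{a,b}"] unfolding D'_def by auto
  \<comment> \<open>The vertex permutation of the glued map arises from
    \<open>\<phi> \<circ> \<epsilon>\<close> by dropping \<open>b\<close>, exchanging the values at
    \<open>a\<close> and \<open>y\<close>, and dropping \<open>a\<close>. Dropping keeps the number
    of cycles here, so the number of vertices changes only through the exchange, by one.\<close>
  define \<rho>2 where "\<rho>2 = skip b (\<phi> \<circ> \<epsilon>)"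
  define \<tau> where "\<tau> = \<rho>2(a := \<rho>2 y, y := \<rho>2 a)"
  have pr2: "perm_on (D - {b}) \<rho>2" unfolding \<rho>2_def by (rule perm_on_skip[OF M(8) ab(2)])
  have aD: "a \<in> D - {b}" and yD: "y \<in> D - {b}" using ab xy ne by auto
  have pt: "perm_on (D - {b}) \<tau>" unfolding \<tau>_def by (rule perm_on_swap[OF pr2 aD yD])
  have r2: "\<rho>2 x = \<phi> y" "\<rho>2 y = h" "\<rho>2 a = \<phi> x"
    "\<And>z. z \<in> D' \<Longrightarrow> z \<noteq> x \<Longrightarrow> \<rho>2 z = \<phi> (\<epsilon> z)"
  proof -
    show "\<rho>2 x = \<phi> y" "\<rho>2 y = h" using xy c hne y_def unfolding \<rho>2_def skip_def by auto
    have "\<phi> x \<noteq> b" using inj[of x a] xy ab ne c by metis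
    then show "\<rho>2 a = \<phi> x" using x_def unfolding \<rho>2_def skip_def by auto
    fix z assume z: "z \<in> D'" "z \<noteq> x"
    then have zD: "z \<in> D" "z \<noteq> a" "z \<noteq> b" unfolding D'_def by auto
    then have "\<epsilon> z \<noteq> a" using M(3)[of z] z(2) unfolding x_def by metis
    then have "\<phi> (\<epsilon> z) \<noteq> b" using inj[of "\<epsilon> z" a] M(1)[of z] zD ab c by metis
    then show "\<rho>2 z = \<phi> (\<epsilon> z)" unfolding \<rho>2_def skip_def by simp
  qed
  have ta: "\<tau> a = h" using r2(2) ne unfolding \<tau>_def by simp
  have rho: "(\<phi>' \<circ> \<epsilon>') z = skip a \<tau> z" if z: "z \<in> D'" for z
  proof -
    have zn: "z \<noteq> a" using z unfolding D'_def by auto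
    consider "z = x" | "z = y" | "z \<noteq> x" "z \<noteq> y" by auto
    then show ?thesis
    proof cases
      case 1
      then have "\<tau> z = \<phi> y" using r2(1) ne unfolding \<tau>_def by simp
      then show ?thesis using 1 eps(1) phi'[OF xyD(2)] ta unfolding skip_def by simp
    next
      case 2
      then have "\<tau> z = \<phi> x" using r2(3) ne unfolding \<tau>_def by simp
      then show ?thesis using 2 eps(2) phi'[OF xyD(1)] ta unfolding skip_def by simp
    next
      case 3
      then have "\<tau> z = \<phi> (\<epsilon> z)" using r2(4)[OF z] zn unfolding \<tau>_def by simp
      moreover have "\<epsilon> z \<in> D'" using eD[OF z] 3 by simp
      ultimately show ?thesis using 3 eps(3)[of z] phi'[of "\<epsilon> z"] ta unfolding skip_def by simp
    qed
  qed
  have "cycle_count (\<phi>' \<circ> \<epsilon>') D' = cycle_count (skip a \<tau>) D'"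
    by (rule cycle_count_cong) (use rho perm_onD(3)[OF M'(8)] in auto)
  also have "\<dots> = cycle_count \<tau> (D - {b})"
    unfolding D''(2) by (rule cycle_count_skip[OF pt aD]) (use ta hne in simp)
  finally have Vt: "cycle_count (\<phi>' \<circ> \<epsilon>') D' = cycle_count \<tau> (D - {b})" .
  have "\<phi> y \<noteq> b" using inj[of y a] xy ab ne c by metis
  then have V2: "cycle_count \<rho>2 (D - {b}) = cycle_count (\<phi> \<circ> \<epsilon>) D"
    unfolding \<rho>2_def by (intro cycle_count_skip[OF M(8) ab(2)]) (use y_def in auto)
  note sw = cycle_count_swap[OF pr2 aD yD ne(3)[symmetric], folded \<tau>_def]
  have VF: "2 * cycle_count (\<phi> \<circ> \<epsilon>) D + 2 * cycle_count \<phi> D = card D + 4"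
    using dg(1) unfolding planar_map_iff by simp
  \<comment> \<open>Any planar part of the glued map that contains the rest of the outer face serves
    as the new diagram, because its other faces are faces of the old one.\<close>
  have result: "\<exists>D' \<epsilon>' \<phi>' M. M \<le> N \<and> diagram Y D' \<epsilon>' \<phi>' l P M"
    if K: "planar_map K \<epsilon>' \<phi>'" "K \<subseteq> D'" "set P \<subseteq> K" for K
  proof -
    have mK: "dart_map K \<epsilon>' \<phi>'" using K(1) unfolding planar_map_iff by simp
    define N' where "N' = cycle_count \<phi>' K - 1"
    have "K \<noteq> {}" using K(1) unfolding planar_map_iff by simp
    then have "cycle_count \<phi>' K > 0"
      using dart_mapD(5)[OF mK] unfolding cycle_count_def by (simp add: card_gt_0_iff)
    then have N': "cycle_count \<phi>' K = Suc N'" unfolding N'_def by simp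
    have "cycle_count \<phi>' K \<le> cycle_count \<phi>' D'"
      unfolding cycle_count_def using K(2) M'(5) by (intro card_mono image_mono) auto
    then have "N' \<le> N" using F N' dg(10) by simp
    moreover have "diagram Y K \<epsilon>' \<phi>' l P N'"
      unfolding diagram_def
    proof (intro conjI ballI allI impI)
      fix w assume "w \<in> K"
      then have w: "w \<in> D'" "w \<in> D" using K(2) unfolding D'_def by auto
      show "l w \<in> edges Y" using dg(4) w by simp
      have lx: "l x = rv Y (l a)" "l y = rv Y (l b)" using dg(5) ab unfolding x_def y_def by auto
      have la: "l a \<in> edges Y" using dg(4) ab by simp
      consider "w = x" | "w = y" | "w \<noteq> x" "w \<noteq> y" by auto
      then show "l (\<epsilon>' w) = rv Y (l w)"
      proof cases
        case 1
        then show ?thesis unfolding 1 eps(1) lx assms(2) using la by simp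
      next
        case 2
        then show ?thesis unfolding 2 eps(2) lx assms(2) using la by simp
      next
        case 3
        then show ?thesis using eps(3) dg(5) w by simp
      qed
      have "src Y (l h) = tgt Y (l b)" using dg(6)[OF ab(2)] c by simp
      also have "\<dots> = src Y (l a)" unfolding assms(2) using la by simp
      finally show "src Y (l (\<phi>' w)) = tgt Y (l w)" using phi'[OF w(1)] dg(6)[OF w(2)] by auto
    next
      fix ys assume ys: "is_cycle \<phi>' ys" "set ys \<subseteq> K" "set ys \<inter> set P = {}"
      have "\<phi>' w = \<phi> w" if w: "w \<in> set ys" for w
      proof -
        have "\<phi>' w \<in> set ys" using is_cycle_closed[OF ys(1)] w by auto
        then have "\<phi>' w \<noteq> h" using ys(3) ab by auto
        moreover have "w \<in> D'" using ys(2) K(2) w by auto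
        ultimately show ?thesis using phi'[of w] by (auto split: if_splits)
      qed
      then have "is_cycle \<phi> ys" using is_cycle_cong[OF _ ys(1)] by blast
      then show "face_label Y (map l ys)"
        by (rule dg(9)) (use ys K(2) in \<open>auto simp: D'_def\<close>)
    qed (use K P' N' in auto)
    ultimately show ?thesis by blast
  qed
  show ?thesis
  proof (cases "transitive_pair D' \<epsilon>' \<phi>'")
    case True
    have "D' \<noteq> {}" using xyD by auto
    from dart_map_euler_le[OF m' this True]
    have le: "2 * cycle_count (\<phi>' \<circ> \<epsilon>') D' + 2 * cycle_count \<phi>' D' \<le> 4 + card D'" .
    \<comment> \<open>At most one vertex is lost. This gives one inequality of Euler's formula for
      the glued map; the other is \<open>dart_map_euler_le\<close>.\<close>
    have "cycle_count (\<phi> \<circ> \<epsilon>) D \<le> Suc (cycle_count (\<phi>' \<circ> \<epsilon>') D')"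
      using sw Vt V2 by (cases "y \<in> cycle_of \<rho>2 a") auto
    then have "2 * cycle_count (\<phi>' \<circ> \<epsilon>') D' + 2 * cycle_count \<phi>' D' = card D' + 4"
      using le VF F cD by linarith
    then have "planar_map D' \<epsilon>' \<phi>'" using m' True \<open>D' \<noteq> {}\<close> unfolding planar_map_iff by simp
    then show ?thesis by (rule result) (use PD' in auto)
  next
    case False
    obtain A where A: "A \<subseteq> D'" "A \<noteq> {}" "\<epsilon>' ` A \<subseteq> A" "\<phi>' ` A \<subseteq> A" "A \<noteq> D'"
      using False unfolding transitive_pair_def by blast
    have A': "\<epsilon>' ` (D' - A) \<subseteq> D' - A" "\<phi>' ` (D' - A) \<subseteq> D' - A"
      using perm_on_Diff[OF M'(7) A(1,3)] perm_on_Diff[OF M'(4) A(1,4)] by auto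
    have hD: "h \<in> D'" using PD' ab by auto
    have "\<exists>K. K \<subseteq> D' \<and> h \<in> K \<and> K \<noteq> D' \<and> \<epsilon>' ` K \<subseteq> K \<and> \<phi>' ` K \<subseteq> K"
    proof (cases "h \<in> A")
      case True
      then show ?thesis using A by blast
    next
      case False
      then show ?thesis using A A' hD by (intro exI[of _ "D' - A"]) auto
    qed
    then obtain K where K: "K \<subseteq> D'" "h \<in> K" "K \<noteq> D'" "\<epsilon>' ` K \<subseteq> K" "\<phi>' ` K \<subseteq> K" by blast
    define L where "L = D' - K"
    have L: "L \<subseteq> D'" "\<epsilon>' ` L \<subseteq> L" "\<phi>' ` L \<subseteq> L" "L \<noteq> {}" "K \<inter> L = {}" "K \<union> L = D'" "h \<notin> L"
      using perm_on_Diff[OF M'(7) K(1,4)] perm_on_Diff[OF M'(4) K(1,5)] K unfolding L_def by auto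
    have meetP: "set P \<subseteq> C" if "\<phi>' ` C \<subseteq> C" "h \<in> C" for C
      using cycle_of_subset[OF that] cycle_of_is_cycle[OF P'] ab by blast
    have PK: "set P \<subseteq> K" by (rule meetP[OF K(5,2)])
    \<comment> \<open>a closed set of the glued map that contains the rest of the outer face and the glued edge, or
      neither of them, comes from a closed set of the original map\<close>
    have whole: "C = D'" if C: "C \<subseteq> D'" "\<epsilon>' ` C \<subseteq> C" "\<phi>' ` C \<subseteq> C" "h \<in> C" "x \<in> C" for C
    proof -
      have "y \<in> C" using C(2,5) eps(1) by (metis image_subset_iff)
      have "C \<union> {a, b} = D"
      proof (rule transitive_pairD[OF dg(3)])
        show "\<epsilon> ` (C \<union> {a, b}) \<subseteq> C \<union> {a, b}"
        proof
          fix z assume "z \<in> \<epsilon> ` (C \<union> {a, b})"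
          then obtain w where w: "w \<in> C \<union> {a, b}" "z = \<epsilon> w" by auto
          consider "w = a" | "w = b" | "w = x" | "w = y" | "w \<in> C" "w \<noteq> x" "w \<noteq> y" using w by auto
          then show "z \<in> C \<union> {a, b}"
          proof cases
            case 5
            then have "\<epsilon>' w \<in> C" using C(2) by auto
            then show ?thesis using eps(3)[OF 5(2,3)] w by simp
          qed (use w xy C(5) \<open>y \<in> C\<close> in \<open>auto simp: x_def[symmetric] y_def[symmetric]\<close>)
        qed
        show "\<phi> ` (C \<union> {a, b}) \<subseteq> C \<union> {a, b}"
        proof
          fix z assume "z \<in> \<phi> ` (C \<union> {a, b})"
          then obtain w where w: "w \<in> C \<union> {a, b}" "z = \<phi> w" by auto
          show "z \<in> C \<union> {a, b}"
          proof (cases "w \<in> C")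
            case True
            then have "\<phi>' w \<in> C" using C(3) by auto
            then show ?thesis using phi'[of w] C(1) True w by (auto split: if_splits)
          next
            case False
            then show ?thesis using w c C(4) by auto
          qed
        qed
      qed (use C ab in \<open>auto simp: D'_def\<close>)
      then show ?thesis using C(1) unfolding D'_def by auto
    qed
    have none: "C = {}" if C: "C \<subseteq> D'" "\<epsilon>' ` C \<subseteq> C" "\<phi>' ` C \<subseteq> C" "h \<notin> C" "x \<notin> C" for C
    proof (rule ccontr)
      assume "C \<noteq> {}"
      have "y \<notin> C" using C(2,5) eps(2) by (metis image_subset_iff)
      have "C = D"
      proof (rule transitive_pairD[OF dg(3) _ \<open>C \<noteq> {}\<close>])
        show "C \<subseteq> D" using C(1) unfolding D'_def by auto
        show "\<epsilon> ` C \<subseteq> C"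
        proof
          fix z assume "z \<in> \<epsilon> ` C"
          then obtain w where w: "w \<in> C" "z = \<epsilon> w" by auto
          then have "\<epsilon>' w = z" using eps(3)[of w] C(5) \<open>y \<notin> C\<close> by auto
          then show "z \<in> C" using C(2) w(1) by auto
        qed
        show "\<phi> ` C \<subseteq> C"
        proof
          fix z assume "z \<in> \<phi> ` C"
          then obtain w where w: "w \<in> C" "z = \<phi> w" by auto
          then have "\<phi>' w \<in> C" "w \<in> D'" using C(1,3) by auto
          moreover from this have "\<phi>' w \<noteq> h" using C(4) by auto
          ultimately show "z \<in> C" using phi'[of w] w(2) by (auto split: if_splits)
        qed
      qed
      then show False using C(1) ab unfolding D'_def by auto
    qed
    have xL: "x \<in> L" "x \<notin> K" using whole[OF K(1,4,5,2)] K(3) xyD(1) unfolding L_def by auto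
    have yL: "y \<in> L" "y \<notin> K" using L(2) xL eps(1) L(5) by (metis image_subset_iff, metis disjoint_iff image_subset_iff)
    have tK: "transitive_pair K \<epsilon>' \<phi>'"
      unfolding transitive_pair_def
    proof (intro allI impI)
      fix C assume C: "C \<subseteq> K" "C \<noteq> {}" "\<epsilon>' ` C \<subseteq> C" "\<phi>' ` C \<subseteq> C"
      show "C = K"
      proof (cases "h \<in> C")
        case True
        have "\<epsilon>' ` (C \<union> L) \<subseteq> C \<union> L" "\<phi>' ` (C \<union> L) \<subseteq> C \<union> L" using C(3,4) L(2,3) by blast+
        then have "C \<union> L = D'" using whole[of "C \<union> L"] C(1) K(1) L(1) True xL(1) by blast
        then show ?thesis using C(1) L(5) K(1) by blast
      next
        case False
        then have "C = {}" using none[of C] C K(1) xL(2) by blast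
        then show ?thesis using C(2) by simp
      qed
    qed
    have tL: "transitive_pair L \<epsilon>' \<phi>'"
      unfolding transitive_pair_def
    proof (intro allI impI)
      fix C assume C: "C \<subseteq> L" "C \<noteq> {}" "\<epsilon>' ` C \<subseteq> C" "\<phi>' ` C \<subseteq> C"
      show "C = L"
      proof (cases "x \<in> C")
        case True
        have "\<epsilon>' ` (C \<union> K) \<subseteq> C \<union> K" "\<phi>' ` (C \<union> K) \<subseteq> C \<union> K" using C(3,4) K(4,5) by blast+
        then have "C \<union> K = D'" using whole[of "C \<union> K"] C(1) K(1,2) L(1) True by blast
        then show ?thesis using C(1) L(1,5) by blast
      next
        case False
        then have "C = {}" using none[of C] C L(1,7) by blast
        then show ?thesis using C(2) by simp
      qed
    qed
    have sub: "dart_map Z \<epsilon>' \<phi>'" if "Z \<subseteq> D'" "\<epsilon>' ` Z \<subseteq> Z" "\<phi>' ` Z \<subseteq> Z" for Z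
      unfolding dart_map_def using that M'(1-3) perm_on_subset[OF M'(4)] by auto
    \<comment> \<open>Otherwise the cycle of \<open>y\<close> under \<open>\<rho>2\<close> avoids
      \<open>a\<close>. One step leads from \<open>y\<close> to \<open>h\<close>, which lies in
      \<open>K\<close>, and as long as \<open>a\<close> is avoided the cycle cannot leave
      \<open>K\<close>; but \<open>y\<close> is not in \<open>K\<close>.\<close>
    have "y \<in> cycle_of \<rho>2 a"
    proof (rule ccontr)
      assume n: "y \<notin> cycle_of \<rho>2 a"
      have yD': "y \<in> D - {b}" "h \<in> D - {b}" using yD hD unfolding D'_def by auto
      have an: "a \<notin> cycle_of \<rho>2 y"
      proof
        assume "a \<in> cycle_of \<rho>2 y"
        then have "cycle_of \<rho>2 a = cycle_of \<rho>2 y" by (rule cycle_of_eq[OF pr2 yD'(1)])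
        then show False using n self_in_cycle_of[of y \<rho>2] by simp
      qed
      have hC: "h \<in> cycle_of \<rho>2 y"
        using cycle_of_closed[of \<rho>2 y] self_in_cycle_of[of y \<rho>2] r2(2) by (metis image_subset_iff)
      have "\<rho>2 ` (cycle_of \<rho>2 y \<inter> K) \<subseteq> cycle_of \<rho>2 y \<inter> K"
      proof
        fix z assume "z \<in> \<rho>2 ` (cycle_of \<rho>2 y \<inter> K)"
        then obtain w where w: "w \<in> cycle_of \<rho>2 y" "w \<in> K" "z = \<rho>2 w" by auto
        have zc: "z \<in> cycle_of \<rho>2 y" using cycle_of_closed[of \<rho>2 y] w by auto
        have wn: "w \<in> D'" "w \<noteq> x" "w \<noteq> y" using w(2) K(1) xL yL by auto
        then have z: "z = \<phi> (\<epsilon> w)" using r2(4) w(3) by simp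
        have "\<epsilon> w \<in> K" using K(4) w(2) eps(3)[OF wn(2,3)] by (metis image_subset_iff)
        moreover have "\<phi> (\<epsilon> w) \<noteq> a" using zc an z by auto
        ultimately have "\<phi>' (\<epsilon> w) = z" "\<phi>' (\<epsilon> w) \<in> K" using phi'[of "\<epsilon> w"] K(1,5) z by auto
        then show "z \<in> cycle_of \<rho>2 y \<inter> K" using zc by simp
      qed
      then have "cycle_of \<rho>2 h \<subseteq> K" using cycle_of_subset[of \<rho>2 "cycle_of \<rho>2 y \<inter> K" h] hC K(2) by auto
      moreover have "cycle_of \<rho>2 h = cycle_of \<rho>2 y" by (rule cycle_of_eq[OF pr2 yD'(1) hC])
      ultimately show False using yL(2) self_in_cycle_of[of y \<rho>2] by auto
    qed
    then have V: "cycle_count (\<phi>' \<circ> \<epsilon>') D' = Suc (cycle_count (\<phi> \<circ> \<epsilon>) D)" using sw(2) Vt V2 by simp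
    have K0: "K \<noteq> {}" using K(2) by auto
    note eK = dart_map_euler_le[OF sub[OF K(1,4,5)] K0 tK] and eL = dart_map_euler_le[OF sub[OF L(1-3)] L(4) tL]
    have fin: "finite K" "finite L" using finite_subset[OF K(1) M'(5)] finite_subset[OF L(1) M'(5)] .
    have "(\<phi>' \<circ> \<epsilon>') ` K \<subseteq> K" "(\<phi>' \<circ> \<epsilon>') ` L \<subseteq> L" 
      unfolding image_comp[symmetric] using image_mono[OF K(4), of \<phi>'] image_mono[OF L(2), of \<phi>'] K(5) L(3)
      by (meson order_trans)+
    then have "cycle_count (\<phi>' \<circ> \<epsilon>') D' = cycle_count (\<phi>' \<circ> \<epsilon>') K + cycle_count (\<phi>' \<circ> \<epsilon>') L"
      "cycle_count \<phi>' D' = cycle_count \<phi>' K + cycle_count \<phi>' L"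
      using cycle_count_Un[OF fin L(5)] K(5) L(3,6) by metis+
    moreover have "card D' = card K + card L" using card_Un_disjoint[OF fin L(5)] L(6) by simp
    \<comment> \<open>The number of vertices has risen by one, so the two Euler bounds for
      \<open>K\<close> and \<open>L\<close> add up to exactly the total, and both are
      equalities.\<close>
    ultimately have "2 * cycle_count (\<phi>' \<circ> \<epsilon>') K + 2 * cycle_count \<phi>' K = card K + 4"
      using eK eL V VF F cD by linarith
    then have "planar_map K \<epsilon>' \<phi>'" using sub[OF K(1,4,5)] tK K0 unfolding planar_map_iff by simp
    then show ?thesis by (rule result) (use K(1) PK in auto)
  qed
qed

lemma filled_by_rotate:
  assumes "filled_by Y (p @ q) N"
  shows "filled_by Y (q @ p) N"
proof (cases "p @ q = []")
  case True
  then show ?thesis using assms by simp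
next
  case False
  then obtain D :: "nat set" and \<epsilon> \<phi> l R where dg: "diagram Y D \<epsilon> \<phi> l R N" and R: "map l R = p @ q"
    using filled_byE[OF assms] by metis
  then obtain P Q where "R = P @ Q" "map l P = p" "map l Q = q" by (metis map_eq_append_conv)
  then show ?thesis using diagram_rotate[of Y D \<epsilon> \<phi> l P Q N] dg by (intro filled_byI[of Y D \<epsilon> \<phi> l "Q @ P"]) auto
qed

text \<open>The count may drop, because the gluing can cut off a piece of the map.\<close>

lemma filled_by_fold:
  assumes "filled_by Y (e # rv Y e # p) N"
  shows "\<exists>M\<le>N. filled_by Y p M"
proof (cases "p = []")
  case True
  then show ?thesis by simp
next
  case False
  obtain D :: "nat set" and \<epsilon> \<phi> l R where dg: "diagram Y D \<epsilon> \<phi> l R N" and R: "map l R = e # rv Y e # p"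
    using filled_byE[OF assms] by (metis list.distinct(1))
  then obtain a b P where abP: "R = a # b # P" "l a = e" "l b = rv Y e" "map l P = p" by (auto simp: map_eq_Cons_conv)
  have "l b = rv Y (l a)" "P \<noteq> []" using abP False by auto
  from diagram_fold[OF dg[unfolded abP(1)] this]
  obtain D' :: "nat set" and \<epsilon>' \<phi>' M where "M \<le> N" "diagram Y D' \<epsilon>' \<phi>' l P M" by metis
  then show ?thesis using filled_byI[OF _ abP(4)] by blast
qed

lemma filled_by_insert_inverse:
  assumes "filled_by Y p N" "edge_path Y v p v" "edge_path Y v w u"
  shows "filled_by Y (w @ path_inv w @ p) N"
  using assms
proof (induction w arbitrary: p v)
  case (Cons e w)
  have e: "e \<in> edges Y" "src Y e = v" and w: "edge_path Y (tgt Y e) w u" using Cons.prems(3) by auto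
  have "filled_by Y ([e] @ (rv Y e # p)) N" using filled_by_add_spike[OF Cons.prems(1,2) e] by simp
  then have f: "filled_by Y ((rv Y e # p) @ [e]) N" by (rule filled_by_rotate)
  have "edge_path Y (tgt Y e) ((rv Y e # p) @ [e]) (tgt Y e)"
    using Cons.prems(2) e edge_path_append[OF Cons.prems(2), of "[e]" "tgt Y e"] by simp
  from Cons.IH[OF f this w]
  have "filled_by Y ((w @ path_inv w @ rv Y e # p) @ [e]) N" by simp
  from filled_by_rotate[OF this] show ?case by (simp add: path_inverse_Cons)
qed simp

lemma filled_by_delete_inverse:
  assumes "filled_by Y (w @ path_inv w @ p) N"
  shows "\<exists>M\<le>N. filled_by Y p M"
  using assms
proof (induction w arbitrary: p N)
  case (Cons e w)
  have "filled_by Y ([e] @ (w @ path_inv w @ rv Y e # p)) N" using Cons.prems by (simp add: path_inverse_Cons)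
  from filled_by_rotate[OF this] have "filled_by Y (w @ path_inv w @ (rv Y e # p @ [e])) N" by simp
  then obtain M where M: "M \<le> N" "filled_by Y ((rv Y e # p) @ [e]) M" using Cons.IH by fastforce
  from filled_by_rotate[OF M(2)] have "filled_by Y (e # rv Y e # p) M" by simp
  then obtain M' where "M' \<le> M" "filled_by Y p M'" using filled_by_fold by blast
  then show ?case using M(1) le_trans by blast
qed auto

text \<open>With \<open>c = e # w\<close>, the cancelling word \<open>path_inv w @ w\<close> is
  inserted in front of \<open>p\<close>. Then \<open>e\<close> is added as a chord over
  \<open>path_inv w\<close>, which closes a face labelled by the inverse of \<open>c\<close> up to
  rotation.\<close>

lemma filled_by_insert_face:
  assumes "filled_by Y p N" "edge_path Y v p v" "edge_path Y v c v" "face_label Y c" "c \<noteq> []"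
  shows "filled_by Y (c @ p) (Suc N)"
proof -
  obtain e w where c: "c = e # w" using assms(5) by (cases c) auto
  have e: "e \<in> edges Y" "src Y e = v" and w: "edge_path Y (tgt Y e) w v" using assms(3) c by auto
  have iw: "edge_path Y v (path_inv w) (tgt Y e)" by (rule edge_path_inverse[OF w])
  have "filled_by Y (path_inv w @ path_inv (path_inv w) @ p) N"
    by (rule filled_by_insert_inverse[OF assms(1,2) iw])
  then have f: "filled_by Y (path_inv w @ (w @ p)) N" using edge_path_edges[OF w] by simp
  have "face_label Y (path_inv c)" by (rule face_label_inverse[OF assms(4)])
  then have "face_label Y (rotate (length w) (path_inv w @ [rv Y e]))"
    using face_label_rotate unfolding c path_inverse_Cons by blast
  then have "face_label Y (rv Y e # path_inv w)" using rotate_append[of "path_inv w" "[rv Y e]"] by simp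
  then show ?thesis
    using filled_by_add_chord[OF f e(1)] iw edge_path_append[OF w assms(2)] e(2) c by simp
qed

text \<open>The diagram follows the homotopy. Inserted pairs become spikes, and deleted pairs are
  folded. An inserted boundary is a new face; a deleted one is undone by inserting a face with the
  inverse boundary in front of it and folding the two words together.\<close>

lemma homotopic_filled_by:
  assumes "homotopic Y v v N q p" "filled_by Y q K"
  shows "\<exists>M\<le>K + N. filled_by Y p M"
  using assms
proof (induction rule: homotopic.induct)
  case (refl p N)
  then show ?case by (metis le_add1)
next
  case (forward N p q k r)
  then obtain M where M: "M \<le> K + N" "filled_by Y q M" by blast
  from forward.hyps(2) M(2) have "\<exists>M'\<le>M + k. filled_by Y r M'"
  proof (induction rule: homotopy_step.induct)
    case (cancel p e q)
    from filled_by_rotate[OF cancel(2)] have "filled_by Y (e # rv Y e # q @ p) M" by simp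
    then obtain M' where "M' \<le> M" "filled_by Y (q @ p) M'" using filled_by_fold by blast
    then show ?case using filled_by_rotate by fastforce
  next
    case (face f p q)
    from filled_by_rotate[OF face(3)] have f: "filled_by Y (bdry Y f @ q @ p) M" by simp
    obtain u where u: "edge_path Y u (bdry Y f) u" using face_loop face(1) by blast
    obtain w w' where w: "edge_path Y v p w" "edge_path Y w (bdry Y f) w'" "edge_path Y w' q v"
      using face(2) by (auto simp: edge_path_append_iff)
    have ne: "bdry Y f \<noteq> []" using face_nonempty face(1) .
    have uw: "u = w" "w' = w" using u w(2) ne edge_path_source_unique edge_path_target_unique by metis+
    have qp: "edge_path Y u (bdry Y f @ q @ p) u" using u uw w edge_path_append by metis
    have "face_label Y (path_inv (bdry Y f))"
      by (rule face_label_inverse) (use face(1) in \<open>auto simp: face_label_def same_cycle_def intro!: bexI exI[of _ 0]\<close>)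
    then have "filled_by Y (path_inv (bdry Y f) @ (bdry Y f @ q @ p)) (Suc M)"
      by (intro filled_by_insert_face[OF f qp edge_path_inverse[OF u]])
        (use ne in \<open>auto simp: path_inverse_def\<close>)
    then have "filled_by Y (path_inv (bdry Y f) @ path_inv (path_inv (bdry Y f)) @ (q @ p)) (Suc M)"
      using edge_path_edges[OF u] by simp
    then obtain M' where "M' \<le> Suc M" "filled_by Y (q @ p) M'" using filled_by_delete_inverse by blast
    then show ?case using filled_by_rotate by fastforce
  qed
  then obtain M' where "M' \<le> M + k" "filled_by Y r M'" by blast
  then show ?case using M(1) by (intro exI[of _ M']) auto
next
  case (backward N p q k r)
  then obtain M where M: "M \<le> K + N" "filled_by Y q M" by blast
  from backward.hyps(2) M(2) have "\<exists>M'\<le>M + k. filled_by Y r M'"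
  proof (induction rule: homotopy_step.induct)
    case (cancel p e q)
    obtain w where w: "edge_path Y v p w" "edge_path Y w ([e, rv Y e] @ q) v"
      using cancel(1) by (auto simp: edge_path_append_iff)
    then have e: "e \<in> edges Y" "src Y e = w" "edge_path Y w q v" by auto
    from filled_by_rotate[OF cancel(2)] have "filled_by Y (q @ p) M" .
    from filled_by_add_spike[OF this edge_path_append[OF e(3) w(1)] e(1,2)]
    have "filled_by Y (([e, rv Y e] @ q) @ p) M" by simp
    from filled_by_rotate[OF this] show ?case by auto
  next
    case (face f p q)
    obtain u where u: "edge_path Y u (bdry Y f) u" using face_loop face(1) by blast
    obtain w w' where w: "edge_path Y v p w" "edge_path Y w (bdry Y f) w'" "edge_path Y w' q v"
      using face(2) by (auto simp: edge_path_append_iff)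
    have ne: "bdry Y f \<noteq> []" using face_nonempty face(1) .
    have uw: "u = w" "w' = w" using u w(2) ne edge_path_source_unique edge_path_target_unique by metis+
    have fl: "face_label Y (bdry Y f)"
      using face(1) by (auto simp: face_label_def same_cycle_def intro!: bexI exI[of _ 0])
    from filled_by_rotate[OF face(3)] have "filled_by Y (q @ p) M" .
    then have "filled_by Y (bdry Y f @ q @ p) (Suc M)"
      by (rule filled_by_insert_face[OF _ _ u fl ne]) (use uw w edge_path_append in metis)
    then have "filled_by Y (p @ bdry Y f @ q) (Suc M)" using filled_by_rotate[of "bdry Y f @ q" p] by simp
    then show ?case by auto
  qed
  then obtain M' where "M' \<le> M + k" "filled_by Y r M'" by blast
  then show ?case using M(1) by (intro exI[of _ M']) auto
qed

text \<open>Identifies the filling area with the least cost of a null-homotopy, after which planar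
  maps can be forgotten. As \<open>filling_area\<close> is a \<open>LEAST\<close>, the given
  homotopy also provides the existence of some filling.\<close>

theorem filling_area_homotopic:
  assumes "homotopic Y v v N p []"
  shows "filling_area Y p \<le> N" "homotopic Y v v (filling_area Y p) p []"
proof -
  have "filled_by Y [] 0" by simp
  then obtain M where M: "M \<le> N" "filled_by Y p M"
    using homotopic_filled_by[OF homotopic_sym[OF assms], of 0] by auto
  then show "filling_area Y p \<le> N" unfolding filling_area_def by (meson Least_le le_trans)
  have "filled_by Y p (filling_area Y p)" unfolding filling_area_def using M(2) by (rule LeastI)
  then show "homotopic Y v v (filling_area Y p) p []"
    using filled_by_homotopic homotopic_path[OF assms] by blast
qed

end

section \<open>Maps between complexes\<close>

text \<open>A map of edge paths that depends on a state \<open>s\<close>, which is updated along the path. Without states this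
  is a map of complexes; with group elements as states it is a map from a covering complex.\<close>

fun develop :: "('s \<Rightarrow> 'e \<Rightarrow> 'd list) \<Rightarrow> ('s \<Rightarrow> 'e \<Rightarrow> 's) \<Rightarrow> 's \<Rightarrow> 'e list \<Rightarrow> 'd list" where
  "develop F st s [] = []"
| "develop F st s (e # p) = F s e @ develop F st (st s e) p"

lemma develop_append: "develop F st s (p @ q) = develop F st s p @ develop F st (foldl st s p) q"
  by (induction p arbitrary: s) auto

lemma develop_stateless: "develop (\<lambda>_. F) st s p = concat (map F p)"
  by (induction p arbitrary: s) auto

lemma length_concat_map_le: "(\<And>e. e \<in> set p \<Longrightarrow> length (F e) \<le> L) \<Longrightarrow> length (concat (map F p)) \<le> L * length p"
proof (induction p)
  case (Cons e p)
  then have "length (F e) \<le> L" "length (concat (map F p)) \<le> L * length p" by auto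
  then show ?case by simp
qed simp

lemma length_develop_le:
  assumes "\<And>s e. s \<in> I \<Longrightarrow> e \<in> set p \<Longrightarrow> length (F s e) \<le> L" "\<And>s e. s \<in> I \<Longrightarrow> e \<in> set p \<Longrightarrow> st s e \<in> I" "s \<in> I"
  shows "length (develop F st s p) \<le> L * length p"
  using assms
proof (induction p arbitrary: s)
  case (Cons e p)
  have "length (F s e) \<le> L" using Cons.prems by simp
  moreover have "length (develop F st (st s e) p) \<le> L * length p"
    by (rule Cons.IH) (use Cons.prems in auto)
  ultimately show ?case by simp
qed simp

text \<open>\<open>b\<close> bounds the area in \<open>B\<close> of the image of one face of
  \<open>A\<close>. By \<open>st_back\<close> and \<open>F_back\<close> a cancelling pair is mapped
  to a path followed by its inverse, with the state restored, and so costs nothing.\<close>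

locale developing_map = A: two_complex A + B: two_complex B
  for A :: "('v, 'e, 'f) complex2" and B :: "('w, 'd, 'g) complex2" +
  fixes I :: "'s set" and F :: "'s \<Rightarrow> 'e \<Rightarrow> 'd list" and st :: "'s \<Rightarrow> 'e \<Rightarrow> 's" and vm :: "'s \<Rightarrow> 'v \<Rightarrow> 'w" and b :: nat
  assumes vm: "\<And>s u. s \<in> I \<Longrightarrow> u \<in> verts A \<Longrightarrow> vm s u \<in> verts B"
    and st: "\<And>s e. s \<in> I \<Longrightarrow> e \<in> edges A \<Longrightarrow> st s e \<in> I"
    and F: "\<And>s e. s \<in> I \<Longrightarrow> e \<in> edges A \<Longrightarrow> edge_path B (vm s (src A e)) (F s e) (vm (st s e) (tgt A e))"
    and st_back: "\<And>s e. s \<in> I \<Longrightarrow> e \<in> edges A \<Longrightarrow> st (st s e) (rv A e) = s"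
    and F_back: "\<And>s e. s \<in> I \<Longrightarrow> e \<in> edges A \<Longrightarrow> F (st s e) (rv A e) = path_inverse B (F s e)"
    and face_state: "\<And>s f. s \<in> I \<Longrightarrow> f \<in> faces A \<Longrightarrow> foldl st s (bdry A f) = s"
    and face_area: "\<And>s f u. s \<in> I \<Longrightarrow> f \<in> faces A \<Longrightarrow> edge_path A u (bdry A f) u \<Longrightarrow>
      homotopic B (vm s u) (vm s u) b (develop F st s (bdry A f)) []"
begin

lemma state: "set p \<subseteq> edges A \<Longrightarrow> s \<in> I \<Longrightarrow> foldl st s p \<in> I"
  by (induction p arbitrary: s) (auto intro: st)

lemma develop_path:
  "edge_path A u p v \<Longrightarrow> s \<in> I \<Longrightarrow> edge_path B (vm s u) (develop F st s p) (vm (foldl st s p) v)"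
proof (induction p arbitrary: s u)
  case Nil
  then show ?case by (auto intro: vm)
next
  case (Cons e p)
  then have e: "e \<in> edges A" "src A e = u" "edge_path A (tgt A e) p v" by auto
  show ?case using B.edge_path_append[OF F[OF Cons.prems(2) e(1)] Cons.IH[OF e(3) st[OF Cons.prems(2) e(1)]]] e(2)
    by simp
qed

lemma step:
  assumes "homotopy_step A u v k p q" "s \<in> I"
  shows "foldl st s p = foldl st s q \<and>
    homotopic B (vm s u) (vm (foldl st s p) v) (b * k) (develop F st s p) (develop F st s q)"
  using assms
proof (induction rule: homotopy_step.induct)
  case (cancel p e q)
  then obtain w where w: "edge_path A u p w" "edge_path A w ([e, rv A e] @ q) v"
    by (auto simp: A.edge_path_append_iff)
  then have e: "e \<in> edges A" "src A e = w" "edge_path A w q v" by auto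
  let ?t = "foldl st s p"
  have t: "?t \<in> I" by (rule state[OF A.edge_path_edges[OF w(1)] cancel.prems])
  have bk: "st (st ?t e) (rv A e) = ?t" "F (st ?t e) (rv A e) = path_inverse B (F ?t e)"
    using st_back[OF t e(1)] F_back[OF t e(1)] .
  have "homotopic B (vm ?t w) (vm ?t w) 0 (F ?t e @ path_inverse B (F ?t e)) []"
    by (rule B.homotopic_cancel) (use F[OF t e(1)] e(2) in simp)
  from B.homotopic_context[OF this develop_path[OF w(1) cancel.prems] develop_path[OF e(3) t]]
  show ?case using bk by (simp add: develop_append)
next
  case (face f p q)
  then obtain w w' where w: "edge_path A u p w" "edge_path A w (bdry A f) w'" "edge_path A w' q v"
    by (auto simp: A.edge_path_append_iff)
  obtain x where "edge_path A x (bdry A f) x" using A.face_loop face(1) by blast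
  then have ww: "w' = w" using w(2) A.face_nonempty[OF face(1)] A.edge_path_source_unique A.edge_path_target_unique by metis
  let ?t = "foldl st s p"
  have t: "?t \<in> I" by (rule state[OF A.edge_path_edges[OF w(1)] face.prems])
  have "edge_path A w (bdry A f) w" using w(2) ww by simp
  from B.homotopic_context[OF face_area[OF t face(1) this] develop_path[OF w(1) face.prems] develop_path[OF w(3)[unfolded ww] t]]
  show ?case using face_state[OF t face(1)] by (simp add: develop_append)
qed

lemma develop_homotopic:
  assumes "homotopic A u v N p q" "s \<in> I"
  shows "foldl st s p = foldl st s q \<and>
    homotopic B (vm s u) (vm (foldl st s p) v) (b * N) (develop F st s p) (develop F st s q)"
  using assms
proof (induction rule: homotopic.induct)
  case (refl p N)
  from homotopic.refl[OF develop_path[OF this]] show ?case by simp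
next
  case (forward N p q k r)
  note 1 = forward.IH[OF forward.prems] and 2 = step[OF forward.hyps(2) forward.prems]
  have "homotopic B (vm s u) (vm (foldl st s p) v) (b * k) (develop F st s q) (develop F st s r)"
    using 1 2 by metis
  from B.homotopic_trans[OF conjunct2[OF 1] this] show ?case
    using 1 2 by (simp add: add_mult_distrib2)
next
  case (backward N p q k r)
  note 1 = backward.IH[OF backward.prems] and 2 = step[OF backward.hyps(2) backward.prems]
  have "homotopic B (vm s u) (vm (foldl st s p) v) (b * k) (develop F st s q) (develop F st s r)"
    using 1 2 B.homotopic_sym by metis
  from B.homotopic_trans[OF conjunct2[OF 1] this] show ?case
    using 1 2 by (simp add: add_mult_distrib2)
qed

end

lemma (in two_complex) homotopic_subcomplex:
  assumes "homotopic Z u v N p q" "verts Z \<subseteq> verts Y" "edges Z \<subseteq> edges Y" "faces Z \<subseteq> faces Y"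
    "src Z = src Y" "rv Z = rv Y" "bdry Z = bdry Y"
  shows "homotopic Y u v N p q"
proof -
  have t: "tgt Z = tgt Y" using assms unfolding tgt_def by auto
  have path: "edge_path Y u p v" if "edge_path Z u p v" for u p
    using that by (induction p arbitrary: u) (use assms t in auto)
  have step: "homotopy_step Y u v k p q" if "homotopy_step Z u v k p q" for k p q
    using that
  proof (induction rule: homotopy_step.induct)
    case (cancel p e q)
    then show ?case using homotopy_step.cancel[OF path] assms by metis
  next
    case (face f p q)
    then show ?case using homotopy_step.face[of f Y u p q v] path assms by (metis subsetD)
  qed
  show ?thesis using assms(1)
    by (induction rule: homotopic.induct) (auto intro: homotopic.intros path step)
qed

section \<open>Free cocompact actions\<close>

text \<open>A bound at one point of an orbit holds on all of it by invariance, and the maximum over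
  the finitely many orbits does for all points.\<close>

lemma finite_orbits_bound:
  assumes act: "group_action H X \<phi>" and fin: "finite (orbits H X \<phi>)"
    and ex: "\<And>x. x \<in> X \<Longrightarrow> \<exists>n. P x n"
    and mono: "\<And>x m n. P x m \<Longrightarrow> m \<le> n \<Longrightarrow> P x n"
    and inv: "\<And>h x n. h \<in> carrier H \<Longrightarrow> x \<in> X \<Longrightarrow> P x n \<Longrightarrow> P (\<phi> h x) n"
  shows "\<exists>B::nat. \<forall>x\<in>X. P x B"
proof -
  have "\<forall>C\<in>orbits H X \<phi>. \<exists>n. \<forall>x\<in>C. P x n"
  proof
    fix C assume "C \<in> orbits H X \<phi>"
    then obtain x where x: "x \<in> X" "C = orbit H \<phi> x" unfolding orbits_def by auto
    obtain n where "P x n" using ex[OF x(1)] by blast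
    then show "\<exists>n. \<forall>x\<in>C. P x n" using inv[OF _ x(1)] unfolding x(2) orbit_def by blast
  qed
  then obtain n where n: "\<And>C x. C \<in> orbits H X \<phi> \<Longrightarrow> x \<in> C \<Longrightarrow> P x (n C)" by metis
  show ?thesis
  proof (intro exI ballI)
    fix x assume x: "x \<in> X"
    then have C: "orbit H \<phi> x \<in> orbits H X \<phi>" unfolding orbits_def by auto
    have "x \<in> orbit H \<phi> x" using group_action.orbit_refl[OF act x] .
    moreover have "n (orbit H \<phi> x) \<le> Max (insert 0 (n ` orbits H X \<phi>))" using fin C by simp
    ultimately show "P x (Max (insert 0 (n ` orbits H X \<phi>)))" using n[OF C] mono by blast
  qed
qed

definition label_product :: "('a, 'm) monoid_scheme \<Rightarrow> ('e \<Rightarrow> 'a) \<Rightarrow> 'e list \<Rightarrow> 'a" where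
  "label_product G \<mu> p = foldr (\<lambda>e g. \<mu> e \<otimes>\<^bsub>G\<^esub> g) p \<one>\<^bsub>G\<^esub>"

lemma label_product_Nil [simp]: "label_product G \<mu> [] = \<one>\<^bsub>G\<^esub>"
  and label_product_Cons [simp]: "label_product G \<mu> (e # p) = \<mu> e \<otimes>\<^bsub>G\<^esub> label_product G \<mu> p"
  unfolding label_product_def by auto

context group
begin

lemma label_product_closed: "(\<And>e. e \<in> set p \<Longrightarrow> \<mu> e \<in> carrier G) \<Longrightarrow> label_product G \<mu> p \<in> carrier G"
  by (induction p) auto

lemma label_product_append:
  "(\<And>e. e \<in> set (p @ q) \<Longrightarrow> \<mu> e \<in> carrier G) \<Longrightarrow>
    label_product G \<mu> (p @ q) = label_product G \<mu> p \<otimes> label_product G \<mu> q"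
  by (induction p) (auto simp: label_product_closed m_assoc)

lemma label_product_foldl:
  "(\<And>e. e \<in> set p \<Longrightarrow> \<mu> e \<in> carrier G) \<Longrightarrow> g \<in> carrier G \<Longrightarrow>
    foldl (\<lambda>g e. g \<otimes> \<mu> e) g p = g \<otimes> label_product G \<mu> p"
  by (induction p arbitrary: g) (auto simp: label_product_closed m_assoc)

end

text \<open>Edges are oriented by \<open>pos\<close>, so that a choice for positive edges extends to all edges.\<close>

locale labelled_complex = two_complex Z + group G
  for Z :: "('v, 'e, 'f) complex2" and G (structure) +
  fixes \<mu> :: "'e \<Rightarrow> 'a" and pos :: "'e \<Rightarrow> bool"
  assumes label_closed: "e \<in> edges Z \<Longrightarrow> \<mu> e \<in> carrier G"
    and label_rv: "e \<in> edges Z \<Longrightarrow> \<mu> (rv Z e) = inv (\<mu> e)"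
    and pos_rv: "e \<in> edges Z \<Longrightarrow> pos (rv Z e) \<longleftrightarrow> \<not> pos e"
    and label_face: "f \<in> faces Z \<Longrightarrow> label_product G \<mu> (bdry Z f) = \<one>"
begin

lemma path_label_closed: "set p \<subseteq> edges Z \<Longrightarrow> label_product G \<mu> p \<in> carrier G"
  by (rule label_product_closed) (auto intro: label_closed)

lemma path_label_append:
  "set p \<subseteq> edges Z \<Longrightarrow> set q \<subseteq> edges Z \<Longrightarrow>
    label_product G \<mu> (p @ q) = label_product G \<mu> p \<otimes> label_product G \<mu> q"
  by (rule label_product_append) (auto intro: label_closed)

lemma path_label_inverse:
  "set p \<subseteq> edges Z \<Longrightarrow> label_product G \<mu> (path_inverse Z p) = inv (label_product G \<mu> p)"
proof (induction p)
  case (Cons e p)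
  then have e: "e \<in> edges Z" "set p \<subseteq> edges Z" by auto
  have "set (path_inverse Z p) \<subseteq> edges Z" using e(2) by (rule path_inverse_edges)
  then show ?case
    using Cons.IH[OF e(2)] e label_closed[OF e(1)] path_label_closed[OF e(2)]
    by (simp add: path_inverse_Cons path_label_append label_rv inv_mult_group)
qed simp

end

lemma (in group) inv_mult_cancel: "g \<in> carrier G \<Longrightarrow> b \<in> carrier G \<Longrightarrow> inv g \<otimes> (g \<otimes> b) = b"
  by (simp add: m_assoc[symmetric])

locale free_cocompact = two_complex Y + group H
  for Y :: "('v, 'e, 'f) complex2" and H :: "('a, 'm) monoid_scheme" (structure) +
  fixes \<alpha> :: "'a \<Rightarrow> 'v \<Rightarrow> 'v" and \<beta> :: "'a \<Rightarrow> 'e \<Rightarrow> 'e" and \<gamma> :: "'a \<Rightarrow> 'f \<Rightarrow> 'f"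
  assumes action: "free_cocompact_action H Y \<alpha> \<beta> \<gamma>" and simply: "simply_connected2 Y"
begin

lemma acts: "group_action H (verts Y) \<alpha>" "group_action H (edges Y) \<beta>" "group_action H (faces Y) \<gamma>"
  and finite_orbits: "finite (orbits H (verts Y) \<alpha>)" "finite (orbits H (edges Y) \<beta>)" "finite (orbits H (faces Y) \<gamma>)"
  using action unfolding free_cocompact_action_def by auto

lemma vertex_act [simp]: "g \<in> carrier H \<Longrightarrow> u \<in> verts Y \<Longrightarrow> \<alpha> g u \<in> verts Y"
  and edge_act [simp]: "g \<in> carrier H \<Longrightarrow> e \<in> edges Y \<Longrightarrow> \<beta> g e \<in> edges Y"
  and face_act [simp]: "g \<in> carrier H \<Longrightarrow> f \<in> faces Y \<Longrightarrow> \<gamma> g f \<in> faces Y"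
  using group_action.element_image[OF acts(1)] group_action.element_image[OF acts(2)]
    group_action.element_image[OF acts(3)] by blast+

lemma vertex_act_one [simp]: "u \<in> verts Y \<Longrightarrow> \<alpha> \<one> u = u"
  and edge_act_one [simp]: "e \<in> edges Y \<Longrightarrow> \<beta> \<one> e = e"
  using group_action.id_eq_one[OF acts(1)] group_action.id_eq_one[OF acts(2)] by (metis restrict_apply')+

lemma vertex_act_mult: "g \<in> carrier H \<Longrightarrow> h \<in> carrier H \<Longrightarrow> u \<in> verts Y \<Longrightarrow> \<alpha> (g \<otimes> h) u = \<alpha> g (\<alpha> h u)"
  and edge_act_mult: "g \<in> carrier H \<Longrightarrow> h \<in> carrier H \<Longrightarrow> e \<in> edges Y \<Longrightarrow> \<beta> (g \<otimes> h) e = \<beta> g (\<beta> h e)"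
  using group_action.composition_rule[OF acts(1)] group_action.composition_rule[OF acts(2)] by auto

lemma act_src [simp]: "g \<in> carrier H \<Longrightarrow> e \<in> edges Y \<Longrightarrow> src Y (\<beta> g e) = \<alpha> g (src Y e)"
  and act_rv [simp]: "g \<in> carrier H \<Longrightarrow> e \<in> edges Y \<Longrightarrow> rv Y (\<beta> g e) = \<beta> g (rv Y e)"
  using action unfolding free_cocompact_action_def by auto

lemma act_tgt [simp]: "g \<in> carrier H \<Longrightarrow> e \<in> edges Y \<Longrightarrow> tgt Y (\<beta> g e) = \<alpha> g (tgt Y e)"
  unfolding tgt_def by simp

lemma vertex_free: "g \<in> carrier H \<Longrightarrow> u \<in> verts Y \<Longrightarrow> \<alpha> g u = u \<Longrightarrow> g = \<one>"
  and edge_free: "g \<in> carrier H \<Longrightarrow> e \<in> edges Y \<Longrightarrow> \<beta> g e \<noteq> rv Y e"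
proof -
  show "g \<in> carrier H \<Longrightarrow> u \<in> verts Y \<Longrightarrow> \<alpha> g u = u \<Longrightarrow> g = \<one>"
    using action unfolding free_cocompact_action_def by blast
  assume g: "g \<in> carrier H" and e: "e \<in> edges Y"
  show "\<beta> g e \<noteq> rv Y e"
  proof (cases "g = \<one>")
    case True
    then show ?thesis using rv_neq[OF e] e by simp
  next
    case False
    then show ?thesis using action g e unfolding free_cocompact_action_def by blast
  qed
qed

lemma vertex_act_cancel:
  assumes "g \<in> carrier H" "h \<in> carrier H" "u \<in> verts Y" "\<alpha> g u = \<alpha> h u"
  shows "g = h"
proof -
  have "\<alpha> (inv h \<otimes> g) u = \<alpha> (inv h) (\<alpha> h u)" using assms by (simp add: vertex_act_mult)
  also have "\<dots> = \<alpha> (inv h \<otimes> h) u" using assms by (simp only: vertex_act_mult inv_closed)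
  also have "\<dots> = u" using assms by simp
  finally have "inv h \<otimes> g = \<one>" using assms vertex_free[of "inv h \<otimes> g" u] by simp
  then show ?thesis using assms(1,2) by (metis inv_equality inv_inv inv_closed)
qed

lemma map_act_mult:
  "g \<in> carrier H \<Longrightarrow> h \<in> carrier H \<Longrightarrow> set p \<subseteq> edges Y \<Longrightarrow> map (\<beta> (g \<otimes> h)) p = map (\<beta> g) (map (\<beta> h) p)"
  by (induction p) (auto simp: edge_act_mult)

lemma map_act_one: "set p \<subseteq> edges Y \<Longrightarrow> map (\<beta> \<one>) p = p"
  by (induction p) auto

lemma map_act_edges: "g \<in> carrier H \<Longrightarrow> set p \<subseteq> edges Y \<Longrightarrow> set (map (\<beta> g) p) \<subseteq> edges Y"
  by auto

lemma path_inverse_act: "g \<in> carrier H \<Longrightarrow> set p \<subseteq> edges Y \<Longrightarrow> path_inv (map (\<beta> g) p) = map (\<beta> g) (path_inv p)"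
  by (induction p) (auto simp: path_inverse_Cons)

lemma edge_path_act: "g \<in> carrier H \<Longrightarrow> edge_path Y u p v \<Longrightarrow> edge_path Y (\<alpha> g u) (map (\<beta> g) p) (\<alpha> g v)"
  by (induction p arbitrary: u) auto

text \<open>The boundary of a translated face agrees with the translated boundary only up to
  rotation and inversion, so the face case goes through \<open>homotopic_face_cycle\<close>.\<close>

lemma homotopic_act:
  assumes g: "g \<in> carrier H" and "homotopic Y u v N p q"
  shows "homotopic Y (\<alpha> g u) (\<alpha> g v) N (map (\<beta> g) p) (map (\<beta> g) q)"
proof -
  have step: "homotopic Y (\<alpha> g u) (\<alpha> g v) k (map (\<beta> g) p) (map (\<beta> g) q)" if "homotopy_step Y u v k p q" for k p q
    using that
  proof (induction rule: homotopy_step.induct)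
    case (cancel p e q)
    have e: "e \<in> edges Y" using edge_path_edges[OF cancel] by auto
    have "edge_path Y (\<alpha> g u) (map (\<beta> g) p @ [\<beta> g e, rv Y (\<beta> g e)] @ map (\<beta> g) q) (\<alpha> g v)"
      using edge_path_act[OF g cancel] g e by simp
    from homotopy_step_homotopic(1)[OF homotopy_step.cancel[OF this]] show ?case using g e by simp
  next
    case (face f p q)
    then obtain w w' where w: "edge_path Y u p w" "edge_path Y w (bdry Y f) w'" "edge_path Y w' q v"
      by (auto simp: edge_path_append_iff)
    obtain x where "edge_path Y x (bdry Y f) x" using face_loop face(1) by blast
    then have ww: "w' = w" using w(2) face_nonempty[OF face(1)] edge_path_source_unique edge_path_target_unique by metis
    have pf: "edge_path Y (\<alpha> g w) (map (\<beta> g) (bdry Y f)) (\<alpha> g w)" using edge_path_act[OF g w(2)] ww by simp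
    have "same_cycle Y (bdry Y (\<gamma> g f)) (map (\<beta> g) (bdry Y f))"
      using action g face(1) unfolding free_cocompact_action_def by blast
    then have "same_cycle Y (map (\<beta> g) (bdry Y f)) (bdry Y (\<gamma> g f))"
      by (rule same_cycle_sym[OF _ edge_path_edges[OF pf]])
    from homotopic_face_cycle[OF face_act[OF g face(1)] this pf]
    have "homotopic Y (\<alpha> g w) (\<alpha> g w) 1 (map (\<beta> g) (bdry Y f)) []" .
    from homotopic_context[OF this edge_path_act[OF g w(1)] edge_path_act[OF g w(3)[unfolded ww]]]
    show ?case by simp
  qed
  show ?thesis using assms(2)
  proof (induction rule: homotopic.induct)
    case (refl p N)
    then show ?case using homotopic.refl[OF edge_path_act[OF g]] by simp
  next
    case (forward N p q k r)
    from homotopic_trans[OF forward.IH step[OF forward.hyps(2)]] show ?case .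
  next
    case (backward N p q k r)
    from homotopic_trans[OF backward.IH homotopic_sym[OF step[OF backward.hyps(2)]]] show ?case .
  qed
qed

lemma null_homotopic:
  assumes "edge_path Y v p v"
  shows "\<exists>N. homotopic Y v v N p []"
proof -
  have "equivclp (loop_step Y v) p []"
    using simply assms edge_path_verts[OF assms] unfolding simply_connected2_def by blast
  then show ?thesis using equivclp_loop_step_iff[OF assms] by blast
qed

lemma homotopic_exists:
  assumes "edge_path Y u p v" "edge_path Y u q v"
  shows "\<exists>N. homotopic Y u v N p q"
  using null_homotopic[OF edge_path_append[OF assms(1) edge_path_inverse[OF assms(2)]]]
    homotopic_of_loop[OF assms] by blast

lemma connected_by_path: "u \<in> verts Y \<Longrightarrow> v \<in> verts Y \<Longrightarrow> \<exists>p. edge_path Y u p v"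
  using simply unfolding simply_connected2_def by blast

text \<open>Coordinates for the action. \<open>rep\<close> depends on the orbit only, because
  \<open>SOME\<close> is applied to the same set; by freeness \<open>elt u\<close> is then
  determined by \<open>u\<close>, and \<open>elt (\<alpha> g u) = g \<otimes> elt u\<close>. Hence
  \<open>edge_label\<close> is invariant, and its product along a path from \<open>u\<close> to
  \<open>v\<close> is \<open>inv (elt u) \<otimes> elt v\<close>. The path \<open>conn u\<close>
  joins the translate of \<open>base\<close> by \<open>elt u\<close> to \<open>u\<close>
  equivariantly.\<close>

definition rep where "rep u = (SOME r. r \<in> orbit H \<alpha> u)"
definition elt where "elt u = (SOME g. g \<in> carrier H \<and> \<alpha> g (rep u) = u)"
definition base where "base = rep (SOME u. u \<in> verts Y)"
definition conn where "conn u = map (\<beta> (elt u)) (SOME p. edge_path Y base p (rep u))"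
definition edge_label where "edge_label e = inv (elt (src Y e)) \<otimes> elt (tgt Y e)"

lemma rep:
  assumes "u \<in> verts Y"
  shows rep_orbit: "rep u \<in> orbit H \<alpha> u" and rep_in [simp]: "rep u \<in> verts Y"
proof -
  show "rep u \<in> orbit H \<alpha> u"
    unfolding rep_def using group_action.orbit_refl[OF acts(1) assms] by (rule someI)
  then show "rep u \<in> verts Y" using assms unfolding orbit_def by auto
qed

lemma orbit_act:
  assumes "g \<in> carrier H" "u \<in> verts Y"
  shows "orbit H \<alpha> (\<alpha> g u) = orbit H \<alpha> u"
proof
  show "orbit H \<alpha> (\<alpha> g u) \<subseteq> orbit H \<alpha> u"
  proof
    fix w assume "w \<in> orbit H \<alpha> (\<alpha> g u)"
    then obtain h where h: "h \<in> carrier H" "w = \<alpha> h (\<alpha> g u)" unfolding orbit_def by auto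
    then have "w = \<alpha> (h \<otimes> g) u" using assms by (simp add: vertex_act_mult)
    then show "w \<in> orbit H \<alpha> u" using h assms unfolding orbit_def by auto
  qed
  show "orbit H \<alpha> u \<subseteq> orbit H \<alpha> (\<alpha> g u)"
  proof
    fix w assume "w \<in> orbit H \<alpha> u"
    then obtain h where h: "h \<in> carrier H" "w = \<alpha> h u" unfolding orbit_def by auto
    then have "\<alpha> (h \<otimes> inv g) (\<alpha> g u) = \<alpha> ((h \<otimes> inv g) \<otimes> g) u" using assms by (simp add: vertex_act_mult)
    also have "(h \<otimes> inv g) \<otimes> g = h" using h assms by (simp add: m_assoc)
    finally have "w = \<alpha> (h \<otimes> inv g) (\<alpha> g u)" using h by simp
    then show "w \<in> orbit H \<alpha> (\<alpha> g u)" using h assms unfolding orbit_def by auto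
  qed
qed

lemma rep_act [simp]: "g \<in> carrier H \<Longrightarrow> u \<in> verts Y \<Longrightarrow> rep (\<alpha> g u) = rep u"
  unfolding rep_def by (simp add: orbit_act)

lemma elt:
  assumes "u \<in> verts Y"
  shows elt_in [simp]: "elt u \<in> carrier H" and elt_rep: "\<alpha> (elt u) (rep u) = u"
proof -
  obtain h where h: "h \<in> carrier H" "rep u = \<alpha> h u" using rep_orbit[OF assms] unfolding orbit_def by auto
  then have "\<alpha> (inv h) (rep u) = u"
    using group_action.orbit_sym_aux[OF acts(1) h(1) assms] by simp
  then have "\<exists>g. g \<in> carrier H \<and> \<alpha> g (rep u) = u" using h by auto
  from someI_ex[OF this] show "elt u \<in> carrier H" "\<alpha> (elt u) (rep u) = u" unfolding elt_def by auto
qed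

lemma elt_act:
  assumes "g \<in> carrier H" "u \<in> verts Y"
  shows "elt (\<alpha> g u) = g \<otimes> elt u"
proof (rule vertex_act_cancel)
  show "\<alpha> (elt (\<alpha> g u)) (rep u) = \<alpha> (g \<otimes> elt u) (rep u)"
    using elt_rep[of "\<alpha> g u"] elt_rep[of u] assms by (simp add: vertex_act_mult)
qed (use assms in auto)

lemma finite_reps: "finite (rep ` verts Y)"
proof -
  have "rep ` verts Y = (\<lambda>C. SOME r. r \<in> C) ` orbits H (verts Y) \<alpha>"
    unfolding rep_def orbits_def by auto
  then show ?thesis using finite_orbits(1) by simp
qed

lemma base_in [simp]: "base \<in> verts Y"
  and elt_base [simp]: "elt base = \<one>"
proof -
  have "verts Y \<noteq> {}" using simply unfolding simply_connected2_def by simp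
  then have u: "(SOME u. u \<in> verts Y) \<in> verts Y" by (rule some_in_eq[THEN iffD2])
  then show b: "base \<in> verts Y" unfolding base_def by simp
  obtain h where "h \<in> carrier H" "base = \<alpha> h (SOME u. u \<in> verts Y)"
    using rep_orbit[OF u] unfolding base_def orbit_def by auto
  then have "rep base = base" using u unfolding base_def by simp
  then show "elt base = \<one>" using elt_rep[OF b] vertex_free[OF elt_in[OF b] b] by simp
qed

lemma conn_path: "u \<in> verts Y \<Longrightarrow> edge_path Y (\<alpha> (elt u) base) (conn u) u"
  using edge_path_act[OF elt_in[of u] someI_ex[OF connected_by_path[OF base_in rep_in]], of u]
  by (simp add: conn_def elt_rep)

lemma conn_act: "g \<in> carrier H \<Longrightarrow> u \<in> verts Y \<Longrightarrow> conn (\<alpha> g u) = map (\<beta> g) (conn u)"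
  unfolding conn_def rep_act elt_act
  by (rule map_act_mult) (use edge_path_edges someI_ex[OF connected_by_path[OF base_in rep_in]] in auto)

lemma edge_label_in [simp]: "e \<in> edges Y \<Longrightarrow> edge_label e \<in> carrier H"
  unfolding edge_label_def by simp

lemma edge_label_act: "g \<in> carrier H \<Longrightarrow> e \<in> edges Y \<Longrightarrow> edge_label (\<beta> g e) = edge_label e"
  unfolding edge_label_def by (simp add: elt_act inv_mult_group m_assoc inv_mult_cancel)

lemma edge_label_rv: "e \<in> edges Y \<Longrightarrow> edge_label (rv Y e) = inv (edge_label e)"
  unfolding edge_label_def by (simp add: inv_mult_group)

lemma elt_tgt: "e \<in> edges Y \<Longrightarrow> elt (tgt Y e) = elt (src Y e) \<otimes> edge_label e"
  unfolding edge_label_def by (simp add: m_assoc[symmetric])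

lemma path_label: "edge_path Y u p v \<Longrightarrow> elt v = elt u \<otimes> label_product H edge_label p"
proof (induction p arbitrary: u)
  case (Cons e p)
  then have e: "e \<in> edges Y" "src Y e = u" "edge_path Y (tgt Y e) p v" by auto
  have "label_product H edge_label p \<in> carrier H"
    by (rule label_product_closed) (use edge_path_edges[OF e(3)] in auto)
  moreover have "elt u \<in> carrier H" using edge_path_verts[OF Cons.prems] by simp
  ultimately show ?case using Cons.IH[OF e(3)] e by (simp add: elt_tgt m_assoc)
qed simp

text \<open>The set of the two orbits is the same for \<open>e\<close> and \<open>rv Y e\<close>, so
  \<open>SOME\<close> selects one orientation for both, invariantly under \<open>H\<close>. The two
  orbits differ by \<open>edge_free\<close>.\<close>

definition oriented where
  "oriented e \<longleftrightarrow> orbit H \<beta> e = (SOME C. C \<in> {orbit H \<beta> e, orbit H \<beta> (rv Y e)})"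

lemma edge_orbit_act:
  assumes "g \<in> carrier H" "e \<in> edges Y"
  shows "orbit H \<beta> (\<beta> g e) = orbit H \<beta> e"
proof
  show "orbit H \<beta> (\<beta> g e) \<subseteq> orbit H \<beta> e"
  proof
    fix w assume "w \<in> orbit H \<beta> (\<beta> g e)"
    then obtain h where h: "h \<in> carrier H" "w = \<beta> h (\<beta> g e)" unfolding orbit_def by auto
    then have "w = \<beta> (h \<otimes> g) e" using assms by (simp add: edge_act_mult)
    then show "w \<in> orbit H \<beta> e" using h assms unfolding orbit_def by auto
  qed
  show "orbit H \<beta> e \<subseteq> orbit H \<beta> (\<beta> g e)"
  proof
    fix w assume "w \<in> orbit H \<beta> e"
    then obtain h where h: "h \<in> carrier H" "w = \<beta> h e" unfolding orbit_def by auto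
    then have "\<beta> (h \<otimes> inv g) (\<beta> g e) = \<beta> ((h \<otimes> inv g) \<otimes> g) e" using assms by (simp add: edge_act_mult)
    also have "(h \<otimes> inv g) \<otimes> g = h" using h assms by (simp add: m_assoc)
    finally have "w = \<beta> (h \<otimes> inv g) (\<beta> g e)" using h by simp
    then show "w \<in> orbit H \<beta> (\<beta> g e)" using h assms unfolding orbit_def by auto
  qed
qed

lemma oriented_act: "g \<in> carrier H \<Longrightarrow> e \<in> edges Y \<Longrightarrow> oriented (\<beta> g e) \<longleftrightarrow> oriented e"
  unfolding oriented_def by (simp add: edge_orbit_act)

lemma oriented_rv:
  assumes "e \<in> edges Y"
  shows "oriented (rv Y e) \<longleftrightarrow> \<not> oriented e"
proof -
  let ?C = "SOME C. C \<in> {orbit H \<beta> e, orbit H \<beta> (rv Y e)}"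
  have "?C \<in> {orbit H \<beta> e, orbit H \<beta> (rv Y e)}" by (rule someI[of _ "orbit H \<beta> e"]) simp
  moreover have "orbit H \<beta> e \<noteq> orbit H \<beta> (rv Y e)"
  proof
    assume "orbit H \<beta> e = orbit H \<beta> (rv Y e)"
    then have "rv Y e \<in> orbit H \<beta> e" using group_action.orbit_refl[OF acts(2) rv_in[OF assms]] by simp
    then show False using edge_free[OF _ assms] unfolding orbit_def by fastforce
  qed
  moreover have "(SOME C. C \<in> {orbit H \<beta> (rv Y e), orbit H \<beta> (rv Y (rv Y e))}) = ?C"
    using assms by (simp add: insert_commute)
  ultimately show ?thesis unfolding oriented_def by auto
qed

lemma face_length_bound: "\<exists>B. \<forall>f\<in>faces Y. length (bdry Y f) \<le> B"
proof (rule finite_orbits_bound[OF acts(3) finite_orbits(3)])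
  fix h f n assume h: "h \<in> carrier H" "f \<in> faces Y" "length (bdry Y f) \<le> n"
  have "same_cycle Y (bdry Y (\<gamma> h f)) (map (\<beta> h) (bdry Y f))"
    using action h unfolding free_cocompact_action_def by blast
  then show "length (bdry Y (\<gamma> h f)) \<le> n" using h(3) unfolding same_cycle_def by auto
qed auto

text \<open>An element mapping one edge at \<open>u\<close> to another edge at \<open>u\<close>
  fixes \<open>u\<close>, so by freeness distinct edges at \<open>u\<close> lie in distinct
  orbits.\<close>

lemma finite_edges_at: "finite {e \<in> edges Y. src Y e = u}"
proof (rule finite_imageD)
  show "finite (orbit H \<beta> ` {e \<in> edges Y. src Y e = u})"
    by (rule finite_subset[OF _ finite_orbits(2)]) (auto simp: orbits_def)
  show "inj_on (orbit H \<beta>) {e \<in> edges Y. src Y e = u}"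
  proof (rule inj_onI)
    fix e e' assume e: "e \<in> {e \<in> edges Y. src Y e = u}" "e' \<in> {e \<in> edges Y. src Y e = u}"
      and eq: "orbit H \<beta> e = orbit H \<beta> e'"
    then have "e' \<in> orbit H \<beta> e" using group_action.orbit_refl[OF acts(2)] by simp
    then obtain h where h: "h \<in> carrier H" "e' = \<beta> h e" unfolding orbit_def by auto
    then have "\<alpha> h u = u" using e by auto
    moreover have "u \<in> verts Y" using e(1) by auto
    ultimately have "h = \<one>" using vertex_free[OF h(1)] by simp
    then show "e = e'" using h e by simp
  qed
qed

lemma finite_paths: "finite {p. (\<exists>v. edge_path Y u p v) \<and> length p \<le> n}"
proof (induction n arbitrary: u)
  case 0
  then show ?case by simp
next
  case (Suc n)
  have "{p. (\<exists>v. edge_path Y u p v) \<and> length p \<le> Suc n} \<subseteq>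
      insert [] (\<Union>e\<in>{e \<in> edges Y. src Y e = u}. (#) e ` {p. (\<exists>v. edge_path Y (tgt Y e) p v) \<and> length p \<le> n})"
    (is "?A \<subseteq> ?B")
  proof
    fix p assume "p \<in> ?A"
    then show "p \<in> ?B"
    proof (cases p)
      case (Cons e q)
      with \<open>p \<in> ?A\<close> have "e \<in> edges Y" "src Y e = u" "q \<in> {p. (\<exists>v. edge_path Y (tgt Y e) p v) \<and> length p \<le> n}"
        by auto
      then show ?thesis unfolding Cons by blast
    qed simp
  qed
  moreover have "finite ?B" using finite_edges_at Suc.IH by auto
  ultimately show ?case by (rule finite_subset)
qed

text \<open>Needed so that the \<open>Sup\<close> in \<open>dehn_function\<close> is taken over a
  bounded set. Up to translation a loop starts at one of finitely many representatives, and local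
  finiteness leaves finitely many loops of length at most \<open>n\<close> there.\<close>

lemma loop_area_bound: "\<exists>B. \<forall>v p. edge_path Y v p v \<longrightarrow> length p \<le> n \<longrightarrow> homotopic Y v v B p []"
proof -
  define P where "P = (\<Union>r\<in>rep ` verts Y. {r} \<times> {p. edge_path Y r p r \<and> length p \<le> n})"
  have "finite {p. edge_path Y r p r \<and> length p \<le> n}" for r
    by (rule finite_subset[OF _ finite_paths[of r n]]) auto
  then have fin: "finite P" unfolding P_def by (intro finite_UN_I finite_reps finite_cartesian_product) simp_all
  have "\<forall>x\<in>P. \<exists>N. homotopic Y (fst x) (fst x) N (snd x) []"
    using null_homotopic unfolding P_def by auto
  from bchoice[OF this] obtain N where N: "\<forall>x\<in>P. homotopic Y (fst x) (fst x) (N x) (snd x) []" by blast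
  show ?thesis
  proof (intro exI allI impI)
    fix v p assume p: "edge_path Y v p v" "length p \<le> n"
    let ?g = "inv (elt v)"
    have v: "v \<in> verts Y" using edge_path_verts[OF p(1)] by simp
    have r: "\<alpha> ?g v = rep v"
      using group_action.orbit_sym_aux[OF acts(1) elt_in[OF v] rep_in[OF v] elt_rep[OF v]] .
    have g: "?g \<in> carrier H" using v by simp
    have "edge_path Y (rep v) (map (\<beta> ?g) p) (rep v)" using edge_path_act[OF g p(1)] r by simp
    then have x: "(rep v, map (\<beta> ?g) p) \<in> P" using p v unfolding P_def by auto
    have le: "N (rep v, map (\<beta> ?g) p) \<le> Max (insert 0 (N ` P))" using fin x by (intro Max_ge) auto
    have "homotopic Y (rep v) (rep v) (Max (insert 0 (N ` P))) (map (\<beta> ?g) p) []"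
      using homotopic_mono[OF _ le] bspec[OF N x] by simp
    from homotopic_act[OF elt_in[OF v] this]
    have "homotopic Y v v (Max (insert 0 (N ` P))) (map (\<beta> (elt v)) (map (\<beta> ?g) p)) []"
      using elt_rep[OF v] by simp
    also have "map (\<beta> (elt v)) (map (\<beta> ?g) p) = map (\<beta> (elt v \<otimes> ?g)) p"
      by (rule map_act_mult[symmetric]) (use v edge_path_edges[OF p(1)] in auto)
    also have "\<dots> = p" using v map_act_one[OF edge_path_edges[OF p(1)]] by simp
    finally show "homotopic Y v v (Max (insert 0 (N ` P))) p []" .
  qed
qed

lemma dehn_function_homotopic:
  assumes "edge_path Y v p v" "length p \<le> n"
  shows "homotopic Y v v (dehn_function Y n) p []"
proof -
  let ?S = "{filling_area Y p | p. (\<exists>v. edge_path Y v p v) \<and> length p \<le> n}"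
  obtain B where B: "\<And>v p. edge_path Y v p v \<Longrightarrow> length p \<le> n \<Longrightarrow> homotopic Y v v B p []"
    using loop_area_bound by metis
  have "bdd_above ?S" by (rule bdd_aboveI[of _ B]) (use B filling_area_homotopic(1) in blast)
  then have "filling_area Y p \<le> dehn_function Y n"
    unfolding dehn_function_def by (rule cSup_upper[rotated]) (use assms in blast)
  then show ?thesis using homotopic_mono filling_area_homotopic(2)[OF B[OF assms]] by blast
qed

end

lemma (in two_complex) dehn_function_le:
  assumes "verts Y \<noteq> {}" "\<And>v p. edge_path Y v p v \<Longrightarrow> length p \<le> n \<Longrightarrow> homotopic Y v v B p []"
  shows "dehn_function Y n \<le> B"
  unfolding dehn_function_def
proof (rule cSup_least)
  obtain v where "v \<in> verts Y" using assms(1) by auto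
  then have "edge_path Y v [] v" by simp
  then have "\<exists>v. edge_path Y v [] v" by blast
  then show "{filling_area Y p | p. (\<exists>v. edge_path Y v p v) \<and> length p \<le> n} \<noteq> {}" by fastforce
  show "x \<le> B" if "x \<in> {filling_area Y p | p. (\<exists>v. edge_path Y v p v) \<and> length p \<le> n}" for x
    using that assms(2) filling_area_homotopic(1) by blast
qed

lemma finite_bound:
  assumes "finite X" "\<And>x. x \<in> X \<Longrightarrow> \<exists>n. P x n" "\<And>x m n. P x m \<Longrightarrow> m \<le> n \<Longrightarrow> P x n"
  shows "\<exists>B::nat. \<forall>x\<in>X. P x B"
proof -
  have "\<forall>x\<in>X. \<exists>n. P x n" using assms(2) by blast
  from bchoice[OF this] obtain n where n: "\<forall>x\<in>X. P x (n x)" by blast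
  have "n x \<le> Max (insert 0 (n ` X))" if "x \<in> X" for x using assms(1) that by (intro Max_ge) auto
  then show ?thesis using n assms(3) by blast
qed

section \<open>Words as paths through the orbit of the base point\<close>

context free_cocompact
begin

definition translate_path where "translate_path g = (SOME p. edge_path Y base p (\<alpha> g base))"

text \<open>A negative letter traces the translated inverse of the path chosen for the opposite
  letter, so a letter and its reverse develop to inverse paths.\<close>

definition letter_path where
  "letter_path \<mu> pos z =
    (if pos z then translate_path (\<mu> z) else map (\<beta> (\<mu> z)) (path_inv (translate_path (inv (\<mu> z)))))"

definition orbit_path where
  "orbit_path \<mu> pos = develop (\<lambda>s z. map (\<beta> s) (letter_path \<mu> pos z)) (\<lambda>s z. s \<otimes> \<mu> z)"

lemma translate_path: "g \<in> carrier H \<Longrightarrow> edge_path Y base (translate_path g) (\<alpha> g base)"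
  unfolding translate_path_def using connected_by_path[OF base_in vertex_act[OF _ base_in]] by (rule someI_ex)

lemma letter_path_path: "\<mu> z \<in> carrier H \<Longrightarrow> edge_path Y base (letter_path \<mu> pos z) (\<alpha> (\<mu> z) base)"
  using edge_path_act[OF _ edge_path_inverse[OF translate_path[of "inv (\<mu> z)"]], of "\<mu> z"]
    translate_path[of "\<mu> z"]
  by (simp add: letter_path_def vertex_act_mult[symmetric])

lemma orbit_path_path:
  assumes "\<And>z. z \<in> set p \<Longrightarrow> \<mu> z \<in> carrier H" "g \<in> carrier H"
  shows "edge_path Y (\<alpha> g base) (orbit_path \<mu> pos g p) (\<alpha> (g \<otimes> label_product H \<mu> p) base)"
  using assms
proof (induction p arbitrary: g)
  case Nil
  then show ?case by (simp add: orbit_path_def)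
next
  case (Cons z p)
  have m: "\<mu> z \<in> carrier H" "label_product H \<mu> p \<in> carrier H"
    using Cons.prems label_product_closed[of p \<mu>] by auto
  have "edge_path Y (\<alpha> g base) (map (\<beta> g) (letter_path \<mu> pos z)) (\<alpha> (g \<otimes> \<mu> z) base)"
    using edge_path_act[OF Cons.prems(2) letter_path_path[of \<mu> z pos, OF m(1)]] Cons.prems(2) m by (simp add: vertex_act_mult)
  moreover have "edge_path Y (\<alpha> (g \<otimes> \<mu> z) base) (orbit_path \<mu> pos (g \<otimes> \<mu> z) p)
      (\<alpha> (g \<otimes> \<mu> z \<otimes> label_product H \<mu> p) base)"
    by (rule Cons.IH) (use Cons.prems m in auto)
  ultimately show ?case using edge_path_append Cons.prems(2) m by (simp add: orbit_path_def m_assoc)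
qed

lemma orbit_path_translate:
  assumes "\<And>z. z \<in> set p \<Longrightarrow> \<mu> z \<in> carrier H" "g \<in> carrier H" "h \<in> carrier H"
  shows "orbit_path \<mu> pos (g \<otimes> h) p = map (\<beta> g) (orbit_path \<mu> pos h p)"
  using assms
proof (induction p arbitrary: h)
  case (Cons z p)
  have m: "\<mu> z \<in> carrier H" using Cons.prems by simp
  have "orbit_path \<mu> pos (g \<otimes> (h \<otimes> \<mu> z)) p = map (\<beta> g) (orbit_path \<mu> pos (h \<otimes> \<mu> z) p)"
    by (rule Cons.IH) (use Cons.prems m in auto)
  moreover have "map (\<beta> (g \<otimes> h)) (letter_path \<mu> pos z) = map (\<beta> g) (map (\<beta> h) (letter_path \<mu> pos z))"
    by (rule map_act_mult) (use Cons.prems edge_path_edges[OF letter_path_path[of \<mu> z pos]] m in auto)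
  ultimately show ?case using Cons.prems m by (simp add: orbit_path_def m_assoc)
qed (simp add: orbit_path_def)

lemma orbit_path_length:
  assumes "finite X" "\<And>z. z \<in> X \<Longrightarrow> \<mu> z \<in> carrier H"
  shows "\<exists>L. \<forall>z\<in>X. length (letter_path \<mu> pos z) \<le> L"
    "(\<And>z. z \<in> X \<Longrightarrow> length (letter_path \<mu> pos z) \<le> L) \<Longrightarrow> set p \<subseteq> X \<Longrightarrow> g \<in> carrier H \<Longrightarrow>
      length (orbit_path \<mu> pos g p) \<le> L * length p"
proof -
  show "\<exists>L. \<forall>z\<in>X. length (letter_path \<mu> pos z) \<le> L" by (rule finite_bound[OF assms(1)]) auto
  show "length (orbit_path \<mu> pos g p) \<le> L * length p"
    if "\<And>z. z \<in> X \<Longrightarrow> length (letter_path \<mu> pos z) \<le> L" "set p \<subseteq> X" "g \<in> carrier H"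
    unfolding orbit_path_def by (rule length_develop_le[where I = "carrier H"]) (use that assms in auto)
qed

lemma concat_label:
  assumes "\<And>e. e \<in> edges Y \<Longrightarrow> set (W e) \<subseteq> E \<and> label_product H \<mu> (W e) = edge_label e"
    "\<And>z. z \<in> E \<Longrightarrow> \<mu> z \<in> carrier H" "set p \<subseteq> edges Y"
  shows "set (concat (map W p)) \<subseteq> E \<and> label_product H \<mu> (concat (map W p)) = label_product H edge_label p"
  using assms(3)
proof (induction p)
  case (Cons e p)
  have "label_product H \<mu> (W e @ concat (map W p)) = label_product H \<mu> (W e) \<otimes> label_product H \<mu> (concat (map W p))"
    by (rule label_product_append) (use assms(1)[of e] assms(2) Cons in auto)
  then show ?case using Cons assms(1)[of e] by auto
qed simp

lemma loop_label:
  assumes "edge_path Y v p v"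
  shows "label_product H edge_label p = \<one>"
proof -
  have "label_product H edge_label p \<in> carrier H"
    by (rule label_product_closed) (use edge_path_edges[OF assms] in auto)
  moreover have "elt v \<in> carrier H" using edge_path_verts[OF assms] by simp
  ultimately show ?thesis using path_label[OF assms] l_cancel_one[of "elt v"] by simp
qed

text \<open>A trivial word is developed into a loop of \<open>Y\<close>, filled there, and the
  filling is mapped back. A face of \<open>Y\<close> becomes a short trivial word and costs one
  face; comparing the word with its image costs one face per letter, whence the summand
  \<open>length p\<close>. All complexes \<open>Zs K\<close> have the same edges, so the constants
  are found before \<open>K\<close> is chosen.\<close>

theorem word_area_le_dehn:
  fixes Zs :: "nat \<Rightarrow> ('w, 'd, 'g) complex2"
  assumes lab: "\<And>K. labelled_complex (Zs K) H \<mu> pos"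
    and verts: "\<And>K. verts (Zs K) = {z0}" and edges: "\<And>K. edges (Zs K) = E"
    and rvs: "\<And>K. rv (Zs K) = r" and fin: "finite E"
    and gen: "\<And>g. g \<in> carrier H \<Longrightarrow> \<exists>p. set p \<subseteq> E \<and> label_product H \<mu> p = g"
    and full: "\<And>K p. set p \<subseteq> E \<Longrightarrow> label_product H \<mu> p = \<one> \<Longrightarrow> length p \<le> K \<Longrightarrow> homotopic (Zs K) z0 z0 1 p []"
  shows "\<exists>K0 L. \<forall>K\<ge>K0. \<forall>p. set p \<subseteq> E \<longrightarrow> label_product H \<mu> p = \<one> \<longrightarrow>
    homotopic (Zs K) z0 z0 (dehn_function Y (L * length p) + length p) p []"
proof -
  have c: "two_complex (Zs K)" for K using lab[of K] unfolding labelled_complex_def by simp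
  have mu: "\<mu> z \<in> carrier H" if "z \<in> E" for z using labelled_complex.label_closed[OF lab] edges that by metis
  let ?ri = "\<lambda>p. rev (map r p)"
  have ri: "path_inverse (Zs K) p = ?ri p" for K p unfolding path_inverse_def rvs ..
  have riE: "set (?ri p) \<subseteq> E \<and> ?ri (?ri p) = p \<and> label_product H \<mu> (?ri p) = inv (label_product H \<mu> p)"
    if "set p \<subseteq> E" for p
    using two_complex.path_inverse_edges[OF c[of 0], of p] two_complex.path_inverse_inverse[OF c[of 0], of p]
      labelled_complex.path_label_inverse[OF lab[of 0], of p] that unfolding ri edges by simp
  have path: "edge_path (Zs K) z0 p z0" if "set p \<subseteq> E" for K p
    using that
  proof (induction p)
    case (Cons z p)
    then have "z \<in> edges (Zs K)" using edges by auto
    then have "src (Zs K) z = z0" "tgt (Zs K) z = z0"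
      using two_complex.src_in[OF c] two_complex.tgt_in[OF c] verts by (metis singletonD)+
    then show ?case using Cons edges by simp
  qed (simp add: verts)
  define W where "W g = (SOME p. set p \<subseteq> E \<and> label_product H \<mu> p = g)" for g
  have W: "set (W g) \<subseteq> E \<and> label_product H \<mu> (W g) = g" if "g \<in> carrier H" for g
    unfolding W_def by (rule someI_ex[OF gen[OF that]])
  \<comment> \<open>Words are chosen for oriented edges only and inverted on the others, so that
    reversing an edge inverts its word literally.\<close>
  define \<Phi> where "\<Phi> e = (if oriented e then W (edge_label e) else ?ri (W (inv (edge_label e))))" for e
  have \<Phi>: "set (\<Phi> e) \<subseteq> E \<and> label_product H \<mu> (\<Phi> e) = edge_label e" if "e \<in> edges Y" for e
    using W[OF edge_label_in[OF that]] W[OF inv_closed[OF edge_label_in[OF that]]]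
      riE[of "W (inv (edge_label e))"] that unfolding \<Phi>_def by simp
  have \<Phi>_rv: "\<Phi> (rv Y e) = ?ri (\<Phi> e)" if "e \<in> edges Y" for e
    using that oriented_rv[OF that] edge_label_rv[OF that] riE[of "W (inv (edge_label e))"]
      W[OF inv_closed[OF edge_label_in[OF that]]] unfolding \<Phi>_def by simp
  have \<Phi>_act: "\<Phi> (\<beta> h e) = \<Phi> e" if "h \<in> carrier H" "e \<in> edges Y" for h e
    using that by (simp add: \<Phi>_def edge_label_act oriented_act)
  have \<Phi>cl: "set (concat (map \<Phi> p)) \<subseteq> E \<and> label_product H \<mu> (concat (map \<Phi> p)) = label_product H edge_label p"
    if "set p \<subseteq> edges Y" for p
    by (rule concat_label[OF \<Phi> mu that])
  have "\<exists>L. \<forall>e\<in>edges Y. length (\<Phi> e) \<le> L"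
    by (rule finite_orbits_bound[OF acts(2) finite_orbits(2)]) (auto simp: \<Phi>_act)
  then obtain L1 where L1: "\<And>e. e \<in> edges Y \<Longrightarrow> length (\<Phi> e) \<le> L1" by blast
  have \<Phi>len: "length (concat (map \<Phi> p)) \<le> L1 * length p" if "set p \<subseteq> edges Y" for p
    by (rule length_concat_map_le) (use L1 that in auto)
  obtain L where L: "\<And>z. z \<in> E \<Longrightarrow> length (letter_path \<mu> pos z) \<le> L"
    using orbit_path_length(1)[of E \<mu> pos] fin mu by blast
  obtain bL where bL: "\<And>f. f \<in> faces Y \<Longrightarrow> length (bdry Y f) \<le> bL" using face_length_bound by blast
  \<comment> \<open>Room for the word of a face boundary, of length at most \<open>L1 * bL\<close>,
    and for a letter followed by the inverse of its round trip through \<open>Y\<close>, of length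
    at most \<open>1 + L1 * L\<close>.\<close>
  define K0 where "K0 = L1 * bL + (1 + L1 * L)"
  have "homotopic (Zs K) z0 z0 (dehn_function Y (L * length p) + length p) p []"
    if K: "K \<ge> K0" and p: "set p \<subseteq> E" "label_product H \<mu> p = \<one>" for K p
  proof -
    interpret Z: two_complex "Zs K" by (rule c)
    interpret dev: developing_map Y "Zs K" "{()}" "\<lambda>_. \<Phi>" "\<lambda>_ _. ()" "\<lambda>_ _. z0" 1
    proof unfold_locales
      fix s :: unit and e assume e: "e \<in> edges Y"
      show "edge_path (Zs K) z0 (\<Phi> e) z0" by (rule path) (use \<Phi>[OF e] in simp)
      show "\<Phi> (rv Y e) = path_inverse (Zs K) (\<Phi> e)" using \<Phi>_rv[OF e] ri by simp
    next
      fix s :: unit and f u assume f: "f \<in> faces Y" "edge_path Y u (bdry Y f) u"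
      note E = edge_path_edges[OF f(2)]
      have "length (concat (map \<Phi> (bdry Y f))) \<le> L1 * bL"
        using \<Phi>len[OF E] mult_le_mono2[OF bL[OF f(1)], of L1] by linarith
      then have "homotopic (Zs K) z0 z0 1 (concat (map \<Phi> (bdry Y f))) []"
        by (intro full) (use \<Phi>cl[OF E] loop_label[OF f(2)] K in \<open>auto simp: K0_def\<close>)
      then show "homotopic (Zs K) z0 z0 1 (develop (\<lambda>_. \<Phi>) (\<lambda>_ _. ()) s (bdry Y f)) []"
        by (simp add: develop_stateless)
    qed (simp_all add: verts)
    \<comment> \<open>The round trip turns each letter into a word with the same label, so one short
      loop per letter repairs the difference.\<close>
    have letters: "homotopic (Zs K) z0 z0 (length q) q (concat (map \<Phi> (orbit_path \<mu> pos s q)))"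
      if "set q \<subseteq> E" "s \<in> carrier H" for q s
      using that
    proof (induction q arbitrary: s)
      case Nil
      then show ?case by (auto simp: orbit_path_def verts intro: homotopic.refl)
    next
      case (Cons z q)
      then have z: "z \<in> E" "\<mu> z \<in> carrier H" using mu by auto
      let ?l = "letter_path \<mu> pos z"
      have lp: "edge_path Y base ?l (\<alpha> (\<mu> z) base)" by (rule letter_path_path[of \<mu> z pos, OF z(2)])
      note lE = edge_path_edges[OF lp]
      have "label_product H edge_label ?l \<in> carrier H"
        by (rule label_product_closed) (use lE in auto)
      then have ll: "label_product H \<mu> (concat (map \<Phi> ?l)) = \<mu> z"
        using path_label[OF lp] \<Phi>cl[OF lE] elt_act[OF z(2) base_in] z by simp
      let ?w = "[z] @ ?ri (concat (map \<Phi> ?l))"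
      have "length (concat (map \<Phi> ?l)) \<le> L1 * L"
        using \<Phi>len[OF lE] mult_le_mono2[OF L[OF z(1)], of L1] by linarith
      then have "homotopic (Zs K) z0 z0 1 ?w []"
        by (intro full) (use riE[of "concat (map \<Phi> ?l)"] \<Phi>cl[OF lE] ll z K in \<open>auto simp: K0_def\<close>)
      then have loop: "homotopic (Zs K) z0 z0 1 ([z] @ path_inverse (Zs K) (concat (map \<Phi> ?l))) []"
        unfolding ri .
      have p1: "edge_path (Zs K) z0 [z] z0" by (rule path) (use z in simp)
      have p2: "edge_path (Zs K) z0 (concat (map \<Phi> ?l)) z0" by (rule path) (rule conjunct1[OF \<Phi>cl[OF lE]])
      have "homotopic (Zs K) z0 z0 1 [z] (concat (map \<Phi> ?l))" by (rule Z.homotopic_of_loop[OF p1 p2 loop])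
      moreover have "map \<Phi> (map (\<beta> s) ?l) = map \<Phi> ?l"
        unfolding map_map by (rule map_cong) (use \<Phi>_act Cons.prems lE in auto)
      ultimately have "homotopic (Zs K) z0 z0 1 [z] (concat (map \<Phi> (map (\<beta> s) ?l)))" by (simp only:)
      moreover have "homotopic (Zs K) z0 z0 (length q) q (concat (map \<Phi> (orbit_path \<mu> pos (s \<otimes> \<mu> z) q)))"
        by (rule Cons.IH) (use Cons.prems z in auto)
      ultimately have "homotopic (Zs K) z0 z0 (1 + length q) ([z] @ q)
         (concat (map \<Phi> (map (\<beta> s) ?l)) @ concat (map \<Phi> (orbit_path \<mu> pos (s \<otimes> \<mu> z) q)))"
        by (rule Z.homotopic_append)
      then show ?case by (simp add: orbit_path_def)
    qed
    have "edge_path Y (\<alpha> \<one> base) (orbit_path \<mu> pos \<one> p) (\<alpha> (\<one> \<otimes> label_product H \<mu> p) base)"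
      by (rule orbit_path_path) (use p mu in auto)
    then have loop: "edge_path Y base (orbit_path \<mu> pos \<one> p) base" using p by simp
    have "length (orbit_path \<mu> pos \<one> p) \<le> L * length p"
      using orbit_path_length(2)[of E \<mu> pos L p \<one>] fin mu L p by blast
    from dev.develop_homotopic[OF dehn_function_homotopic[OF loop this], of "()"]
    have "homotopic (Zs K) z0 z0 (dehn_function Y (L * length p)) (concat (map \<Phi> (orbit_path \<mu> pos \<one> p))) []"
      by (simp add: develop_stateless)
    from Z.homotopic_trans[OF letters[OF p(1) one_closed] this] show ?thesis by (simp add: add.commute)
  qed
  then show ?thesis by blast
qed

end

section \<open>Filling loops of an arbitrary complex through a labelled one\<close>

locale labelled_action = free_cocompact Y H \<alpha> \<beta> \<gamma> + Z: labelled_complex Z H \<mu> pos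
  for Y :: "('v, 'e, 'f) complex2" and H :: "('a, 'm) monoid_scheme" (structure) and \<alpha> \<beta> \<gamma>
    and Z :: "('w, 'd, 'g) complex2" and \<mu> :: "'d \<Rightarrow> 'a" and pos :: "'d \<Rightarrow> bool"
begin

lemma letter_path_rv:
  assumes "z \<in> edges Z" "s \<in> carrier H"
  shows "map (\<beta> (s \<otimes> \<mu> z)) (letter_path \<mu> pos (rv Z z)) = path_inv (map (\<beta> s) (letter_path \<mu> pos z))"
proof -
  have m: "\<mu> z \<in> carrier H" "\<mu> (rv Z z) = inv (\<mu> z)" using Z.label_closed Z.label_rv assms(1) by auto
  have E: "set (translate_path g) \<subseteq> edges Y" if "g \<in> carrier H" for g
    using edge_path_edges[OF translate_path[OF that]] .
  show ?thesis
  proof (cases "pos z")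
    case True
    let ?T = "translate_path (\<mu> z)"
    have T: "set ?T \<subseteq> edges Y" "set (path_inv ?T) \<subseteq> edges Y" using E[OF m(1)] path_inverse_edges by auto
    have "letter_path \<mu> pos (rv Z z) = map (\<beta> (inv (\<mu> z))) (path_inv ?T)"
      using True Z.pos_rv[OF assms(1)] m by (simp add: letter_path_def)
    then have "map (\<beta> (s \<otimes> \<mu> z)) (letter_path \<mu> pos (rv Z z)) = map (\<beta> ((s \<otimes> \<mu> z) \<otimes> inv (\<mu> z))) (path_inv ?T)"
      using map_act_mult[of "s \<otimes> \<mu> z" "inv (\<mu> z)" "path_inv ?T"] m assms(2) T by simp
    also have "(s \<otimes> \<mu> z) \<otimes> inv (\<mu> z) = s" using m assms(2) by (simp add: m_assoc)
    finally show ?thesis using True path_inverse_act[OF assms(2) T(1)] by (simp add: letter_path_def)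
  next
    case False
    let ?T = "translate_path (inv (\<mu> z))"
    have T: "set ?T \<subseteq> edges Y" "set (path_inv ?T) \<subseteq> edges Y" "set (map (\<beta> (\<mu> z)) (path_inv ?T)) \<subseteq> edges Y"
      using E[of "inv (\<mu> z)"] path_inverse_edges map_act_edges m by auto
    have "letter_path \<mu> pos (rv Z z) = ?T" "letter_path \<mu> pos z = map (\<beta> (\<mu> z)) (path_inv ?T)"
      using False Z.pos_rv[OF assms(1)] m by (simp_all add: letter_path_def)
    moreover have "path_inv (map (\<beta> s) (map (\<beta> (\<mu> z)) (path_inv ?T))) = map (\<beta> s) (map (\<beta> (\<mu> z)) ?T)"
      using path_inverse_act[OF assms(2) T(3)] path_inverse_act[OF m(1) T(2)] path_inverse_inverse[OF T(1)] by simp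
    ultimately show ?thesis using map_act_mult[OF assms(2) m(1) T(1)] by simp
  qed
qed

text \<open>The development of \<open>Z\<close> into \<open>Y\<close> along the orbit of
  \<open>base\<close>, with group elements as states. The label of a face is \<open>\<one>\<close>,
  so its development is closed, and by equivariance the bound \<open>B\<close> at
  \<open>base\<close> holds at every translate.\<close>

lemma orbit_path_homotopic:
  assumes B: "\<And>f. f \<in> faces Z \<Longrightarrow> homotopic Y base base B (orbit_path \<mu> pos \<one> (bdry Z f)) []"
    and pq: "homotopic Z u v N p q" and g: "g \<in> carrier H"
  shows "homotopic Y (\<alpha> g base) (\<alpha> (g \<otimes> label_product H \<mu> p) base) (B * N) (orbit_path \<mu> pos g p) (orbit_path \<mu> pos g q)"
proof -
  interpret dev: developing_map Z Y "carrier H" "\<lambda>s z. map (\<beta> s) (letter_path \<mu> pos z)" "\<lambda>s z. s \<otimes> \<mu> z"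
    "\<lambda>s u. \<alpha> s base" B
  proof unfold_locales
    fix s z assume sz: "s \<in> carrier H" "z \<in> edges Z"
    note m = Z.label_closed[OF sz(2)]
    show "s \<otimes> \<mu> z \<in> carrier H" using sz m by simp
    show "edge_path Y (\<alpha> s base) (map (\<beta> s) (letter_path \<mu> pos z)) (\<alpha> (s \<otimes> \<mu> z) base)"
      using edge_path_act[OF sz(1) letter_path_path[of \<mu> z pos, OF m]] sz m by (simp add: vertex_act_mult)
    show "s \<otimes> \<mu> z \<otimes> \<mu> (rv Z z) = s" using sz m Z.label_rv[OF sz(2)] by (simp add: m_assoc)
    show "map (\<beta> (s \<otimes> \<mu> z)) (letter_path \<mu> pos (rv Z z)) = path_inv (map (\<beta> s) (letter_path \<mu> pos z))"
      by (rule letter_path_rv[OF sz(2,1)])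
  next
    fix s f assume sf: "s \<in> carrier H" "f \<in> faces Z"
    obtain u where u: "edge_path Z u (bdry Z f) u" using Z.face_loop[OF sf(2)] by blast
    have m: "\<And>z. z \<in> set (bdry Z f) \<Longrightarrow> \<mu> z \<in> carrier H" using Z.edge_path_edges[OF u] Z.label_closed by auto
    have "foldl (\<lambda>s z. s \<otimes> \<mu> z) s (bdry Z f) = s \<otimes> label_product H \<mu> (bdry Z f)"
      by (rule label_product_foldl) (use m sf in auto)
    then show "foldl (\<lambda>s z. s \<otimes> \<mu> z) s (bdry Z f) = s" using Z.label_face[OF sf(2)] sf(1) by simp
    have "orbit_path \<mu> pos (s \<otimes> \<one>) (bdry Z f) = map (\<beta> s) (orbit_path \<mu> pos \<one> (bdry Z f))"
      by (rule orbit_path_translate) (use m sf in auto)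
    then show "homotopic Y (\<alpha> s base) (\<alpha> s base) B
       (develop (\<lambda>s z. map (\<beta> s) (letter_path \<mu> pos z)) (\<lambda>s z. s \<otimes> \<mu> z) s (bdry Z f)) []"
      using homotopic_act[OF sf(1) B[OF sf(2)]] sf(1) by (simp add: orbit_path_def)
  qed (simp_all)
  have fl: "foldl (\<lambda>s z. s \<otimes> \<mu> z) g p = g \<otimes> label_product H \<mu> p"
    by (rule label_product_foldl) (use Z.edge_path_edges[OF conjunct1[OF Z.homotopic_path[OF pq]]] Z.label_closed g in auto)
  show ?thesis using conjunct2[OF dev.develop_homotopic[OF pq g]] unfolding orbit_path_def fl .
qed

text \<open>The comparison opposite to \<open>word_area_le_dehn\<close>. The edge labels of a loop
  in \<open>Y\<close> are spelled as loops at \<open>z0\<close>, the resulting loop is filled in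
  \<open>Z\<close>, and the filling is developed into \<open>Y\<close>, where each face has bounded
  area. It remains to compare each edge with its image, at bounded cost.\<close>

theorem filling_from_complex:
  assumes "finite (edges Z)" "finite (faces Z)" "z0 \<in> verts Z"
    and gen: "\<And>g. g \<in> carrier H \<Longrightarrow> \<exists>p. edge_path Z z0 p z0 \<and> label_product H \<mu> p = g"
    and A: "\<And>p m. edge_path Z z0 p z0 \<Longrightarrow> label_product H \<mu> p = \<one> \<Longrightarrow> length p \<le> m \<Longrightarrow> homotopic Z z0 z0 (A m) p []"
  shows "\<exists>C. \<forall>v p n. edge_path Y v p v \<longrightarrow> length p \<le> n \<longrightarrow> homotopic Y v v (C * A (C * n) + C * n) p []"
proof -
  define W where "W g = (SOME p. edge_path Z z0 p z0 \<and> label_product H \<mu> p = g)" for g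
  have W: "edge_path Z z0 (W g) z0 \<and> label_product H \<mu> (W g) = g" if "g \<in> carrier H" for g
    unfolding W_def by (rule someI_ex[OF gen[OF that]])
  let ?W = "\<lambda>e. W (edge_label e)"
  have Wl: "set (?W e) \<subseteq> edges Z \<and> label_product H \<mu> (?W e) = edge_label e" if "e \<in> edges Y" for e
    using W[OF edge_label_in[OF that]] Z.edge_path_edges by blast
  have Wcl: "set (concat (map ?W p)) \<subseteq> edges Z \<and> label_product H \<mu> (concat (map ?W p)) = label_product H edge_label p"
    if "set p \<subseteq> edges Y" for p
    by (rule concat_label[OF Wl Z.label_closed that])
  have Wpath: "edge_path Z z0 (concat (map ?W p)) z0" if "set p \<subseteq> edges Y" for p
    using that
  proof (induction p)
    case Nil
    then show ?case using assms(3) by simp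
  next
    case (Cons e p)
    then have e: "e \<in> edges Y" "edge_path Z z0 (concat (map ?W p)) z0" by auto
    show ?case using Z.edge_path_append[OF conjunct1[OF W[OF edge_label_in[OF e(1)]]] e(2)] by simp
  qed
  have "\<exists>L. \<forall>e\<in>edges Y. length (?W e) \<le> L"
    by (rule finite_orbits_bound[OF acts(2) finite_orbits(2)]) (auto simp: edge_label_act)
  then obtain L where L: "\<And>e. e \<in> edges Y \<Longrightarrow> length (?W e) \<le> L" by blast
  have "\<exists>B. \<forall>f\<in>faces Z. homotopic Y base base B (orbit_path \<mu> pos \<one> (bdry Z f)) []"
  proof (rule finite_bound[OF assms(2)])
    fix f assume f: "f \<in> faces Z"
    obtain u where u: "edge_path Z u (bdry Z f) u" using Z.face_loop[OF f] by blast
    have "edge_path Y (\<alpha> \<one> base) (orbit_path \<mu> pos \<one> (bdry Z f)) (\<alpha> (\<one> \<otimes> label_product H \<mu> (bdry Z f)) base)"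
      by (rule orbit_path_path) (use Z.edge_path_edges[OF u] Z.label_closed in auto)
    then have "edge_path Y base (orbit_path \<mu> pos \<one> (bdry Z f)) base" using Z.label_face[OF f] by simp
    then show "\<exists>B. homotopic Y base base B (orbit_path \<mu> pos \<one> (bdry Z f)) []" by (rule null_homotopic)
  qed (rule homotopic_mono)
  then obtain B where B: "\<And>f. f \<in> faces Z \<Longrightarrow> homotopic Y base base B (orbit_path \<mu> pos \<one> (bdry Z f)) []" by blast
  \<comment> \<open>The round trip of \<open>e\<close>: back from its source to the translate of
    \<open>base\<close>, along the developed word, and forward to its target. It commutes with the
    action, so a single area bound holds for all edges.\<close>
  let ?R = "\<lambda>e. path_inv (conn (src Y e)) @ orbit_path \<mu> pos (elt (src Y e)) (?W e) @ conn (tgt Y e)"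
  have Ppath: "edge_path Y (\<alpha> (elt u) base) (orbit_path \<mu> pos (elt u) (concat (map ?W p))) (\<alpha> (elt v) base)"
    if p: "edge_path Y u p v" for u p v
  proof -
    note c = Wcl[OF edge_path_edges[OF p]]
    have "edge_path Y (\<alpha> (elt u) base) (orbit_path \<mu> pos (elt u) (concat (map ?W p)))
       (\<alpha> (elt u \<otimes> label_product H \<mu> (concat (map ?W p))) base)"
      by (rule orbit_path_path) (use c Z.label_closed edge_path_verts[OF p] in auto)
    then show ?thesis using c path_label[OF p] by simp
  qed
  have Opath: "edge_path Y (\<alpha> (elt (src Y e)) base) (orbit_path \<mu> pos (elt (src Y e)) (?W e)) (\<alpha> (elt (tgt Y e)) base)"
    if "e \<in> edges Y" for e using Ppath[of "src Y e" "[e]" "tgt Y e"] that by simp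
  have Rpath: "edge_path Y (src Y e) (?R e) (tgt Y e)" if e: "e \<in> edges Y" for e
    using edge_path_append[OF edge_path_inverse[OF conn_path[OF src_in[OF e]]]
      edge_path_append[OF Opath[OF e] conn_path[OF tgt_in[OF e]]]] .
  have "\<exists>B. \<forall>e\<in>edges Y. homotopic Y (src Y e) (tgt Y e) B [e] (?R e)"
  proof (rule finite_orbits_bound[OF acts(2) finite_orbits(2)])
    fix e assume e: "e \<in> edges Y"
    show "\<exists>n. homotopic Y (src Y e) (tgt Y e) n [e] (?R e)"
      by (rule homotopic_exists[OF _ Rpath[OF e]]) (use e in simp)
  next
    fix h e n assume h: "h \<in> carrier H" "e \<in> edges Y" and hom: "homotopic Y (src Y e) (tgt Y e) n [e] (?R e)"
    have "orbit_path \<mu> pos (h \<otimes> elt (src Y e)) (?W e) = map (\<beta> h) (orbit_path \<mu> pos (elt (src Y e)) (?W e))"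
      by (rule orbit_path_translate) (use Wl[OF h(2)] Z.label_closed h in auto)
    moreover have "path_inv (map (\<beta> h) (conn (src Y e))) = map (\<beta> h) (path_inv (conn (src Y e)))"
      by (rule path_inverse_act[OF h(1) edge_path_edges[OF conn_path]]) (use h in simp)
    ultimately have "?R (\<beta> h e) = map (\<beta> h) (?R e)"
      using h by (simp add: conn_act elt_act edge_label_act)
    then show "homotopic Y (src Y (\<beta> h e)) (tgt Y (\<beta> h e)) n [\<beta> h e] (?R (\<beta> h e))"
      using homotopic_act[OF h(1) hom] h by simp
  qed (rule homotopic_mono)
  then obtain D where D: "\<And>e. e \<in> edges Y \<Longrightarrow> homotopic Y (src Y e) (tgt Y e) D [e] (?R e)" by blast
  have main: "homotopic Y u v (D * length p) p
      (path_inv (conn u) @ orbit_path \<mu> pos (elt u) (concat (map ?W p)) @ conn v)" if "edge_path Y u p v" for u v p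
    using that
  proof (induction p arbitrary: u)
    case Nil
    then have u: "u = v" "u \<in> verts Y" by auto
    show ?case using homotopic_sym[OF homotopic_cancel'[OF conn_path[OF u(2)], of 0]] u by (simp add: orbit_path_def)
  next
    case (Cons e p)
    then have e: "e \<in> edges Y" "src Y e = u" and p: "edge_path Y (tgt Y e) p v" by auto
    let ?O = "orbit_path \<mu> pos (elt u) (?W e)" and ?P = "orbit_path \<mu> pos (elt (tgt Y e)) (concat (map ?W p))"
    have E: "homotopic Y u (tgt Y e) D [e] (path_inv (conn u) @ ?O @ conn (tgt Y e))" using D[OF e(1)] e(2) by simp
    have "homotopic Y u v (D + D * length p) ([e] @ p)
       ((path_inv (conn u) @ ?O @ conn (tgt Y e)) @ path_inv (conn (tgt Y e)) @ ?P @ conn v)"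
      by (rule homotopic_append[OF E Cons.IH[OF p]])
    then have 1: "homotopic Y u v (D * length (e # p)) (e # p)
       ((path_inv (conn u) @ ?O) @ (conn (tgt Y e) @ path_inv (conn (tgt Y e))) @ (?P @ conn v))" by simp
    \<comment> \<open>Consecutive round trips telescope: the connecting path to the common vertex is
      followed by its own inverse.\<close>
    have "homotopic Y (\<alpha> (elt (tgt Y e)) base) (\<alpha> (elt (tgt Y e)) base) 0 (conn (tgt Y e) @ path_inv (conn (tgt Y e))) []"
      by (rule homotopic_cancel[OF conn_path]) (use e in simp)
    moreover have "edge_path Y u (path_inv (conn u) @ ?O) (\<alpha> (elt (tgt Y e)) base)"
      using edge_path_append[OF edge_path_inverse[OF conn_path[OF src_in[OF e(1)]]] Opath[OF e(1)]] e(2) by simp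
    moreover have "edge_path Y (\<alpha> (elt (tgt Y e)) base) (?P @ conn v) v"
      using edge_path_append[OF Ppath[OF p] conn_path[OF conjunct2[OF edge_path_verts[OF p]]]] .
    ultimately have "homotopic Y u v 0
       ((path_inv (conn u) @ ?O) @ (conn (tgt Y e) @ path_inv (conn (tgt Y e))) @ (?P @ conn v))
       ((path_inv (conn u) @ ?O) @ [] @ (?P @ conn v))"
      by (rule homotopic_context)
    from homotopic_trans[OF 1 this]
    have 2: "homotopic Y u v (D * length (e # p)) (e # p) (path_inv (conn u) @ (?O @ ?P) @ conn v)" by simp
    have "foldl (\<lambda>s z. s \<otimes> \<mu> z) (elt u) (?W e) = elt u \<otimes> label_product H \<mu> (?W e)"
      by (rule label_product_foldl) (use Wl[OF e(1)] Z.label_closed e src_in[OF e(1)] in auto)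
    also have "\<dots> = elt (tgt Y e)" using Wl[OF e(1)] elt_tgt[OF e(1)] e(2) by simp
    finally have "orbit_path \<mu> pos (elt u) (concat (map ?W (e # p))) = ?O @ ?P"
      by (simp add: orbit_path_def develop_append)
    then show ?case using 2 by simp
  qed
  \<comment> \<open>\<open>L\<close> bounds the words of edges, \<open>B\<close> the area of a
    developed face, and \<open>D\<close> the area between an edge and its round trip.\<close>
  define C where "C = D + B + L"
  show ?thesis
  proof (intro exI allI impI)
    fix v p n assume p: "edge_path Y v p v" and n: "length p \<le> n"
    note pE = edge_path_edges[OF p]
    have v: "v \<in> verts Y" using edge_path_verts[OF p] by simp
    have lab: "label_product H \<mu> (concat (map ?W p)) = \<one>" using Wcl[OF pE] loop_label[OF p] by simp
    have "length (concat (map ?W p)) \<le> L * length p" by (rule length_concat_map_le) (use L pE in auto)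
    also have "\<dots> \<le> C * n" using n unfolding C_def by (intro mult_mono) auto
    finally have len: "length (concat (map ?W p)) \<le> C * n" .
    from orbit_path_homotopic[OF B A[OF Wpath[OF pE] lab len] elt_in[OF v]]
    have 1: "homotopic Y (\<alpha> (elt v) base) (\<alpha> (elt v) base) (B * A (C * n)) (orbit_path \<mu> pos (elt v) (concat (map ?W p))) []"
      using lab v by (simp add: orbit_path_def)
    from homotopic_context[OF 1 edge_path_inverse[OF conn_path[OF v]] conn_path[OF v]]
    have "homotopic Y v v (B * A (C * n)) (path_inv (conn v) @ orbit_path \<mu> pos (elt v) (concat (map ?W p)) @ conn v)
      (path_inv (conn v) @ conn v)" by simp
    from homotopic_trans[OF homotopic_trans[OF main[OF p] this] homotopic_cancel'[OF conn_path[OF v], of 0]]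
    have hom: "homotopic Y v v (D * length p + B * A (C * n)) p []" by simp
    moreover have "D * length p \<le> C * n" "B * A (C * n) \<le> C * A (C * n)"
      using n unfolding C_def by (intro mult_mono; simp)+
    ultimately show "homotopic Y v v (C * A (C * n) + C * n) p []" by (intro homotopic_mono[OF hom]) linarith
  qed
qed

end

section \<open>Words in a graph of groups\<close>

text \<open>Loop erasure: whenever the next vertex has been visited before, the list is cut back to
  that visit.\<close>

lemma rtranclp_distinct_list:
  assumes "r\<^sup>*\<^sup>* y v"
  shows "\<exists>xs. xs \<noteq> [] \<and> distinct xs \<and> hd xs = y \<and> last xs = v \<and> successively r xs"
  using assms
proof (induction rule: rtranclp_induct)
  case base
  then show ?case by (intro exI[of _ "[y]"]) simp
next
  case (step w z)
  then obtain xs where xs: "xs \<noteq> []" "distinct xs" "hd xs = y" "last xs = w" "successively r xs" by blast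
  show ?case
  proof (cases "z \<in> set xs")
    case True
    then obtain as bs where ab: "xs = as @ z # bs" by (meson split_list)
    have "successively r (as @ [z])" using xs(5) unfolding ab by (auto simp: successively_append_iff successively_Cons)
    moreover have "hd (as @ [z]) = y" using xs(3) unfolding ab by (cases as) auto
    ultimately show ?thesis using xs(2) unfolding ab by (intro exI[of _ "as @ [z]"]) auto
  next
    case False
    have "successively r (xs @ [z])" using xs step.hyps(2) by (auto simp: successively_append_iff)
    then show ?thesis using xs False by (intro exI[of _ "xs @ [z]"]) auto
  qed
qed

text \<open>A walk avoiding this directed edge, made free of repetitions, has at least three
  vertices, since \<open>[y, v]\<close> is ruled out. Together with the edge \<open>{v, y}\<close>
  it would close up to a circuit.\<close>

lemma tree_crossing:
  assumes "is_tree V E" "{y, v} \<in> E" "y \<noteq> v"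
  shows "\<not> (\<lambda>a b. {a, b} \<in> E \<and> (a, b) \<noteq> (y, v))\<^sup>*\<^sup>* y v"
proof
  let ?r = "\<lambda>a b. {a, b} \<in> E \<and> (a, b) \<noteq> (y, v)"
  assume "?r\<^sup>*\<^sup>* y v"
  from rtranclp_distinct_list[OF this]
  obtain xs where xs: "xs \<noteq> []" "distinct xs" "hd xs = y" "last xs = v" "successively ?r xs"
    by (elim exE conjE)
  have E: "successively (\<lambda>u v. {u, v} \<in> E) xs" by (rule successively_mono[OF xs(5)]) simp
  have "length xs \<ge> 3"
  proof (rule ccontr)
    assume "\<not> length xs \<ge> 3"
    moreover have "length xs \<noteq> 0" using xs(1) by simp
    ultimately have "length xs = 1 \<or> length xs = 2" by linarith
    then consider "length xs = 1" | "length xs = 2" by blast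
    then show False
    proof cases
      case 1
      then show False using xs(3,4) assms(3) by (auto simp: length_Suc_conv)
    next
      case 2
      then obtain a b where "xs = [a, b]" by (auto simp: length_Suc_conv numeral_2_eq_2)
      then show False using xs(3,4,5) by simp
    qed
  qed
  moreover have "{last xs, hd xs} \<in> E" using xs(3,4) assms(2) by (simp add: insert_commute)
  ultimately show False using assms(1) xs(2) E unfolding is_tree_def by blast
qed

lemma word_eval_label: "word_eval G w = label_product G (\<lambda>(s, b). if b then s else inv\<^bsub>G\<^esub> s) w"
  by (induction w) auto

context group
begin

lemma word_eval_closed: "set w \<subseteq> S \<times> UNIV \<Longrightarrow> S \<subseteq> carrier G \<Longrightarrow> word_eval G w \<in> carrier G"
  by (induction w) auto

lemma word_eval_append:
  "set w \<subseteq> S \<times> UNIV \<Longrightarrow> set w' \<subseteq> S \<times> UNIV \<Longrightarrow> S \<subseteq> carrier G \<Longrightarrow>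
    word_eval G (w @ w') = word_eval G w \<otimes> word_eval G w'"
proof (induction w)
  case Nil
  then show ?case using word_eval_closed[of w' S] by simp
next
  case (Cons x w)
  obtain s b where x: "x = (s, b)" by (cases x)
  have "s \<in> carrier G" "word_eval G w \<in> carrier G" "word_eval G w' \<in> carrier G"
    using Cons.prems x word_eval_closed[of w S] word_eval_closed[of w' S] by auto
  then show ?case using Cons x by (simp add: m_assoc)
qed

lemma word_exists:
  assumes "finite_generating_set G S" "g \<in> carrier G"
  shows "\<exists>w. set w \<subseteq> S \<times> UNIV \<and> word_eval G w = g"
proof -
  have S: "S \<subseteq> carrier G" and "g \<in> generate G S" using assms unfolding finite_generating_set_def by auto
  from this(2) show ?thesis
  proof (induction rule: generate.induct)
    case one
    then show ?case by (intro exI[of _ "[]"]) simp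
  next
    case (incl h)
    then show ?case using S by (intro exI[of _ "[(h, True)]"]) auto
  next
    case (inv h)
    then show ?case using S by (intro exI[of _ "[(h, False)]"]) auto
  next
    case (eng h1 h2)
    then obtain w1 w2 where "set w1 \<subseteq> S \<times> UNIV" "word_eval G w1 = h1" "set w2 \<subseteq> S \<times> UNIV" "word_eval G w2 = h2" by blast
    then show ?case using word_eval_append[OF _ _ S] by (intro exI[of _ "w1 @ w2"]) auto
  qed
qed

lemma word_eval_subgroup:
  assumes "subgroup K G" "set w \<subseteq> S \<times> UNIV" "S \<subseteq> K"
  shows "word_eval (G\<lparr>carrier := K\<rparr>) w = word_eval G w"
  using assms(2,3) by (induction w) (auto simp: m_inv_consistent[OF assms(1)])

end

text \<open>The two ends of an edge representative are indexed by a Boolean, and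
  \<open>tr e b\<close> carries the vertex representative \<open>org e b\<close> to the end
  \<open>endp e b\<close>. By \<open>conj\<close>, the generators of an edge group are, after
  conjugation, among those of both adjacent vertex groups, so an edge word can be rewritten letter
  by letter on either side.\<close>

locale graph_of_groups = group G for G :: "('a, 'm) monoid_scheme" (structure) +
  fixes V :: "'v set" and E :: "'v set set" and \<psi> :: "'a \<Rightarrow> 'v \<Rightarrow> 'v" and RV :: "'v set" and RE :: "'v set set"
    and endp :: "'v set \<Rightarrow> bool \<Rightarrow> 'v" and tr :: "'v set \<Rightarrow> bool \<Rightarrow> 'a" and org :: "'v set \<Rightarrow> bool \<Rightarrow> 'v"
    and X :: "'v \<Rightarrow> 'a set" and T :: "'v set \<Rightarrow> 'a set"
  assumes tree_act: "tree_action G V E \<psi>" and no_inv: "without_inversion G E \<psi>"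
    and RV: "orbit_representatives G V \<psi> RV" and RE: "orbit_representatives G E (edge_act \<psi>) RE"
    and endp: "e \<in> RE \<Longrightarrow> e = {endp e True, endp e False} \<and> endp e True \<noteq> endp e False"
    and tr: "e \<in> RE \<Longrightarrow> tr e b \<in> carrier G \<and> org e b \<in> RV \<and> \<psi> (tr e b) (org e b) = endp e b"
    and X: "v \<in> RV \<Longrightarrow> finite_generating_set (vertex_group G \<psi> v) (X v)"
    and T: "e \<in> RE \<Longrightarrow> finite_generating_set (edge_group G \<psi> e) (T e)"
    and conj: "e \<in> RE \<Longrightarrow> c \<in> T e \<Longrightarrow> inv (tr e b) \<otimes> c \<otimes> tr e b \<in> X (org e b)"
begin

lemma tree: "is_tree V E" and act: "group_action G V \<psi>"
  and edge_image: "g \<in> carrier G \<Longrightarrow> e \<in> E \<Longrightarrow> edge_act \<psi> g e \<in> E"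
  using tree_act unfolding tree_action_def by auto

lemma RV_V: "v \<in> RV \<Longrightarrow> v \<in> V" and finite_RV: "finite RV"
  and RE_E: "e \<in> RE \<Longrightarrow> e \<in> E" and finite_RE: "finite RE"
  using RV RE unfolding orbit_representatives_def by auto

lemma psi_V [simp]: "g \<in> carrier G \<Longrightarrow> x \<in> V \<Longrightarrow> \<psi> g x \<in> V"
  using group_action.element_image[OF act] by blast

lemma psi_one [simp]: "x \<in> V \<Longrightarrow> \<psi> \<one> x = x"
  using group_action.id_eq_one[OF act] by (metis restrict_apply')

lemma psi_mult: "g \<in> carrier G \<Longrightarrow> h \<in> carrier G \<Longrightarrow> x \<in> V \<Longrightarrow> \<psi> (g \<otimes> h) x = \<psi> g (\<psi> h x)"
  using group_action.composition_rule[OF act] by auto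

lemma psi_inv: "g \<in> carrier G \<Longrightarrow> x \<in> V \<Longrightarrow> \<psi> g x = y \<Longrightarrow> \<psi> (inv g) y = x"
  using group_action.orbit_sym_aux[OF act] by blast

lemma psi_inj: "g \<in> carrier G \<Longrightarrow> x \<in> V \<Longrightarrow> y \<in> V \<Longrightarrow> \<psi> g x = \<psi> g y \<Longrightarrow> x = y"
  using psi_inv by metis

lemma RV_unique:
  assumes "u \<in> RV" "u' \<in> RV" "g \<in> carrier G" "\<psi> g u = u'"
  shows "u = u'"
proof -
  have "u \<in> orbit G \<psi> u" "u' \<in> orbit G \<psi> u"
    using group_action.orbit_refl[OF act RV_V[OF assms(1)]] assms(3,4) unfolding orbit_def by auto
  then show ?thesis using RV RV_V[OF assms(1)] assms(1,2) unfolding orbit_representatives_def by blast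
qed

lemma endp_V: "e \<in> RE \<Longrightarrow> endp e b \<in> V"
  using tr[of e b] RV_V psi_V by metis

lemma org_V: "e \<in> RE \<Longrightarrow> org e b \<in> V" "e \<in> RE \<Longrightarrow> org e b \<in> RV" "e \<in> RE \<Longrightarrow> tr e b \<in> carrier G"
  using tr RV_V by auto

lemma edge_eq: "e \<in> RE \<Longrightarrow> e = {endp e b, endp e (\<not> b)}" and endp_neq: "e \<in> RE \<Longrightarrow> endp e b \<noteq> endp e (\<not> b)"
  using endp[of e] by (cases b; auto)+

lemma stabilizer_subgroup: "v \<in> V \<Longrightarrow> subgroup (stabilizer G \<psi> v) G"
  using group_action.stabilizer_subgroup[OF act] .

lemma edge_stabilizer_fixes:
  assumes "e \<in> RE" "g \<in> carrier G" "edge_act \<psi> g e = e"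
  shows "\<psi> g (endp e b) = endp e b"
proof -
  have "endp e b \<in> e" using edge_eq[OF assms(1), of b] by auto
  then show ?thesis using no_inv RE_E[OF assms(1)] assms(2,3) unfolding without_inversion_def by blast
qed

lemma edge_stabilizer_iff:
  assumes "e \<in> RE"
  shows "g \<in> stabilizer G (edge_act \<psi>) e \<longleftrightarrow> g \<in> carrier G \<and> (\<forall>b. \<psi> g (endp e b) = endp e b)"
proof -
  have "edge_act \<psi> g e = e" if "\<forall>b. \<psi> g (endp e b) = endp e b"
    using edge_eq[OF assms, of True] that unfolding edge_act_def by (metis image_empty image_insert)
  then show ?thesis using edge_stabilizer_fixes[OF assms] unfolding stabilizer_def by auto
qed

lemma edge_stabilizer_subgroup:
  assumes "e \<in> RE"
  shows "subgroup (stabilizer G (edge_act \<psi>) e) G"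
proof -
  have "stabilizer G (edge_act \<psi>) e = stabilizer G \<psi> (endp e True) \<inter> stabilizer G \<psi> (endp e False)"
    using edge_stabilizer_iff[OF assms] unfolding stabilizer_def by (auto, metis (full_types))
  then show ?thesis
    using subgroups_Inter_pair[OF stabilizer_subgroup stabilizer_subgroup] endp_V[OF assms] by simp
qed

lemma X_stab: "v \<in> RV \<Longrightarrow> s \<in> X v \<Longrightarrow> s \<in> carrier G \<and> \<psi> s v = v" and finite_X: "v \<in> RV \<Longrightarrow> finite (X v)"
  using X[of v] unfolding finite_generating_set_def vertex_group_def stabilizer_def by auto

lemma T_stab: "e \<in> RE \<Longrightarrow> T e \<subseteq> stabilizer G (edge_act \<psi>) e" and finite_T: "e \<in> RE \<Longrightarrow> finite (T e)"
  using T[of e] unfolding finite_generating_set_def edge_group_def by auto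

text \<open>Letters of \<open>Inl\<close> generate the vertex groups, and \<open>(Inr e, b)\<close> is the stable letter of \<open>e\<close> read
  from the end \<open>endp e b = \<psi> (tr e b) (org e b)\<close>. A path from \<open>v\<close> spelling \<open>g\<close> and ending at \<open>u\<close> is traced
  by a path in the tree from \<open>v\<close> to \<open>\<psi> g u\<close>.\<close>

fun lsrc :: "('v \<times> 'a + 'v set) \<times> bool \<Rightarrow> 'v" where
  "lsrc (Inl (v, s), b) = v"
| "lsrc (Inr e, b) = org e b"

fun lrv :: "('v \<times> 'a + 'v set) \<times> bool \<Rightarrow> ('v \<times> 'a + 'v set) \<times> bool" where
  "lrv (z, b) = (z, \<not> b)"

fun lab :: "('v \<times> 'a + 'v set) \<times> bool \<Rightarrow> 'a" where
  "lab (Inl (v, s), b) = (if b then s else inv s)"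
| "lab (Inr e, b) = inv (tr e b) \<otimes> tr e (\<not> b)"

definition letters where
  "letters = (Inl ` (SIGMA v:RV. X v) \<union> Inr ` RE) \<times> (UNIV :: bool set)"

text \<open>Without faces; it makes \<open>edge_path\<close> available when the faces of
  \<open>groupoid_complex\<close> are defined.\<close>

definition skeleton :: "('v, ('v \<times> 'a + 'v set) \<times> bool, (('v \<times> 'a + 'v set) \<times> bool) list) complex2" where
  "skeleton = \<lparr>verts = RV, edges = letters, faces = {}, src = lsrc, rv = lrv, bdry = \<lambda>p. p\<rparr>"

abbreviation plab where "plab \<equiv> label_product G lab"

definition groupoid_complex where
  "groupoid_complex K = skeleton\<lparr>faces := {p. p \<noteq> [] \<and> length p \<le> K \<and> plab p = \<one> \<and> (\<exists>v. edge_path skeleton v p v)}\<rparr>"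

lemma groupoid_complex_simps [simp]:
  "verts (groupoid_complex K) = RV" "edges (groupoid_complex K) = letters" "src (groupoid_complex K) = lsrc"
  "rv (groupoid_complex K) = lrv" "bdry (groupoid_complex K) = (\<lambda>p. p)" "tgt (groupoid_complex K) z = lsrc (lrv z)"
  unfolding groupoid_complex_def skeleton_def tgt_def by auto

lemma edge_path_skeleton: "edge_path skeleton u p v \<longleftrightarrow> edge_path (groupoid_complex K) u p v"
proof (induction p arbitrary: u)
  case Nil
  then show ?case by (simp add: skeleton_def)
next
  case (Cons z p)
  then show ?case by (simp add: skeleton_def tgt_def)
qed

lemma letter_cases:
  assumes "z \<in> letters"
  obtains v s b where "z = (Inl (v, s), b)" "v \<in> RV" "s \<in> X v" | e b where "z = (Inr e, b)" "e \<in> RE"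
  using assms unfolding letters_def by auto

lemma finite_letters: "finite letters"
  unfolding letters_def using finite_RV finite_RE finite_X by auto

lemma letter_rv [simp]: "z \<in> letters \<Longrightarrow> lrv z \<in> letters" and lrv_lrv [simp]: "lrv (lrv z) = z"
  and lrv_neq: "lrv z \<noteq> z" and letter_src [simp]: "z \<in> letters \<Longrightarrow> lsrc z \<in> RV"
  by (cases z; auto simp: letters_def org_V)+

lemma lab_closed [simp]: "z \<in> letters \<Longrightarrow> lab z \<in> carrier G"
  by (erule letter_cases) (auto simp: X_stab org_V)

lemma lab_rv: "z \<in> letters \<Longrightarrow> lab (lrv z) = inv (lab z)"
  by (erule letter_cases) (auto simp: X_stab org_V inv_mult_group)

sublocale Z: labelled_complex "groupoid_complex K" G lab snd for K
proof unfold_locales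
  show "is_complex2 (groupoid_complex K)"
    unfolding is_complex2_def
  proof (intro conjI ballI)
    fix f assume f: "f \<in> faces (groupoid_complex K)"
    then have "f \<noteq> []" by (simp add: groupoid_complex_def)
    then show "bdry (groupoid_complex K) f \<noteq> []" by simp
    obtain v where "edge_path skeleton v f v" using f unfolding groupoid_complex_def by auto
    then show "\<exists>v. edge_path (groupoid_complex K) v (bdry (groupoid_complex K) f) v"
      using edge_path_skeleton by auto
  qed (auto simp: lrv_neq)
  fix z assume z: "z \<in> edges (groupoid_complex K)"
  show "snd (rv (groupoid_complex K) z) = (\<not> snd z)" by (cases z) simp
  show "lab z \<in> carrier G" "lab (rv (groupoid_complex K) z) = inv (lab z)" using z lab_rv by auto
next
  fix f assume "f \<in> faces (groupoid_complex K)"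
  then have "plab f = \<one>" by (simp add: groupoid_complex_def)
  then show "plab (bdry (groupoid_complex K) f) = \<one>" by simp
qed

lemma short_loop:
  assumes "edge_path (groupoid_complex K) v p v" "plab p = \<one>" "length p \<le> K"
  shows "homotopic (groupoid_complex K) v v 1 p []"
proof (cases "p = []")
  case True
  then show ?thesis using assms(1) by (auto intro: homotopic.refl)
next
  case False
  then have "p \<in> faces (groupoid_complex K)"
    using assms edge_path_skeleton[of v p v K] unfolding groupoid_complex_def by auto
  from Z.homotopic_face[OF this] show ?thesis using assms(1) by simp
qed

lemma short_homotopic:
  assumes "edge_path (groupoid_complex K) u p v" "edge_path (groupoid_complex K) u q v" "plab p = plab q"
    "length p + length q \<le> K"
  shows "homotopic (groupoid_complex K) u v 1 p q"
proof (rule Z.homotopic_of_loop[OF assms(1,2)])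
  have s: "set p \<subseteq> letters" "set q \<subseteq> letters"
    using Z.edge_path_edges[OF assms(1)] Z.edge_path_edges[OF assms(2)] by auto
  have "set (path_inverse (groupoid_complex K) q) \<subseteq> letters" using Z.path_inverse_edges[of q K] s by simp
  then have "plab (p @ path_inverse (groupoid_complex K) q) = \<one>"
    using Z.path_label_append[of p K "path_inverse (groupoid_complex K) q"] Z.path_label_inverse[of q K]
      Z.path_label_closed[of q K] s assms(3) by simp
  then show "homotopic (groupoid_complex K) u u 1 (p @ path_inverse (groupoid_complex K) q) []"
    by (intro short_loop) (use assms Z.edge_path_append[OF assms(1) Z.edge_path_inverse[OF assms(2)]] in auto)
qed

lemma plab_closed [simp]: "set p \<subseteq> letters \<Longrightarrow> plab p \<in> carrier G"
  by (rule label_product_closed) auto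

lemma plab_append: "set p \<subseteq> letters \<Longrightarrow> set q \<subseteq> letters \<Longrightarrow> plab (p @ q) = plab p \<otimes> plab q"
  by (rule label_product_append) auto

lemma path_letters: "edge_path (groupoid_complex K) u p v \<Longrightarrow> set p \<subseteq> letters"
  using Z.edge_path_edges by fastforce

text \<open>Translates a stable letter into the tree: read at \<open>g\<close>, the letter
  \<open>(Inr e, b)\<close> runs along the translate of \<open>e\<close> by
  \<open>g \<otimes> inv (tr e b)\<close>, from its end \<open>b\<close> to the other one.\<close>

lemma stable_crossing:
  assumes "e \<in> RE" "g \<in> carrier G"
  shows "\<psi> g (org e b) = \<psi> (g \<otimes> inv (tr e b)) (endp e b)"
    "\<psi> (g \<otimes> lab (Inr e, b)) (org e (\<not> b)) = \<psi> (g \<otimes> inv (tr e b)) (endp e (\<not> b))"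
    "edge_act \<psi> (g \<otimes> inv (tr e b)) e = {\<psi> g (org e b), \<psi> (g \<otimes> lab (Inr e, b)) (org e (\<not> b))}"
    "\<psi> g (org e b) \<noteq> \<psi> (g \<otimes> lab (Inr e, b)) (org e (\<not> b))"
proof -
  note o = org_V[OF assms(1)]
  have eb: "\<psi> (tr e c) (org e c) = endp e c" for c using tr[OF assms(1)] by auto
  have "\<psi> (inv (tr e b)) (endp e b) = org e b" by (rule psi_inv[OF _ _ eb]) (use o in auto)
  then show 1: "\<psi> g (org e b) = \<psi> (g \<otimes> inv (tr e b)) (endp e b)"
    using assms(2) o endp_V[OF assms(1)] by (simp add: psi_mult)
  show 2: "\<psi> (g \<otimes> lab (Inr e, b)) (org e (\<not> b)) = \<psi> (g \<otimes> inv (tr e b)) (endp e (\<not> b))"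
    using assms(2) o eb[of "\<not> b"] by (simp add: psi_mult m_assoc[symmetric])
  show "edge_act \<psi> (g \<otimes> inv (tr e b)) e = {\<psi> g (org e b), \<psi> (g \<otimes> lab (Inr e, b)) (org e (\<not> b))}"
    unfolding 1 2 edge_act_def using edge_eq[OF assms(1), of b] by (metis image_empty image_insert)
  show "\<psi> g (org e b) \<noteq> \<psi> (g \<otimes> lab (Inr e, b)) (org e (\<not> b))"
    unfolding 1 2 using psi_inj[of "g \<otimes> inv (tr e b)" "endp e b" "endp e (\<not> b)"] endp_neq[OF assms(1)]
      endp_V[OF assms(1)] assms(2) o by auto
qed

text \<open>Read along the path, the current vertex of the tree stays put at a vertex letter and
  moves along an edge at a stable letter. A walk from \<open>y\<close> to its neighbour
  \<open>v\<close> has to pass this edge in this direction by \<open>tree_crossing\<close>.\<close>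

lemma crossing_exists:
  assumes "edge_path (groupoid_complex K) u p u'" "g \<in> carrier G" "{y, v} \<in> E" "y \<noteq> v"
    "\<psi> g u = y" "\<psi> (g \<otimes> plab p) u' = v"
  shows "\<exists>p1 z p2. p = p1 @ z # p2 \<and> edge_path (groupoid_complex K) u p1 (lsrc z) \<and>
    \<psi> (g \<otimes> plab p1) (lsrc z) = y \<and> \<psi> (g \<otimes> plab p1 \<otimes> lab z) (lsrc (lrv z)) = v"
proof (rule ccontr)
  let ?r = "\<lambda>a b. {a, b} \<in> E \<and> (a, b) \<noteq> (y, v)"
  assume n: "\<not> ?thesis"
  have "?r\<^sup>*\<^sup>* (\<psi> (g \<otimes> plab q0) w) (\<psi> (g \<otimes> plab (q0 @ q)) u')"
    if "p = q0 @ q" "edge_path (groupoid_complex K) u q0 w" "edge_path (groupoid_complex K) w q u'" for q0 q w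
    using that
  proof (induction q arbitrary: q0 w)
    case Nil
    then show ?case by simp
  next
    case (Cons z q)
    then have z: "z \<in> letters" "lsrc z = w" and q: "edge_path (groupoid_complex K) (lsrc (lrv z)) q u'" by auto
    have q0: "set q0 \<subseteq> letters" "plab q0 \<in> carrier G" using path_letters[OF Cons.prems(2)] by auto
    have q0z: "edge_path (groupoid_complex K) u (q0 @ [z]) (lsrc (lrv z))"
      by (rule Z.edge_path_append[OF Cons.prems(2)]) (use z in simp)
    have "?r\<^sup>*\<^sup>* (\<psi> (g \<otimes> plab (q0 @ [z])) (lsrc (lrv z))) (\<psi> (g \<otimes> plab ((q0 @ [z]) @ q)) u')"
      by (rule Cons.IH[OF _ q0z q]) (use Cons.prems(1) in simp)
    moreover have gz: "g \<otimes> plab (q0 @ [z]) = g \<otimes> plab q0 \<otimes> lab z"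
      using plab_append[of q0 "[z]"] q0 z assms(2) by (simp add: m_assoc)
    moreover have "?r\<^sup>*\<^sup>* (\<psi> (g \<otimes> plab q0) w) (\<psi> (g \<otimes> plab q0 \<otimes> lab z) (lsrc (lrv z)))"
      using z(1)
    proof (cases rule: letter_cases)
      case (1 v' s b)
      have "\<psi> (lab z) v' = v'"
        using 1 X_stab[OF 1(2,3)] psi_inv[of s v' v'] RV_V[OF 1(2)] by auto
      then have "\<psi> (g \<otimes> plab q0 \<otimes> lab z) v' = \<psi> (g \<otimes> plab q0) v'"
        using psi_mult[of "g \<otimes> plab q0" "lab z" v'] assms(2) q0 z(1) RV_V[OF 1(2)] by simp
      then show ?thesis using 1(1) z(2) by simp
    next
      case (2 e b)
      have c: "g \<otimes> plab q0 \<in> carrier G" using assms(2) q0 by simp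
      have "edge_act \<psi> (g \<otimes> plab q0 \<otimes> inv (tr e b)) e \<in> E"
        by (rule edge_image) (use c org_V[OF 2(2)] RE_E[OF 2(2)] in auto)
      then have "{\<psi> (g \<otimes> plab q0) w, \<psi> (g \<otimes> plab q0 \<otimes> lab z) (lsrc (lrv z))} \<in> E"
        unfolding stable_crossing(3)[OF 2(2) c] using 2(1) z(2) by simp
      moreover have "(\<psi> (g \<otimes> plab q0) w, \<psi> (g \<otimes> plab q0 \<otimes> lab z) (lsrc (lrv z))) \<noteq> (y, v)"
      proof
        assume "(\<psi> (g \<otimes> plab q0) w, \<psi> (g \<otimes> plab q0 \<otimes> lab z) (lsrc (lrv z))) = (y, v)"
        then have "p = q0 @ z # q \<and> edge_path (groupoid_complex K) u q0 (lsrc z) \<and>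
           \<psi> (g \<otimes> plab q0) (lsrc z) = y \<and> \<psi> (g \<otimes> plab q0 \<otimes> lab z) (lsrc (lrv z)) = v"
          using Cons.prems(1,2) z(2) by simp
        then show False using n by blast
      qed
      ultimately show ?thesis by blast
    qed
    ultimately show ?case by (simp add: rtranclp_trans)
  qed
  from this[of "[]" p u] have "?r\<^sup>*\<^sup>* y v" using assms Z.edge_path_verts[OF assms(1)] by simp
  then show False using tree_crossing[OF tree assms(3,4)] by blast
qed

text \<open>Having crossed a tree edge, the path has to come back through it. The returning letter
  moves along a translate of some representative \<open>e'\<close>; uniqueness of representatives
  gives \<open>e' = e\<close>, and the absence of inversions makes it the opposite stable letter.
  The part \<open>p1\<close> in between represents, after conjugation, an element fixing both ends
  of \<open>e\<close>.\<close>

lemma excursion: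
  assumes e: "e \<in> RE" and p: "edge_path (groupoid_complex K) (org e (\<not> b)) p w"
    and ret: "\<psi> (plab ((Inr e, b) # p)) w = org e b"
  shows "\<exists>p1 p2. p = p1 @ (Inr e, \<not> b) # p2 \<and> edge_path (groupoid_complex K) (org e (\<not> b)) p1 (org e (\<not> b)) \<and>
    edge_path (groupoid_complex K) (org e b) p2 w \<and> \<psi> (plab p2) w = org e b \<and>
    \<psi> (plab p1) (org e (\<not> b)) = org e (\<not> b) \<and>
    tr e (\<not> b) \<otimes> plab p1 \<otimes> inv (tr e (\<not> b)) \<in> stabilizer G (edge_act \<psi>) e"
proof -
  let ?t = "(Inr e, b) :: ('v \<times> 'a + 'v set) \<times> bool" and ?q = "org e (\<not> b)"
  note o = org_V[OF e]
  have lt: "lab ?t \<in> carrier G" using o by simp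
  have tl: "?t \<in> letters" using e unfolding letters_def by auto
  \<comment> \<open>The far end of the tree edge crossed by the first letter. The rest of the path
    leads from \<open>y\<close> back to \<open>org e b\<close> and therefore contains a letter
    crossing this edge backwards.\<close>
  define y where "y = \<psi> (lab ?t) ?q"
  note c0 = stable_crossing[OF e one_closed, of b]
  have y1: "edge_act \<psi> (inv (tr e b)) e = {org e b, y}" "org e b \<noteq> y"
    using c0(3,4) o lt by (auto simp: y_def)
  have yE: "{y, org e b} \<in> E" using edge_image[OF inv_closed[OF o(3)] RE_E[OF e], of b] y1(1) by (simp add: insert_commute)
  from crossing_exists[OF p lt yE y1(2)[symmetric] y_def[symmetric]] ret
  obtain p1 z p2 where z: "p = p1 @ z # p2" "edge_path (groupoid_complex K) ?q p1 (lsrc z)"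
    "\<psi> (lab ?t \<otimes> plab p1) (lsrc z) = y" "\<psi> (lab ?t \<otimes> plab p1 \<otimes> lab z) (lsrc (lrv z)) = org e b" by auto
  have p1: "set p1 \<subseteq> letters" "plab p1 \<in> carrier G" and zl: "z \<in> letters" and p2l: "set p2 \<subseteq> letters"
    using path_letters[OF p] z(1) by auto
  have "edge_path (groupoid_complex K) (lsrc z) (z # p2) w"
    using p z(1,2) Z.edge_path_append_iff Z.edge_path_target_unique by metis
  then have p2: "edge_path (groupoid_complex K) (lsrc (lrv z)) p2 w" by simp
  have sV: "lsrc z \<in> V" using zl RV_V by simp
  have "\<psi> (lab ?t) (\<psi> (plab p1) (lsrc z)) = \<psi> (lab ?t) ?q" using z(3) psi_mult[OF lt p1(2) sV] unfolding y_def by simp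
  \<comment> \<open>\<open>p1\<close> returns to its starting point in the tree, hence also to its
    starting representative, as two representatives in one orbit are equal.\<close>
  from psi_inj[OF lt psi_V[OF p1(2) sV] o(1) this] have fixq: "\<psi> (plab p1) (lsrc z) = ?q" .
  then have sz: "lsrc z = ?q" using RV_unique[OF letter_src[OF zl] o(2) p1(2)] by simp
  define g where "g = lab ?t \<otimes> plab p1"
  have g: "g \<in> carrier G" using lt p1 unfolding g_def by simp
  have "z = (Inr e, \<not> b)"
    using zl
  proof (cases rule: letter_cases)
    case (1 v' s c)
    have "\<psi> (lab z) v' = v'"
      using 1 X_stab[OF 1(2,3)] psi_inv[of s v' v'] RV_V[OF 1(2)] by auto
    then have "\<psi> (g \<otimes> lab z) v' = \<psi> g v'"
      using psi_mult[of g "lab z" v'] g zl RV_V[OF 1(2)] by simp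
    then show ?thesis using z(3,4) y1(2) 1(1) unfolding g_def[symmetric] by simp
  next
    case (2 e' b')
    note o' = org_V[OF 2(2)]
    have ea: "edge_act \<psi> (g \<otimes> inv (tr e' b')) e' = {y, org e b}"
      using stable_crossing(3)[OF 2(2) g, of b'] z(3,4) 2(1) unfolding g_def by simp
    let ?h = "tr e b \<otimes> (g \<otimes> inv (tr e' b'))"
    have h: "?h \<in> carrier G" using o o' g by simp
    have comp: "edge_act \<psi> (k \<otimes> k') e'' = edge_act \<psi> k (edge_act \<psi> k' e'')"
      if "k \<in> carrier G" "k' \<in> carrier G" "e'' \<subseteq> V" for k k' e''
      unfolding edge_act_def image_image by (rule image_cong) (use that psi_mult in auto)
    have sub: "e'' \<subseteq> V" if "e'' \<in> RE" for e'' using edge_eq[OF that, of True] endp_V[OF that] by (metis empty_subsetI insert_subset)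
    have he: "edge_act \<psi> ?h e' = e"
    proof -
      have "edge_act \<psi> ?h e' = edge_act \<psi> (tr e b) (edge_act \<psi> (g \<otimes> inv (tr e' b')) e')"
        by (rule comp) (use o o' g sub[OF 2(2)] in auto)
      also have "\<dots> = edge_act \<psi> (tr e b) (edge_act \<psi> (inv (tr e b)) e)" using ea y1(1) by (simp add: insert_commute)
      also have "\<dots> = edge_act \<psi> (tr e b \<otimes> inv (tr e b)) e" by (rule comp[symmetric]) (use o sub[OF e] in auto)
      also have "\<dots> = e" using o sub[OF e] unfolding edge_act_def by (auto simp: subset_iff image_iff)
      finally show ?thesis .
    qed
    have "e' = e"
    proof -
      have "edge_act \<psi> \<one> e' = e'" using sub[OF 2(2)] unfolding edge_act_def by (auto simp: subset_iff image_iff)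
      then have "e' \<in> orbit G (edge_act \<psi>) e'" "e \<in> orbit G (edge_act \<psi>) e'" using he h unfolding orbit_def by force+
      then show ?thesis using RE RE_E[OF 2(2)] 2(2) e unfolding orbit_representatives_def by blast
    qed
    \<comment> \<open>With \<open>b' = b\<close> the element \<open>?h\<close> would stabilise
      \<open>e\<close> and move its end \<open>endp e b\<close> to the other end, an
      inversion.\<close>
    moreover have "b' = (\<not> b)"
    proof (rule ccontr)
      assume "b' \<noteq> (\<not> b)"
      then have b': "b' = b" by simp
      have "\<psi> ?h (endp e b) = endp e b" using edge_stabilizer_fixes[OF e h] he \<open>e' = e\<close> by simp
      moreover have "\<psi> ?h (endp e b) = \<psi> (tr e b) (\<psi> g (org e b))"
        using stable_crossing(1)[OF e g, of b] b' \<open>e' = e\<close> psi_mult[of "tr e b" "g \<otimes> inv (tr e b)" "endp e b"] o g endp_V[OF e]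
        by simp
      moreover have "org e b = lsrc z" using 2(1) b' \<open>e' = e\<close> by simp
      then have "\<psi> g (org e b) = y" using z(3) unfolding g_def by simp
      moreover have "\<psi> (tr e b) y = endp e (\<not> b)"
      proof -
        have "y = \<psi> (inv (tr e b)) (endp e (\<not> b))" using c0(2) o lt unfolding y_def by simp
        moreover have "endp e (\<not> b) = \<psi> (tr e b) (\<psi> (inv (tr e b)) (endp e (\<not> b)))"
          using psi_mult[of "tr e b" "inv (tr e b)" "endp e (\<not> b)"] o endp_V[OF e] by simp
        ultimately show ?thesis by simp
      qed
      ultimately show False using endp_neq[OF e, of b] by simp
    qed
    ultimately show ?thesis using 2(1) by simp
  qed
  note zt = this
  have srv: "lsrc (lrv z) = org e b" using zt by simp
  have lz: "lab z \<in> carrier G" using zl by simp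
  have gz: "\<psi> (g \<otimes> lab z) (org e b) = org e b" using z(4) srv unfolding g_def by simp
  have wV: "w \<in> V" using Z.edge_path_verts[OF p] RV_V by simp
  have "plab (?t # p) = (g \<otimes> lab z) \<otimes> plab p2"
    using plab_append[OF p1(1), of "z # p2"] zl p2l lt p1(2) unfolding z(1) g_def by (simp add: m_assoc)
  then have "\<psi> (g \<otimes> lab z) (\<psi> (plab p2) w) = \<psi> (g \<otimes> lab z) (org e b)"
    using ret gz psi_mult[of "g \<otimes> lab z" "plab p2" w] g lz p2l wV by simp
  from psi_inj[OF m_closed[OF g lz] psi_V[OF plab_closed[OF p2l] wV] o(1) this]
  have r2: "\<psi> (plab p2) w = org e b" .
  let ?c = "tr e (\<not> b) \<otimes> plab p1 \<otimes> inv (tr e (\<not> b))"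
  have c: "?c \<in> carrier G" using o p1 by simp
  have eb: "\<psi> (tr e d) (org e d) = endp e d" "\<psi> (inv (tr e d)) (endp e d) = org e d" for d
    using tr[OF e] psi_inv[of "tr e d" "org e d" "endp e d"] o by auto
  have "\<psi> ?c (endp e (\<not> b)) = endp e (\<not> b)"
    using psi_mult o p1 endp_V[OF e] eb[of "\<not> b"] fixq sz by simp
  \<comment> \<open>The other end is fixed too: \<open>g \<otimes> lab z\<close>, the element of the
    whole excursion, fixes \<open>org e b\<close>, and its conjugate by \<open>tr e b\<close> is
    \<open>?c\<close>.\<close>
  moreover have "\<psi> ?c (endp e b) = endp e b"
  proof -
    have lz': "lab z = inv (tr e (\<not> b)) \<otimes> tr e b" using zt by simp
    have "tr e b \<otimes> (g \<otimes> lab z) = ?c \<otimes> tr e b"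
    proof -
      have "tr e b \<otimes> (inv (tr e b) \<otimes> tr e (\<not> b)) = tr e (\<not> b)" using o by (simp add: m_assoc[symmetric])
      then show ?thesis using o p1(2) unfolding lz' g_def by (simp add: m_assoc[symmetric])
    qed
    then have "\<psi> (?c \<otimes> tr e b) (org e b) = \<psi> (tr e b) (\<psi> (g \<otimes> lab z) (org e b))"
      using psi_mult[of "tr e b" "g \<otimes> lab z" "org e b"] o g lz by simp
    then show ?thesis using gz eb(1)[of b] psi_mult[OF c o(3) o(1), of b b] by simp
  qed
  ultimately have "\<forall>d. \<psi> ?c (endp e d) = endp e d" by (intro allI, case_tac "d = b") auto
  then have "?c \<in> stabilizer G (edge_act \<psi>) e" unfolding edge_stabilizer_iff[OF e] using c by simp
  then show ?thesis using z(1,2) sz zt srv p2 r2 fixq by auto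
qed

end

section \<open>Corridors, normal forms and the area estimate\<close>

context graph_of_groups
begin

definition vletters where "vletters v = Inl ` ({v} \<times> X v) \<times> (UNIV :: bool set)"

lemma vletters_letters: "v \<in> RV \<Longrightarrow> vletters v \<subseteq> letters"
  unfolding vletters_def letters_def by auto

lemma vletters_src: "z \<in> vletters v \<Longrightarrow> lsrc z = v \<and> lrv z \<in> vletters v"
  unfolding vletters_def by auto

lemma vpath: "v \<in> RV \<Longrightarrow> set p \<subseteq> vletters v \<Longrightarrow> edge_path (groupoid_complex K) v p v"
proof (induction p)
  case (Cons z p)
  then show ?case using vletters_src[of z v] vletters_src[of "lrv z" v] vletters_letters[of v] by auto
qed simp

lemma vpath_inverse: "set p \<subseteq> vletters v \<Longrightarrow> set (path_inverse (groupoid_complex K) p) \<subseteq> vletters v"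
  unfolding path_inverse_def using vletters_src by auto

lemma plab_path_inverse: "set p \<subseteq> letters \<Longrightarrow> plab (path_inverse (groupoid_complex K) p) = inv (plab p)"
  using Z.path_label_inverse[of p K] by simp

definition vword :: "'v \<Rightarrow> ('a \<times> bool) list \<Rightarrow> (('v \<times> 'a + 'v set) \<times> bool) list" where
  "vword v w = map (\<lambda>(s, b). (Inl (v, s), b)) w"

lemma vword_letters: "set w \<subseteq> X v \<times> UNIV \<Longrightarrow> set (vword v w) \<subseteq> vletters v"
  unfolding vword_def vletters_def by auto

lemma plab_vword: "plab (vword v w) = word_eval G w"
  unfolding vword_def by (induction w) auto

lemma vertex_label_fixes:
  assumes "v \<in> RV" "set p \<subseteq> vletters v"
  shows "plab p \<in> stabilizer G \<psi> v"
proof -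
  have s: "subgroup (stabilizer G \<psi> v) G" by (rule stabilizer_subgroup[OF RV_V[OF assms(1)]])
  show ?thesis using assms(2)
  proof (induction p)
    case Nil
    then show ?case using subgroup.one_closed[OF s] by simp
  next
    case (Cons z p)
    then obtain x b where z: "z = (Inl (v, x), b)" "x \<in> X v" by (auto simp: vletters_def)
    have "x \<in> stabilizer G \<psi> v" using X_stab[OF assms(1) z(2)] unfolding stabilizer_def by simp
    then have "lab z \<in> stabilizer G \<psi> v" using z(1) subgroup.m_inv_closed[OF s] by simp
    then show ?case using subgroup.m_closed[OF s] Cons by simp
  qed
qed

lemma vertex_word_exists:
  assumes "v \<in> RV" "g \<in> stabilizer G \<psi> v"
  shows "\<exists>p. set p \<subseteq> vletters v \<and> plab p = g"
proof -
  note s = stabilizer_subgroup[OF RV_V[OF assms(1)]]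
  have H: "group (vertex_group G \<psi> v)" unfolding vertex_group_def by (rule subgroup.subgroup_is_group[OF s]) (rule is_group)
  obtain w where w: "set w \<subseteq> X v \<times> UNIV" "word_eval (vertex_group G \<psi> v) w = g"
    using group.word_exists[OF H X[OF assms(1)]] assms(2) unfolding vertex_group_def by auto
  have "X v \<subseteq> stabilizer G \<psi> v" using X_stab[OF assms(1)] unfolding stabilizer_def by auto
  then have "word_eval G w = g" using word_eval_subgroup[OF s w(1)] w(2) unfolding vertex_group_def by simp
  then show ?thesis using vword_letters[OF w(1)] plab_vword by blast
qed

text \<open>A word over the edge generators, spelled in the vertex group at the end
  \<open>b\<close>. Each generator becomes one letter, so the length is kept.\<close>

definition side where
  "side e b w = map (\<lambda>(s, d). (Inl (org e b, inv (tr e b) \<otimes> s \<otimes> tr e b), d)) w"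

lemma T_closed: "e \<in> RE \<Longrightarrow> T e \<subseteq> carrier G"
  using T_stab[of e] edge_stabilizer_iff[of e] by auto

lemma side_letters: "e \<in> RE \<Longrightarrow> set w \<subseteq> T e \<times> UNIV \<Longrightarrow> set (side e b w) \<subseteq> vletters (org e b)"
  unfolding side_def vletters_def using conj by auto

lemma length_side [simp]: "length (side e b w) = length w"
  unfolding side_def by simp

lemma conj_mult:
  assumes "t \<in> carrier G" "x \<in> carrier G" "y \<in> carrier G"
  shows "(inv t \<otimes> x \<otimes> t) \<otimes> (inv t \<otimes> y \<otimes> t) = inv t \<otimes> (x \<otimes> y) \<otimes> t"
proof -
  have "t \<otimes> (inv t \<otimes> (y \<otimes> t)) = y \<otimes> t" using assms by (simp add: m_assoc[symmetric])
  then show ?thesis using assms by (simp add: m_assoc)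
qed

lemma conj_inv:
  assumes "t \<in> carrier G" "x \<in> carrier G"
  shows "inv (inv t \<otimes> x \<otimes> t) = inv t \<otimes> inv x \<otimes> t"
  using assms by (simp add: inv_mult_group m_assoc)

lemma plab_side:
  assumes "e \<in> RE" "set w \<subseteq> T e \<times> UNIV"
  shows "plab (side e b w) = inv (tr e b) \<otimes> word_eval G w \<otimes> tr e b"
  using assms(2)
proof (induction w)
  case Nil
  then show ?case using org_V(3)[OF assms(1)] by (simp add: side_def)
next
  case (Cons x w)
  obtain s d where x: "x = (s, d)" by (cases x)
  have c: "s \<in> carrier G" "word_eval G w \<in> carrier G" "tr e b \<in> carrier G"
    using Cons.prems x T_closed[OF assms(1)] word_eval_closed[of w "T e"] org_V(3)[OF assms(1)] by auto
  have "plab (side e b (x # w)) =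
     (inv (tr e b) \<otimes> (if d then s else inv s) \<otimes> tr e b) \<otimes> (inv (tr e b) \<otimes> word_eval G w \<otimes> tr e b)"
    using Cons x c conj_inv by (simp add: side_def)
  then show ?case using conj_mult[of "tr e b" "if d then s else inv s" "word_eval G w"] x c by simp
qed

text \<open>A strip of quadrilaterals between the two copies of an edge word. Each letter costs one
  relator made of two stable letters and two vertex letters, which is where \<open>4 \<le> K\<close>
  comes from.\<close>

lemma corridor:
  assumes "e \<in> RE" "set w \<subseteq> T e \<times> UNIV" "4 \<le> K"
  shows "homotopic (groupoid_complex K) (org e b) (org e b) (length w)
    ((Inr e, b) # side e (\<not> b) w @ [(Inr e, \<not> b)]) (side e b w)"
  using assms(2)
proof (induction w)
  let ?t = "(Inr e, b) :: ('v \<times> 'a + 'v set) \<times> bool"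
  have t: "edge_path (groupoid_complex K) (org e b) [?t] (org e (\<not> b))"
    "edge_path (groupoid_complex K) (org e (\<not> b)) [lrv ?t] (org e b)"
    using assms(1) org_V[OF assms(1)] by (auto simp: letters_def)
  case Nil
  show ?case using Z.homotopic_cancel[OF t(1)] by (simp add: side_def path_inverse_def)
next
  let ?t = "(Inr e, b) :: ('v \<times> 'a + 'v set) \<times> bool"
  have t: "edge_path (groupoid_complex K) (org e b) [?t] (org e (\<not> b))"
    "edge_path (groupoid_complex K) (org e (\<not> b)) [lrv ?t] (org e b)"
    using assms(1) org_V[OF assms(1)] by (auto simp: letters_def)
  case (Cons x w)
  let ?x = "side e (\<not> b) [x]" and ?C = "side e (\<not> b) w"
  have x: "set [x] \<subseteq> T e \<times> UNIV" and w: "set w \<subseteq> T e \<times> UNIV" using Cons.prems by auto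
  have px: "edge_path (groupoid_complex K) (org e c) (side e c [x]) (org e c)" for c
    by (rule vpath[OF org_V(2)[OF assms(1)] side_letters[OF assms(1) x]])
  have pC: "edge_path (groupoid_complex K) (org e (\<not> b)) ?C (org e (\<not> b))"
    by (rule vpath[OF org_V(2)[OF assms(1)] side_letters[OF assms(1) w]])
  have "homotopic (groupoid_complex K) (org e (\<not> b)) (org e (\<not> b)) 0 (path_inverse (groupoid_complex K) [?t] @ [?t]) []"
    by (rule Z.homotopic_cancel'[OF t(1)])
  from Z.homotopic_context[OF Z.homotopic_sym[OF this] Z.edge_path_append[OF t(1) px] Z.edge_path_append[OF pC t(2)]]
  have 1: "homotopic (groupoid_complex K) (org e b) (org e b) 0 (([?t] @ ?x) @ ?C @ [lrv ?t])
     (([?t] @ ?x @ [lrv ?t]) @ (?t # ?C @ [lrv ?t]))" by (simp add: path_inverse_def)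
  have "plab ([?t] @ ?x @ [lrv ?t]) = plab (side e b [x])"
  proof -
    obtain s d where sd: "x = (s, d)" "s \<in> carrier G" using x T_closed[OF assms(1)] by (cases x) auto
    note o = org_V(3)[OF assms(1)]
    let ?y = "if d then s else inv s"
    have y: "?y \<in> carrier G" using sd by simp
    have side1: "plab (side e c [x]) = inv (tr e c) \<otimes> ?y \<otimes> tr e c" for c
      using plab_side[OF assms(1) x, of c] sd y by simp
    have a: "tr e (\<not> b) \<otimes> (inv (tr e (\<not> b)) \<otimes> g) = g" if "g \<in> carrier G" for g
      using that o by (simp add: m_assoc[symmetric])
    have "plab ([?t] @ ?x @ [lrv ?t]) = lab ?t \<otimes> (plab ?x \<otimes> lab (lrv ?t))"
      using plab_append[of ?x "[lrv ?t]"] path_letters[OF px] path_letters[OF t(2)] o by simp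
    also have "\<dots> = inv (tr e b) \<otimes> ?y \<otimes> tr e b"
      unfolding side1 using o y a by (simp add: m_assoc)
    finally show ?thesis unfolding side1 .
  qed
  then have "homotopic (groupoid_complex K) (org e b) (org e b) 1 ([?t] @ ?x @ [lrv ?t]) (side e b [x])"
    by (intro short_homotopic Z.edge_path_append[OF t(1)] Z.edge_path_append[OF px] t(2) px) (use assms(3) in auto)
  from Z.homotopic_append[OF this Cons.IH[OF w]]
  have "homotopic (groupoid_complex K) (org e b) (org e b) (Suc (length w)) (([?t] @ ?x @ [lrv ?t]) @ (?t # ?C @ [lrv ?t]))
     (side e b [x] @ side e b w)" by simp
  from Z.homotopic_trans[OF 1 this] show ?case by (simp add: side_def)
qed

text \<open>The path is peeled from the left. A vertex letter is kept. A stable letter starts an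
  excursion, and the path splits into that letter, \<open>p1\<close>, the opposite letter and
  \<open>p2\<close>. By induction \<open>p1\<close> becomes a vertex word \<open>q1\<close>, which
  is replaced by a word \<open>cw\<close> in the edge group and pushed through a corridor to the
  near side. As \<open>B\<close> is superadditive, the bounds for \<open>cw\<close> and for the
  normal form of \<open>p2\<close> add up to \<open>B (length p)\<close>.\<close>

lemma normal_form:
  assumes K: "4 \<le> K"
    and A: "\<And>v p l. v \<in> RV \<Longrightarrow> set p \<subseteq> vletters v \<Longrightarrow> plab p = \<one> \<Longrightarrow> length p \<le> l \<Longrightarrow>
      homotopic (groupoid_complex K) v v (A l) p []"
    and B_add: "\<And>m n. B m + B n \<le> B (m + n)" and B_ge: "\<And>n. n \<le> B n"
    and B: "\<And>e b p. e \<in> RE \<Longrightarrow> edge_path (groupoid_complex K) (org e b) p (org e b) \<Longrightarrow>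
      tr e b \<otimes> plab p \<otimes> inv (tr e b) \<in> stabilizer G (edge_act \<psi>) e \<Longrightarrow>
      \<exists>w. set w \<subseteq> T e \<times> UNIV \<and> word_eval G w = tr e b \<otimes> plab p \<otimes> inv (tr e b) \<and> length w \<le> B (length p + 2)"
    and p: "edge_path (groupoid_complex K) v p w" "\<psi> (plab p) w = v" "length p \<le> n"
  shows "w = v \<and> (\<exists>q. set q \<subseteq> vletters v \<and> plab q = plab p \<and> length q \<le> B (length p) \<and>
    homotopic (groupoid_complex K) v v (length p * (A (2 * B n) + B n)) p q)"
  using p
proof (induction "length p" arbitrary: p v w rule: less_induct)
  case less
  let ?Z = "groupoid_complex K" and ?M = "A (2 * B n) + B n"
  have B_mono: "B m \<le> B k" if "m \<le> k" for m k using B_add[of m "k - m"] that by simp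
  have v: "v \<in> RV" and w: "w \<in> RV" using Z.edge_path_verts[OF less.prems(1)] by auto
  note pl = path_letters[OF less.prems(1)]
  show ?case
  proof (cases p)
    case Nil
    then have "w = v" using less.prems(1) by simp
    moreover have "homotopic ?Z v v 0 [] []" using v by (intro homotopic.refl) simp
    ultimately show ?thesis using Nil by (intro conjI exI[of _ "[]"]) simp_all
  next
    case (Cons z p')
    then have z: "z \<in> letters" "lsrc z = v" and p': "edge_path ?Z (lsrc (lrv z)) p' w" using less.prems(1) by auto
    note p'l = path_letters[OF p']
    from z(1) show ?thesis
    proof (cases rule: letter_cases)
      case (1 v' s b)
      then have vv: "v' = v" using z(2) by simp
      have zv: "z \<in> vletters v" using 1 vv unfolding vletters_def by auto
      have fixv: "\<psi> (lab z) v = v" using vertex_label_fixes[OF v, of "[z]"] zv z(1) unfolding stabilizer_def by simp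
      have "\<psi> (lab z) (\<psi> (plab p') w) = \<psi> (lab z) v"
        using less.prems(2) Cons psi_mult[of "lab z" "plab p'" w] z(1) p'l RV_V[OF w] fixv by simp
      from psi_inj[OF lab_closed[OF z(1)] psi_V[OF plab_closed[OF p'l] RV_V[OF w]] RV_V[OF v] this]
      have f: "\<psi> (plab p') w = v" .
      have pv: "edge_path ?Z v p' w" using p' 1 vv by simp
      from less.hyps[OF _ pv f] obtain q where q: "w = v" "set q \<subseteq> vletters v" "plab q = plab p'"
        "length q \<le> B (length p')" "homotopic ?Z v v (length p' * ?M) p' q" using Cons less.prems(3) by auto
      have "homotopic ?Z v v (0 + length p' * ?M) ([z] @ p') ([z] @ q)"
        by (rule Z.homotopic_append[OF homotopic.refl q(5)]) (rule vpath[OF v], use zv in simp)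
      from Z.homotopic_mono[OF this, of "length p * ?M"]
      have "homotopic ?Z v v (length p * ?M) p (z # q)" using Cons by simp
      moreover have "length (z # q) \<le> B (length p)"
        using q(4) B_add[of 1 "length p'"] B_ge[of 1] Cons by simp
      ultimately show ?thesis using q zv Cons by (intro conjI exI[of _ "z # q"]) auto
    next
      case (2 e b)
      note o = org_V[OF 2(2)]
      have vo: "v = org e b" using 2 z(2) by simp
      have p'': "edge_path ?Z (org e (\<not> b)) p' w" using p' 2 by simp
      have "\<psi> (plab ((Inr e, b) # p')) w = org e b" using less.prems(2) Cons 2 vo by simp
      from excursion[OF 2(2) p'' this] obtain p1 p2 where
        s: "p' = p1 @ (Inr e, \<not> b) # p2" and p1: "edge_path ?Z (org e (\<not> b)) p1 (org e (\<not> b))"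
        and p2: "edge_path ?Z v p2 w" "\<psi> (plab p2) w = v"
        and f1: "\<psi> (plab p1) (org e (\<not> b)) = org e (\<not> b)"
        and c: "tr e (\<not> b) \<otimes> plab p1 \<otimes> inv (tr e (\<not> b)) \<in> stabilizer G (edge_act \<psi>) e"
        unfolding vo by blast
      have len: "length p = length p1 + length p2 + 2" using Cons s by simp
      from less.hyps[OF _ p1 f1] obtain q1 where q1: "set q1 \<subseteq> vletters (org e (\<not> b))" "plab q1 = plab p1"
        "length q1 \<le> B (length p1)" "homotopic ?Z (org e (\<not> b)) (org e (\<not> b)) (length p1 * ?M) p1 q1"
        using len less.prems(3) by auto
      from less.hyps[OF _ p2] obtain q2 where q2: "w = v" "set q2 \<subseteq> vletters v" "plab q2 = plab p2"
        "length q2 \<le> B (length p2)" "homotopic ?Z v v (length p2 * ?M) p2 q2"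
        using len less.prems(3) by auto
      obtain cw where cw: "set cw \<subseteq> T e \<times> UNIV" "word_eval G cw = tr e (\<not> b) \<otimes> plab p1 \<otimes> inv (tr e (\<not> b))"
        "length cw \<le> B (length p1 + 2)" using B[OF 2(2) p1 c] by blast
      let ?C = "side e (\<not> b) cw" and ?t = "(Inr e, b) :: ('v \<times> 'a + 'v set) \<times> bool"
      have C: "set ?C \<subseteq> vletters (org e (\<not> b))" by (rule side_letters[OF 2(2) cw(1)])
      note l1 = path_letters[OF p1]
      have a: "inv (tr e (\<not> b)) \<otimes> (tr e (\<not> b) \<otimes> g) = g" if "g \<in> carrier G" for g
        using that o by (simp add: m_assoc[symmetric])
      have labC: "plab ?C = plab p1"
        using plab_side[OF 2(2) cw(1), of "\<not> b"] cw(2) o l1 a by (simp add: m_assoc)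
      have cl: "set q1 \<subseteq> letters" "set ?C \<subseteq> letters" "set (path_inverse ?Z ?C) \<subseteq> letters"
        using subset_trans[OF _ vletters_letters[OF o(2)]] q1(1) C vpath_inverse[OF C, of K] by metis+
      \<comment> \<open>Both words lie in the vertex group at the far end and represent the same
        element. Each has length at most \<open>B n\<close>, which is the origin of
        \<open>2 * B n\<close>.\<close>
      have "homotopic ?Z (org e (\<not> b)) (org e (\<not> b)) (A (2 * B n)) (q1 @ path_inverse ?Z ?C) []"
      proof (rule A[OF o(2)])
        show "set (q1 @ path_inverse ?Z ?C) \<subseteq> vletters (org e (\<not> b))" using q1(1) vpath_inverse[OF C, of K] by simp
        show "plab (q1 @ path_inverse ?Z ?C) = \<one>"
          using plab_append[OF cl(1,3)] plab_path_inverse[OF cl(2), of K] labC q1(2) l1 by simp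
        have "length cw \<le> B n" "length q1 \<le> B n"
          using cw(3) q1(3) B_mono[of "length p1 + 2" n] B_mono[of "length p1" n]
            len less.prems(3) by auto
        then show "length (q1 @ path_inverse ?Z ?C) \<le> 2 * B n" by simp
      qed
      from Z.homotopic_of_loop[OF vpath[OF o(2) q1(1)] vpath[OF o(2) C] this]
      have "homotopic ?Z (org e (\<not> b)) (org e (\<not> b)) (A (2 * B n)) q1 ?C" .
      from Z.homotopic_trans[OF q1(4) this]
      have h1: "homotopic ?Z (org e (\<not> b)) (org e (\<not> b)) (length p1 * ?M + A (2 * B n)) p1 ?C" .
      have t: "edge_path ?Z v [?t] (org e (\<not> b))" "edge_path ?Z (org e (\<not> b)) [lrv ?t] v"
        using 2 o vo by (auto simp: letters_def)
      from Z.homotopic_context[OF h1 t]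
      have h2: "homotopic ?Z v v (length p1 * ?M + A (2 * B n)) (?t # p1 @ [lrv ?t]) (?t # ?C @ [(Inr e, \<not> b)])" by simp
      have h3: "homotopic ?Z v v (length p1 * ?M + A (2 * B n) + length cw) (?t # p1 @ [lrv ?t]) (side e b cw)"
        using Z.homotopic_trans[OF h2 corridor[OF 2(2) cw(1) K, of b, folded vo]] .
      from Z.homotopic_append[OF h3 q2(5)]
      have h4: "homotopic ?Z v v (length p1 * ?M + A (2 * B n) + length cw + length p2 * ?M) p (side e b cw @ q2)"
        using Cons s 2(1) by simp
      have "length cw \<le> B n"
        using cw(3) B_mono[of "length p1 + 2" n] len less.prems(3) by auto
      \<comment> \<open>The two stable letters removed here contribute 2 to \<open>length p\<close>
        and are charged a single \<open>?M\<close>, which covers the vertex filling and the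
        corridor.\<close>
      then have "length p1 * ?M + A (2 * B n) + length cw + length p2 * ?M \<le> (length p1 + length p2 + 1) * ?M"
        by (simp add: algebra_simps)
      also have "\<dots> \<le> length p * ?M" using len by (intro mult_le_mono1) simp
      finally have h5: "homotopic ?Z v v (length p * ?M) p (side e b cw @ q2)" by (rule Z.homotopic_mono[OF h4])
      have sl: "set (side e b cw) \<subseteq> vletters v" unfolding vo by (rule side_letters[OF 2(2) cw(1)])
      have sl': "set (side e b cw) \<subseteq> letters" "set q2 \<subseteq> letters" using subset_trans[OF _ vletters_letters[OF v]] sl q2(2) by metis+
      have "plab (side e b cw @ q2) = plab p"
      proof -
        have l2: "set p2 \<subseteq> letters" by (rule path_letters[OF p2(1)])
        have tl: "?t \<in> letters" "lrv ?t \<in> letters" using 2 by (auto simp: letters_def)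
        have "plab p = lab ?t \<otimes> (plab p1 \<otimes> (lab (lrv ?t) \<otimes> plab p2))"
          using Cons s 2(1) plab_append[OF l1, of "lrv ?t # p2"] l2 tl by simp
        moreover have "plab (side e b cw) = lab ?t \<otimes> (plab p1 \<otimes> lab (lrv ?t))"
          using plab_side[OF 2(2) cw(1), of b] cw(2) o l1 by (simp add: m_assoc)
        ultimately show ?thesis
          using plab_append[OF sl'] q2(3) o l1 l2 by (simp add: m_assoc)
      qed
      moreover have "length (side e b cw @ q2) \<le> B (length p)"
      proof -
        \<comment> \<open>The bound on \<open>cw\<close> comes from the length of \<open>p1\<close>,
          not from that of \<open>q1\<close>; the shift by 2 is accounted for by the two stable
          letters.\<close>
        have "length cw + length q2 \<le> B (length p1 + 2) + B (length p2)" using cw(3) q2(4) by simp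
        also have "\<dots> \<le> B (length p1 + 2 + length p2)" by (rule B_add)
        also have "length p1 + 2 + length p2 = length p" using len by simp
        finally show ?thesis by simp
      qed
      ultimately show ?thesis using q2(1,2) sl h5 by (intro conjI exI[of _ "side e b cw @ q2"]) auto
    qed
  qed
qed

text \<open>Every vertex of the tree is reached by a path from \<open>z0\<close>: neighbours are
  reached through a stable letter after a correction in a vertex group. For the vertex
  \<open>\<psi> g z0\<close> the remaining discrepancy again lies in a vertex group and is spelled
  by a vertex word.\<close>

lemma loop_exists:
  assumes "z0 \<in> RV" "g \<in> carrier G"
  shows "\<exists>p. edge_path (groupoid_complex K) z0 p z0 \<and> plab p = g"
proof -
  let ?Z = "groupoid_complex K"
  define P where "P x \<longleftrightarrow> (\<exists>p u. edge_path ?Z z0 p u \<and> \<psi> (plab p) u = x)" for x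
  have step: "P x'" if P: "P x" and xx: "{x, x'} \<in> E" for x x'
  proof -
    obtain p u where p: "edge_path ?Z z0 p u" "\<psi> (plab p) u = x" using P unfolding P_def by blast
    have u: "u \<in> RV" using Z.edge_path_verts[OF p(1)] by simp
    note pl = path_letters[OF p(1)]
    have xV: "x \<in> V" "x' \<in> V" "x \<noteq> x'"
    proof -
      obtain a b where "a \<in> V" "b \<in> V" "a \<noteq> b" "{x, x'} = {a, b}" using tree xx unfolding is_tree_def by metis
      then show "x \<in> V" "x' \<in> V" "x \<noteq> x'" by (auto simp: doubleton_eq_iff)
    qed
    obtain e h where e: "e \<in> RE" "h \<in> carrier G" "e = edge_act \<psi> h {x, x'}"
      using RE xx unfolding orbit_representatives_def orbit_def by blast
    have ee: "e = {\<psi> h x, \<psi> h x'}" using e(3) unfolding edge_act_def by simp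
    obtain b where b: "\<psi> h x = endp e b" "\<psi> h x' = endp e (\<not> b)"
      using edge_eq[OF e(1), of True] ee by (metis (full_types) doubleton_eq_iff)
    note o = org_V[OF e(1)]
    let ?k = "inv h"
    have k: "\<psi> ?k (endp e b) = x" "\<psi> ?k (endp e (\<not> b)) = x'" using psi_inv[OF e(2)] xV b by auto
    \<comment> \<open>The correction at the end \<open>u\<close> of the path that makes the stable
      letter run along the given tree edge. It maps \<open>org e b\<close> to \<open>u\<close>, so
      these representatives agree and a vertex word spells it.\<close>
    let ?s = "inv (plab p) \<otimes> (?k \<otimes> tr e b)"
    have s: "?s \<in> carrier G" using pl e(2) o by simp
    have "\<psi> ?s (org e b) = \<psi> (inv (plab p)) (\<psi> ?k (\<psi> (tr e b) (org e b)))"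
      using psi_mult pl e(2) o by simp
    also have "\<dots> = u" using tr[OF e(1)] k psi_inv[OF plab_closed[OF pl] RV_V[OF u] p(2)] by simp
    finally have su: "\<psi> ?s (org e b) = u" .
    have "org e b = u" by (rule RV_unique[OF o(2) u s su])
    then have "?s \<in> stabilizer G \<psi> u" using s su unfolding stabilizer_def by simp
    then obtain w where w: "set w \<subseteq> vletters u" "plab w = ?s" using vertex_word_exists[OF u] by blast
    let ?t = "(Inr e, b) :: ('v \<times> 'a + 'v set) \<times> bool"
    have t: "edge_path ?Z u [?t] (org e (\<not> b))" using e(1) o \<open>org e b = u\<close> by (auto simp: letters_def)
    have pp: "edge_path ?Z z0 (p @ w @ [?t]) (org e (\<not> b))"
      using Z.edge_path_append[OF p(1) Z.edge_path_append[OF vpath[OF u w(1)] t]] .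
    have wl: "set w \<subseteq> letters" "set [?t] \<subseteq> letters" using subset_trans[OF w(1) vletters_letters[OF u]] path_letters[OF t] by metis+
    have a: "plab p \<otimes> (inv (plab p) \<otimes> g) = g" "tr e b \<otimes> (inv (tr e b) \<otimes> g) = g" if "g \<in> carrier G" for g
      using that pl o by (simp_all add: m_assoc[symmetric])
    have "plab (p @ w @ [?t]) = plab p \<otimes> (plab w \<otimes> plab [?t])"
      using plab_append[OF pl, of "w @ [?t]"] plab_append[OF wl] wl by simp
    also have "\<dots> = ?k \<otimes> tr e (\<not> b)" unfolding w(2) using pl o e(2) a by (simp add: m_assoc)
    finally have "\<psi> (plab (p @ w @ [?t])) (org e (\<not> b)) = x'"
      using psi_mult[of ?k "tr e (\<not> b)" "org e (\<not> b)"] e(2) o tr[OF e(1), of "\<not> b"] k by simp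
    then show ?thesis using pp unfolding P_def by blast
  qed
  have list: "P (last xs)" if "xs \<noteq> []" "successively (\<lambda>u v. {u, v} \<in> E) xs" "P (hd xs)" for xs
    using that
  proof (induction xs)
    case (Cons x xs)
    show ?case
    proof (cases "xs = []")
      case False
      then have "P (hd xs)" using Cons.prems step by (auto simp: successively_Cons)
      then show ?thesis using False Cons by (auto simp: successively_Cons)
    qed (use Cons in simp)
  qed simp
  have "P z0" unfolding P_def by (rule exI[of _ "[]"], rule exI[of _ z0]) (use assms(1) RV_V in simp)
  moreover obtain xs where "xs \<noteq> []" "hd xs = z0" "last xs = \<psi> g z0" "successively (\<lambda>u v. {u, v} \<in> E) xs"
    using tree RV_V[OF assms(1)] psi_V[OF assms(2) RV_V[OF assms(1)]] unfolding is_tree_def by metis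
  ultimately have "P (\<psi> g z0)" using list by metis
  then obtain p u where p: "edge_path ?Z z0 p u" "\<psi> (plab p) u = \<psi> g z0" unfolding P_def by blast
  have u: "u \<in> RV" using Z.edge_path_verts[OF p(1)] by simp
  note pl = path_letters[OF p(1)]
  let ?s = "inv (plab p) \<otimes> g"
  have s: "?s \<in> carrier G" using pl assms(2) by simp
  have "\<psi> ?s z0 = \<psi> (inv (plab p)) (\<psi> (plab p) u)"
    using psi_mult[of "inv (plab p)" g z0] pl assms RV_V p(2) by simp
  also have "\<dots> = u" using psi_inv[OF plab_closed[OF pl] RV_V[OF u] HOL.refl] .
  finally have su: "\<psi> ?s z0 = u" .
  have zu: "z0 = u" by (rule RV_unique[OF assms(1) u s su])
  then have "?s \<in> stabilizer G \<psi> u" using s su unfolding stabilizer_def by simp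
  then obtain w where w: "set w \<subseteq> vletters u" "plab w = ?s" using vertex_word_exists[OF u] by blast
  have "edge_path ?Z z0 (p @ w) z0" using Z.edge_path_append[OF p(1) vpath[OF u w(1)]] zu by simp
  moreover have "plab (p @ w) = g"
    using plab_append[OF pl subset_trans[OF w(1) vletters_letters[OF u]]] w(2) pl assms(2) by (simp add: m_assoc[symmetric])
  ultimately show ?thesis by blast
qed

text \<open>The normal form of a path with label \<open>\<one>\<close> is a trivial vertex word of
  length at most \<open>B n\<close>; the last summand pays for its filling.\<close>

theorem groupoid_area:
  assumes K: "4 \<le> K"
    and A: "\<And>v p l. v \<in> RV \<Longrightarrow> set p \<subseteq> vletters v \<Longrightarrow> plab p = \<one> \<Longrightarrow> length p \<le> l \<Longrightarrow>
      homotopic (groupoid_complex K) v v (A l) p []"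
    and B_add: "\<And>m n. B m + B n \<le> B (m + n)" and B_ge: "\<And>n. n \<le> B n"
    and B: "\<And>e b p. e \<in> RE \<Longrightarrow> edge_path (groupoid_complex K) (org e b) p (org e b) \<Longrightarrow>
      tr e b \<otimes> plab p \<otimes> inv (tr e b) \<in> stabilizer G (edge_act \<psi>) e \<Longrightarrow>
      \<exists>w. set w \<subseteq> T e \<times> UNIV \<and> word_eval G w = tr e b \<otimes> plab p \<otimes> inv (tr e b) \<and> length w \<le> B (length p + 2)"
    and p: "edge_path (groupoid_complex K) v p v" "plab p = \<one>" "length p \<le> n"
  shows "homotopic (groupoid_complex K) v v (n * (A (2 * B n) + B n) + A (2 * B n)) p []"
proof -
  have v: "v \<in> RV" using Z.edge_path_verts[OF p(1)] by simp
  have B_mono: "B m \<le> B k" if "m \<le> k" for m k using B_add[of m "k - m"] that by simp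
  have fixv: "\<psi> (plab p) v = v" using p(2) RV_V[OF v] by simp
  have "v = v \<and> (\<exists>q. set q \<subseteq> vletters v \<and> plab q = plab p \<and> length q \<le> B (length p) \<and>
    homotopic (groupoid_complex K) v v (length p * (A (2 * B n) + B n)) p q)"
    by (rule normal_form[where A = A and B = B and n = n]) (fact K A B_add B_ge B p(1) fixv p(3))+
  then obtain q where q: "set q \<subseteq> vletters v" "plab q = plab p" "length q \<le> B (length p)"
    "homotopic (groupoid_complex K) v v (length p * (A (2 * B n) + B n)) p q" by blast
  have "length q \<le> 2 * B n" using q(3) B_mono[of "length p" n] p(3) by simp
  from A[OF v q(1) _ this] have "homotopic (groupoid_complex K) v v (A (2 * B n)) q []" using q(2) p(2) by simp
  from Z.homotopic_trans[OF q(4) this] show ?thesis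
    by (rule Z.homotopic_mono) (use p(3) in simp)
qed

end

section \<open>Fillings in the vertex groups\<close>

context graph_of_groups
begin

text \<open>A subcomplex of \<open>groupoid_complex K\<close> at the single vertex \<open>v\<close>.
  Its labels lie in the vertex group, so that \<open>word_area_le_dehn\<close> applies to
  it.\<close>

definition vertex_complex where
  "vertex_complex K v = \<lparr>verts = {v}, edges = vletters v,
     faces = {p. p \<noteq> [] \<and> length p \<le> K \<and> plab p = \<one> \<and> set p \<subseteq> vletters v}, src = lsrc, rv = lrv, bdry = \<lambda>p. p\<rparr>"

lemma vertex_complex_path:
  "edge_path (vertex_complex K v) v p v \<longleftrightarrow> set p \<subseteq> vletters v"
proof (induction p)
  case (Cons z p)
  then show ?case using vletters_src[of z v] vletters_src[of "lrv z" v] by (auto simp: vertex_complex_def tgt_def)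
qed (simp add: vertex_complex_def)

lemma vertex_complex_labelled:
  assumes "v \<in> RV"
  shows "labelled_complex (vertex_complex K v) (vertex_group G \<psi> v) lab snd"
proof -
  have s: "subgroup (stabilizer G \<psi> v) G" by (rule stabilizer_subgroup[OF RV_V[OF assms]])
  have fixz: "lab z \<in> stabilizer G \<psi> v" if "z \<in> vletters v" for z
    using vertex_label_fixes[OF assms, of "[z]"] that vletters_letters[OF assms] lab_closed[of z] by auto
  have pl: "label_product (vertex_group G \<psi> v) lab p = plab p" for p
    by (induction p) (simp_all add: vertex_group_def)
  show ?thesis
  proof (intro labelled_complex.intro two_complex.intro labelled_complex_axioms.intro)
    show "group (vertex_group G \<psi> v)"
      unfolding vertex_group_def by (rule subgroup.subgroup_is_group[OF s]) (rule is_group)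
    show "is_complex2 (vertex_complex K v)"
      unfolding is_complex2_def
    proof (intro conjI ballI)
      fix f assume "f \<in> faces (vertex_complex K v)"
      then have f: "f \<noteq> []" "set f \<subseteq> vletters v" by (simp_all add: vertex_complex_def)
      show "bdry (vertex_complex K v) f \<noteq> []" using f(1) by (simp add: vertex_complex_def)
      have "edge_path (vertex_complex K v) v f v" using f(2) vertex_complex_path by simp
      then show "\<exists>v'. edge_path (vertex_complex K v) v' (bdry (vertex_complex K v) f) v'"
        by (auto simp: vertex_complex_def)
    qed (use vletters_src lrv_neq in \<open>auto simp: vertex_complex_def\<close>)
    fix z assume "z \<in> edges (vertex_complex K v)"
    then have z: "z \<in> vletters v" by (simp add: vertex_complex_def)
    show "lab z \<in> carrier (vertex_group G \<psi> v)" using fixz[OF z] by (simp add: vertex_group_def)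
    have "inv\<^bsub>vertex_group G \<psi> v\<^esub> (lab z) = inv (lab z)"
      unfolding vertex_group_def by (rule m_inv_consistent[OF s fixz[OF z]])
    then show "lab (rv (vertex_complex K v) z) = inv\<^bsub>vertex_group G \<psi> v\<^esub> (lab z)"
      using lab_rv[of z] subsetD[OF vletters_letters[OF assms] z] by (simp add: vertex_complex_def)
    show "snd (rv (vertex_complex K v) z) = (\<not> snd z)" by (cases z) (simp add: vertex_complex_def)
  next
    fix f assume "f \<in> faces (vertex_complex K v)"
    then have "plab f = \<one>" by (simp add: vertex_complex_def)
    then show "label_product (vertex_group G \<psi> v) lab (bdry (vertex_complex K v) f) = \<one>\<^bsub>vertex_group G \<psi> v\<^esub>"
      unfolding pl by (simp add: vertex_complex_def vertex_group_def)
  qed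
qed

text \<open>\<open>word_area_le_dehn\<close> for the vertex complexes, moved into
  \<open>groupoid_complex K\<close>. The bound is provided for all large \<open>K\<close>, since one
  \<open>K\<close> has to serve all vertex groups.\<close>

lemma vertex_area:
  fixes Y' :: "('v2, 'e2, 'f2) complex2"
  assumes v: "v \<in> RV" and Y': "dehn_complex (vertex_group G \<psi> v) Y'"
  shows "\<exists>K0 L. \<forall>K\<ge>K0. \<forall>p l. set p \<subseteq> vletters v \<longrightarrow> plab p = \<one> \<longrightarrow> length p \<le> l \<longrightarrow>
    homotopic (groupoid_complex K) v v (dehn_function Y' (L * l) + l) p []"
proof -
  let ?H = "vertex_group G \<psi> v"
  have s: "subgroup (stabilizer G \<psi> v) G" by (rule stabilizer_subgroup[OF RV_V[OF v]])
  obtain \<alpha> \<beta> \<gamma> where Y: "is_complex2 Y'" "simply_connected2 Y'" "free_cocompact_action ?H Y' \<alpha> \<beta> \<gamma>"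
    using Y' unfolding dehn_complex_def by blast
  have H: "group ?H" unfolding vertex_group_def by (rule subgroup.subgroup_is_group[OF s]) (rule is_group)
  interpret Y: free_cocompact Y' ?H \<alpha> \<beta> \<gamma>
    by (intro free_cocompact.intro two_complex.intro free_cocompact_axioms.intro) (fact Y H)+
  have pl: "label_product ?H lab p = plab p" for p
    by (induction p) (simp_all add: vertex_group_def)
  have one: "\<one>\<^bsub>?H\<^esub> = \<one>" by (simp add: vertex_group_def)
  have "\<exists>K0 L. \<forall>K\<ge>K0. \<forall>p. set p \<subseteq> vletters v \<longrightarrow> label_product ?H lab p = \<one>\<^bsub>?H\<^esub> \<longrightarrow>
    homotopic (vertex_complex K v) v v (dehn_function Y' (L * length p) + length p) p []"
  proof (rule Y.word_area_le_dehn[where pos = snd and r = lrv])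
    show "labelled_complex (vertex_complex K v) ?H lab snd" for K by (rule vertex_complex_labelled[OF v])
    show "finite (vletters v)" using finite_X[OF v] unfolding vletters_def by simp
    show "\<exists>p. set p \<subseteq> vletters v \<and> label_product ?H lab p = g" if "g \<in> carrier ?H" for g
      using vertex_word_exists[OF v, of g] that unfolding pl by (simp add: vertex_group_def)
    show "homotopic (vertex_complex K v) v v 1 p []"
      if p: "set p \<subseteq> vletters v" "label_product ?H lab p = \<one>\<^bsub>?H\<^esub>" "length p \<le> K" for K p
    proof (cases "p = []")
      case True
      then show ?thesis by (auto simp: vertex_complex_def intro: homotopic.refl)
    next
      case False
      interpret W: two_complex "vertex_complex K v"
        using vertex_complex_labelled[OF v] unfolding labelled_complex_def by simp
      have "p \<in> faces (vertex_complex K v)" using p False unfolding pl one by (simp add: vertex_complex_def)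
      from W.homotopic_face[OF this, of v] show ?thesis
        using vertex_complex_path p(1) by (simp add: vertex_complex_def)
    qed
  qed (simp_all add: vertex_complex_def)
  then obtain K0 L where KL: "\<And>K p. K \<ge> K0 \<Longrightarrow> set p \<subseteq> vletters v \<Longrightarrow> plab p = \<one> \<Longrightarrow>
    homotopic (vertex_complex K v) v v (dehn_function Y' (L * length p) + length p) p []"
    unfolding pl one by blast
  have "homotopic (groupoid_complex K) v v (dehn_function Y' (L * l) + l) p []"
    if p: "K \<ge> K0" "set p \<subseteq> vletters v" "plab p = \<one>" "length p \<le> l" for K p l
  proof -
    have "dehn_function Y' (L * length p) \<le> dehn_function Y' (L * l)"
    proof (rule Y.dehn_function_le)
      show "verts Y' \<noteq> {}" using Y(2) unfolding simply_connected2_def by simp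
      fix u q assume q: "edge_path Y' u q u" "length q \<le> L * length p"
      have "L * length p \<le> L * l" using p(4) by simp
      then show "homotopic Y' u u (dehn_function Y' (L * l)) q []"
        by (intro Y.dehn_function_homotopic[OF q(1)]) (use q(2) in linarith)
    qed
    moreover have "homotopic (groupoid_complex K) v v (dehn_function Y' (L * length p) + length p) p []"
    proof (rule Z.homotopic_subcomplex[OF KL[OF p(1-3)]])
      show "faces (vertex_complex K v) \<subseteq> faces (groupoid_complex K)"
      proof
        fix f assume "f \<in> faces (vertex_complex K v)"
        then have f: "f \<noteq> []" "length f \<le> K" "plab f = \<one>" "set f \<subseteq> vletters v" by (simp_all add: vertex_complex_def)
        have "edge_path skeleton v f v" using vpath[OF v f(4)] edge_path_skeleton by blast
        then show "f \<in> faces (groupoid_complex K)" using f unfolding groupoid_complex_def by auto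
      qed
    qed (use v vletters_letters[OF v] in \<open>simp_all add: vertex_complex_def\<close>)
    ultimately show ?thesis using Z.homotopic_mono p(4) by (meson add_le_mono)
  qed
  then show ?thesis by blast
qed

text \<open>A qualitative counterpart of \<open>vertex_area\<close>, from a presentation instead of
  a complex. The letters at \<open>v\<close> are rewritten over \<open>S\<close>, and the
  equivalence of words is replayed step by step, each relator being a short loop.\<close>

lemma vertex_null_homotopic:
  assumes v: "v \<in> RV" and S: "finite_generating_set (vertex_group G \<psi> v) S" "S \<subseteq> X v"
    and R: "finite R" "R \<subseteq> lists (S \<times> UNIV)"
    and pres: "\<forall>w\<in>lists (S \<times> UNIV). word_eval (vertex_group G \<psi> v) w = \<one>\<^bsub>vertex_group G \<psi> v\<^esub> \<longleftrightarrow> equivclp (word_step S R) w []"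
  shows "\<exists>K0. \<forall>K\<ge>K0. \<forall>p. set p \<subseteq> vletters v \<longrightarrow> plab p = \<one> \<longrightarrow> (\<exists>N. homotopic (groupoid_complex K) v v N p [])"
proof -
  let ?H = "vertex_group G \<psi> v"
  have s: "subgroup (stabilizer G \<psi> v) G" by (rule stabilizer_subgroup[OF RV_V[OF v]])
  have H: "group ?H" unfolding vertex_group_def by (rule subgroup.subgroup_is_group[OF s]) (rule is_group)
  have Xs: "X v \<subseteq> stabilizer G \<psi> v" using X_stab[OF v] unfolding stabilizer_def by auto
  have ev: "word_eval ?H w = word_eval G w" if "set w \<subseteq> S \<times> UNIV" for w
    unfolding vertex_group_def by (rule word_eval_subgroup[OF s that]) (use S(2) Xs in auto)
  have one: "\<one>\<^bsub>?H\<^esub> = \<one>" by (simp add: vertex_group_def)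
  have vl: "set (vword v w) \<subseteq> vletters v" if "set w \<subseteq> S \<times> UNIV" for w
    by (rule vword_letters) (use that S(2) in auto)
  define \<sigma> where "\<sigma> z = (SOME w. set w \<subseteq> S \<times> UNIV \<and> word_eval G w = lab z)" for z :: "('v \<times> 'a + 'v set) \<times> bool"
  have \<sigma>: "set (\<sigma> z) \<subseteq> S \<times> UNIV \<and> word_eval G (\<sigma> z) = lab z" if "z \<in> vletters v" for z
  proof -
    have "lab z \<in> carrier ?H"
      using vertex_label_fixes[OF v, of "[z]"] that vletters_letters[OF v] lab_closed[of z]
      by (auto simp: vertex_group_def)
    then have "\<exists>w. set w \<subseteq> S \<times> UNIV \<and> word_eval G w = lab z" using group.word_exists[OF H S(1)] ev by metis
    then show ?thesis unfolding \<sigma>_def by (rule someI_ex)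
  qed
  have "finite (vletters v)" using finite_X[OF v] unfolding vletters_def by simp
  then obtain L where L: "\<forall>z\<in>vletters v. length (\<sigma> z) \<le> L" using finite_bound[of _ "\<lambda>z n. length (\<sigma> z) \<le> n"] by fastforce
  obtain M where M: "\<forall>r\<in>R. length r \<le> M" using finite_bound[OF R(1), of "\<lambda>r n. length r \<le> n"] by fastforce
  \<comment> \<open>\<open>L + 1\<close> is room for a letter compared with its word over
    \<open>S\<close>, and \<open>M\<close> bounds the given relators.\<close>
  have "\<exists>N. homotopic (groupoid_complex K) v v N p []"
    if K: "K \<ge> L + 1 + M" and p: "set p \<subseteq> vletters v" "plab p = \<one>" for K p
  proof -
    let ?Z = "groupoid_complex K"
    have trans: "\<exists>w. set w \<subseteq> S \<times> UNIV \<and> word_eval G w = plab p \<and> (\<exists>N. homotopic ?Z v v N p (vword v w))"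
      using p(1)
    proof (induction p)
      case Nil
      have "homotopic ?Z v v 0 [] (vword v [])" using v by (auto simp: vword_def intro: homotopic.refl)
      then show ?case by (intro exI[of _ "[]"]) auto
    next
      case (Cons z p)
      then obtain w N where w: "set w \<subseteq> S \<times> UNIV" "word_eval G w = plab p" "homotopic ?Z v v N p (vword v w)" by auto
      have z: "z \<in> vletters v" using Cons.prems by simp
      note sz = \<sigma>[OF z]
      have "homotopic ?Z v v 1 [z] (vword v (\<sigma> z))"
      proof (rule short_homotopic)
        show "edge_path ?Z v [z] v" by (rule vpath[OF v]) (use z in simp)
        show "edge_path ?Z v (vword v (\<sigma> z)) v" by (rule vpath[OF v vl]) (use sz in simp)
        show "plab [z] = plab (vword v (\<sigma> z))" using sz plab_vword z vletters_letters[OF v] lab_closed by auto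
        show "length [z] + length (vword v (\<sigma> z)) \<le> K" using L z K by (force simp: vword_def)
      qed
      from Z.homotopic_append[OF this w(3)]
      have "homotopic ?Z v v (1 + N) (z # p) (vword v (\<sigma> z @ w))" by (simp add: vword_def)
      moreover have "S \<subseteq> carrier G" using S(2) X_stab[OF v] by auto
      then have "word_eval G (\<sigma> z @ w) = plab (z # p)" using word_eval_append[of "\<sigma> z" S w] sz w by simp
      moreover have "set (\<sigma> z @ w) \<subseteq> S \<times> UNIV" using sz w by simp
      ultimately show ?case by blast
    qed
    then obtain w N where w: "set w \<subseteq> S \<times> UNIV" "word_eval G w = \<one>" "homotopic ?Z v v N p (vword v w)" using p by auto
    \<comment> \<open>The context words in \<open>word_step\<close> are arbitrary, so it has to be
      checked that a chain of steps starting over \<open>S\<close> stays over \<open>S\<close>, in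
      both directions of a step.\<close>
    have hstep: "(set a \<subseteq> S \<times> UNIV \<longleftrightarrow> set b \<subseteq> S \<times> UNIV) \<and>
        (set a \<subseteq> S \<times> UNIV \<longrightarrow> (\<exists>N. homotopic ?Z v v N (vword v a) (vword v b)))" if "word_step S R a b" for a b
      using that
    proof (induction rule: word_step.induct)
      case (cancel x a c b)
      have "homotopic ?Z v v 0 (vword v (a @ [(x, c), (x, \<not> c)] @ b)) (vword v (a @ b))"
        if ab: "set (a @ [(x, c), (x, \<not> c)] @ b) \<subseteq> S \<times> UNIV"
      proof -
        have ab': "set a \<subseteq> S \<times> UNIV" "set b \<subseteq> S \<times> UNIV" "set [(x, c)] \<subseteq> S \<times> UNIV" using ab by auto
        from Z.homotopic_cancel[OF vpath[OF v vl[OF ab'(3)]]]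
        have "homotopic ?Z v v 0 (vword v [(x, c), (x, \<not> c)]) []" by (simp add: vword_def path_inverse_def)
        from Z.homotopic_context[OF this vpath[OF v vl[OF ab'(1)]] vpath[OF v vl[OF ab'(2)]]]
        show ?thesis by (simp add: vword_def)
      qed
      then show ?case using cancel by auto
    next
      case (relator r a b)
      have rl: "set r \<subseteq> S \<times> UNIV" using R(2) relator by auto
      have "word_step S R ([] @ r @ []) ([] @ [])" by (rule word_step.relator[OF relator])
      then have "equivclp (word_step S R) r []" by auto
      moreover have "r \<in> lists (S \<times> UNIV)" using R(2) relator by auto
      ultimately have "word_eval G r = \<one>" using bspec[OF pres] ev[OF rl] one by metis
      then have r1: "homotopic ?Z v v 1 (vword v r) []"
        by (intro short_loop vpath[OF v vl[OF rl]]) (use bspec[OF M relator] K plab_vword in \<open>simp_all add: vword_def\<close>)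
      have "homotopic ?Z v v 1 (vword v (a @ r @ b)) (vword v (a @ b))" if ab: "set (a @ r @ b) \<subseteq> S \<times> UNIV"
      proof -
        have ab': "set a \<subseteq> S \<times> UNIV" "set b \<subseteq> S \<times> UNIV" using ab by auto
        from Z.homotopic_context[OF r1 vpath[OF v vl[OF ab'(1)]] vpath[OF v vl[OF ab'(2)]]]
        show ?thesis by (simp add: vword_def)
      qed
      then show ?case using rl by auto
    qed
    have "w \<in> lists (S \<times> UNIV)" using w(1) by auto
    then have "equivclp (word_step S R) w []" using bspec[OF pres] w(2) ev[OF w(1)] one by metis
    then have "set [] \<subseteq> S \<times> (UNIV :: bool set) \<and> (\<exists>N. homotopic ?Z v v N (vword v w) (vword v []))"
    proof (induction rule: equivclp_induct)
      case base
      have "homotopic ?Z v v 0 (vword v w) (vword v w)" by (rule homotopic.refl[OF vpath[OF v vl[OF w(1)]]])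
      then show ?case using w(1) by blast
    next
      case (step y z)
      then obtain N where y: "set y \<subseteq> S \<times> UNIV" "homotopic ?Z v v N (vword v w) (vword v y)" by blast
      from step(2) obtain N' where z: "set z \<subseteq> S \<times> UNIV" "homotopic ?Z v v N' (vword v y) (vword v z)"
        using hstep[of y z] hstep[of z y] y(1) Z.homotopic_sym by blast
      from Z.homotopic_trans[OF y(2) z(2)] show ?case using z(1) by blast
    qed
    then obtain N' where "homotopic ?Z v v N' (vword v w) []" by (auto simp: vword_def)
    from Z.homotopic_trans[OF w(3) this] show ?thesis by blast
  qed
  then show ?thesis by blast
qed

end

section \<open>Word lengths and distortion\<close>

context group
begin

lemma word_length_word:
  assumes "finite_generating_set G S" "g \<in> carrier G"
  shows "\<exists>w. set w \<subseteq> S \<times> UNIV \<and> length w = word_length G S g \<and> word_eval G w = g"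
proof -
  obtain w where "set w \<subseteq> S \<times> UNIV" "word_eval G w = g" using word_exists[OF assms] by blast
  then have "\<exists>n w. w \<in> lists (S \<times> UNIV) \<and> length w = n \<and> word_eval G w = g" by (metis in_lists_conv_set subsetD)
  then have "\<exists>w. w \<in> lists (S \<times> UNIV) \<and> length w = word_length G S g \<and> word_eval G w = g"
    unfolding word_length_def by (rule LeastI_ex)
  then show ?thesis by auto
qed

lemma word_length_le: "set w \<subseteq> S \<times> UNIV \<Longrightarrow> word_length G S (word_eval G w) \<le> length w"
  unfolding word_length_def by (rule Least_le) (auto intro!: exI[of _ w])

lemma word_length_mult:
  assumes "finite_generating_set G S" "g \<in> carrier G" "h \<in> carrier G"
  shows "word_length G S (g \<otimes> h) \<le> word_length G S g + word_length G S h"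
proof -
  obtain u w where u: "set u \<subseteq> S \<times> UNIV" "length u = word_length G S g" "word_eval G u = g"
    and w: "set w \<subseteq> S \<times> UNIV" "length w = word_length G S h" "word_eval G w = h"
    using word_length_word assms by metis
  have "S \<subseteq> carrier G" using assms(1) unfolding finite_generating_set_def by simp
  then show ?thesis using word_length_le[of "u @ w" S] word_eval_append[of u S w] u w by simp
qed

text \<open>Balls with respect to a finite generating set are finite, so the \<open>Sup\<close> in
  \<open>distortion\<close> is taken over a bounded set and is an upper bound.\<close>

lemma word_length_distortion:
  assumes "finite_generating_set G S" "h \<in> H" "H \<subseteq> carrier G" "word_length G S h \<le> n"
  shows "word_length (G\<lparr>carrier := H\<rparr>) S' h \<le> distortion G S H S' n"
  unfolding distortion_def
proof (rule cSup_upper)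
  have "{h. h \<in> H \<and> word_length G S h \<le> n} \<subseteq> word_eval G ` {w. set w \<subseteq> S \<times> UNIV \<and> length w \<le> n}"
  proof
    fix h assume h: "h \<in> {h. h \<in> H \<and> word_length G S h \<le> n}"
    then obtain w where "set w \<subseteq> S \<times> UNIV" "length w = word_length G S h" "word_eval G w = h"
      using word_length_word[OF assms(1)] assms(3) by blast
    then show "h \<in> word_eval G ` {w. set w \<subseteq> S \<times> UNIV \<and> length w \<le> n}" using h by auto
  qed
  moreover have "finite (S \<times> (UNIV :: bool set))" using assms(1) unfolding finite_generating_set_def by simp
  ultimately have "finite {h. h \<in> H \<and> word_length G S h \<le> n}"
    using finite_lists_length_le finite_subset by blast
  then have "finite (word_length (G\<lparr>carrier := H\<rparr>) S' ` {h. h \<in> H \<and> word_length G S h \<le> n})" by simp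
  then show "bdd_above {word_length (G\<lparr>carrier := H\<rparr>) S' h | h. h \<in> H \<and> word_length G S h \<le> n}"
    by (intro bdd_above_finite) (simp add: setcompr_eq_image)
qed (use assms in blast)

lemma word_eval_generate:
  assumes "set w \<subseteq> S \<times> UNIV"
  shows "word_eval G w \<in> generate G S"
  using assms
proof (induction w)
  case (Cons x w)
  obtain s b where "x = (s, b)" by (cases x)
  then show ?case using Cons generate.eng[of _ G S] generate.incl[of s S G] generate.inv[of s S G] by auto
qed (simp add: generate.one)

end

text \<open>\<open>m * g m\<close> is superadditive for nondecreasing \<open>g\<close>. The summand
  1 in \<open>g\<close> gives \<open>n \<le> B n\<close>, and the shift by 2 keeps the factor in
  front of \<open>g\<close> positive at \<open>n = 0\<close>.\<close>

lemma superadditive_dominates: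
  fixes f :: "nat \<Rightarrow> nat"
  shows "\<exists>B. (\<forall>m n. B m + B n \<le> B (m + n)) \<and> (\<forall>n. n \<le> B n) \<and> (\<forall>n. f n \<le> B (n + 2))"
proof -
  define g where "g m = (\<Sum>i\<le>m. f i) + 1" for m
  have mono: "g m \<le> g n" if "m \<le> n" for m n unfolding g_def using that by (intro add_mono sum_mono2) auto
  have "m * g m + n * g n \<le> (m + n) * g (m + n)" for m n
    unfolding add_mult_distrib by (intro add_mono mult_le_mono2 mono) simp_all
  moreover have "n \<le> n * g n" for n unfolding g_def by simp
  moreover have "f n \<le> (n + 2) * g (n + 2)" for n
  proof -
    have "f n \<le> (\<Sum>i\<le>n + 2. f i)" by (rule member_le_sum) auto
    then have "f n \<le> g (n + 2)" unfolding g_def by simp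
    then show ?thesis by simp
  qed
  ultimately show ?thesis by (intro exI[of _ "\<lambda>m. m * g m"]) blast
qed

section \<open>Edge words and finite presentability\<close>

context graph_of_groups
begin

text \<open>\<open>\<kappa>\<close> bounds the word lengths of all letters and of the elements
  \<open>tr e b\<close> and their inverses. A path contributes \<open>\<kappa>\<close> per letter
  and the conjugation twice more; a shortest word over \<open>T e\<close> is then bounded by the
  distortion.\<close>

lemma edge_words_distortion:
  assumes S: "finite_generating_set G S"
  shows "\<exists>\<kappa>. \<forall>K e b p. e \<in> RE \<longrightarrow> edge_path (groupoid_complex K) (org e b) p (org e b) \<longrightarrow>
    tr e b \<otimes> plab p \<otimes> inv (tr e b) \<in> stabilizer G (edge_act \<psi>) e \<longrightarrow>
    (\<exists>w. set w \<subseteq> T e \<times> UNIV \<and> word_eval G w = tr e b \<otimes> plab p \<otimes> inv (tr e b) \<and>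
      length w \<le> edist G S \<psi> RE T (\<kappa> * (length p + 2)))"
proof -
  let ?X = "lab ` letters \<union> (\<Union>e\<in>RE. \<Union>b. {tr e b, inv (tr e b)})"
  have fin: "finite ?X" using finite_letters finite_RE by auto
  have "\<exists>\<kappa>. \<forall>g\<in>?X. word_length G S g \<le> \<kappa>" by (rule finite_bound[OF fin]) (blast, rule le_trans)
  then obtain \<kappa> where \<kappa>: "\<forall>g\<in>?X. word_length G S g \<le> \<kappa>" by (rule exE)
  have pl: "word_length G S (plab p) \<le> \<kappa> * length p" if "set p \<subseteq> letters" for p
    using that
  proof (induction p)
    case Nil
    then show ?case using word_length_le[of "[]" S] by simp
  next
    case (Cons z p)
    have "word_length G S (lab z \<otimes> plab p) \<le> word_length G S (lab z) + word_length G S (plab p)"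
      by (rule word_length_mult[OF S]) (use Cons.prems in auto)
    moreover have "word_length G S (lab z) \<le> \<kappa>" using \<kappa> Cons.prems by auto
    moreover have "word_length G S (plab p) \<le> \<kappa> * length p" using Cons by simp
    ultimately show ?case by simp
  qed
  show ?thesis
  proof (intro exI[of _ \<kappa>] allI impI)
    fix K e b p
    assume e: "e \<in> RE" and p: "edge_path (groupoid_complex K) (org e b) p (org e b)"
      and c: "tr e b \<otimes> plab p \<otimes> inv (tr e b) \<in> stabilizer G (edge_act \<psi>) e"
    let ?c = "tr e b \<otimes> plab p \<otimes> inv (tr e b)" and ?H = "stabilizer G (edge_act \<psi>) e"
    note l = path_letters[OF p] and o = org_V(3)[OF e] and s = edge_stabilizer_subgroup[OF e]
    have "word_length G S ?c \<le> word_length G S (tr e b \<otimes> plab p) + word_length G S (inv (tr e b))"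
      by (rule word_length_mult[OF S]) (use o l in auto)
    also have "\<dots> \<le> (word_length G S (tr e b) + word_length G S (plab p)) + word_length G S (inv (tr e b))"
      by (intro add_mono word_length_mult[OF S] order_refl) (use o l in auto)
    also have "\<dots> \<le> (\<kappa> + \<kappa> * length p) + \<kappa>" by (intro add_mono pl[OF l]) (use \<kappa> e in blast)+
    also have "\<dots> = \<kappa> * (length p + 2)" by simp
    finally have len: "word_length G S ?c \<le> \<kappa> * (length p + 2)" .
    have eg: "edge_group G \<psi> e = G\<lparr>carrier := ?H\<rparr>" by (simp add: edge_group_def)
    have H: "group (edge_group G \<psi> e)" unfolding eg by (rule subgroup.subgroup_is_group[OF s]) (rule is_group)
    have "?c \<in> carrier (edge_group G \<psi> e)" using c by (simp add: eg)
    then obtain w where w: "set w \<subseteq> T e \<times> UNIV" "length w = word_length (edge_group G \<psi> e) (T e) ?c"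
      "word_eval (edge_group G \<psi> e) w = ?c"
      using group.word_length_word[OF H T[OF e]] by blast
    have "length w \<le> distortion G S ?H (T e) (\<kappa> * (length p + 2))"
      unfolding w(2) eg by (rule word_length_distortion[OF S c subgroup.subset[OF s] len])
    also have "\<dots> \<le> edist G S \<psi> RE T (\<kappa> * (length p + 2))"
      unfolding edist_def by (rule cSUP_upper[OF e]) (use finite_RE in simp)
    finally have "length w \<le> edist G S \<psi> RE T (\<kappa> * (length p + 2))" .
    moreover have "word_eval G w = ?c"
      using word_eval_subgroup[OF s w(1) T_stab[OF e]] w(3) unfolding eg by simp
    ultimately show "\<exists>w. set w \<subseteq> T e \<times> UNIV \<and> word_eval G w = ?c \<and> length w \<le> edist G S \<psi> RE T (\<kappa> * (length p + 2))"
      using w(1) by blast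
  qed
qed

text \<open>The crude version for finite presentability, where no finite generating set of
  \<open>G\<close> is given. For each length there are finitely many paths, hence finitely many
  elements to be spelled.\<close>

lemma edge_words_bound:
  "\<exists>f. \<forall>K e b p. e \<in> RE \<longrightarrow> edge_path (groupoid_complex K) (org e b) p (org e b) \<longrightarrow>
    tr e b \<otimes> plab p \<otimes> inv (tr e b) \<in> stabilizer G (edge_act \<psi>) e \<longrightarrow>
    (\<exists>w. set w \<subseteq> T e \<times> UNIV \<and> word_eval G w = tr e b \<otimes> plab p \<otimes> inv (tr e b) \<and> length w \<le> f (length p))"
proof -
  define c where "c = (\<lambda>(e, b, p). tr e b \<otimes> plab p \<otimes> inv (tr e b))"
  define Q where "Q x n \<longleftrightarrow> (\<exists>w. set w \<subseteq> T (fst x) \<times> UNIV \<and> word_eval G w = c x \<and> length w \<le> n)" for x n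
  have "\<exists>N. \<forall>x\<in>{x \<in> RE \<times> UNIV \<times> {p. set p \<subseteq> letters \<and> length p \<le> m}. c x \<in> stabilizer G (edge_act \<psi>) (fst x)}. Q x N" for m
  proof (rule finite_bound)
    have "finite (RE \<times> (UNIV :: bool set) \<times> {p. set p \<subseteq> letters \<and> length p \<le> m})"
      using finite_RE finite_lists_length_le[OF finite_letters] by auto
    then show "finite {x \<in> RE \<times> UNIV \<times> {p. set p \<subseteq> letters \<and> length p \<le> m}. c x \<in> stabilizer G (edge_act \<psi>) (fst x)}" by simp
    fix x assume x: "x \<in> {x \<in> RE \<times> UNIV \<times> {p. set p \<subseteq> letters \<and> length p \<le> m}. c x \<in> stabilizer G (edge_act \<psi>) (fst x)}"
    then have e: "fst x \<in> RE" by auto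
    note s = edge_stabilizer_subgroup[OF e]
    have eg: "edge_group G \<psi> (fst x) = G\<lparr>carrier := stabilizer G (edge_act \<psi>) (fst x)\<rparr>" by (simp add: edge_group_def)
    have H: "group (edge_group G \<psi> (fst x))" unfolding eg by (rule subgroup.subgroup_is_group[OF s]) (rule is_group)
    have "c x \<in> carrier (edge_group G \<psi> (fst x))" using x by (simp add: eg)
    then obtain w where "set w \<subseteq> T (fst x) \<times> UNIV" "word_eval (edge_group G \<psi> (fst x)) w = c x"
      using group.word_exists[OF H T[OF e]] by blast
    then show "\<exists>n. Q x n" unfolding Q_def using word_eval_subgroup[OF s _ T_stab[OF e]] unfolding eg by fastforce
  next
    show "Q x n" if "Q x m" "m \<le> n" for x m n using that unfolding Q_def by force
  qed
  then have "\<forall>m. \<exists>N. \<forall>x\<in>{x \<in> RE \<times> UNIV \<times> {p. set p \<subseteq> letters \<and> length p \<le> m}. c x \<in> stabilizer G (edge_act \<psi>) (fst x)}. Q x N"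
    by (rule allI)
  from choice[OF this] obtain f where
    f: "\<forall>m. \<forall>x\<in>{x \<in> RE \<times> UNIV \<times> {p. set p \<subseteq> letters \<and> length p \<le> m}. c x \<in> stabilizer G (edge_act \<psi>) (fst x)}. Q x (f m)"
    by (rule exE)
  show ?thesis
  proof (intro exI[of _ f] allI impI)
    fix K e b p
    assume e: "e \<in> RE" and p: "edge_path (groupoid_complex K) (org e b) p (org e b)"
      and st: "tr e b \<otimes> plab p \<otimes> inv (tr e b) \<in> stabilizer G (edge_act \<psi>) e"
    have "Q (e, b, p) (f (length p))" by (rule bspec[OF spec[OF f]]) (use e path_letters[OF p] st in \<open>auto simp: c_def\<close>)
    then show "\<exists>w. set w \<subseteq> T e \<times> UNIV \<and> word_eval G w = tr e b \<otimes> plab p \<otimes> inv (tr e b) \<and> length w \<le> f (length p)"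
      unfolding Q_def c_def by simp
  qed
qed

text \<open>\<open>groupoid_area\<close> with functions that merely exist: \<open>A\<close> is a
  maximum over the finitely many vertex words of given length, and
  \<open>superadditive_dominates\<close> turns the bound on edge words into a superadditive
  \<open>B\<close>.\<close>

lemma loops_null_homotopic:
  assumes K: "4 \<le> K"
    and null: "\<And>v p. v \<in> RV \<Longrightarrow> set p \<subseteq> vletters v \<Longrightarrow> plab p = \<one> \<Longrightarrow> \<exists>N. homotopic (groupoid_complex K) v v N p []"
    and p: "edge_path (groupoid_complex K) v p v" "plab p = \<one>"
  shows "\<exists>N. homotopic (groupoid_complex K) v v N p []"
proof -
  have "\<exists>N. \<forall>x\<in>{x \<in> RV \<times> {p. set p \<subseteq> letters \<and> length p \<le> l}. set (snd x) \<subseteq> vletters (fst x) \<and> plab (snd x) = \<one>}.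
      homotopic (groupoid_complex K) (fst x) (fst x) N (snd x) []" for l
  proof (rule finite_bound)
    have "finite (RV \<times> {p. set p \<subseteq> letters \<and> length p \<le> l})"
      using finite_RV finite_lists_length_le[OF finite_letters] by auto
    then show "finite {x \<in> RV \<times> {p. set p \<subseteq> letters \<and> length p \<le> l}. set (snd x) \<subseteq> vletters (fst x) \<and> plab (snd x) = \<one>}" by simp
  qed (use null Z.homotopic_mono in auto)
  then have "\<forall>l. \<exists>N. \<forall>x\<in>{x \<in> RV \<times> {p. set p \<subseteq> letters \<and> length p \<le> l}. set (snd x) \<subseteq> vletters (fst x) \<and> plab (snd x) = \<one>}.
      homotopic (groupoid_complex K) (fst x) (fst x) N (snd x) []" by (rule allI)
  from choice[OF this] obtain A where
    A: "\<forall>l. \<forall>x\<in>{x \<in> RV \<times> {p. set p \<subseteq> letters \<and> length p \<le> l}. set (snd x) \<subseteq> vletters (fst x) \<and> plab (snd x) = \<one>}.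
      homotopic (groupoid_complex K) (fst x) (fst x) (A l) (snd x) []" by (rule exE)
  have A': "homotopic (groupoid_complex K) v v (A l) p []"
    if "v \<in> RV" "set p \<subseteq> vletters v" "plab p = \<one>" "length p \<le> l" for v p l
    using bspec[OF spec[OF A, of l], of "(v, p)"] that vletters_letters[OF that(1)] by auto
  obtain f where f: "\<And>e b p. e \<in> RE \<Longrightarrow> edge_path (groupoid_complex K) (org e b) p (org e b) \<Longrightarrow>
      tr e b \<otimes> plab p \<otimes> inv (tr e b) \<in> stabilizer G (edge_act \<psi>) e \<Longrightarrow>
      \<exists>w. set w \<subseteq> T e \<times> UNIV \<and> word_eval G w = tr e b \<otimes> plab p \<otimes> inv (tr e b) \<and> length w \<le> f (length p)"
    using edge_words_bound by meson
  obtain B where B: "\<And>m n. B m + B n \<le> B (m + n)" "\<And>n. n \<le> B n" "\<And>n. f n \<le> B (n + 2)"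
    using superadditive_dominates[of f] by blast
  have B': "\<exists>w. set w \<subseteq> T e \<times> UNIV \<and> word_eval G w = tr e b \<otimes> plab p \<otimes> inv (tr e b) \<and> length w \<le> B (length p + 2)"
    if "e \<in> RE" "edge_path (groupoid_complex K) (org e b) p (org e b)"
      "tr e b \<otimes> plab p \<otimes> inv (tr e b) \<in> stabilizer G (edge_act \<psi>) e" for e b p
    using f[OF that] B(3)[of "length p"] le_trans by blast
  have "homotopic (groupoid_complex K) v v (length p * (A (2 * B (length p)) + B (length p)) + A (2 * B (length p))) p []"
    by (rule groupoid_area[where A = A and B = B and n = "length p"]) (fact K A' B(1) B(2) B' p order_refl)+
  then show ?thesis by blast
qed

text \<open>\<open>W\<close> is a presentation complex: its generators are the labels of positive
  letters, its relators all short nonempty words with value \<open>\<one>\<close>. A trivial word is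
  turned into a loop of \<open>groupoid_complex K\<close> at \<open>z0\<close> and contracted there,
  and the contraction is read back in \<open>W\<close>.\<close>

lemma finite_presentation:
  assumes K: "4 \<le> K"
    and null: "\<And>v p. v \<in> RV \<Longrightarrow> set p \<subseteq> vletters v \<Longrightarrow> plab p = \<one> \<Longrightarrow> \<exists>N. homotopic (groupoid_complex K) v v N p []"
  shows "finitely_presented G"
proof -
  let ?Z = "groupoid_complex K"
  have "V \<noteq> {}" using tree unfolding is_tree_def by simp
  then obtain z0 where z0: "z0 \<in> RV" using RV unfolding orbit_representatives_def by blast
  define S where "S = lab ` {z \<in> letters. snd z}"
  have S: "finite S" "S \<subseteq> carrier G" unfolding S_def using finite_letters by auto
  let ?E = "S \<times> (UNIV :: bool set)"
  define lp where "lp s = (SOME p. edge_path ?Z z0 p z0 \<and> plab p = s)" for s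
  have lp: "edge_path ?Z z0 (lp s) z0 \<and> plab (lp s) = s" if s: "s \<in> S" for s
  proof -
    have "\<exists>p. edge_path ?Z z0 p z0 \<and> plab p = s" by (rule loop_exists[OF z0 subsetD[OF S(2) s]])
    then show ?thesis unfolding lp_def by (rule someI_ex)
  qed
  have "\<exists>L. \<forall>s\<in>S. length (lp s) \<le> L" by (rule finite_bound[OF S(1)]) (blast, rule le_trans)
  then obtain L where L: "\<forall>s\<in>S. length (lp s) \<le> L" by (rule exE)
  define \<Phi> where "\<Phi> x = (if snd x then lp (fst x) else path_inverse ?Z (lp (fst x)))" for x
  \<comment> \<open>\<open>K\<close> is for the images of faces, \<open>1 + L\<close> for a
    generator compared with the image of its loop.\<close>
  define K' where "K' = K + 1 + L"
  define R where "R = {w. set w \<subseteq> ?E \<and> length w \<le> K' \<and> w \<noteq> [] \<and> word_eval G w = \<one>}"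
  have "finite {w. set w \<subseteq> ?E \<and> length w \<le> K'}" by (rule finite_lists_length_le) (use S in simp)
  then have R: "finite R" "R \<subseteq> lists ?E" unfolding R_def by (auto elim: finite_subset[rotated])
  define W :: "(unit, 'a \<times> bool, ('a \<times> bool) list) complex2" where
    "W = \<lparr>verts = {()}, edges = ?E, faces = R, src = \<lambda>_. (), rv = \<lambda>(s, b). (s, \<not> b), bdry = \<lambda>p. p\<rparr>"
  let ?\<mu> = "\<lambda>(s, b). if b then s else inv s"
  have Wpath: "edge_path W () p () \<longleftrightarrow> set p \<subseteq> ?E" for p
    by (induction p) (auto simp: W_def)
  have Wlab: "labelled_complex W G ?\<mu> snd"
  proof (intro labelled_complex.intro two_complex.intro labelled_complex_axioms.intro is_group)
    show "is_complex2 W"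
      unfolding is_complex2_def
    proof (intro conjI ballI)
      fix f assume "f \<in> faces W"
      then have f: "f \<noteq> []" "set f \<subseteq> ?E" by (auto simp: W_def R_def)
      show "bdry W f \<noteq> []" using f by (simp add: W_def)
      show "\<exists>v. edge_path W v (bdry W f) v" using Wpath[of f] f by (auto simp: W_def)
    qed (auto simp: W_def)
  qed (use S in \<open>auto simp: W_def R_def word_eval_label[symmetric]\<close>)
  have Ws: "faces W = R" "bdry W = (\<lambda>p. p)" by (simp_all add: W_def)
  interpret W: labelled_complex W G ?\<mu> snd by (rule Wlab)
  have short: "homotopic W () () 1 p q"
    if pq: "set p \<subseteq> ?E" "set q \<subseteq> ?E" "word_eval G p = word_eval G q" "length p + length q \<le> K'" for p q
  proof (rule W.homotopic_of_loop)
    let ?r = "p @ path_inverse W q"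
    have q': "set (path_inverse W q) \<subseteq> ?E" using W.path_inverse_edges[of q] pq(2) by (simp add: W_def)
    have r: "set ?r \<subseteq> ?E" using pq(1) q' by simp
    have "word_eval G (path_inverse W q) = inv (word_eval G q)"
      using W.path_label_inverse[of q] pq(2) by (simp add: W_def word_eval_label)
    then have one: "word_eval G ?r = \<one>"
      using word_eval_append[OF pq(1) q' S(2)] pq(3) word_eval_closed[OF pq(2) S(2)] by simp
    show "edge_path W () p ()" "edge_path W () q ()" using pq Wpath by auto
    show "homotopic W () () 1 ?r []"
    proof (cases "?r = []")
      case True
      then show ?thesis by (auto simp: W_def intro: homotopic.refl)
    next
      case False
      then have "?r \<in> R" using r one pq(4) unfolding R_def by simp
      then have "?r \<in> faces W" unfolding Ws .
      from W.homotopic_face[OF this, of "()", unfolded Ws] show ?thesis using Wpath[of ?r] r by simp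
    qed
  qed
  \<comment> \<open>A letter goes to the generator labelling its positive version, with the same
    sign. Lengths are kept, so faces are mapped to words of length at most \<open>K\<close>.\<close>
  define \<theta> where "\<theta> z = [(lab (fst z, True), snd z)]" for z :: "('v \<times> 'a + 'v set) \<times> bool"
  have \<theta>E: "set (\<theta> z) \<subseteq> ?E \<and> word_eval G (\<theta> z) = lab z" if z: "z \<in> letters" for z
  proof -
    obtain y b where y: "z = (y, b)" by (cases z)
    have t: "(y, True) \<in> letters" using z unfolding y letters_def by auto
    then have "lab (y, True) \<in> S" unfolding S_def by force
    moreover have "lab (y, False) = inv (lab (y, True))" using lab_rv[OF t] by simp
    ultimately show ?thesis using lab_closed[OF t] lab_closed[OF z] unfolding \<theta>_def y by (cases b) auto
  qed
  have \<theta>path: "set (concat (map \<theta> p)) \<subseteq> ?E \<and> word_eval G (concat (map \<theta> p)) = plab p" if "set p \<subseteq> letters" for p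
    using that
  proof (induction p)
    case (Cons z p)
    then show ?case using \<theta>E[of z] word_eval_append[of "\<theta> z" S "concat (map \<theta> p)"] S(2) by simp
  qed simp
  have \<theta>len: "length (concat (map \<theta> p)) = length p" for p
    by (induction p) (simp_all add: \<theta>_def)
  interpret dev: developing_map ?Z W "{()}" "\<lambda>_. \<theta>" "\<lambda>_ _. ()" "\<lambda>_ _. ()" 1
  proof unfold_locales
    fix s :: unit and z assume z: "z \<in> edges ?Z"
    show "edge_path W () (\<theta> z) ()" using Wpath \<theta>E[of z] z by simp
    show "\<theta> (rv ?Z z) = path_inverse W (\<theta> z)" by (cases z) (simp add: \<theta>_def path_inverse_def W_def)
  next
    fix s :: unit and f u assume f: "f \<in> faces ?Z" "edge_path ?Z u (bdry ?Z f) u"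
    have fl: "set f \<subseteq> letters" using path_letters[OF f(2)] by simp
    have "length f \<le> K" "plab f = \<one>" using f(1) by (auto simp: groupoid_complex_def)
    then have "homotopic W () () 1 (concat (map \<theta> f)) []"
      by (intro short) (use \<theta>path[OF fl] \<theta>len K'_def in auto)
    then show "homotopic W () () 1 (develop (\<lambda>_. \<theta>) (\<lambda>_ _. ()) s (bdry ?Z f)) []"
      by (simp add: develop_stateless)
  qed (simp_all add: W_def)
  have gen: "generate G S = carrier G"
  proof
    show "generate G S \<subseteq> carrier G" using generate_in_carrier[OF S(2)] by blast
    show "carrier G \<subseteq> generate G S"
    proof
      fix g assume g: "g \<in> carrier G"
      obtain p where p: "edge_path ?Z z0 p z0" "plab p = g" using loop_exists[OF z0 g] by blast
      then show "g \<in> generate G S" using \<theta>path[OF path_letters[OF p(1)]] word_eval_generate by metis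
    qed
  qed
  \<comment> \<open>Steps are also used backwards in the equivalence closure, so being a word over
    \<open>S\<close> is carried along as an equivalence.\<close>
  have sound: "(set a \<subseteq> ?E \<longleftrightarrow> set b \<subseteq> ?E) \<and> (set a \<subseteq> ?E \<longrightarrow> word_eval G a = word_eval G b)" if "word_step S R a b" for a b
    using that
  proof (induction rule: word_step.induct)
    case (cancel s u c w)
    have "word_eval G (u @ [(s, c), (s, \<not> c)] @ w) = word_eval G (u @ w)" if uw: "set u \<subseteq> ?E" "set w \<subseteq> ?E"
    proof -
      have s: "s \<in> carrier G" "word_eval G w \<in> carrier G"
        using cancel S(2) word_eval_closed[OF uw(2) S(2)] by auto
      have "word_eval G ((s, c) # (s, \<not> c) # w) = word_eval G w"
        using s by (cases c) (simp_all add: m_assoc[symmetric])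
      moreover have "set ((s, c) # (s, \<not> c) # w) \<subseteq> ?E" using cancel uw by simp
      ultimately show ?thesis using word_eval_append[OF uw(1) _ S(2)] uw(2) by simp
    qed
    then show ?case using cancel by auto
  next
    case (relator r u w)
    then have r: "set r \<subseteq> ?E" "word_eval G r = \<one>" by (auto simp: R_def)
    have "word_eval G (u @ r @ w) = word_eval G (u @ w)" if uw: "set u \<subseteq> ?E" "set w \<subseteq> ?E"
    proof -
      have "word_eval G (r @ w) = word_eval G w"
        using word_eval_append[OF r(1) uw(2) S(2)] r(2) word_eval_closed[OF uw(2) S(2)] by simp
      moreover have "set (r @ w) \<subseteq> ?E" using r uw by simp
      ultimately show ?thesis using word_eval_append[OF uw(1) _ S(2)] uw(2) by simp
    qed
    then show ?case using r(1) by auto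
  qed
  have soundc: "set b \<subseteq> ?E \<and> word_eval G b = word_eval G a" if "equivclp (word_step S R) a b" "set a \<subseteq> ?E" for a b
    using that
  proof (induction rule: equivclp_induct)
    case (step y z)
    then show ?case using sound[of y z] sound[of z y] by auto
  qed simp
  have complete: "equivclp (word_step S R) a b" if "homotopic W () () N a b" for N a b
  proof -
    have st: "word_step S R a b" if "homotopy_step W () () k a b" for k a b
      using that
    proof (induction rule: homotopy_step.induct)
      case (cancel p e q)
      then have e: "fst e \<in> S" using Wpath by auto
      have "[e, rv W e] = [(fst e, snd e), (fst e, \<not> snd e)]" by (cases e) (simp add: W_def)
      then show ?case using word_step.cancel[OF e, of R p "snd e" q] by simp
    next
      case (face f p q)
      then show ?case using word_step.relator[of f R S p q] by (simp add: W_def)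
    qed
    show ?thesis using that
    proof (induction rule: homotopic.induct)
      case (forward N p q k r)
      then show ?case using st equivclp_into_equivclp by metis
    next
      case (backward N p q k r)
      then show ?case using st equivclp_into_equivclp by metis
    qed simp
  qed
  have trivial: "equivclp (word_step S R) w []" if w: "set w \<subseteq> ?E" "word_eval G w = \<one>" for w
  proof -
    have \<Phi>: "edge_path ?Z z0 (\<Phi> x) z0 \<and> plab (\<Phi> x) = ?\<mu> x \<and> length (\<Phi> x) \<le> L" if x: "x \<in> ?E" for x
    proof -
      have s: "fst x \<in> S" using x by auto
      note l = lp[OF s]
      show ?thesis
      proof (cases "snd x")
        case True
        then show ?thesis using l L s unfolding \<Phi>_def by (cases x) auto
      next
        case False
        have "plab (path_inverse ?Z (lp (fst x))) = inv (fst x)"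
          using plab_path_inverse[OF path_letters[OF conjunct1[OF l]], of K] l by simp
        then show ?thesis using False l L s Z.edge_path_inverse[OF conjunct1[OF l]] unfolding \<Phi>_def
          by (cases x) (auto simp: path_inverse_def)
      qed
    qed
    \<comment> \<open>A word over \<open>S\<close> is spelled by loops at \<open>z0\<close> and read
      back letter by letter. A generator and its round trip have the same value, so they differ by
      one relator.\<close>
    have \<Phi>w: "edge_path ?Z z0 (concat (map \<Phi> w)) z0 \<and> plab (concat (map \<Phi> w)) = word_eval G w \<and>
      homotopic W () () (length w) w (concat (map \<theta> (concat (map \<Phi> w))))" if "set w \<subseteq> ?E" for w
      using that
    proof (induction w)
      case Nil
      then show ?case using z0 by (auto simp: W_def intro: homotopic.refl)
    next
      case (Cons x w)
      then have x: "x \<in> ?E" and w: "set w \<subseteq> ?E" by auto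
      note IH = Cons.IH[OF w] and px = \<Phi>[OF x]
      have lx: "set (\<Phi> x) \<subseteq> letters" "set (concat (map \<Phi> w)) \<subseteq> letters"
        using path_letters[OF conjunct1[OF px]] path_letters[OF conjunct1[OF IH]] .
      have 1: "edge_path ?Z z0 (concat (map \<Phi> (x # w))) z0"
        using Z.edge_path_append[OF conjunct1[OF px] conjunct1[OF IH]] by simp
      have 2: "plab (concat (map \<Phi> (x # w))) = word_eval G (x # w)"
        using plab_append[OF lx] px IH by (cases x) simp
      have s: "fst x \<in> carrier G" using x S(2) by auto
      have "homotopic W () () 1 [x] (concat (map \<theta> (\<Phi> x)))"
      proof (rule short)
        show "word_eval G [x] = word_eval G (concat (map \<theta> (\<Phi> x)))"
          using \<theta>path[OF lx(1)] px s by (cases x) simp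
        show "length [x] + length (concat (map \<theta> (\<Phi> x))) \<le> K'" using px \<theta>len unfolding K'_def by simp
      qed (use x \<theta>path[OF lx(1)] in auto)
      from W.homotopic_append[OF this conjunct2[OF conjunct2[OF IH]]]
      have "homotopic W () () (length (x # w)) (x # w) (concat (map \<theta> (concat (map \<Phi> (x # w)))))" by simp
      then show ?case using 1 2 by blast
    qed
    note f = \<Phi>w[OF w(1)]
    have "plab (concat (map \<Phi> w)) = \<one>" using conjunct1[OF conjunct2[OF f]] w(2) by (rule trans)
    then obtain N where "homotopic ?Z z0 z0 N (concat (map \<Phi> w)) []"
      using loops_null_homotopic[where K = K and v = z0 and p = "concat (map \<Phi> w)", OF K null conjunct1[OF f]] by blast
    from dev.develop_homotopic[OF this, of "()"]
    have "homotopic W () () N (concat (map \<theta> (concat (map \<Phi> w)))) []" by (simp add: develop_stateless)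
    from W.homotopic_trans[OF conjunct2[OF conjunct2[OF f]] this] show ?thesis by (rule complete)
  qed
  show ?thesis
    unfolding finitely_presented_def finite_generating_set_def
  proof (intro exI conjI ballI)
    show "finite S" "S \<subseteq> carrier G" "generate G S = carrier G" "finite R" "R \<subseteq> lists (S \<times> UNIV)" using S R gen by auto
    fix w :: "('a \<times> bool) list" assume "w \<in> lists (S \<times> UNIV)"
    then have w: "set w \<subseteq> ?E" by auto
    show "word_eval G w = \<one> \<longleftrightarrow> equivclp (word_step S R) w []" using trivial[OF w] soundc[OF _ w, of "[]"] by auto
  qed
qed

end

section \<open>Superadditive closures and the absorption of constants\<close>

lemma finite_partitions: "finite {ns :: nat list. (\<forall>m\<in>set ns. 1 \<le> m) \<and> sum_list ns = n}"
proof (rule finite_subset)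
  have "length ns \<le> sum_list ns \<and> set ns \<subseteq> {..sum_list ns}" if "\<forall>m\<in>set ns. 1 \<le> m" for ns :: "nat list"
    using that by (induction ns) auto
  then show "{ns :: nat list. (\<forall>m\<in>set ns. 1 \<le> m) \<and> sum_list ns = n} \<subseteq> {ns. set ns \<subseteq> {..n} \<and> length ns \<le> n}"
    by blast
qed (rule finite_lists_length_le, simp)

lemma finite_partition_sums:
  "finite {sum_list (map f ns) | ns. (\<forall>m\<in>set ns. 1 \<le> m) \<and> sum_list ns = (n :: nat)}" for f :: "nat \<Rightarrow> nat"
  using finite_imageI[OF finite_partitions[of n], of "\<lambda>ns. sum_list (map f ns)"] by (simp add: setcompr_eq_image)

lemma superadd_closure_upper:
  "\<forall>m\<in>set ns. 1 \<le> m \<Longrightarrow> sum_list (map f ns) \<le> superadd_closure f (sum_list ns)"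
  unfolding superadd_closure_def by (rule Max_ge[OF finite_partition_sums]) blast

lemma superadd_closure_attained:
  obtains ns where "\<forall>m\<in>set ns. 1 \<le> m" "sum_list ns = n" "superadd_closure f n = sum_list (map f ns)"
proof -
  have "sum_list (map f (replicate n 1)) \<in> {sum_list (map f ns) | ns. (\<forall>m\<in>set ns. 1 \<le> m) \<and> sum_list ns = n}"
    by (rule CollectI, rule exI[of _ "replicate n 1"]) (simp add: sum_list_replicate)
  then have "superadd_closure f n \<in> {sum_list (map f ns) | ns. (\<forall>m\<in>set ns. 1 \<le> m) \<and> sum_list ns = n}"
    unfolding superadd_closure_def by (intro Max_in finite_partition_sums) blast
  then show ?thesis using that by blast
qed

lemma superadd_closure_add: "superadd_closure f m + superadd_closure f n \<le> superadd_closure f (m + n)"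
proof -
  obtain ms where ms: "\<forall>m\<in>set ms. 1 \<le> m" "sum_list ms = m" "superadd_closure f m = sum_list (map f ms)"
    by (rule superadd_closure_attained)
  obtain ns where ns: "\<forall>m\<in>set ns. 1 \<le> m" "sum_list ns = n" "superadd_closure f n = sum_list (map f ns)"
    by (rule superadd_closure_attained)
  have "\<forall>m\<in>set (ms @ ns). 1 \<le> m" using ms ns by auto
  from superadd_closure_upper[OF this, of f] show ?thesis using ms ns by simp
qed

lemma superadd_closure_ge: "1 \<le> n \<Longrightarrow> f n \<le> superadd_closure f n"
  using superadd_closure_upper[of "[n]" f] by simp

lemma superadd_closure_mono: "m \<le> n \<Longrightarrow> superadd_closure f m \<le> superadd_closure f n"
  using superadd_closure_add[of f m "n - m"] by simp

lemma superadd_closure_mult: "k * superadd_closure f n \<le> superadd_closure f (k * n)"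
proof (induction k)
  case (Suc k)
  then show ?case using superadd_closure_add[of f n "k * n"] by simp
qed simp

text \<open>This is where the nonvanishing of a representative enters: \<open>k\<close> blocks of
  size \<open>n\<close> contribute at least 1 each.\<close>

lemma superadd_closure_linear:
  assumes "1 \<le> n" "f n \<noteq> 0"
  shows "k \<le> superadd_closure f (n * k)"
proof -
  have "k * 1 \<le> k * superadd_closure f n"
    using superadd_closure_ge[OF assms(1), of f] assms(2) by (intro mult_le_mono2) simp
  also have "\<dots> \<le> superadd_closure f (k * n)" by (rule superadd_closure_mult)
  finally show ?thesis by (simp add: mult.commute)
qed

text \<open>The factor in front of \<open>D\<close> goes into the argument by superadditivity, and
  the additive constant is dominated by the linear growth from
  \<open>superadd_closure_linear\<close>. The case \<open>m = 0\<close> is left out because the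
  closure is 0 there.\<close>

lemma represents_dist_bound:
  assumes "represents_dist f D"
  shows "\<exists>q. (\<forall>m\<ge>1. f (\<kappa> * m) \<le> superadd_closure D (q * m)) \<and> (\<forall>n. n \<le> superadd_closure D (q * n))"
proof -
  let ?D = "superadd_closure D"
  obtain n1 where n1: "1 \<le> n1" "D n1 \<noteq> 0" using assms unfolding represents_dist_def by blast
  obtain C :: nat where C: "C > 0" "\<And>n. real (f n) \<le> real C * real (D (C * n + C)) + real C"
    using assms unfolding represents_dist_def fun_simeq_def dominated_strict_def by blast
  have f: "f n \<le> C * D (C * n + C) + C" for n
    using C(2)[of n] by (metis of_nat_add of_nat_le_iff of_nat_mult)
  \<comment> \<open>The first summand covers the argument for the multiple of \<open>D\<close>,
    \<open>n1 * C\<close> the one for the additive constant, and \<open>n1\<close> the linear lower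
    bound.\<close>
  define q where "q = C * (C * \<kappa> + C) + n1 * C + n1"
  have "f (\<kappa> * m) \<le> ?D (q * m)" if "1 \<le> m" for m
  proof -
    have "C * D (C * (\<kappa> * m) + C) \<le> C * ?D (C * (\<kappa> * m) + C)"
      using C(1) by (intro mult_le_mono2 superadd_closure_ge) simp
    also have "\<dots> \<le> ?D (C * (C * (\<kappa> * m) + C))" by (rule superadd_closure_mult)
    finally have "f (\<kappa> * m) \<le> ?D (C * (C * (\<kappa> * m) + C)) + ?D (n1 * C)"
      using f[of "\<kappa> * m"] superadd_closure_linear[where f = D, OF n1, of C] by linarith
    also have "\<dots> \<le> ?D (C * (C * (\<kappa> * m) + C) + n1 * C)" by (rule superadd_closure_add)
    also have "\<dots> \<le> ?D (q * m)"
    proof (rule superadd_closure_mono)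
      obtain k where "m = Suc k" using \<open>1 \<le> m\<close> not0_implies_Suc[of m] by auto
      then show "C * (C * (\<kappa> * m) + C) + n1 * C \<le> q * m" unfolding q_def by (simp add: algebra_simps)
    qed
    finally show ?thesis .
  qed
  moreover have "n \<le> ?D (q * n)" for n
    using superadd_closure_linear[where f = D, OF n1, of n] superadd_closure_mono[of "n1 * n" "q * n" D]
    unfolding q_def by (simp add: algebra_simps)
  ultimately show ?thesis by blast
qed

text \<open>All constants are collected in one \<open>N\<close>. Superadditivity moves factors and
  summands inside \<open>superadd_closure D\<close>, monotonicity of \<open>\<Delta>\<close>
  enlarges its argument, and \<open>real n \<le> \<Delta> n\<close> absorbs the corridor term
  \<open>B\<close> into the Dehn term.\<close>

lemma area_dominated:
  fixes D :: "nat \<Rightarrow> nat" and \<Delta> :: "nat \<Rightarrow> real"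
  assumes n1: "1 \<le> n1" "D n1 \<noteq> 0" and \<Delta>: "mono \<Delta>" "\<And>n. real n \<le> \<Delta> n"
    and A: "\<And>l. real (A l) \<le> real c * \<Delta> (c * l + c)"
    and B: "\<And>m. B m = superadd_closure D (q * m)"
    and F: "\<And>n. F n \<le> C * (C * n * (A (2 * B (C * n)) + B (C * n)) + A (2 * B (C * n))) + C * n"
  shows "(\<lambda>n. real (F n)) \<preceq> (\<lambda>n. real n * \<Delta> (superadd_closure D n))"
proof -
  let ?D = "superadd_closure D"
  \<comment> \<open>In this order: the coefficient of \<open>\<Delta>\<close>, the two parts of its
    argument, the argument of the closure in \<open>B\<close>, the linear term, and
    positivity.\<close>
  define N where "N = C * (c + 1) * (C + 1) + 2 * c * q * C + n1 * c + q * C + C + 1"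
  have "real (F n) \<le> real N * (real (N * n + N) * \<Delta> (?D (N * n + N))) + real N * real n + real N" for n
  proof -
    let ?y = "?D (N * n + N)"
    have B1: "B (C * n) \<le> ?y" unfolding B
      by (rule superadd_closure_mono) (simp add: N_def algebra_simps)
    \<comment> \<open>The factor \<open>2 * c\<close> moves inside the closure, and the summand
      \<open>c\<close> is at most the closure at \<open>n1 * c\<close>.\<close>
    have "c * (2 * B (C * n)) + c \<le> ?D (2 * c * (q * (C * n))) + ?D (n1 * c)"
      using superadd_closure_mult[of "2 * c" D "q * (C * n)"] superadd_closure_linear[where f = D, OF n1, of c]
      unfolding B by (simp add: algebra_simps)
    also have "\<dots> \<le> ?D (2 * c * (q * (C * n)) + n1 * c)" by (rule superadd_closure_add)
    also have "\<dots> \<le> ?y" by (rule superadd_closure_mono) (simp add: N_def algebra_simps)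
    finally have "\<Delta> (c * (2 * B (C * n)) + c) \<le> \<Delta> ?y" by (rule monoD[OF \<Delta>(1)])
    then have A1: "real (A (2 * B (C * n))) \<le> real c * \<Delta> ?y"
      using A[of "2 * B (C * n)"] mult_left_mono[of "\<Delta> (c * (2 * B (C * n)) + c)" "\<Delta> ?y" "real c"] by linarith
    have y: "real (B (C * n)) \<le> \<Delta> ?y" "0 \<le> \<Delta> ?y" using B1 \<Delta>(2)[of ?y] by linarith+
    have "real (F n) \<le> real (C * (C * n * (A (2 * B (C * n)) + B (C * n)) + A (2 * B (C * n))) + C * n)"
      using F[of n] of_nat_le_iff by blast
    also have "\<dots> = real C * (real (C * n) * (real (A (2 * B (C * n))) + real (B (C * n))) + real (A (2 * B (C * n)))) + real (C * n)"
      by simp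
    also have "\<dots> \<le> real C * (real (C * n) * (real c * \<Delta> ?y + \<Delta> ?y) + real c * \<Delta> ?y) + real (C * n)"
      by (intro add_mono mult_left_mono A1 y(1)) auto
    also have "\<dots> = real (C * (C * n * (c + 1) + c)) * \<Delta> ?y + real (C * n)" by (simp add: algebra_simps)
    also have "\<dots> \<le> real (N * (N * n + N)) * \<Delta> ?y + real (N * n)"
    proof (intro add_mono mult_right_mono y(2))
      have "C * (C * n * (c + 1) + c) \<le> (C * (c + 1) * (C + 1)) * (1 * n + 1)" by (simp add: algebra_simps)
      also have "\<dots> \<le> N * (N * n + N)" by (intro mult_le_mono add_mono) (simp_all add: N_def)
      finally show "real (C * (C * n * (c + 1) + c)) \<le> real (N * (N * n + N))" by (rule of_nat_mono)
      show "real (C * n) \<le> real (N * n)" by (intro of_nat_mono mult_le_mono1) (simp add: N_def)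
    qed
    finally show ?thesis by (simp add: mult.assoc)
  qed
  moreover have "N > 0" unfolding N_def by simp
  ultimately show ?thesis unfolding dominated_def by blast
qed

text \<open>The linear error term in \<open>\<preceq>\<close> is absorbed because each
  \<open>\<delta> v\<close> is bounded below by the identity. Monotonicity then allows a common
  constant for the finitely many vertices.\<close>

lemma max_dominated:
  fixes h :: "'v \<Rightarrow> nat \<Rightarrow> nat" and \<delta> :: "'v \<Rightarrow> nat \<Rightarrow> real"
  assumes R: "finite R" "R \<noteq> {}"
    and h: "\<And>v. v \<in> R \<Longrightarrow> (\<lambda>n. real (h v n)) \<preceq> \<delta> v"
    and \<delta>: "\<And>v. v \<in> R \<Longrightarrow> mono (\<delta> v)" "\<And>v n. v \<in> R \<Longrightarrow> real n \<le> \<delta> v n"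
  shows "mono (\<lambda>n. MAX v\<in>R. \<delta> v n)" "\<And>n. real n \<le> (MAX v\<in>R. \<delta> v n)"
    "\<exists>c. \<forall>l. real ((MAX v\<in>R. h v (L v * l)) + l) \<le> real c * (MAX v\<in>R. \<delta> v (c * l + c))"
proof -
  let ?\<Delta> = "\<lambda>n. MAX v\<in>R. \<delta> v n"
  have ge: "\<delta> v n \<le> ?\<Delta> n" if "v \<in> R" for v n using R(1) that by (intro Max_ge) auto
  have \<delta>0: "0 \<le> \<delta> v n" if "v \<in> R" for v n using \<delta>(2)[OF that, of n] by linarith
  show mono: "mono ?\<Delta>"
  proof (rule monoI)
    fix m n :: nat assume "m \<le> n"
    then have "\<delta> v m \<le> ?\<Delta> n" if "v \<in> R" for v using monoD[OF \<delta>(1)[OF that]] ge[OF that] order_trans by blast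
    then show "?\<Delta> m \<le> ?\<Delta> n" using R by simp
  qed
  show lin: "real n \<le> ?\<Delta> n" for n
  proof -
    obtain v where "v \<in> R" using R by blast
    then show ?thesis using \<delta>(2) ge order_trans by blast
  qed
  have "\<exists>c. \<forall>v\<in>R. v \<in> R \<and> (\<forall>l. real (h v (L v * l)) \<le> real c * \<delta> v (c * l + c))"
  proof (rule finite_bound[OF R(1)])
    fix v assume v: "v \<in> R"
    obtain C where C: "\<And>n. real (h v n) \<le> real C * \<delta> v (C * n + C) + real C * real n + real C"
      using h[OF v] unfolding dominated_def by blast
    \<comment> \<open>Covers both the coefficient \<open>C + 1\<close>, which results from absorbing
      the linear term, and the argument \<open>C * (L v * l) + C\<close>.\<close>
    let ?c = "C * L v + C + 1"
    have "real (h v (L v * l)) \<le> real ?c * \<delta> v (?c * l + ?c)" for l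
    proof -
      let ?x = "C * (L v * l) + C"
      have "real (h v (L v * l)) \<le> real C * \<delta> v ?x + real ?x" using C[of "L v * l"] by simp
      also have "\<dots> \<le> real (C + 1) * \<delta> v ?x" using \<delta>(2)[OF v, of ?x] by (simp add: algebra_simps)
      also have "\<dots> \<le> real ?c * \<delta> v (?c * l + ?c)"
        by (intro mult_mono monoD[OF \<delta>(1)[OF v]] \<delta>0[OF v]) (simp_all add: algebra_simps)
      finally show ?thesis .
    qed
    then show "\<exists>c. v \<in> R \<and> (\<forall>l. real (h v (L v * l)) \<le> real c * \<delta> v (c * l + c))" using v by blast
  next
    fix v and m n :: nat
    assume v: "v \<in> R \<and> (\<forall>l. real (h v (L v * l)) \<le> real m * \<delta> v (m * l + m))" and "m \<le> n"
    then have "real m * \<delta> v (m * l + m) \<le> real n * \<delta> v (n * l + n)" for l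
      using v by (intro mult_mono monoD[OF \<delta>(1)] \<delta>0 add_mono) auto
    then show "v \<in> R \<and> (\<forall>l. real (h v (L v * l)) \<le> real n * \<delta> v (n * l + n))" using v order_trans by blast
  qed
  then obtain c where c: "\<And>v l. v \<in> R \<Longrightarrow> real (h v (L v * l)) \<le> real c * \<delta> v (c * l + c)" by blast
  show "\<exists>c. \<forall>l. real ((MAX v\<in>R. h v (L v * l)) + l) \<le> real c * ?\<Delta> (c * l + c)"
  proof (intro exI[of _ "c + 1"] allI)
    fix l
    let ?y = "(c + 1) * l + (c + 1)"
    have "real (MAX v\<in>R. h v (L v * l)) \<le> real c * ?\<Delta> ?y"
    proof -
      have "(MAX v\<in>R. h v (L v * l)) \<in> (\<lambda>v. h v (L v * l)) ` R" using R by (intro Max_in) auto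
      then obtain v where v: "v \<in> R" "(MAX v\<in>R. h v (L v * l)) = h v (L v * l)" by blast
      have "real (h v (L v * l)) \<le> real c * \<delta> v (c * l + c)" by (rule c[OF v(1)])
      also have "\<dots> \<le> real c * ?\<Delta> ?y"
        by (intro mult_left_mono order_trans[OF monoD[OF \<delta>(1)[OF v(1)]] ge[OF v(1)]]) simp_all
      finally show ?thesis using v(2) by simp
    qed
    moreover have "real l \<le> ?\<Delta> ?y"
    proof -
      have "real l \<le> real ?y" by (rule of_nat_mono) simp
      then show ?thesis using lin[of ?y] by linarith
    qed
    ultimately show "real ((MAX v\<in>R. h v (L v * l)) + l) \<le> real (c + 1) * ?\<Delta> ?y" by (simp add: algebra_simps)
  qed
qed

section \<open>Choosing the data of the graph of groups\<close>

context group
begin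

text \<open>The given generators of a vertex group are enlarged by the conjugates of the edge
  generators at all ends with this representative. They lie in the vertex group since the action has
  no inversions, and \<open>X0 v \<subseteq> X v\<close> preserves a presentation on the old
  generators.\<close>

lemma exists_graph_of_groups:
  assumes tree_act: "tree_action G V E \<psi>" and no_inv: "without_inversion G E \<psi>"
    and RV: "orbit_representatives G V \<psi> RV" and RE: "orbit_representatives G E (edge_act \<psi>) RE"
    and X0: "\<And>v. v \<in> RV \<Longrightarrow> finite_generating_set (vertex_group G \<psi> v) (X0 v)"
    and T: "\<And>e. e \<in> RE \<Longrightarrow> finite_generating_set (edge_group G \<psi> e) (T e)"
  shows "\<exists>endp tr org X. graph_of_groups G V E \<psi> RV RE endp tr org X T \<and> (\<forall>v\<in>RV. X0 v \<subseteq> X v)"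
proof -
  have act: "group_action G V \<psi>" and tree: "is_tree V E" using tree_act unfolding tree_action_def by auto
  have RVV: "RV \<subseteq> V" and REE: "RE \<subseteq> E" and fin: "finite RV" "finite RE"
    using RV RE unfolding orbit_representatives_def by auto
  have "\<forall>e\<in>RE. \<exists>a. fst a \<in> V \<and> snd a \<in> V \<and> fst a \<noteq> snd a \<and> e = {fst a, snd a}"
    using tree REE unfolding is_tree_def by (metis fst_conv snd_conv subsetD)
  from bchoice[OF this] obtain ends where
    ends: "\<forall>e\<in>RE. fst (ends e) \<in> V \<and> snd (ends e) \<in> V \<and> fst (ends e) \<noteq> snd (ends e) \<and> e = {fst (ends e), snd (ends e)}"
    by (rule exE)
  define endp where "endp e b = (if b then fst (ends e) else snd (ends e))" for e b
  have endp: "e = {endp e True, endp e False} \<and> endp e True \<noteq> endp e False" "endp e b \<in> V" "endp e b \<in> e"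
    if "e \<in> RE" for e b
    using bspec[OF ends that] unfolding endp_def by auto
  have "\<forall>x\<in>V. \<exists>a. fst a \<in> RV \<and> snd a \<in> carrier G \<and> \<psi> (snd a) (fst a) = x"
  proof
    fix x assume x: "x \<in> V"
    then obtain r where r: "r \<in> RV" "r \<in> orbit G \<psi> x" using RV unfolding orbit_representatives_def by blast
    then obtain g where g: "g \<in> carrier G" "\<psi> g x = r" unfolding orbit_def by blast
    have "\<psi> (inv g) r = x" by (rule group_action.orbit_sym_aux[OF act g(1) x g(2)])
    then show "\<exists>a. fst a \<in> RV \<and> snd a \<in> carrier G \<and> \<psi> (snd a) (fst a) = x"
      using r(1) g(1) by (intro exI[of _ "(r, inv g)"]) simp
  qed
  from bchoice[OF this] obtain rep where
    rep: "\<forall>x\<in>V. fst (rep x) \<in> RV \<and> snd (rep x) \<in> carrier G \<and> \<psi> (snd (rep x)) (fst (rep x)) = x"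
    by (rule exE)
  define org where "org e b = fst (rep (endp e b))" for e b
  define tr where "tr e b = snd (rep (endp e b))" for e b
  have tr: "tr e b \<in> carrier G \<and> org e b \<in> RV \<and> \<psi> (tr e b) (org e b) = endp e b" if "e \<in> RE" for e b
    using bspec[OF rep endp(2)[OF that]] unfolding tr_def org_def by blast
  define X where "X v = X0 v \<union> (\<Union>e\<in>RE. \<Union>b\<in>{b. org e b = v}. (\<lambda>c. inv (tr e b) \<otimes> c \<otimes> tr e b) ` T e)" for v
  have conj: "inv (tr e b) \<otimes> c \<otimes> tr e b \<in> X (org e b)" if "e \<in> RE" "c \<in> T e" for e b c
    unfolding X_def using that by blast
  have stab: "inv (tr e b) \<otimes> c \<otimes> tr e b \<in> stabilizer G \<psi> (org e b)" if e: "e \<in> RE" and c: "c \<in> T e" for e b c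
  proof -
    note t = tr[OF e, of b]
    have "c \<in> stabilizer G (edge_act \<psi>) e" using T[OF e] c unfolding finite_generating_set_def edge_group_def by auto
    then have cG: "c \<in> carrier G" and "edge_act \<psi> c e = e" unfolding stabilizer_def by auto
    then have fix_end: "\<psi> c (endp e b) = endp e b"
      using no_inv e REE endp(3)[OF e, of b] unfolding without_inversion_def by blast
    have V: "org e b \<in> V" "endp e b \<in> V" using t RVV endp(2)[OF e] by auto
    have "\<psi> (inv (tr e b) \<otimes> c \<otimes> tr e b) (org e b) = \<psi> (inv (tr e b)) (\<psi> c (\<psi> (tr e b) (org e b)))"
      using group_action.composition_rule[OF act] V t cG fix_end by simp
    also have "\<dots> = org e b" using fix_end t group_action.orbit_sym_aux[OF act _ V(1)] by simp
    finally show ?thesis using t cG unfolding stabilizer_def by simp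
  qed
  have X: "finite_generating_set (vertex_group G \<psi> v) (X v)" if v: "v \<in> RV" for v
  proof -
    let ?H = "vertex_group G \<psi> v"
    have H: "group ?H" unfolding vertex_group_def
      using group_action.stabilizer_subgroup[OF act] v RVV subgroup.subgroup_is_group is_group by blast
    have X0v: "finite (X0 v)" "X0 v \<subseteq> carrier ?H" "generate ?H (X0 v) = carrier ?H"
      using X0[OF v] unfolding finite_generating_set_def by auto
    have "finite (T e)" if "e \<in> RE" for e using T[OF that] unfolding finite_generating_set_def by simp
    then have f: "finite (X v)" unfolding X_def using X0v(1) fin(2) by auto
    have c: "X v \<subseteq> carrier ?H" using X0v(2) stab unfolding X_def vertex_group_def by auto
    have "carrier ?H \<subseteq> generate ?H (X v)"
      using group.mono_generate[OF H, of "X0 v" "X v"] X0v(3) unfolding X_def by auto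
    moreover have "generate ?H (X v) \<subseteq> carrier ?H" using group.generate_in_carrier[OF H c] by blast
    ultimately show ?thesis using f c unfolding finite_generating_set_def by blast
  qed
  have "graph_of_groups G V E \<psi> RV RE endp tr org X T"
    by (intro graph_of_groups.intro graph_of_groups_axioms.intro is_group)
      (fact tree_act no_inv RV RE endp(1) tr X T conj)+
  then show ?thesis unfolding X_def by blast
qed

end

section \<open>Assembling the inequality between Dehn functions\<close>

context graph_of_groups
begin

text \<open>\<open>A\<close> is the maximum of the vertex Dehn functions plus a linear term, from
  \<open>vertex_area\<close>; \<open>B\<close> is the closure of \<open>D\<close> at a multiple of
  the length, from the distortion of the edge groups. \<open>groupoid_area\<close> fills loops of
  \<open>groupoid_complex K\<close>, and \<open>filling_from_complex\<close> carries the bound to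
  \<open>Y\<close>.\<close>

lemma dehn_function_dominated:
  fixes Y :: "('v1, 'e1, 'f1) complex2" and Y' :: "'v \<Rightarrow> ('v2, 'e2, 'f2) complex2"
  assumes Y: "dehn_complex G Y"
    and Y': "\<And>v. v \<in> RV \<Longrightarrow> dehn_complex (vertex_group G \<psi> v) (Y' v)"
    and \<delta>: "\<And>v. v \<in> RV \<Longrightarrow> represents_dehn (Y' v) (\<delta> v)"
    and S: "finite_generating_set G S" and D: "represents_dist (edist G S \<psi> RE T) D"
  shows "(\<lambda>n. real (dehn_function Y n)) \<preceq> (\<lambda>n. real n * (MAX v\<in>RV. \<delta> v (superadd_closure D n)))"
proof -
  have "V \<noteq> {}" using tree unfolding is_tree_def by simp
  then obtain z0 where z0: "z0 \<in> RV" using RV unfolding orbit_representatives_def by blast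
  have "\<forall>v\<in>RV. \<exists>a. \<forall>K\<ge>fst a. \<forall>p l. set p \<subseteq> vletters v \<longrightarrow> plab p = \<one> \<longrightarrow> length p \<le> l \<longrightarrow>
    homotopic (groupoid_complex K) v v (dehn_function (Y' v) (snd a * l) + l) p []"
  proof
    fix v assume v: "v \<in> RV"
    obtain K0 L where "\<forall>K\<ge>K0. \<forall>p l. set p \<subseteq> vletters v \<longrightarrow> plab p = \<one> \<longrightarrow> length p \<le> l \<longrightarrow>
      homotopic (groupoid_complex K) v v (dehn_function (Y' v) (L * l) + l) p []"
      using vertex_area[OF v Y'[OF v]] by (elim exE)
    then show "\<exists>a. \<forall>K\<ge>fst a. \<forall>p l. set p \<subseteq> vletters v \<longrightarrow> plab p = \<one> \<longrightarrow> length p \<le> l \<longrightarrow>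
      homotopic (groupoid_complex K) v v (dehn_function (Y' v) (snd a * l) + l) p []"
      by (intro exI[of _ "(K0, L)"]) simp
  qed
  from bchoice[OF this] obtain a where a: "\<forall>v\<in>RV. \<forall>K\<ge>fst (a v). \<forall>p l. set p \<subseteq> vletters v \<longrightarrow> plab p = \<one> \<longrightarrow>
    length p \<le> l \<longrightarrow> homotopic (groupoid_complex K) v v (dehn_function (Y' v) (snd (a v) * l) + l) p []"
    by (rule exE)
  \<comment> \<open>The sum is at least each of the thresholds, and 4 is the length of the relators
    in a corridor.\<close>
  define K where "K = 4 + (\<Sum>v\<in>RV. fst (a v))"
  have K4: "4 \<le> K" unfolding K_def by simp
  have K: "fst (a v) \<le> K" if "v \<in> RV" for v
    using member_le_sum[OF that, of "\<lambda>v. fst (a v)"] finite_RV unfolding K_def by simp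
  define A where "A l = (MAX v\<in>RV. dehn_function (Y' v) (snd (a v) * l)) + l" for l
  have A: "homotopic (groupoid_complex K) v v (A l) p []"
    if "v \<in> RV" "set p \<subseteq> vletters v" "plab p = \<one>" "length p \<le> l" for v p l
  proof (rule Z.homotopic_mono)
    show "homotopic (groupoid_complex K) v v (dehn_function (Y' v) (snd (a v) * l) + l) p []"
      using bspec[OF a that(1)] K[OF that(1)] that(2,3,4) by blast
    have "dehn_function (Y' v) (snd (a v) * l) \<le> (MAX v\<in>RV. dehn_function (Y' v) (snd (a v) * l))"
      by (rule Max_ge) (use finite_RV that(1) in auto)
    then show "dehn_function (Y' v) (snd (a v) * l) + l \<le> A l" unfolding A_def by simp
  qed
  obtain \<kappa> where \<kappa>: "\<forall>K e b p. e \<in> RE \<longrightarrow> edge_path (groupoid_complex K) (org e b) p (org e b) \<longrightarrow>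
    tr e b \<otimes> plab p \<otimes> inv (tr e b) \<in> stabilizer G (edge_act \<psi>) e \<longrightarrow>
    (\<exists>w. set w \<subseteq> T e \<times> UNIV \<and> word_eval G w = tr e b \<otimes> plab p \<otimes> inv (tr e b) \<and>
      length w \<le> edist G S \<psi> RE T (\<kappa> * (length p + 2)))"
    using edge_words_distortion[OF S] by (rule exE)
  obtain q where q: "\<And>m. 1 \<le> m \<Longrightarrow> edist G S \<psi> RE T (\<kappa> * m) \<le> superadd_closure D (q * m)"
    "\<And>n. n \<le> superadd_closure D (q * n)"
    using represents_dist_bound[OF D, of \<kappa>] by blast
  define B where "B m = superadd_closure D (q * m)" for m
  have B_add: "B m + B n \<le> B (m + n)" for m n
    unfolding B_def distrib_left by (rule superadd_closure_add)
  have B_ge: "n \<le> B n" for n unfolding B_def by (rule q(2))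
  have B: "\<exists>w. set w \<subseteq> T e \<times> UNIV \<and> word_eval G w = tr e b \<otimes> plab p \<otimes> inv (tr e b) \<and> length w \<le> B (length p + 2)"
    if "e \<in> RE" "edge_path (groupoid_complex K) (org e b) p (org e b)"
      "tr e b \<otimes> plab p \<otimes> inv (tr e b) \<in> stabilizer G (edge_act \<psi>) e" for e b p
  proof -
    have "edist G S \<psi> RE T (\<kappa> * (length p + 2)) \<le> B (length p + 2)" unfolding B_def by (rule q(1)) simp
    then show ?thesis using \<kappa> that le_trans by blast
  qed
  let ?A = "\<lambda>m. m * (A (2 * B m) + B m) + A (2 * B m)"
  have area: "homotopic (groupoid_complex K) v v (?A m) p []"
    if "edge_path (groupoid_complex K) v p v" "plab p = \<one>" "length p \<le> m" for v p m
    by (rule groupoid_area[where A = A and B = B and n = m]) (fact K4 A B_add B_ge B that)+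
  obtain \<alpha> \<beta> \<gamma> where Y3: "is_complex2 Y" "simply_connected2 Y" "free_cocompact_action G Y \<alpha> \<beta> \<gamma>"
    using Y unfolding dehn_complex_def by blast
  interpret Y: labelled_action Y G \<alpha> \<beta> \<gamma> "groupoid_complex K" lab snd
    by (intro labelled_action.intro free_cocompact.intro two_complex.intro free_cocompact_axioms.intro
      Z.labelled_complex_axioms is_group) (fact Y3)+
  have faces: "finite (faces (groupoid_complex K))"
  proof (rule finite_subset)
    show "faces (groupoid_complex K) \<subseteq> {p. set p \<subseteq> letters \<and> length p \<le> K}"
    proof
      fix f assume f: "f \<in> faces (groupoid_complex K)"
      then obtain u where "edge_path (groupoid_complex K) u f u" using Z.face_loop[OF f] by auto
      then show "f \<in> {p. set p \<subseteq> letters \<and> length p \<le> K}"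
        using path_letters f unfolding groupoid_complex_def by auto
    qed
  qed (rule finite_lists_length_le[OF finite_letters])
  have edges: "finite (edges (groupoid_complex K))" and verts: "z0 \<in> verts (groupoid_complex K)"
    using finite_letters z0 by auto
  have "\<exists>C. \<forall>v p n. edge_path Y v p v \<longrightarrow> length p \<le> n \<longrightarrow> homotopic Y v v (C * ?A (C * n) + C * n) p []"
  proof (rule Y.filling_from_complex[OF edges faces verts])
    show "\<exists>p. edge_path (groupoid_complex K) z0 p z0 \<and> plab p = g" if "g \<in> carrier G" for g
      by (rule loop_exists[OF z0 that])
    show "homotopic (groupoid_complex K) z0 z0 (?A m) p []"
      if "edge_path (groupoid_complex K) z0 p z0" "plab p = \<one>" "length p \<le> m" for p m
      by (rule area[OF that])
  qed
  then obtain C where C: "\<forall>v p n. edge_path Y v p v \<longrightarrow> length p \<le> n \<longrightarrow> homotopic Y v v (C * ?A (C * n) + C * n) p []"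
    by (rule exE)
  have F: "dehn_function Y n \<le> C * ?A (C * n) + C * n" for n
    by (rule Y.dehn_function_le) (use Y3(2) C in \<open>auto simp: simply_connected2_def\<close>)
  have \<delta>': "(\<lambda>n. real (dehn_function (Y' v) n)) \<preceq> \<delta> v" "mono (\<delta> v)" "real n \<le> \<delta> v n" if "v \<in> RV" for v n
    using \<delta>[OF that] unfolding represents_dehn_def fun_approx_def by blast+
  have RV_ne: "RV \<noteq> {}" using z0 by blast
  let ?h = "\<lambda>v. dehn_function (Y' v)" and ?\<Delta> = "\<lambda>n. MAX v\<in>RV. \<delta> v n"
  have \<Delta>: "mono ?\<Delta>" by (rule max_dominated(1)[where h = ?h]) (fact finite_RV RV_ne \<delta>')+
  have \<Delta>_ge: "real n \<le> ?\<Delta> n" for n by (rule max_dominated(2)[where h = ?h]) (fact finite_RV RV_ne \<delta>')+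
  have "\<exists>c. \<forall>l. real (A l) \<le> real c * ?\<Delta> (c * l + c)"
    unfolding A_def by (rule max_dominated(3)) (fact finite_RV RV_ne \<delta>')+
  then obtain c where c: "\<And>l. real (A l) \<le> real c * ?\<Delta> (c * l + c)" by blast
  obtain n1 where n1: "1 \<le> n1" "D n1 \<noteq> 0" using D unfolding represents_dist_def by blast
  show ?thesis
    by (rule area_dominated[where D = D and \<Delta> = "\<lambda>n. MAX v\<in>RV. \<delta> v n" and A = A and B = B and F = "dehn_function Y" and C = C and q = q and c = c])
      (fact n1 \<Delta> \<Delta>_ge c B_def F)+
qed

end

theorem theoremB:
  fixes G :: "('a, 'm) monoid_scheme"
    and V :: "'v set" and E :: "'v set set" and \<psi> :: "'a \<Rightarrow> 'v \<Rightarrow> 'v"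
    and RV :: "'v set" and RE :: "'v set set"
  assumes "group G"
    and "tree_action G V E \<psi>"
    and "without_inversion G E \<psi>"
    and "cocompact G V E \<psi>"
    and "\<forall>v\<in>V. finitely_presented (vertex_group G \<psi> v)"
    and "\<forall>e\<in>E. finitely_generated (edge_group G \<psi> e)"
    and "orbit_representatives G V \<psi> RV"
    and "orbit_representatives G E (edge_act \<psi>) RE"
  shows "finitely_presented G \<and>
    (\<forall>(Y :: ('v1, 'e1, 'f1) complex2) (Y' :: 'v \<Rightarrow> ('v2, 'e2, 'f2) complex2) S S' \<delta> D.
       dehn_complex G Y \<and>
       (\<forall>v\<in>RV. dehn_complex (vertex_group G \<psi> v) (Y' v) \<and> represents_dehn (Y' v) (\<delta> v)) \<and>
       finite_generating_set G S \<and>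
       (\<forall>e\<in>RE. finite_generating_set (edge_group G \<psi> e) (S' e)) \<and>
       represents_dist (edist G S \<psi> RE S') D \<longrightarrow>
       (\<lambda>n. real (dehn_function Y n)) \<preceq>
         (\<lambda>n. real n * (MAX v\<in>RV. \<delta> v (superadd_closure D n))))"
proof -
  interpret group G by fact
  have RVV: "RV \<subseteq> V" and REE: "RE \<subseteq> E" and fin: "finite RV"
    using assms(7,8) unfolding orbit_representatives_def by auto
  let ?H = "vertex_group G \<psi>"
  have "\<forall>v\<in>RV. \<exists>a. finite_generating_set (?H v) (fst a) \<and> finite (snd a) \<and> snd a \<subseteq> lists (fst a \<times> UNIV) \<and>
    (\<forall>w\<in>lists (fst a \<times> UNIV). word_eval (?H v) w = \<one>\<^bsub>?H v\<^esub> \<longleftrightarrow> equivclp (word_step (fst a) (snd a)) w [])"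
  proof
    fix v assume "v \<in> RV"
    then have "finitely_presented (?H v)" using assms(5) RVV by blast
    then obtain S R where SR: "finite_generating_set (?H v) S" "finite R" "R \<subseteq> lists (S \<times> UNIV)"
      "\<forall>w\<in>lists (S \<times> UNIV). word_eval (?H v) w = \<one>\<^bsub>?H v\<^esub> \<longleftrightarrow> equivclp (word_step S R) w []"
      unfolding finitely_presented_def by (elim exE conjE)
    show "\<exists>a. finite_generating_set (?H v) (fst a) \<and> finite (snd a) \<and> snd a \<subseteq> lists (fst a \<times> UNIV) \<and>
      (\<forall>w\<in>lists (fst a \<times> UNIV). word_eval (?H v) w = \<one>\<^bsub>?H v\<^esub> \<longleftrightarrow> equivclp (word_step (fst a) (snd a)) w [])"
      by (rule exI[of _ "(S, R)"], unfold fst_conv snd_conv) (intro conjI SR)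
  qed
  from bchoice[OF this] obtain pr where pr: "\<forall>v\<in>RV. finite_generating_set (?H v) (fst (pr v)) \<and>
    finite (snd (pr v)) \<and> snd (pr v) \<subseteq> lists (fst (pr v) \<times> UNIV) \<and>
    (\<forall>w\<in>lists (fst (pr v) \<times> UNIV). word_eval (?H v) w = \<one>\<^bsub>?H v\<^esub> \<longleftrightarrow>
      equivclp (word_step (fst (pr v)) (snd (pr v))) w [])"
    by (rule exE)
  have gens: "finite_generating_set (?H v) (fst (pr v))" if "v \<in> RV" for v using pr that by blast
  have "finitely_presented G"
  proof -
    have "\<forall>e\<in>RE. \<exists>S. finite_generating_set (edge_group G \<psi> e) S"
      using assms(6) REE unfolding finitely_generated_def by blast
    from bchoice[OF this] obtain T where "\<forall>e\<in>RE. finite_generating_set (edge_group G \<psi> e) (T e)" by (rule exE)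
    then have T: "finite_generating_set (edge_group G \<psi> e) (T e)" if "e \<in> RE" for e using that by blast
    \<comment> \<open>The generators of the presentations are kept inside \<open>X v\<close>, as
      \<open>vertex_null_homotopic\<close> requires; the edge generators are arbitrary here.\<close>
    have "\<exists>endp tr org X. graph_of_groups G V E \<psi> RV RE endp tr org X T \<and> (\<forall>v\<in>RV. fst (pr v) \<subseteq> X v)"
      by (rule exists_graph_of_groups) (fact assms gens T)+
    then obtain endp tr org X where gg: "graph_of_groups G V E \<psi> RV RE endp tr org X T"
      and prX: "\<forall>v\<in>RV. fst (pr v) \<subseteq> X v"
      by (elim exE conjE)
    interpret graph_of_groups G V E \<psi> RV RE endp tr org X T by (rule gg)
    have "\<forall>v\<in>RV. \<exists>K0. \<forall>K\<ge>K0. \<forall>p. set p \<subseteq> vletters v \<longrightarrow> plab p = \<one>\<^bsub>G\<^esub> \<longrightarrow> (\<exists>N. homotopic (groupoid_complex K) v v N p [])"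
    proof
      fix v assume v: "v \<in> RV"
      show "\<exists>K0. \<forall>K\<ge>K0. \<forall>p. set p \<subseteq> vletters v \<longrightarrow> plab p = \<one>\<^bsub>G\<^esub> \<longrightarrow> (\<exists>N. homotopic (groupoid_complex K) v v N p [])"
        using bspec[OF pr v] bspec[OF prX v] by (intro vertex_null_homotopic[where S = "fst (pr v)" and R = "snd (pr v)", OF v]) blast+
    qed
    from bchoice[OF this] obtain K0 where K0: "\<forall>v\<in>RV. \<forall>K\<ge>K0 v. \<forall>p. set p \<subseteq> vletters v \<longrightarrow> plab p = \<one>\<^bsub>G\<^esub> \<longrightarrow>
      (\<exists>N. homotopic (groupoid_complex K) v v N p [])" by (rule exE)
    define K where "K = 4 + (\<Sum>v\<in>RV. K0 v)"
    have K: "K0 v \<le> K" if "v \<in> RV" for v using member_le_sum[OF that, of K0] fin unfolding K_def by simp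
    show ?thesis
    proof (rule finite_presentation)
      show "4 \<le> K" unfolding K_def by simp
      show "\<exists>N. homotopic (groupoid_complex K) v v N p []" if "v \<in> RV" "set p \<subseteq> vletters v" "plab p = \<one>\<^bsub>G\<^esub>" for v p
        using bspec[OF K0 that(1)] K[OF that(1)] that(2,3) by blast
    qed
  qed
  moreover have "(\<lambda>n. real (dehn_function Y n)) \<preceq> (\<lambda>n. real n * (MAX v\<in>RV. \<delta> v (superadd_closure D n)))"
    if Y: "dehn_complex G Y"
      and Y': "\<forall>v\<in>RV. dehn_complex (?H v) (Y' v) \<and> represents_dehn (Y' v) (\<delta> v)"
      and S: "finite_generating_set G S"
      and S': "\<forall>e\<in>RE. finite_generating_set (edge_group G \<psi> e) (S' e)"
      and D: "represents_dist (edist G S \<psi> RE S') D"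
    for Y :: "('v1, 'e1, 'f1) complex2" and Y' :: "'v \<Rightarrow> ('v2, 'e2, 'f2) complex2" and S S' \<delta> D
  proof -
    have T: "finite_generating_set (edge_group G \<psi> e) (S' e)" if "e \<in> RE" for e using S' that by blast
    \<comment> \<open>Now the edge generators are the given \<open>S'\<close>, so that the edge
      words are measured by the same \<open>edist\<close>.\<close>
    have "\<exists>endp tr org X. graph_of_groups G V E \<psi> RV RE endp tr org X S' \<and> (\<forall>v\<in>RV. fst (pr v) \<subseteq> X v)"
      by (rule exists_graph_of_groups) (fact assms gens T)+
    then obtain endp tr org X where gg: "graph_of_groups G V E \<psi> RV RE endp tr org X S'"
      by (elim exE conjE)
    show ?thesis
      by (rule graph_of_groups.dehn_function_dominated[OF gg Y _ _ S D]) (use Y' in blast)+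
  qed
  ultimately show ?thesis by blast
qed

end
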